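(* Let $r,s\ge 0$ and let $\mathfrak{B}_{r,s}^n(q)$ act on the mixed tensor space $V^{\otimes r}\otimes {V^*}^{\otimes s}$ as described in the context. Put $S_q(n;r,s):=\mathrm{End}_{\mathfrak{B}_{r,s}^n(q)}(V^{\otimes r}\otimes {V^*}^{\otimes s})$, the $R$-algebra of all $R$-linear endomorphisms of $V^{\otimes r}\otimes {V^*}^{\otimes s}$ commuting with the operators $E$, $S_i$ ($1\le i\le r-1$), $\hat S_j$ ($1\le j\le s-1$). Let $\rho_{\mathrm{mxd}}:\mathbf U\to \mathrm{End}_R(V^{\otimes r}\otimes {V^*}^{\otimes s})$ be the representation of $\mathbf U$ on the mixed tensor space. Then \[ S_q(n;r,s)=\rho_{\mathrm{mxd}}(\mathbf U)=\rho_{\mathrm{mxd}}(\mathbf U'). \] Furthermore, $S_q(n;r,s)$ is a free $R$-module with a basis indexed by the standard rational bitableaux (for the given $n,r,s$).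
   Context: $R$ is a commutative ring with $1$, $q\in R$ is invertible, $n\ge 1$. Let $U_q(\mathfrak{gl}_n)$ be the $\mathbb{Q}(q)$-algebra ($q$ an indeterminate) generated by $e_i,f_i$ ($1\le i\le n-1$) and $q^h$ ($h\in P^\vee=\bigoplus_{j=1}^n\mathbb{Z}h_j$) with relations $q^0=1$, $q^hq^{h'}=q^{h+h'}$, $q^he_iq^{-h}=q^{\alpha_i(h)}e_i$, $q^hf_iq^{-h}=q^{-\alpha_i(h)}f_i$, $e_if_j-f_je_i=\delta_{ij}\frac{K_i-K_i^{-1}}{q-q^{-1}}$ with $K_i=q^{h_i-h_{i+1}}$, $e_i^2e_j-(q+q^{-1})e_ie_je_i+e_je_i^2=0$ and $f_i^2f_j-(q+q^{-1})f_if_jf_i+f_jf_i^2=0$ for $|i-j|=1$, $e_ie_j=e_je_i$, $f_if_j=f_jf_i$ for $|i-j|>1$; here $\varepsilon_j(h_k)=\delta_{jk}$ and $\alpha_i=\varepsilon_i-\varepsilon_{i+1}$. It is a Hopf algebra with $\Delta(q^h)=q^h\otimes q^h$, $\Delta(e_i)=e_i\otimes K_i^{-1}+1\otimes e_i$, $\Delta(f_i)=f_i\otimes 1+K_i\otimes f_i$, $\varepsilon(q^h)=1$, $\varepsilon(e_i)=\varepsilon(f_i)=0$, $S(q^h)=q^{-h}$, $S(e_i)=-e_iK_i$, $S(f_i)=-K_i^{-1}f_i$. With $[l]_q=\sum_{i=0}^{l-1}q^{2i-l+1}$, $[l]_q!=[l]_q\cdots[1]_q$, $e_i^{(l)}=e_i^l/[l]_q!$,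 $f_i^{(l)}=f_i^l/[l]_q!$, let $\mathbf U_{\mathbb Z}$ (resp. $\mathbf U'_{\mathbb Z}$) be the $\mathbb{Z}[q,q^{-1}]$-subalgebra generated by all $q^h$ (resp. all $K_i$) and all $e_i^{(l)},f_i^{(l)}$ ($l\ge0$). Set $\mathbf U=R\otimes_{\mathbb Z[q,q^{-1}]}\mathbf U_{\mathbb Z}$ and $\mathbf U'=R\otimes\mathbf U'_{\mathbb Z}\subseteq \mathbf U$ ($q\mapsto q$); $\mathbf U$ inherits the Hopf structure. $V=R^n$ with basis $v_1,\dots,v_n$ is the $\mathbf U$-module obtained from the $\mathbb Z[q,q^{-1}]$-lattice spanned by $v_1,\dots ,v_n$ in the vector representation: $q^hv_j=q^{\varepsilon_j(h)}v_j$, $e_iv_{i+1}=v_i$, $e_iv_j=0$ for $j\ne i+1$, $f_iv_i=v_{i+1}$, $f_iv_j=0$ for $j\ne i$. $\mathbf U$ acts on tensor products via $\Delta$ and on $V^*=\mathrm{Hom}_R(V,R)$ via $(xf)(w)=f(S(x)w)$. Let $v_1^*,\dots,v_n^*$ be the dual basis, $I(n,r)=\{1,\dots,n\}^r$, and for $\mathbf i\in I(n,r)$, $\mathbf j\in I(n,s)$ put $v_{\mathbf i|\mathbf j}=v_{i_1}\otimes\cdots\otimes v_{i_r}\otimes v_{j_1}^*\otimes\cdots\otimes v_{j_s}^*$. The symmetric group acts on multi-indices by place permutation; $\mathbf i.s_t$ swaps entries $t,t+1$. The quantized walled Brauer algebra $\mathfrak B_{r,s}^n(q)$ acts on the right of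 $V^{\otimes r}\otimes{V^*}^{\otimes s}$, this action being generated by the operators $E$ (if $r,s\ge1$), $S_i$ ($1\le i\le r-1$), $\hat S_j$ ($1\le j\le s-1$) given by: writing $v_{\mathbf i|\mathbf j}=v\otimes v_{i_r}\otimes v_{j_1}^*\otimes v'$, $v_{\mathbf i|\mathbf j}E=\delta_{i_r,j_1}q^{2i_r-n-1}\sum_{t=1}^n v\otimes v_t\otimes v_t^*\otimes v'$; $v_{\mathbf i|\mathbf j}S_i=q^{-1}v_{\mathbf i|\mathbf j}$ if $i_i=i_{i+1}$, $=v_{\mathbf i.s_i|\mathbf j}$ if $i_i<i_{i+1}$, $=v_{\mathbf i.s_i|\mathbf j}+(q^{-1}-q)v_{\mathbf i|\mathbf j}$ if $i_i>i_{i+1}$; $v_{\mathbf i|\mathbf j}\hat S_j=q^{-1}v_{\mathbf i|\mathbf j}$ if $j_j=j_{j+1}$, $=v_{\mathbf i|\mathbf j.s_j}$ if $j_j>j_{j+1}$, $=v_{\mathbf i|\mathbf j.s_j}+(q^{-1}-q)v_{\mathbf i|\mathbf j}$ if $j_j<j_{j+1}$. Tableaux: for a partition $\lambda$, $[\lambda]=\{(i,j):1\le j\le\lambda_i\}$; a $\lambda$-tableau is a map $[\lambda]\to\{1,\dots,n\}$; it is standard if entries strictly increase along rows and weakly increase down columns. A rational $(\rho,\sigma)$-tableau is a pair $(\mathfrak r,\mathfrak s)$ with $\mathfrak r$ a $\rho$-tableau and $\mathfrak s$ a $\sigma$-tableau, where for some $0\le k\le\min(r,s)$, $\rho$ is a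 partition of $r-k$, $\sigma$ a partition of $s-k$, and $\rho_1+\sigma_1\le n$. Let $\mathrm{first}_i(\mathfrak r,\mathfrak s)$ be the number of entries $\le i$ in the first row of $\mathfrak r$ plus that in the first row of $\mathfrak s$. It is standard if $\mathfrak r,\mathfrak s$ are standard and $\mathrm{first}_i(\mathfrak r,\mathfrak s)\le i$ for all $i=1,\dots,n$. A (standard) rational bitableau is a pair of (standard) rational $(\rho,\sigma)$-tableaux of the same shape $(\rho,\sigma)$, $k$ ranging over $0,\dots,\min(r,s)$. *)

theory Defs
  imports Main "HOL-Computational_Algebra.Polynomial" "HOL-Computational_Algebra.Fraction_Field"
begin

text \<open>Linear endomorphisms of the free R-module V^{\<otimes>r} \<otimes> (V^*)^{\<otimes>s} are represented by
  their matrices w.r.t. the basis v_{i|j}. A basis vector v_{i|j} is encoded by the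
  concatenated list w = i @ j of length r+s with entries in {1..n}. A matrix is a function
  A :: nat list => nat list => 'a, A x y = coefficient of basis vector x in the image of
  basis vector y; matrices vanish outside the basis index set.\<close>

type_synonym 'a mat = "nat list \<Rightarrow> nat list \<Rightarrow> 'a"

definition qinv :: "'a::comm_ring_1 \<Rightarrow> 'a" where
  "qinv q = (SOME x. q * x = 1)"

definition qpow :: "'a::comm_ring_1 \<Rightarrow> int \<Rightarrow> 'a" where
  "qpow q z = (if 0 \<le> z then q ^ nat z else qinv q ^ nat (- z))"

definition bas :: "nat \<Rightarrow> nat \<Rightarrow> nat list \<Rightarrow> bool" where
  "bas n m w \<longleftrightarrow> length w = m \<and> set w \<subseteq> {1..n}"

definition mid :: "nat \<Rightarrow> nat \<Rightarrow> 'a::comm_ring_1 mat" where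
  "mid n m x y = (if bas n m x \<and> x = y then 1 else 0)"

definition mmul :: "nat \<Rightarrow> nat \<Rightarrow> 'a::comm_ring_1 mat \<Rightarrow> 'a mat \<Rightarrow> 'a mat" where
  "mmul n m A B x y = (\<Sum>z\<in>{w. bas n m w}. A x z * B z y)"

fun mpow :: "nat \<Rightarrow> nat \<Rightarrow> 'a::comm_ring_1 mat \<Rightarrow> nat \<Rightarrow> 'a mat" where
  "mpow n m A 0 = mid n m"
| "mpow n m A (Suc l) = mmul n m A (mpow n m A l)"

text \<open>n x n matrices indexed by {1..n}: A x y = coefficient of v_x in A v_y.\<close>

definition nmul :: "nat \<Rightarrow> (nat \<Rightarrow> nat \<Rightarrow> 'a::comm_ring_1) \<Rightarrow> (nat \<Rightarrow> nat \<Rightarrow> 'a) \<Rightarrow> nat \<Rightarrow> nat \<Rightarrow> 'a" where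
  "nmul n A B x y = (\<Sum>z\<in>{1..n}. A x z * B z y)"

definition idm :: "nat \<Rightarrow> nat \<Rightarrow> 'a::comm_ring_1" where
  "idm x y = (if x = y then 1 else 0)"

text \<open>On V: e_i v_{i+1} = v_i, f_i v_i = v_{i+1}, q^h v_j = q^{h_j} v_j, K_i = q^{h_i - h_{i+1}};
  vK q i z is the matrix of K_i^z.\<close>
definition ve :: "nat \<Rightarrow> nat \<Rightarrow> nat \<Rightarrow> 'a::comm_ring_1" where
  "ve i x y = (if x = i \<and> y = Suc i then 1 else 0)"
definition vf :: "nat \<Rightarrow> nat \<Rightarrow> nat \<Rightarrow> 'a::comm_ring_1" where
  "vf i x y = (if x = Suc i \<and> y = i then 1 else 0)"
definition vK :: "'a::comm_ring_1 \<Rightarrow> nat \<Rightarrow> int \<Rightarrow> nat \<Rightarrow> nat \<Rightarrow> 'a" where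
  "vK q i z x y = (if x = y then qpow q (z * ((if x = i then 1 else 0) - (if x = Suc i then 1 else 0))) else 0)"
definition vqh :: "'a::comm_ring_1 \<Rightarrow> (nat \<Rightarrow> int) \<Rightarrow> nat \<Rightarrow> nat \<Rightarrow> 'a" where
  "vqh q h x y = (if x = y then qpow q (h x) else 0)"

text \<open>On V^*: (u f)(w) = f(S(u) w), so the matrix of u on V^* (dual basis) is the transpose
  of the matrix of S(u) on V. S(e_i) = - e_i K_i, S(f_i) = - K_i^{-1} f_i, S(K_i^z) = K_i^{-z},
  S(q^h) = q^{-h}.\<close>
definition de :: "nat \<Rightarrow> 'a::comm_ring_1 \<Rightarrow> nat \<Rightarrow> nat \<Rightarrow> nat \<Rightarrow> 'a" where
  "de n q i x y = - nmul n (ve i) (vK q i 1) y x"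
definition df :: "nat \<Rightarrow> 'a::comm_ring_1 \<Rightarrow> nat \<Rightarrow> nat \<Rightarrow> nat \<Rightarrow> 'a" where
  "df n q i x y = - nmul n (vK q i (-1)) (vf i) y x"
definition dK :: "'a::comm_ring_1 \<Rightarrow> nat \<Rightarrow> int \<Rightarrow> nat \<Rightarrow> nat \<Rightarrow> 'a" where
  "dK q i z x y = vK q i (- z) y x"
definition dqh :: "'a::comm_ring_1 \<Rightarrow> (nat \<Rightarrow> int) \<Rightarrow> nat \<Rightarrow> nat \<Rightarrow> 'a" where
  "dqh q h x y = vqh q (\<lambda>j. - h j) y x"

definition fe :: "nat \<Rightarrow> 'a::comm_ring_1 \<Rightarrow> nat \<Rightarrow> nat \<Rightarrow> nat \<Rightarrow> nat \<Rightarrow> nat \<Rightarrow> 'a" where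
  "fe n q r i p = (if p < r then ve i else de n q i)"
definition ff :: "nat \<Rightarrow> 'a::comm_ring_1 \<Rightarrow> nat \<Rightarrow> nat \<Rightarrow> nat \<Rightarrow> nat \<Rightarrow> nat \<Rightarrow> 'a" where
  "ff n q r i p = (if p < r then vf i else df n q i)"
definition fK :: "'a::comm_ring_1 \<Rightarrow> nat \<Rightarrow> nat \<Rightarrow> int \<Rightarrow> nat \<Rightarrow> nat \<Rightarrow> nat \<Rightarrow> 'a" where
  "fK q r i z p = (if p < r then vK q i z else dK q i z)"
definition fqh :: "'a::comm_ring_1 \<Rightarrow> nat \<Rightarrow> (nat \<Rightarrow> int) \<Rightarrow> nat \<Rightarrow> nat \<Rightarrow> nat \<Rightarrow> 'a" where
  "fqh q r h p = (if p < r then vqh q h else dqh q h)"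

definition tens :: "nat \<Rightarrow> nat \<Rightarrow> nat \<Rightarrow> (nat \<Rightarrow> nat \<Rightarrow> nat \<Rightarrow> 'a::comm_ring_1) \<Rightarrow> 'a mat" where
  "tens n r s F x y = (if bas n (r + s) x \<and> bas n (r + s) y
      then (\<Prod>p<r + s. F p (x ! p) (y ! p)) else 0)"

text \<open>Delta(e_i) = e_i \<otimes> K_i^{-1} + 1 \<otimes> e_i, Delta(f_i) = f_i \<otimes> 1 + K_i \<otimes> f_i,
  Delta(q^h) = q^h \<otimes> q^h, iterated.\<close>
definition mx_e :: "nat \<Rightarrow> 'a::comm_ring_1 \<Rightarrow> nat \<Rightarrow> nat \<Rightarrow> nat \<Rightarrow> 'a mat" where
  "mx_e n q r s i = (\<lambda>x y. \<Sum>k<r + s. tens n r s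
      (\<lambda>p. if p < k then idm else if p = k then fe n q r i p else fK q r i (-1) p) x y)"
definition mx_f :: "nat \<Rightarrow> 'a::comm_ring_1 \<Rightarrow> nat \<Rightarrow> nat \<Rightarrow> nat \<Rightarrow> 'a mat" where
  "mx_f n q r s i = (\<lambda>x y. \<Sum>k<r + s. tens n r s
      (\<lambda>p. if p < k then fK q r i 1 p else if p = k then ff n q r i p else idm) x y)"
definition mx_K :: "nat \<Rightarrow> 'a::comm_ring_1 \<Rightarrow> nat \<Rightarrow> nat \<Rightarrow> nat \<Rightarrow> int \<Rightarrow> 'a mat" where
  "mx_K n q r s i z = tens n r s (\<lambda>p. fK q r i z p)"
definition mx_qh :: "nat \<Rightarrow> 'a::comm_ring_1 \<Rightarrow> nat \<Rightarrow> nat \<Rightarrow> (nat \<Rightarrow> int) \<Rightarrow> 'a mat" where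
  "mx_qh n q r s h = tens n r s (\<lambda>p. fqh q r h p)"

subsection \<open>Divided powers: computed over Q(q) and specialised along Z[q,q^{-1}] -> R\<close>

type_synonym Qq = "int poly fract"

definition gq :: Qq where "gq = Fract [:0, 1:] 1"

definition qint :: "nat \<Rightarrow> Qq" where
  "qint l = (\<Sum>i<l. gq powi (2 * int i - int l + 1))"

definition qfact :: "nat \<Rightarrow> Qq" where
  "qfact l = (\<Prod>i\<in>{1..l}. qint i)"

definition spec :: "'a::comm_ring_1 \<Rightarrow> Qq \<Rightarrow> 'a" where
  "spec q c = (if \<exists>p k. c = Fract p 1 * inverse gq ^ k
     then (let (p, k) = (SOME (p, k). c = Fract p 1 * inverse gq ^ k)
           in poly (map_poly of_int p) q * qinv q ^ k)
     else 0)"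

definition mx_e_div :: "nat \<Rightarrow> 'a::comm_ring_1 \<Rightarrow> nat \<Rightarrow> nat \<Rightarrow> nat \<Rightarrow> nat \<Rightarrow> 'a mat" where
  "mx_e_div n q r s i l = (\<lambda>x y. spec q (mpow n (r + s) (mx_e n gq r s i) l x y / qfact l))"
definition mx_f_div :: "nat \<Rightarrow> 'a::comm_ring_1 \<Rightarrow> nat \<Rightarrow> nat \<Rightarrow> nat \<Rightarrow> nat \<Rightarrow> 'a mat" where
  "mx_f_div n q r s i l = (\<lambda>x y. spec q (mpow n (r + s) (mx_f n gq r s i) l x y / qfact l))"

inductive_set alg_gen :: "nat \<Rightarrow> nat \<Rightarrow> 'a::comm_ring_1 mat set \<Rightarrow> 'a mat set"
  for n m G where
  gen: "A \<in> G \<Longrightarrow> A \<in> alg_gen n m G"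
| one: "mid n m \<in> alg_gen n m G"
| add: "A \<in> alg_gen n m G \<Longrightarrow> B \<in> alg_gen n m G \<Longrightarrow> (\<lambda>x y. A x y + B x y) \<in> alg_gen n m G"
| smult: "A \<in> alg_gen n m G \<Longrightarrow> (\<lambda>x y. c * A x y) \<in> alg_gen n m G"
| mult: "A \<in> alg_gen n m G \<Longrightarrow> B \<in> alg_gen n m G \<Longrightarrow> mmul n m A B \<in> alg_gen n m G"

text \<open>rho_mxd(U): U = R \<otimes> U_Z is spanned over R by monomials in q^h, e_i^{(l)}, f_i^{(l)}.\<close>
definition rho_U :: "nat \<Rightarrow> 'a::comm_ring_1 \<Rightarrow> nat \<Rightarrow> nat \<Rightarrow> 'a mat set" where
  "rho_U n q r s = alg_gen n (r + s)
     ({mx_qh n q r s h | h. True}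
      \<union> {mx_e_div n q r s i l | i l. 1 \<le> i \<and> i < n}
      \<union> {mx_f_div n q r s i l | i l. 1 \<le> i \<and> i < n})"

definition rho_U' :: "nat \<Rightarrow> 'a::comm_ring_1 \<Rightarrow> nat \<Rightarrow> nat \<Rightarrow> 'a mat set" where
  "rho_U' n q r s = alg_gen n (r + s)
     ({mx_K n q r s i z | i z. 1 \<le> i \<and> i < n \<and> (z = 1 \<or> z = -1)}
      \<union> {mx_e_div n q r s i l | i l. 1 \<le> i \<and> i < n}
      \<union> {mx_f_div n q r s i l | i l. 1 \<le> i \<and> i < n})"

definition swp :: "nat list \<Rightarrow> nat \<Rightarrow> nat \<Rightarrow> nat list" where
  "swp w a b = w[a := w ! b, b := w ! a]"

text \<open>Matrix of v |-> v E: contracts positions r, r+1 (1-based), i.e. r-1, r (0-based).\<close>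
definition brE :: "nat \<Rightarrow> 'a::comm_ring_1 \<Rightarrow> nat \<Rightarrow> nat \<Rightarrow> 'a mat" where
  "brE n q r s x y = (if bas n (r + s) x \<and> bas n (r + s) y \<and> y ! (r - 1) = y ! r
      \<and> x ! (r - 1) = x ! r \<and> (\<forall>p < r + s. p \<noteq> r - 1 \<and> p \<noteq> r \<longrightarrow> x ! p = y ! p)
     then qpow q (2 * int (y ! (r - 1)) - int n - 1) else 0)"

text \<open>Matrix of v |-> v S_i, 1 <= i <= r-1 (positions i-1, i, 0-based).\<close>
definition brS :: "nat \<Rightarrow> 'a::comm_ring_1 \<Rightarrow> nat \<Rightarrow> nat \<Rightarrow> nat \<Rightarrow> 'a mat" where
  "brS n q r s i x y = (if bas n (r + s) x \<and> bas n (r + s) y then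
     (let a = i - 1; b = i in
      if y ! a = y ! b then (if x = y then qinv q else 0)
      else if y ! a < y ! b then (if x = swp y a b then 1 else 0)
      else (if x = swp y a b then 1 else 0) + (if x = y then qinv q - q else 0))
    else 0)"

text \<open>Matrix of v |-> v hat S_j, 1 <= j <= s-1 (positions r+j-1, r+j, 0-based).\<close>
definition brSh :: "nat \<Rightarrow> 'a::comm_ring_1 \<Rightarrow> nat \<Rightarrow> nat \<Rightarrow> nat \<Rightarrow> 'a mat" where
  "brSh n q r s j x y = (if bas n (r + s) x \<and> bas n (r + s) y then
     (let a = r + j - 1; b = r + j in
      if y ! a = y ! b then (if x = y then qinv q else 0)
      else if y ! a > y ! b then (if x = swp y a b then 1 else 0)
      else (if x = swp y a b then 1 else 0) + (if x = y then qinv q - q else 0))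
    else 0)"

definition qSchur :: "nat \<Rightarrow> 'a::comm_ring_1 \<Rightarrow> nat \<Rightarrow> nat \<Rightarrow> 'a mat set" where
  "qSchur n q r s = {M.
      (\<forall>x y. \<not> (bas n (r + s) x \<and> bas n (r + s) y) \<longrightarrow> M x y = 0)
    \<and> (1 \<le> r \<and> 1 \<le> s \<longrightarrow> mmul n (r + s) M (brE n q r s) = mmul n (r + s) (brE n q r s) M)
    \<and> (\<forall>i. 1 \<le> i \<and> i < r \<longrightarrow> mmul n (r + s) M (brS n q r s i) = mmul n (r + s) (brS n q r s i) M)
    \<and> (\<forall>j. 1 \<le> j \<and> j < s \<longrightarrow> mmul n (r + s) M (brSh n q r s j) = mmul n (r + s) (brSh n q r s j) M)}"

definition is_partition :: "nat list \<Rightarrow> nat \<Rightarrow> bool" where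
  "is_partition lam m \<longleftrightarrow> sorted_wrt (\<ge>) lam \<and> (\<forall>x\<in>set lam. 0 < x) \<and> sum_list lam = m"

definition diagram :: "nat list \<Rightarrow> (nat \<times> nat) set" where
  "diagram lam = {(i, j). 1 \<le> i \<and> i \<le> length lam \<and> 1 \<le> j \<and> j \<le> lam ! (i - 1)}"

definition is_tableau :: "nat \<Rightarrow> nat list \<Rightarrow> (nat \<times> nat \<Rightarrow> nat) \<Rightarrow> bool" where
  "is_tableau n lam t \<longleftrightarrow> (\<forall>c\<in>diagram lam. t c \<in> {1..n}) \<and> (\<forall>c. c \<notin> diagram lam \<longrightarrow> t c = 0)"

definition standard_tab :: "nat list \<Rightarrow> (nat \<times> nat \<Rightarrow> nat) \<Rightarrow> bool" where
  "standard_tab lam t \<longleftrightarrow>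
     (\<forall>i j. (i, j) \<in> diagram lam \<and> (i, Suc j) \<in> diagram lam \<longrightarrow> t (i, j) < t (i, Suc j))
   \<and> (\<forall>i j. (i, j) \<in> diagram lam \<and> (Suc i, j) \<in> diagram lam \<longrightarrow> t (i, j) \<le> t (Suc i, j))"

definition row1 :: "nat list \<Rightarrow> nat" where
  "row1 lam = (if lam = [] then 0 else hd lam)"

definition rat_shape :: "nat \<Rightarrow> nat \<Rightarrow> nat \<Rightarrow> nat list \<times> nat list \<Rightarrow> bool" where
  "rat_shape n r s sh \<longleftrightarrow> (\<exists>k \<le> min r s. is_partition (fst sh) (r - k)
      \<and> is_partition (snd sh) (s - k) \<and> row1 (fst sh) + row1 (snd sh) \<le> n)"

definition first_cnt :: "nat \<Rightarrow> nat list \<times> nat list \<Rightarrow> (nat \<times> nat \<Rightarrow> nat) \<times> (nat \<times> nat \<Rightarrow> nat) \<Rightarrow> nat" where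
  "first_cnt i sh T = card {j. (1, j) \<in> diagram (fst sh) \<and> fst T (1, j) \<le> i}
                    + card {j. (1, j) \<in> diagram (snd sh) \<and> snd T (1, j) \<le> i}"

definition std_rat_tab :: "nat \<Rightarrow> nat list \<times> nat list \<Rightarrow> (nat \<times> nat \<Rightarrow> nat) \<times> (nat \<times> nat \<Rightarrow> nat) \<Rightarrow> bool" where
  "std_rat_tab n sh T \<longleftrightarrow> is_tableau n (fst sh) (fst T) \<and> is_tableau n (snd sh) (snd T)
     \<and> standard_tab (fst sh) (fst T) \<and> standard_tab (snd sh) (snd T)
     \<and> (\<forall>i\<in>{1..n}. first_cnt i sh T \<le> i)"

definition std_rat_bitab :: "nat \<Rightarrow> nat \<Rightarrow> nat \<Rightarrow>
   ((nat list \<times> nat list) \<times> ((nat \<times> nat \<Rightarrow> nat) \<times> (nat \<times> nat \<Rightarrow> nat))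
      \<times> ((nat \<times> nat \<Rightarrow> nat) \<times> (nat \<times> nat \<Rightarrow> nat))) set" where
  "std_rat_bitab n r s = {(sh, T1, T2). rat_shape n r s sh \<and> std_rat_tab n sh T1 \<and> std_rat_tab n sh T2}"

end

theory Submission
  imports Defs
begin

text \<open>The divided powers and the operators E, S_i act on the tensor space by explicit matrices, so the image
of U lies in the commutant. An element M of the commutant is expanded on products of quantum antisymmetrizers,
one for each row of a pair of Young diagrams; together with the induced elements for the smaller
pairs (r - k, s - k), obtained by restricting M to tensors with contracted pairs at the wall, this gives a system of
coefficients D(X, Y) indexed by row lists. Exchanging entries between two neighbouring rows is an action
of U(gl_2), and straightening with it expresses every coefficient by those of standard X and Y.
Hence M is determined by its standard coefficients. Conversely, each standard tableau t is reached by a product B_t of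
divided powers of the f_i, starting at an extreme tableau of its shape. The products of a transposed B_t with
B_t' lie in the image of U' and have a unitriangular (up to units) matrix of standard coefficients,
so they form a basis of the commutant.\<close>

section \<open>Units, index sets and matrices\<close>

text \<open>The ring is arbitrary, so neither semisimplicity nor a dimension count nor division by
  quantum integers is available: every coefficient that gets inverted must visibly be a unit.
  Therefore divided powers are given by a recursion whose entries are single signed powers of q, and
  antisymmetrizers are evaluated on words without dividing by factorials. A dual row is replaced by
  its complement in {1..n}. Then a pair of tableaux becomes one list of r + s subsets, f_i replaces
  i by i + 1 in rows on either side of the wall, and creating pairs at the wall exchanges entries
  between the two middle rows just as elsewhere, up to units. The condition first_i \<le> i becomes
  standardness of these two neighbours, so one straightening rule covers all rows. An exchange
  relation holds only once the coefficients of a larger shape vanish, hence the descending induction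
  over shapes. The products B_t pass through both extreme row lists of their shape; this controls
  their coefficients at all other shapes.\<close>

lemma qinv_right: "(q::'a::comm_ring_1) dvd 1 ==> q * qinv q = 1"
 unfolding qinv_def dvd_def by (rule someI_ex) (metis)

lemma qinv_left: "(q::'a::comm_ring_1) dvd 1 ==> qinv q * q = 1"
 by (metis mult.commute qinv_right)

lemma qpow_0 [simp]: "qpow q 0 = 1" by (simp add: qpow_def)
lemma qpow_1 [simp]: "qpow q 1 = q" by (simp add: qpow_def)
lemma qpow_m1: "qpow q (- 1) = qinv q" by (simp add: qpow_def)
lemma qpow_of_nat: "qpow q (int k) = q ^ k" by (simp add: qpow_def)

lemma qpow_Suc: assumes "(q::'a::comm_ring_1) dvd 1" shows "qpow q (z + 1) = q * qpow q z"
proof (cases "0 \<le> z")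
 case True
 hence "nat (z + 1) = Suc (nat z)" by simp
 thus ?thesis using True by (simp add: qpow_def)
next
 case False
 hence e: "nat (- z) = Suc (nat (- (z + 1)))" by simp
 have "q * qpow q z = (q * qinv q) * qinv q ^ nat (- (z + 1))"
  using False unfolding qpow_def e by (simp add: mult.assoc)
 thus ?thesis using False assms by (auto simp: qpow_def qinv_right)
qed

lemma qpow_pred: assumes "(q::'a::comm_ring_1) dvd 1" shows "qpow q (z - 1) = qinv q * qpow q z"
proof -
 have "qinv q * qpow q z = (qinv q * q) * qpow q (z - 1)"
  using qpow_Suc[OF assms, of "z - 1"] by (simp add: mult.assoc)
 thus ?thesis by (simp add: qinv_left assms)
qed

lemma qpow_add: assumes "(q::'a::comm_ring_1) dvd 1" shows "qpow q (a + b) = qpow q a * qpow q b"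
proof (induction b rule: int_induct[where k = 0])
 case base thus ?case by simp
next
 case (step1 i)
 have "a + (i + 1) = (a + i) + 1" by simp
 thus ?case using step1 by (simp only: qpow_Suc[OF assms] mult.left_commute)
next
 case (step2 i)
 have "a + (i - 1) = (a + i) - 1" by simp
 thus ?case using step2 by (simp only: qpow_pred[OF assms] mult.left_commute)
qed

lemma qpow_minus: assumes "(q::'a::comm_ring_1) dvd 1" shows "qpow q z * qpow q (- z) = 1"
 using qpow_add[OF assms, of z "- z"] by simp

lemma qpow_unit: assumes "(q::'a::comm_ring_1) dvd 1" shows "qpow q z dvd 1"
 using qpow_minus[OF assms] by (metis dvdI)

section \<open>Words that index the tensor basis, and matrices supported on them\<close>

abbreviation bset :: "nat => nat => nat list set" where
 "bset n m \<equiv> {w. bas n m w}"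

lemma bas_Nil [simp]: "bas n m [] \<longleftrightarrow> m = 0" by (auto simp: bas_def)
lemma bas_0 [simp]: "bas n 0 x \<longleftrightarrow> x = []" by (auto simp: bas_def)
lemma bas_Cons [simp]: "bas n (Suc m) (x # xs) \<longleftrightarrow> x \<in> {1..n} \<and> bas n m xs"
 by (auto simp: bas_def)
lemma bas_length: "bas n m x ==> length x = m" by (simp add: bas_def)

lemma finite_bset [simp]: "finite (bset n m)"
proof -
 have "bset n m = {xs. set xs \<subseteq> {1..n} \<and> length xs = m}" by (auto simp: bas_def)
 thus ?thesis using finite_lists_length_eq[of "{1..n}" m] by simp
qed

lemma bset_Suc: "bset n (Suc m) = (\<lambda>(x, xs). x # xs) ` ({1..n} \<times> bset n m)"
proof (rule set_eqI, goal_cases)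
 case (1 w) show ?case by (cases w) (auto simp: bas_def image_iff)
qed

lemma sum_bset_Suc: "(\<Sum>w\<in>bset n (Suc m). g w) = (\<Sum>x\<in>{1..n}. \<Sum>xs\<in>bset n m. g (x # xs))"
proof -
 have inj: "inj_on (\<lambda>(x, xs). x # xs) ({1..n} \<times> bset n m)" by (auto simp: inj_on_def)
 show ?thesis unfolding bset_Suc sum.reindex[OF inj] by (simp add: sum.cartesian_product split_def comp_def)
qed

lemma sum_bset_0 [simp]: "(\<Sum>w\<in>bset n 0. g w) = g []" by simp

lemma sum_single: "finite S ==> a \<in> S ==> (\<And>x. x \<in> S ==> x \<noteq> a ==> g x = 0) ==> sum g S = (g a::'b::comm_monoid_add)"
 using sum.mono_neutral_right[of S "{a}" g] by auto

definition supp :: "nat => nat => 'a::comm_ring_1 mat => bool" where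
 "supp n m A \<longleftrightarrow> (\<forall>x y. \<not> (bas n m x \<and> bas n m y) --> A x y = 0)"

lemma supp_mmul: "supp n m A ==> supp n m C ==> supp n m (mmul n m A C)"
 unfolding supp_def mmul_def by (intro allI impI sum.neutral) auto

lemma alg_gen_mono: assumes "\<And>A. A \<in> G ==> A \<in> alg_gen n m H" and "A \<in> alg_gen n m G" shows "A \<in> alg_gen n m H"
 using assms(2) by induction (auto intro: alg_gen.intros assms(1))

section \<open>Specialisation of Laurent polynomials\<close>

definition ev :: "'a::comm_ring_1 => int poly => 'a" where
 "ev q p = poly (map_poly of_int p) q"

lemma ev_0 [simp]: "ev q 0 = 0" by (simp add: ev_def)
lemma ev_pCons [simp]: "ev q (pCons a p) = of_int a + q * ev q p"
 by (simp add: ev_def map_poly_pCons)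
lemma ev_add: "ev q (p + p') = ev q p + ev q p'"
proof (induction p arbitrary: p')
 case (pCons a p) thus ?case by (cases p') (simp add: algebra_simps)
qed simp
lemma ev_smult: "ev q (smult a p) = of_int a * ev q p"
 by (induction p) (simp_all add: algebra_simps)
lemma ev_mult: "ev q (p * p') = ev q p * ev q p'"
 by (induction p) (simp_all add: ev_add ev_smult algebra_simps)
lemma ev_1 [simp]: "ev q 1 = 1" by (simp add: one_pCons)
lemma ev_power: "ev q (p ^ k) = ev q p ^ k" by (induction k) (simp_all add: ev_mult)

abbreviation PX :: "int poly" where "PX \<equiv> [:0, 1:]"

lemma gq_power: "gq ^ k = Fract (PX ^ k) 1"
 by (induction k) (simp_all add: gq_def One_fract_def)

lemma gq_nz: "gq \<noteq> 0"
 by (simp add: gq_def Zero_fract_def eq_fract)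

text \<open>The Laurent polynomials inside Q(q): exactly the arguments at which \<open>spec\<close>
  does not fall back to its default value 0.\<close>

definition Lau :: "Qq set" where "Lau = {c. \<exists>p k. c = Fract p 1 * inverse gq ^ k}"

text \<open>Clearing denominators gives an identity of integer polynomials, which survives
  evaluation at q; invertibility of q then restores the negative powers. This makes the choice of a
  representation inside \<open>spec\<close> harmless.\<close>

lemma Lau_unique: assumes "Fract p 1 * inverse gq ^ k = Fract p' 1 * inverse gq ^ k'" and q: "q dvd (1::'a::comm_ring_1)"
 shows "ev q p * qinv q ^ k = ev q p' * qinv q ^ k'"
proof -
 have "Fract p 1 * gq ^ k' = Fract p' 1 * gq ^ k"
  using assms(1) gq_nz by (simp add: field_simps power_inverse)
 hence "p * PX ^ k' = p' * PX ^ k" by (simp add: gq_power eq_fract)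
 hence "ev q (p * PX ^ k') = ev q (p' * PX ^ k)" by simp
 hence "ev q p * q ^ k' = ev q p' * q ^ k" by (simp add: ev_mult ev_power)
 hence "ev q p * q ^ k' * (qinv q ^ k * qinv q ^ k') = ev q p' * q ^ k * (qinv q ^ k * qinv q ^ k')" by simp
 moreover have e: "q ^ j * qinv q ^ j = 1" for j using q by (simp add: power_mult_distrib[symmetric] qinv_right)
 have "ev q p * q ^ k' * (qinv q ^ k * qinv q ^ k') = ev q p * qinv q ^ k * (q ^ k' * qinv q ^ k')" by (simp only: mult_ac)
 moreover have "ev q p' * q ^ k * (qinv q ^ k * qinv q ^ k') = ev q p' * qinv q ^ k' * (q ^ k * qinv q ^ k)" by (simp only: mult_ac)
 ultimately show ?thesis by (simp add: e)
qed

lemma spec_eq: assumes "q dvd (1::'a::comm_ring_1)" shows "spec q (Fract p 1 * inverse gq ^ k) = ev q p * qinv q ^ k"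
proof -
 let ?c = "Fract p 1 * inverse gq ^ k"
 define pk where "pk = (SOME (p', k'). ?c = Fract p' 1 * inverse gq ^ k')"
 have ex: "\<exists>p k'. ?c = Fract p 1 * inverse gq ^ k'" by blast
 hence "\<exists>x. (\<lambda>(p', k'). ?c = Fract p' 1 * inverse gq ^ k') x" by auto
 hence "(\<lambda>(p', k'). ?c = Fract p' 1 * inverse gq ^ k') pk" unfolding pk_def by (rule someI_ex)
 hence "?c = Fract (fst pk) 1 * inverse gq ^ snd pk" by (simp add: split_def)
 from Lau_unique[OF this assms] have "ev q p * qinv q ^ k = ev q (fst pk) * qinv q ^ snd pk" .
 moreover have "spec q ?c = ev q (fst pk) * qinv q ^ snd pk"
  unfolding spec_def using ex by (simp only: if_True split_def Let_def ev_def pk_def[unfolded split_def])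
 ultimately show ?thesis by simp
qed

lemma LauI: "c = Fract p 1 * inverse gq ^ k ==> c \<in> Lau" by (auto simp: Lau_def)

lemma Lau_rep: assumes "c \<in> Lau" obtains p k where "c = Fract p 1 * inverse gq ^ k" using assms by (auto simp: Lau_def)

lemma Lau_mult_aux:
 "(Fract p 1 * inverse gq ^ k) * (Fract p' 1 * inverse gq ^ k') = Fract (p * p') 1 * inverse gq ^ (k + k')"
proof -
 have "Fract (p * p') 1 = Fract p 1 * Fract p' 1" by simp
 thus ?thesis by (simp only: power_add mult_ac)
qed

lemma Lau_mult: "c \<in> Lau ==> d \<in> Lau ==> c * d \<in> Lau"
 by (auto simp only: Lau_def Lau_mult_aux mem_Collect_eq) blast
lemma of_int_Fract: "of_int a = Fract [:a:] 1"
proof -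
 have "of_nat k = Fract [:int k:] 1" for k
  by (induction k) (simp_all add: Zero_fract_def One_fract_def one_pCons)
 thus ?thesis by (cases a rule: int_cases2) simp_all
qed
lemma Lau_of_int: "of_int a \<in> Lau"
 by (rule LauI[of _ "[:a:]" 0]) (simp add: of_int_Fract)
lemma Lau_0 [simp]: "0 \<in> Lau" using Lau_of_int[of 0] by simp
lemma Lau_1 [simp]: "1 \<in> Lau" using Lau_of_int[of 1] by simp
lemma Lau_uminus: "c \<in> Lau ==> - c \<in> Lau" using Lau_mult[OF Lau_of_int[of "-1"]] by simp
lemma Lau_gq: "gq \<in> Lau" by (rule LauI[of _ PX 0]) (simp add: gq_def)
lemma Lau_ginv: "inverse gq \<in> Lau" by (rule LauI[of _ 1 1]) (simp add: One_fract_def)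
lemma Lau_power: "c \<in> Lau ==> c ^ k \<in> Lau" by (induction k) (auto intro: Lau_mult)
lemma gq_unit: "gq dvd 1" using gq_nz by (metis dvdI right_inverse)
lemma qinv_gq: "qinv gq = inverse gq"
 using qinv_right[OF gq_unit] gq_nz by (simp add: field_simps)
lemma Lau_qpow: "qpow gq z \<in> Lau"
 by (auto simp: qpow_def qinv_gq intro: Lau_power Lau_gq Lau_ginv)

context
 fixes q :: "'a::comm_ring_1" assumes q: "q dvd 1"
begin

text \<open>Together with signs and powers of q this is what the specialisation of divided powers
  rests on: each of their entries is zero or a single signed power of q.\<close>

lemma spec_mult: assumes "c \<in> Lau" "d \<in> Lau" shows "spec q (c * d) = spec q c * spec q d"
proof -
 obtain p k where c: "c = Fract p 1 * inverse gq ^ k" using assms(1) by (rule Lau_rep)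
 obtain p' k' where d: "d = Fract p' 1 * inverse gq ^ k'" using assms(2) by (rule Lau_rep)
 show ?thesis unfolding c d Lau_mult_aux spec_eq[OF q] by (simp add: ev_mult power_add mult_ac)
qed

lemma spec_of_int: "spec q (of_int a) = of_int a"
 using spec_eq[OF q, of "[:a:]" 0] by (simp add: of_int_Fract)
lemma spec_0 [simp]: "spec q 0 = 0" using spec_of_int[of 0] by simp
lemma spec_1 [simp]: "spec q 1 = 1" using spec_of_int[of 1] by simp
lemma spec_uminus: "c \<in> Lau ==> spec q (- c) = - spec q c"
 using spec_mult[OF Lau_of_int[of "-1"], of c] spec_of_int[of "-1"] by simp
lemma spec_gq: "spec q gq = q"
 using spec_eq[OF q, of PX 0] by (simp add: gq_def)
lemma spec_ginv: "spec q (inverse gq) = qinv q"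
 using spec_eq[OF q, of 1 1] by (simp add: One_fract_def[symmetric])
lemma spec_power: "c \<in> Lau ==> spec q (c ^ k) = spec q c ^ k"
 by (induction k) (simp_all add: spec_mult Lau_power)
lemma spec_qpow: "spec q (qpow gq z) = qpow q z"
 by (simp add: qpow_def qinv_gq spec_power Lau_gq Lau_ginv spec_gq spec_ginv)
end

section \<open>Explicit divided powers\<close>

text \<open>The exponent with which K_i acts on the letter y, read as a vector of V if b is True and
  as a dual vector if b is False. The flag b distinguishes the two sides of the wall in the same way
  in all that follows.\<close>

definition sw :: "nat => bool => nat => int" where
 "sw i b y = (if y = i then (if b then 1 else -1) else if y = Suc i then (if b then -1 else 1) else 0)"

text \<open>f_i carries the letter y to the letter x, up to the scalar \<open>lc\<close>: v_i to
  v_{i+1} in V, and v_{i+1}^* to v_i^* in the dual space.\<close>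

definition low :: "nat => bool => nat => nat => bool" where
 "low i b y x \<longleftrightarrow> (if b then y = i \<and> x = Suc i else y = Suc i \<and> x = i)"

definition lc :: "'a::comm_ring_1 => bool => 'a" where "lc q b = (if b then 1 else - q)"

text \<open>The matrix of f_i^(l). Its coproduct is the sum over a of q^(-a(l-a)) f_i^(a) K_i^(l-a)
  \<otimes> f_i^(l-a), and on a single letter only a = 0 and a = 1 survive. For a = 1 the letter
  being lowered has K_i-weight 1, so q^(-(l-1)) cancels against K_i^(l-1) and only \<open>lc\<close>
  remains. The argument r counts the V-letters still ahead, hence the test 0 < r.\<close>

fun Fd :: "'a::comm_ring_1 => nat => nat => nat => nat list => nat list => 'a" where
 "Fd q i r l [] [] = (if l = 0 then 1 else 0)"
| "Fd q i r l (x # xs) (y # ys) =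
  (if x = y then qpow q (int l * sw i (0 < r) y) * Fd q i (r - 1) l xs ys
   else if 0 < l \<and> low i (0 < r) y x then lc q (0 < r) * Fd q i (r - 1) (l - 1) xs ys else 0)"
| "Fd q i r l [] (y # ys) = 0"
| "Fd q i r l (x # xs) [] = 0"

fun wt :: "nat => nat => nat list => int" where
 "wt i r [] = 0"
| "wt i r (y # ys) = sw i (0 < r) y + wt i (r - 1) ys"

fun dw :: "nat => nat list => int" where
 "dw r [] = 0"
| "dw r (y # ys) = (if 0 < r then 0 else int y) + dw (r - 1) ys"

text \<open>e_i^(l) is the transpose of f_i^(l), conjugated by the diagonal matrix with entries q^(2
  dw) and multiplied by a power of K_i. The conjugation corrects the dual letters, on which f_i has
  the entry -q but e_i has -q^(-1).\<close>

definition Ed :: "'a::comm_ring_1 => nat => nat => nat => nat list => nat list => 'a" where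
 "Ed q i r l x y = qpow q (- (int l * (wt i r x - int l))) * qpow q (2 * (dw r y - dw r x)) * Fd q i r l y x"

lemma low_neq: "low i b y x ==> x \<noteq> y" by (auto simp: low_def split: if_splits)
lemma low_sw: "low i b y x ==> sw i b y = 1 \<and> sw i b x = -1"
 by (auto simp: low_def sw_def split: if_splits)

lemma Fd_wt: "Fd q i r l x y \<noteq> 0 ==> wt i r x = wt i r y - 2 * int l"
 by (induction q i r l x y rule: Fd.induct) (auto split: if_splits dest!: low_sw mult_not_zero)

lemma Fd_0: "length x = length y ==> Fd q i r 0 x y = (if x = y then 1 else 0)"
 by (induction x y arbitrary: r rule: list_induct2) auto

lemma Fd_length: "Fd q i r l x y \<noteq> 0 ==> length x = length y \<and> l \<le> length x"
 by (induction q i r l x y rule: Fd.induct) (auto split: if_splits dest!: mult_not_zero)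

lemma fK_Suc: "fK q r i z (Suc p) = fK q (r - 1) i z p" by (auto simp: fK_def fun_eq_iff)
lemma ff_Suc: "ff n q r i (Suc p) = ff n q (r - 1) i p" by (auto simp: ff_def fun_eq_iff)
lemma fe_Suc: "fe n q r i (Suc p) = fe n q (r - 1) i p" by (auto simp: fe_def fun_eq_iff)

lemma df_eq: "1 \<le> i ==> i < n ==> df n q i x y = (if y = Suc i \<and> x = i then - q else (0::'a::comm_ring_1))"
proof -
 assume i: "1 \<le> i" "i < n"
 have "nmul n (vK q i (-1)) (vf i) y x = (\<Sum>z\<in>{1..n}. if z = y then vK q i (-1) y y * vf i y x else 0)"
  unfolding nmul_def by (rule sum.cong) (auto simp: vK_def)
 also have "... = (if y \<in> {1..n} then vK q i (-1) y y * vf i y x else 0)" by (simp add: sum.delta)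
 also have "... = (if y = Suc i \<and> x = i then q else 0)" using i by (auto simp: vK_def vf_def)
 finally show ?thesis by (simp add: df_def)
qed

lemma de_eq: "1 \<le> i ==> i < n ==> de n q i x y = (if y = i \<and> x = Suc i then - qinv q else (0::'a::comm_ring_1))"
proof -
 assume i: "1 \<le> i" "i < n"
 have "nmul n (ve i) (vK q i 1) y x = (\<Sum>z\<in>{1..n}. if z = x then ve i y x * vK q i 1 x x else 0)"
  unfolding nmul_def by (rule sum.cong) (auto simp: vK_def)
 also have "... = (if x \<in> {1..n} then ve i y x * vK q i 1 x x else 0)" by (simp add: sum.delta)
 also have "... = (if y = i \<and> x = Suc i then qinv q else 0)" using i by (auto simp: vK_def ve_def qpow_m1)
 finally show ?thesis by (simp add: de_def)
qed

lemma ff_eq: "1 \<le> i ==> i < n ==> ff n q r i p x y = (if low i (p < r) y x then lc q (p < r) else 0)"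
 by (auto simp: ff_def low_def lc_def vf_def df_eq)

lemma fe_eq: "1 \<le> i ==> i < n ==> fe n q r i p x y = (if low i (p < r) x y then (if p < r then 1 else - qinv q) else 0)"
 by (auto simp: fe_def low_def ve_def de_eq)

lemma fK_eq: "fK q r i z p x y = (if x = y then qpow q (z * sw i (p < r) y) else 0)"
 by (auto simp: fK_def vK_def dK_def sw_def)

lemma prod_idm: "length x = length y ==> (\<Prod>p<length y. idm (x ! p) (y ! p)) = (if x = y then 1 else (0::'a::comm_ring_1))"
 by (induction x y rule: list_induct2)
  (auto simp: idm_def prod.lessThan_Suc_shift simp del: prod.lessThan_Suc)

lemma prod_fK: assumes q: "q dvd (1::'a::comm_ring_1)" and "length x = length y"
 shows "(\<Prod>p<length y. fK q r i z p (x ! p) (y ! p)) = (if x = y then qpow q (z * wt i r y) else 0)"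
 using assms(2)
proof (induction x y arbitrary: r rule: list_induct2)
 case (Cons x xs y ys)
 have "(\<Prod>p<length (y # ys). fK q r i z p ((x # xs) ! p) ((y # ys) ! p)) = fK q r i z 0 x y * (if xs = ys then qpow q (z * wt i (r - 1) ys) else 0)"
  by (simp add: prod.lessThan_Suc_shift fK_Suc Cons.IH del: prod.lessThan_Suc)
 thus ?case by (auto simp: fK_eq qpow_add[OF q, symmetric] distrib_left)
qed simp

lemma sum_prod_f: assumes "1 \<le> i" "i < n" and "length x = length y"
 shows "(\<Sum>k<length x. \<Prod>p<length x. (if p < k then fK q r i 1 p else if p = k then ff n q r i p else idm) (x ! p) (y ! p))
  = Fd q i r 1 x y"
 using assms(3)
proof (induction x y arbitrary: r rule: list_induct2)
 case (Cons x xs y ys)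
 let ?G = "\<lambda>r k p. (if p < k then fK q r i 1 p else if p = k then ff n q r i p else idm)"
 have "(\<Sum>k<length (x # xs). \<Prod>p<length (x # xs). ?G r k p ((x # xs) ! p) ((y # ys) ! p))
  = ff n q r i 0 x y * (\<Prod>p<length xs. idm (xs ! p) (ys ! p))
   + (\<Sum>k<length xs. fK q r i 1 0 x y * (\<Prod>p<length xs. ?G (r - 1) k p (xs ! p) (ys ! p)))"
  by (simp add: sum.lessThan_Suc_shift prod.lessThan_Suc_shift fK_Suc ff_Suc del: prod.lessThan_Suc sum.lessThan_Suc cong: if_cong)
 also have "... = Fd q i r 1 (x # xs) (y # ys)"
  using Cons assms(1,2) by (auto simp: sum_distrib_left[symmetric] prod_idm ff_eq fK_eq Fd_0 simp del: One_nat_def dest: low_neq)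
 finally show ?case .
qed simp

lemma mx_f_eq: assumes "1 \<le> i" "i < n"
 shows "mx_f n q r s i x y = (if bas n (r + s) x \<and> bas n (r + s) y then Fd q i r 1 x y else 0)"
proof (cases "bas n (r + s) x \<and> bas n (r + s) y")
 case True
 hence "length x = r + s" "length y = r + s" by (auto simp: bas_length)
 thus ?thesis using True sum_prod_f[OF assms, of x y q r] by (simp add: mx_f_def tens_def)
qed (auto simp: mx_f_def tens_def)

text \<open>Splitting off the head reproduces Delta(e_i) = e_i \<otimes> K_i^(-1) + 1 \<otimes> e_i.
  For equal heads the weight of the head in the exponent cancels against the K_i-factor inside
  \<open>Fd\<close>; for a raised head the exponent that is left is the weight of the tail.\<close>

lemma Ed_1_Cons: assumes q: "q dvd (1::'a::comm_ring_1)" and "length xs = length ys"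
 shows "Ed q i r 1 (x # xs) (y # ys) = (if x = y then Ed q i (r - 1) 1 xs ys
  else if low i (0 < r) x y then (if 0 < r then 1 else - qinv q) * qpow q (- wt i (r - 1) ys) * (if xs = ys then 1 else 0) else 0)"
proof (cases "x = y")
 case True
 have e: "qpow q (- (wt i r (x # xs) - 1)) * qpow q (sw i (0 < r) x) = qpow q (- (wt i (r - 1) xs - 1))"
  by (simp add: qpow_add[OF q, symmetric])
 have d: "dw r (y # ys) - dw r (x # xs) = dw (r - 1) ys - dw (r - 1) xs" using True by simp
 have "Ed q i r 1 (x # xs) (y # ys) = (qpow q (- (wt i r (x # xs) - 1)) * qpow q (sw i (0 < r) x))
   * qpow q (2 * (dw (r - 1) ys - dw (r - 1) xs)) * Fd q i (r - 1) 1 ys xs"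
  unfolding Ed_def d using True by (simp add: mult_ac)
 thus ?thesis using True unfolding e by (simp add: Ed_def)
next
 case False
 show ?thesis
 proof (cases "low i (0 < r) x y")
  case True
  show ?thesis
  proof (cases "0 < r")
   case True
   thus ?thesis using \<open>low i (0 < r) x y\<close> False assms(2) low_sw[OF \<open>low i (0 < r) x y\<close>]
    by (auto simp: Ed_def lc_def Fd_0)
  next
   case b: False
   hence "x = Suc i" "y = i" using True by (auto simp: low_def)
   have "qpow q (2 * (dw 0 (y # ys) - dw 0 (x # ys))) * q = qinv q"
    using \<open>x = Suc i\<close> \<open>y = i\<close> qpow_add[OF q, of "-2" 1] by (simp add: qpow_m1)
   thus ?thesis using b True False assms(2) low_sw[OF True] qpow_m1[of q]
    by (auto simp: Ed_def lc_def Fd_0 mult.assoc)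
  qed
 next
  case n: False
  thus ?thesis using False by (auto simp: Ed_def)
 qed
qed

lemma sum_prod_e: assumes q: "q dvd (1::'a::comm_ring_1)" and "1 \<le> i" "i < n" and "length x = length y"
 shows "(\<Sum>k<length x. \<Prod>p<length x. (if p < k then idm else if p = k then fe n q r i p else fK q r i (- 1) p) (x ! p) (y ! p))
  = Ed q i r 1 x y"
 using assms(4)
proof (induction x y arbitrary: r rule: list_induct2)
 case (Cons x xs y ys)
 let ?G = "\<lambda>r k p. (if p < k then idm else if p = k then fe n q r i p else fK q r i (- 1) p)"
 have "(\<Sum>k<length (x # xs). \<Prod>p<length (x # xs). ?G r k p ((x # xs) ! p) ((y # ys) ! p))
  = fe n q r i 0 x y * (\<Prod>p<length xs. fK q (r - 1) i (- 1) p (xs ! p) (ys ! p))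
   + (\<Sum>k<length xs. idm x y * (\<Prod>p<length xs. ?G (r - 1) k p (xs ! p) (ys ! p)))"
  by (simp add: sum.lessThan_Suc_shift prod.lessThan_Suc_shift fK_Suc fe_Suc del: prod.lessThan_Suc sum.lessThan_Suc cong: if_cong)
 also have "... = Ed q i r 1 (x # xs) (y # ys)"
  using Cons assms(2,3) by (auto simp: sum_distrib_left[symmetric] prod_fK[OF q] fe_eq Ed_1_Cons[OF q] idm_def simp del: One_nat_def dest: low_neq)
 finally show ?case .
qed (simp add: Ed_def)

lemma mx_e_eq: assumes q: "q dvd (1::'a::comm_ring_1)" and "1 \<le> i" "i < n"
 shows "mx_e n q r s i x y = (if bas n (r + s) x \<and> bas n (r + s) y then Ed q i r 1 x y else 0)"
proof (cases "bas n (r + s) x \<and> bas n (r + s) y")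
 case True
 hence "length x = r + s" "length y = r + s" by (auto simp: bas_length)
 thus ?thesis using True sum_prod_e[OF assms, of x y r] by (simp add: mx_e_def tens_def)
qed (auto simp: mx_e_def tens_def)

lemma mx_K_eq: assumes q: "q dvd (1::'a::comm_ring_1)"
 shows "mx_K n q r s i z x y = (if bas n (r + s) x \<and> x = y then qpow q (z * wt i r y) else 0)"
proof (cases "bas n (r + s) x \<and> bas n (r + s) y")
 case True
 hence "length x = r + s" "length y = r + s" by (auto simp: bas_length)
 thus ?thesis using True prod_fK[OF q, of x y r i z] by (simp add: mx_K_def tens_def)
qed (auto simp: mx_K_def tens_def)

subsection \<open>Quantum integers and products of divided powers\<close>

text \<open>The quantum integer, by the recursion that arises when f_i multiplies from the left;
  \<open>qn_Suc'\<close> is the mirror form for multiplication from the right.\<close>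

fun qn :: "'a::comm_ring_1 => nat => 'a" where
 "qn q 0 = 0"
| "qn q (Suc l) = q ^ l + qinv q * qn q l"

lemma qn_Suc': assumes "q dvd (1::'a::comm_ring_1)" shows "qn q (Suc l) = qinv q ^ l + q * qn q l"
proof (induction l)
 case (Suc l)
 have "qn q (Suc (Suc l)) = q ^ Suc l + qinv q * (qinv q ^ l + q * qn q l)" using Suc by simp
 also have "... = qinv q ^ Suc l + q * (q ^ l + qinv q * qn q l)" by (simp add: algebra_simps)
 finally show ?case by simp
qed simp

definition FM :: "nat => 'a::comm_ring_1 => nat => nat => nat => nat => 'a mat" where
 "FM n q r s i l x y = (if bas n (r + s) x \<and> bas n (r + s) y then Fd q i r l x y else 0)"
definition EM :: "nat => 'a::comm_ring_1 => nat => nat => nat => nat => 'a mat" where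
 "EM n q r s i l x y = (if bas n (r + s) x \<and> bas n (r + s) y then Ed q i r l x y else 0)"

lemma supp_FM: "supp n (r + s) (FM n q r s i l)" by (simp add: supp_def FM_def)
lemma low_asym: "low i b y x ==> \<not> low i b x z" by (auto simp: low_def split: if_splits)
lemma low_irrefl: "\<not> low i b y y" by (auto simp: low_def split: if_splits)

lemma sum_two: "finite S ==> a \<in> S ==> b \<in> S ==> a \<noteq> b ==> (\<And>x. x \<in> S ==> x \<noteq> a ==> x \<noteq> b ==> g x = 0)
 ==> sum g S = (g a + g b ::'b::comm_monoid_add)"
 using sum.mono_neutral_right[of S "{a, b}" g] by auto

text \<open>A letter can be lowered only once, so the intermediate head is x1 or y1. In the lowered
  case the two summands tell which factor does the lowering; the other one contributes its K_i-power
  at a letter of weight -1 or 1.\<close>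

lemma Fd_conv: fixes q :: "'a::comm_ring_1" and n m r i :: nat and xs ys :: "nat list"
 assumes q: "q dvd 1" and b: "x1 \<in> {1..n}" "y1 \<in> {1..n}"
 defines "S \<equiv> \<lambda>a c. \<Sum>zs\<in>bset n m. Fd q i (r - 1) a xs zs * Fd q i (r - 1) c zs ys"
 shows "(\<Sum>z\<in>bset n (Suc m). Fd q i r a (x1 # xs) z * Fd q i r c z (y1 # ys)) =
  (if x1 = y1 then qpow q (int (a + c) * sw i (0 < r) x1) * S a c
  else if low i (0 < r) y1 x1 then lc q (0 < r) * ((if 0 < c then qpow q (- int a) * S a (c - 1) else 0) + (if 0 < a then qpow q (int c) * S (a - 1) c else 0))
  else 0)"
proof -
 let ?T = "\<lambda>z. \<Sum>zs\<in>bset n m. Fd q i r a (x1 # xs) (z # zs) * Fd q i r c (z # zs) (y1 # ys)" and ?l = "low i (0 < r)"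
 have no: "?T z = 0" if "z \<noteq> x1 \<and> \<not> ?l z x1 \<or> z \<noteq> y1 \<and> \<not> ?l y1 z" for z
  using that by (intro sum.neutral) auto
 have Z: "?T z = 0" if "z \<noteq> x1" "z \<noteq> y1" for z using that low_asym[of i "0 < r" z x1 y1] low_asym[of i "0 < r" y1 z x1] by (intro no) auto
 consider "x1 = y1" | "?l y1 x1" "x1 \<noteq> y1" | "x1 \<noteq> y1" "\<not> ?l y1 x1" by blast
 thus ?thesis
 proof cases
  case 1
  have e: "sum ?T {1..n} = ?T x1" by (rule sum_single) (use b Z 1 in auto)
  show ?thesis unfolding sum_bset_Suc e using 1 by (simp add: S_def sum_distrib_left distrib_right qpow_add[OF q] mult_ac)
 next
  case 2
  have e: "sum ?T {1..n} = ?T x1 + ?T y1" by (rule sum_two) (use b 2 Z in auto)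
  have e1: "?T x1 = lc q (0 < r) * (if 0 < c then qpow q (- int a) * S a (c - 1) else 0)" "?T y1 = lc q (0 < r) * (if 0 < a then qpow q (int c) * S (a - 1) c else 0)"
   using 2 low_sw[OF 2(1)] by (auto simp: S_def sum_distrib_left mult_ac)
  show ?thesis unfolding sum_bset_Suc e e1 using 2 by (simp add: distrib_left)
 next
  case 3
  have "?T z = 0" for z using 3 no[of z] Z[of z] by (cases "z = x1 \<or> z = y1") auto
  thus ?thesis unfolding sum_bset_Suc using 3 by simp
 qed
qed

text \<open>Both orders occur below, since e_i^(l) is built from a transpose and transposition
  reverses products.\<close>

lemma Fd_mult: assumes q: "q dvd (1::'a::comm_ring_1)"
 shows "bas n m x ==> bas n m y ==> (\<Sum>z\<in>bset n m. Fd q i r 1 x z * Fd q i r l z y) = qn q (Suc l) * Fd q i r (Suc l) x y"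
  "bas n m x ==> bas n m y ==> (\<Sum>z\<in>bset n m. Fd q i r l x z * Fd q i r 1 z y) = qn q (Suc l) * Fd q i r (Suc l) x y"
proof (induction m arbitrary: x y r l)
 case (Suc m)
 {
  case 1
  then obtain x1 xs y1 ys where xy: "x = x1 # xs" "y = y1 # ys" "x1 \<in> {1..n}" "y1 \<in> {1..n}" "bas n m xs" "bas n m ys" by (cases x; cases y) (auto simp: bas_def)
  have "(\<Sum>zs\<in>bset n m. Fd q i (r - 1) 0 xs zs * Fd q i (r - 1) l zs ys) = Fd q i (r - 1) l xs ys"
   by (subst sum_single[of _ xs]) (use xy in \<open>auto simp: Fd_0 bas_length\<close>)
  moreover have "(\<Sum>zs\<in>bset n m. Fd q i (r - 1) 1 xs zs * Fd q i (r - 1) (l - 1) zs ys) = qn q l * Fd q i (r - 1) l xs ys" if "0 < l"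
   using Suc.IH(1)[OF xy(5,6), of "r - 1" "l - 1"] that by simp
  ultimately show ?case unfolding xy(1,2) Fd_conv[OF q xy(3,4)] Suc.IH(1)[OF xy(5,6)]
   by (cases "l = 0") (auto simp: low_irrefl algebra_simps qpow_of_nat qpow_m1 simp del: One_nat_def)
 next
  case 2
  then obtain x1 xs y1 ys where xy: "x = x1 # xs" "y = y1 # ys" "x1 \<in> {1..n}" "y1 \<in> {1..n}" "bas n m xs" "bas n m ys" by (cases x; cases y) (auto simp: bas_def)
  have "(\<Sum>zs\<in>bset n m. Fd q i (r - 1) l xs zs * Fd q i (r - 1) 0 zs ys) = Fd q i (r - 1) l xs ys"
   by (subst sum_single[of _ ys]) (use xy in \<open>auto simp: Fd_0 bas_length\<close>)
  moreover have "(\<Sum>zs\<in>bset n m. Fd q i (r - 1) (l - 1) xs zs * Fd q i (r - 1) 1 zs ys) = qn q l * Fd q i (r - 1) l xs ys" if "0 < l"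
   using Suc.IH(2)[OF xy(5,6), of "r - 1" "l - 1"] that by simp
  ultimately show ?case unfolding xy(1,2) Fd_conv[OF q xy(3,4)] Suc.IH(2)[OF xy(5,6)] qn_Suc'[OF q]
   by (cases "l = 0") (auto simp: low_irrefl algebra_simps qpow_def simp del: One_nat_def)
 }
qed simp_all

lemma FM_mult: assumes "q dvd (1::'a::comm_ring_1)" "1 \<le> i" "i < n"
 shows "mmul n (r + s) (FM n q r s i 1) (FM n q r s i l) = (\<lambda>x y. qn q (Suc l) * FM n q r s i (Suc l) x y)"
proof (intro ext)
 fix x y
 show "mmul n (r + s) (FM n q r s i 1) (FM n q r s i l) x y = qn q (Suc l) * FM n q r s i (Suc l) x y"
  using Fd_mult(1)[OF assms(1), of n "r + s" x y i r l] by (auto simp: mmul_def FM_def)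
qed

lemma mmul_smult: "mmul n m A (\<lambda>x y. c * C x y) = (\<lambda>x y. c * mmul n m A C x y)"
 by (intro ext) (simp add: mmul_def sum_distrib_left mult.left_commute)
fun qfac :: "'a::comm_ring_1 => nat => 'a" where
 "qfac q 0 = 1" | "qfac q (Suc l) = qn q (Suc l) * qfac q l"

lemma FM_0: "FM n q r s i 0 = mid n (r + s)"
 by (auto simp: FM_def mid_def Fd_0 bas_length fun_eq_iff)

lemma mpow_FM: assumes "q dvd (1::'a::comm_ring_1)" "1 \<le> i" "i < n"
 shows "mpow n (r + s) (FM n q r s i 1) l = (\<lambda>x y. qfac q l * FM n q r s i l x y)"
 by (induction l) (simp_all add: FM_0 mmul_smult FM_mult[OF assms] mult_ac del: One_nat_def qn.simps)


definition tw :: "'a::comm_ring_1 => nat => nat list => nat list => 'a" where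
 "tw q r x y = qpow q (2 * (dw r y - dw r x))"

lemma tw_mult: "q dvd (1::'a::comm_ring_1) ==> tw q r x y * tw q r y z = tw q r x z"
 by (simp add: tw_def qpow_add[symmetric] algebra_simps)

lemma EM_mult: assumes q: "q dvd (1::'a::comm_ring_1)" and i: "1 \<le> i" "i < n"
 shows "mmul n (r + s) (EM n q r s i 1) (EM n q r s i l) = (\<lambda>x y. qn q (Suc l) * EM n q r s i (Suc l) x y)"
proof (intro ext)
 fix x y
 show "mmul n (r + s) (EM n q r s i 1) (EM n q r s i l) x y = qn q (Suc l) * EM n q r s i (Suc l) x y"
 proof (cases "bas n (r + s) x \<and> bas n (r + s) y")
  case True
  let ?c = "qpow q (- (int (Suc l) * (wt i r x - int (Suc l)))) * tw q r x y"
  have "Ed q i r 1 x z * Ed q i r l z y = ?c * (Fd q i r l y z * Fd q i r 1 z x)" for z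
  proof (cases "Fd q i r 1 z x = 0")
   case True thus ?thesis by (simp add: Ed_def)
  next
   case False
   \<comment> \<open>The entry is nonzero at one weight of z only, so the K_i-exponents of the two
     factors add up to an exponent free of z, which can leave the sum.\<close>
   hence z: "wt i r z = wt i r x - 2" using Fd_wt by fastforce
   have "qpow q (- (wt i r x - 1)) * qpow q (- (int l * (wt i r z - int l))) = qpow q (- (int (Suc l) * (wt i r x - int (Suc l))))"
    unfolding z by (simp add: qpow_add[OF q, symmetric] algebra_simps)
   moreover have "Ed q i r 1 x z * Ed q i r l z y = (qpow q (- (wt i r x - 1)) * qpow q (- (int l * (wt i r z - int l))))
    * (tw q r x z * tw q r z y) * (Fd q i r l y z * Fd q i r 1 z x)"
    by (simp add: Ed_def tw_def mult_ac)
   ultimately show ?thesis unfolding tw_mult[OF q] by simp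
  qed
  hence "(\<Sum>z\<in>bset n (r + s). Ed q i r 1 x z * Ed q i r l z y) = ?c * (\<Sum>z\<in>bset n (r + s). Fd q i r l y z * Fd q i r 1 z x)"
   by (simp add: sum_distrib_left)
  also have "... = qn q (Suc l) * Ed q i r (Suc l) x y"
   unfolding Fd_mult(2)[OF q True[THEN conjunct2] True[THEN conjunct1]] by (simp add: Ed_def tw_def mult_ac del: qn.simps)
  finally show ?thesis using True by (simp add: mmul_def EM_def)
 qed (auto simp: mmul_def EM_def)
qed

lemma Ed_0: "length x = length y ==> Ed q i r 0 x y = (if x = y then 1 else 0)"
 by (auto simp: Ed_def Fd_0)

lemma EM_0: "EM n q r s i 0 = mid n (r + s)"
 by (auto simp: EM_def mid_def Ed_0 bas_length fun_eq_iff)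

lemma mpow_EM: assumes "q dvd (1::'a::comm_ring_1)" "1 \<le> i" "i < n"
 shows "mpow n (r + s) (EM n q r s i 1) l = (\<lambda>x y. qfac q l * EM n q r s i l x y)"
 by (induction l) (simp_all add: EM_0 mmul_smult EM_mult[OF assms] mult_ac del: One_nat_def qn.simps)

subsection \<open>The divided powers of the statement\<close>

lemma qint_eq: "qint l = qn gq l"
proof (induction l)
 case 0 thus ?case by (simp add: qint_def)
next
 case (Suc l)
 have "qint (Suc l) = gq powi (int l) + (\<Sum>i<l. gq powi (2 * int i - int (Suc l) + 1))"
  by (simp add: qint_def)
 also have "(\<Sum>i<l. gq powi (2 * int i - int (Suc l) + 1)) = inverse gq * qint l"
 proof -
  have "gq powi (2 * int i - int (Suc l) + 1) = inverse gq * gq powi (2 * int i - int l + 1)" for i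
  proof -
   have "2 * int i - int (Suc l) + 1 = -1 + (2 * int i - int l + 1)" by simp
   hence "gq powi (2 * int i - int (Suc l) + 1) = gq powi (-1 + (2 * int i - int l + 1))" by (simp only:)
   also have "... = gq powi (-1) * gq powi (2 * int i - int l + 1)" using gq_nz by (intro power_int_add) simp
   finally show ?thesis by (simp add: power_int_minus)
  qed
  thus ?thesis by (simp add: qint_def sum_distrib_left)
 qed
 finally show ?case using Suc by (simp add: qinv_gq)
qed

lemma qfact_eq: "qfact l = qfac gq l"
 by (induction l) (simp_all add: qfact_def qint_eq prod.nat_ivl_Suc' del: qn.simps)

text \<open>q^l [l+1] is an integer polynomial in q whose value at 1 is l + 1, so it does not vanish
  in Q(q).\<close>

lemma qn_gq_nz: "l > 0 ==> qn gq l \<noteq> 0"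
proof -
 have e: "gq ^ l * qn gq (Suc l) = Fract (\<Sum>i\<le>l. PX ^ (2 * i)) 1" for l
 proof (induction l)
  case 0 thus ?case by (simp add: One_fract_def)
 next
  case (Suc l)
  have "gq ^ Suc l * qn gq (Suc (Suc l)) = gq ^ (Suc l + Suc l) + (gq * inverse gq) * (gq ^ l * qn gq (Suc l))"
   unfolding qn.simps(2)[of _ "Suc l"] qinv_gq power_add by (simp add: algebra_simps del: qn.simps)
  hence "gq ^ Suc l * qn gq (Suc (Suc l)) = gq ^ (2 * Suc l) + gq ^ l * qn gq (Suc l)"
   using gq_nz by (simp add: mult_2 del: qn.simps power_Suc)
  thus ?case unfolding Suc unfolding gq_power by (simp add: add.commute)
 qed
 have "poly (\<Sum>i\<le>k. PX ^ (2 * i)) 1 = int (Suc k)" for k by (simp add: poly_sum)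
 hence "(\<Sum>i\<le>k. PX ^ (2 * i)) \<noteq> 0" for k by (metis of_nat_0_eq_iff poly_0 nat.distinct(1))
 hence n: "Fract (\<Sum>i\<le>k. PX ^ (2 * i)) 1 \<noteq> 0" for k by (simp add: Zero_fract_def eq_fract)
 assume "l > 0"
 then obtain k where "l = Suc k" by (cases l) auto
 thus ?thesis using e[of k] n[of k] by auto
qed

lemma qfac_gq_nz: "qfac gq l \<noteq> 0"
 by (induction l) (simp_all add: qn_gq_nz del: qn.simps)

lemma Lau_lc: "lc gq b \<in> Lau" by (simp add: lc_def Lau_uminus Lau_gq)
lemma Lau_Fd: "Fd gq i r l x y \<in> Lau"
 by (induction gq i r l x y rule: Fd.induct) (simp_all add: Lau_mult Lau_qpow Lau_lc)
lemma spec_Fd: "q dvd (1::'a::comm_ring_1) ==> spec q (Fd gq i r l x y) = Fd q i r l x y"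
 by (induction q i r l x y rule: Fd.induct)
  (auto simp: spec_mult Lau_mult Lau_qpow Lau_lc Lau_Fd spec_qpow spec_uminus spec_gq Lau_gq lc_def)
lemma spec_Ed: "q dvd (1::'a::comm_ring_1) ==> spec q (Ed gq i r l x y) = Ed q i r l x y"
 by (simp add: Ed_def spec_mult Lau_mult Lau_qpow Lau_Fd spec_qpow spec_Fd)

text \<open>Over Q(q) the l-th power is [l]! times the explicit matrix, and [l]! can be divided out
  there. What remains has entries in \<open>Lau\<close>, and these specialise factor by
  factor.\<close>

lemma mx_f_div_eq: assumes "q dvd (1::'a::comm_ring_1)" "1 \<le> i" "i < n"
 shows "mx_f_div n q r s i l = FM n q r s i l"
proof (intro ext)
 fix x y
 have "mx_f n gq r s i = FM n gq r s i 1"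
  by (intro ext) (simp add: mx_f_eq[OF assms(2,3)] FM_def)
 hence "mx_f_div n q r s i l x y = spec q (FM n gq r s i l x y)"
  using qfac_gq_nz[of l] by (simp add: mx_f_div_def mpow_FM[OF gq_unit assms(2,3)] qfact_eq del: One_nat_def)
 thus "mx_f_div n q r s i l x y = FM n q r s i l x y" by (simp add: FM_def spec_Fd assms(1))
qed

lemma mx_e_div_eq: assumes "q dvd (1::'a::comm_ring_1)" "1 \<le> i" "i < n"
 shows "mx_e_div n q r s i l = EM n q r s i l"
proof (intro ext)
 fix x y
 have "mx_e n gq r s i = EM n gq r s i 1"
  by (intro ext) (simp add: mx_e_eq[OF gq_unit assms(2,3)] EM_def)
 hence "mx_e_div n q r s i l x y = spec q (EM n gq r s i l x y)"
  using qfac_gq_nz[of l] by (simp add: mx_e_div_def mpow_EM[OF gq_unit assms(2,3)] qfact_eq del: One_nat_def)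
 thus "mx_e_div n q r s i l x y = EM n q r s i l x y" by (simp add: EM_def spec_Ed assms(1))
qed

section \<open>Pointwise Hecke operators\<close>

text \<open>The order is reversed on the dual side because the operators hat S_j exchange the roles
  of < and >. One operator \<open>tau\<close> thus serves both sides of the wall.\<close>

definition lt :: "bool => nat => nat => bool" where "lt b u w \<longleftrightarrow> (if b then u < w else w < u)"

text \<open>A Hecke generator acting on coefficient functions instead of basis vectors. Its matrix
  is symmetric (\<open>tau_sym\<close>), so the same formula describes composition with a matrix
  from either side.\<close>

definition tau :: "bool => 'a::comm_ring_1 => nat => (nat list => 'a) => nat list => 'a" where
 "tau b q a g y = (if y ! a = y ! Suc a then qinv q * g y
  else g (swp y a (Suc a)) + (if lt b (y ! a) (y ! Suc a) then 0 else (qinv q - q) * g y))"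

lemma swp_Cons: "swp (y # ys) (Suc a) (Suc a') = y # swp ys a a'" by (simp add: swp_def)
lemma swp_0: "swp (u # w # ys) 0 (Suc 0) = w # u # ys" by (simp add: swp_def)

lemma tau_Suc: "tau b q (Suc a) g (y # ys) = tau b q a (\<lambda>z. g (y # z)) ys"
 by (simp add: tau_def swp_Cons)
lemma tau_0: "tau b q 0 g (u # w # ys) = (if u = w then qinv q * g (u # w # ys)
  else g (w # u # ys) + (if lt b u w then 0 else (qinv q - q) * g (u # w # ys)))"
 by (simp add: tau_def swp_0)

lemma tau_app: "length L = a ==> tau b q a g (L @ u # w # R) = (if u = w then qinv q * g (L @ u # w # R)
  else g (L @ w # u # R) + (if lt b u w then 0 else (qinv q - q) * g (L @ u # w # R)))"
 by (induction L arbitrary: a g) (auto simp: tau_0 tau_Suc)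

lemma tau_scale: "tau b q a (\<lambda>y. c * g y) y = c * tau b q a g y"
 by (simp add: tau_def algebra_simps)
lemma tau_add: "tau b q a (\<lambda>y. g y + h y) y = tau b q a g y + tau b q a h y"
 by (simp add: tau_def algebra_simps)
lemma tau_zero: "tau b q a (\<lambda>y. 0) y = 0" by (simp add: tau_def)
lemma tau_sum: "tau b q a (\<lambda>y. \<Sum>i\<in>S. g i y) y = (\<Sum>i\<in>S. tau b q a (g i) y)"
 by (induction S rule: infinite_finite_induct) (simp_all add: tau_zero tau_add)

definition dl :: "bool => 'a::comm_ring_1" where "dl P = (if P then 1 else 0)"

text \<open>Sorting by the number of lowered letters among the first two separates three different
  tails. A Hecke operator at these two places acts only on the coefficients in front of the tails,
  so each of the three can be treated on its own.\<close>

lemma Fd_two: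
 assumes b: "b = (0 < r)" "b = (0 < r - 1)"
 shows "Fd q i r l (u1 # u2 # xs) (w1 # w2 # ys) =
  dl (u1 = w1 \<and> u2 = w2) * (qpow q (int l * sw i b w1) * qpow q (int l * sw i b w2)) * Fd q i (r - 1 - 1) l xs ys
 + dl (0 < l) * lc q b * (dl (u1 = w1 \<and> low i b w2 u2) * qpow q (int l * sw i b w1)
    + dl (low i b w1 u1 \<and> u2 = w2) * qpow q (int (l - 1) * sw i b w2)) * Fd q i (r - 1 - 1) (l - 1) xs ys
 + dl (1 < l) * (lc q b * lc q b * dl (low i b w1 u1 \<and> low i b w2 u2)) * Fd q i (r - 1 - 1) (l - 1 - 1) xs ys"
proof -
 have r: "(0 < r) = b" "(0 < r - 1) = b" using b by auto
 have l: "0 < l - 1 \<longleftrightarrow> 1 < l" "1 < l ==> 0 < l" by auto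
 consider "u1 = w1" "u2 = w2" | "u1 = w1" "low i b w2 u2" | "u1 = w1" "u2 \<noteq> w2" "\<not> low i b w2 u2"
  | "low i b w1 u1" "u2 = w2" | "low i b w1 u1" "low i b w2 u2" | "low i b w1 u1" "u2 \<noteq> w2" "\<not> low i b w2 u2"
  | "u1 \<noteq> w1" "\<not> low i b w1 u1" by blast
 thus ?thesis
  unfolding Fd.simps r l
  by cases (auto simp: dl_def mult.assoc low_irrefl dest: low_neq)
qed

text \<open>The coefficients of the three possible tail contributions intertwine separately.\<close>

lemma tau2_A0:
 fixes x1 x2 y1 y2 :: nat and b and c :: "nat => 'a::comm_ring_1"
 defines "A \<equiv> \<lambda>u1 u2 w1 w2. dl (u1 = w1 \<and> u2 = w2) * (c w1 * c w2)"
 shows "(if y1 = y2 then qi * A x1 x2 y1 y2 else A x1 x2 y2 y1 + (if lt b y1 y2 then 0 else h * A x1 x2 y1 y2))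
   = (if x1 = x2 then qi * A x1 x2 y1 y2 else A x2 x1 y1 y2 + (if lt b x1 x2 then 0 else h * A x1 x2 y1 y2))"
proof -
 consider "y1 = y2" "x1 = y1" "x2 = y2" | "y1 = y2" "x1 \<noteq> y1 \<or> x2 \<noteq> y2" | "y1 \<noteq> y2" "x1 = y1" "x2 = y2"
  | "y1 \<noteq> y2" "x1 = y2" "x2 = y1" | "y1 \<noteq> y2" "\<not> (x1 = y1 \<and> x2 = y2)" "\<not> (x1 = y2 \<and> x2 = y1)" by blast
 thus ?thesis unfolding A_def dl_def by cases (auto simp: mult.commute[of "c x1"])
qed

lemma tau2_A2:
 fixes x1 x2 y1 y2 i :: nat and b and c :: "'a::comm_ring_1"
 defines "A \<equiv> \<lambda>u1 u2 w1 w2. c * dl (low i b w1 u1 \<and> low i b w2 u2)"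
 shows "(if y1 = y2 then qi * A x1 x2 y1 y2 else A x1 x2 y2 y1 + (if lt b y1 y2 then 0 else h * A x1 x2 y1 y2))
   = (if x1 = x2 then qi * A x1 x2 y1 y2 else A x2 x1 y1 y2 + (if lt b x1 x2 then 0 else h * A x1 x2 y1 y2))"
proof -
 have l: "low i b w u \<longleftrightarrow> w = (if b then i else Suc i) \<and> u = (if b then Suc i else i)" for w u
  by (auto simp: low_def)
 define lo hi where "lo = (if b then i else Suc i)" and "hi = (if b then Suc i else i)"
 have low: "low i b w u \<longleftrightarrow> w = lo \<and> u = hi" for w u by (simp add: l lo_def hi_def)
 show ?thesis
 proof (cases "x1 = hi \<and> x2 = hi \<and> y1 = lo \<and> y2 = lo")
  case True thus ?thesis by (simp add: A_def low)
 next
  case False thus ?thesis unfolding A_def low dl_def by auto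
 qed
qed

text \<open>The core computation: f_i^(k+1) with exactly one of the two letters lowered. In terms of
  the letter \<open>lo\<close> that can be lowered and its image \<open>hi\<close>, both flags lead
  to the same case table, since \<open>lt b lo hi\<close> holds for either flag.\<close>

lemma tau2_A1:
 fixes x1 x2 y1 y2 i k :: nat and b and q :: "'a::comm_ring_1"
 assumes q: "q dvd 1"
 defines "A \<equiv> \<lambda>u1 u2 w1 w2. dl (u1 = w1 \<and> low i b w2 u2) * qpow q (int (Suc k) * sw i b w1)
    + dl (low i b w1 u1 \<and> u2 = w2) * qpow q (int k * sw i b w2)"
 shows "(if y1 = y2 then qinv q * A x1 x2 y1 y2 else A x1 x2 y2 y1 + (if lt b y1 y2 then 0 else (qinv q - q) * A x1 x2 y1 y2))
   = (if x1 = x2 then qinv q * A x1 x2 y1 y2 else A x2 x1 y1 y2 + (if lt b x1 x2 then 0 else (qinv q - q) * A x1 x2 y1 y2))"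
proof -
 define p where "p = qinv q"
 have pq: "q * p = 1" "p * q = 1" using q by (auto simp: p_def qinv_right qinv_left)
 have pq': "q * (p * z) = z" "p * (q * z) = z" for z by (simp_all add: pq mult.assoc[symmetric])
 define P where "P = p ^ k"
 define Q where "Q = q ^ k"
 define lo hi where "lo = (if b then i else Suc i)" and "hi = (if b then Suc i else i)"
 have lh: "lo \<noteq> hi" "hi \<noteq> lo" by (auto simp: lo_def hi_def)
 have low: "low i b w u \<longleftrightarrow> w = lo \<and> u = hi" for w u by (auto simp: low_def lo_def hi_def)
 have S: "qpow q (int (Suc k) * sw i b w) = (if w = lo then q * Q else if w = hi then p * P else 1)"
     "qpow q (int k * sw i b w) = (if w = lo then Q else if w = hi then P else 1)" for w
  by (auto simp: sw_def lo_def hi_def qpow_def Q_def P_def p_def nat_add_distrib)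
 have L: "lt b lo hi" "\<not> lt b hi lo" "\<And>w. w \<noteq> lo ==> w \<noteq> hi ==> lt b w lo = lt b w hi" "\<And>w. w \<noteq> lo ==> w \<noteq> hi ==> lt b lo w = lt b hi w"
  by (auto simp: lt_def lo_def hi_def split: if_splits)
 show ?thesis unfolding A_def low S p_def[symmetric] dl_def
  apply (cases "y1 = lo"; cases "y1 = hi"; cases "y2 = lo"; cases "y2 = hi")
  apply (simp_all add: lh lh[symmetric] L)
  apply (auto simp: lh L algebra_simps pq pq')
  done
qed

lemma Fd_tau_0:
 assumes q: "q dvd (1::'a::comm_ring_1)" and b: "b = (0 < r)" "b = (0 < r - 1)"
 shows "tau b q 0 (\<lambda>y. Fd q i r l (x1 # x2 # xs) y) (y1 # y2 # ys) = tau b q 0 (\<lambda>x. Fd q i r l x (y1 # y2 # ys)) (x1 # x2 # xs)"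
proof -
 define A0 where "A0 = (\<lambda>u1 u2 w1 w2. dl (u1 = w1 \<and> u2 = w2) * (qpow q (int l * sw i b w1) * qpow q (int l * sw i b w2)))"
 define A1 where "A1 = (\<lambda>u1 u2 w1 w2. dl (u1 = w1 \<and> low i b w2 u2) * qpow q (int l * sw i b w1)
    + dl (low i b w1 u1 \<and> u2 = w2) * qpow q (int (l - 1) * sw i b w2))"
 define A2 where "A2 = (\<lambda>u1 u2 w1 w2. lc q b * lc q b * dl (low i b w1 u1 \<and> low i b w2 u2))"
 define F0 where "F0 = Fd q i (r - 1 - 1) l xs ys"
 define F1 where "F1 = Fd q i (r - 1 - 1) (l - 1) xs ys"
 define F2 where "F2 = Fd q i (r - 1 - 1) (l - 1 - 1) xs ys"
 define d where "d = (dl (0 < l) * lc q b :: 'a)"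
 define d2 where "d2 = (dl (1 < l) :: 'a)"
 have F: "Fd q i r l (u1 # u2 # xs) (w1 # w2 # ys) = A0 u1 u2 w1 w2 * F0 + d * A1 u1 u2 w1 w2 * F1 + d2 * A2 u1 u2 w1 w2 * F2"
  for u1 u2 w1 w2 unfolding A0_def A1_def A2_def d_def d2_def F0_def F1_def F2_def by (rule Fd_two[OF b])
 define Y X where "Y = (\<lambda>A. (if y1 = y2 then qinv q * A x1 x2 y1 y2 else A x1 x2 y2 y1 + (if lt b y1 y2 then 0 else (qinv q - q) * A x1 x2 y1 y2)))"
  and "X = (\<lambda>A. (if x1 = x2 then qinv q * A x1 x2 y1 y2 else A x2 x1 y1 y2 + (if lt b x1 x2 then 0 else (qinv q - q) * A x1 x2 y1 y2)))"
 have 0: "Y A0 = X A0" unfolding X_def Y_def A0_def by (rule tau2_A0)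
 have 2: "Y A2 = X A2" unfolding X_def Y_def A2_def by (rule tau2_A2)
 have 1: "d * Y A1 = d * X A1"
 proof (cases l)
  case 0 thus ?thesis by (simp add: d_def dl_def)
 next
  case (Suc k)
  have "Y A1 = X A1" unfolding X_def Y_def A1_def Suc diff_Suc_1 by (rule tau2_A1[OF q])
  thus ?thesis by simp
 qed
 have "tau b q 0 (\<lambda>y. Fd q i r l (x1 # x2 # xs) y) (y1 # y2 # ys) = Y A0 * F0 + d * Y A1 * F1 + d2 * Y A2 * F2"
  unfolding tau_0 F Y_def by (simp add: algebra_simps)
 moreover have "tau b q 0 (\<lambda>x. Fd q i r l x (y1 # y2 # ys)) (x1 # x2 # xs) = X A0 * F0 + d * X A1 * F1 + d2 * X A2 * F2"
  unfolding tau_0 F X_def by (simp add: algebra_simps)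
 ultimately show ?thesis by (simp only: 0 1 2)
qed

lemma Fd_tau: assumes q: "q dvd (1::'a::comm_ring_1)"
 shows "length x = length y ==> Suc a < length x ==> b \<and> Suc a < r \<or> \<not> b \<and> r \<le> a ==>
  tau b q a (\<lambda>y. Fd q i r l x y) y = tau b q a (\<lambda>x. Fd q i r l x y) x"
proof (induction a arbitrary: r l x y)
 case 0
 obtain x1 x2 xs y1 y2 ys where xy: "x = x1 # x2 # xs" "y = y1 # y2 # ys"
  using 0 by (metis Suc_less_eq length_0_conv length_Suc_conv less_nat_zero_code not_less_zero list.exhaust list.size(3))
 have "b = (0 < r)" "b = (0 < r - 1)" using 0 by auto
 from Fd_tau_0[OF q this] show ?case unfolding xy .
next
 case (Suc a)
 obtain x1 xs y1 ys where xy: "x = x1 # xs" "y = y1 # ys"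
  using Suc.prems by (cases x; cases y) auto
 have IH: "tau b q a (\<lambda>y. Fd q i (r - 1) l xs y) ys = tau b q a (\<lambda>x. Fd q i (r - 1) l x ys) xs" for l
  by (rule Suc.IH) (use Suc.prems xy in auto)
 consider "x1 = y1" | "x1 \<noteq> y1" "0 < l \<and> low i (0 < r) y1 x1" | "x1 \<noteq> y1" "\<not> (0 < l \<and> low i (0 < r) y1 x1)" by blast
 thus ?case
  unfolding xy tau_Suc Fd.simps by cases (simp_all only: if_True if_False simp_thms tau_scale IH tau_zero)
qed

subsection \<open>Creation and evaluation at the wall\<close>

definition ins :: "nat => nat => nat list => nat list" where "ins r t x = take r x @ t # t # drop r x"
definition del :: "nat => nat list => nat list" where "del r z = take r z @ drop (r + 2) z"

lemma ins_0: "ins 0 t x = t # t # x" by (simp add: ins_def)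
lemma ins_Suc: "ins (Suc r) t (x # xs) = x # ins r t xs" by (simp add: ins_def)
lemma del_0: "del 0 (u # w # z) = z" by (simp add: del_def)
lemma del_Suc: "del (Suc r) (u # z) = u # del r z" by (simp add: del_def)

text \<open>The sum of all v_t \<otimes> v_t^* is invariant. Off the diagonal only the pair (i+1, i)
  can arise, from t = i + 1 and from t = i, and the two contributions cancel: the entry -q of the
  dual letter makes up for one K_i-factor.\<close>

lemma Fd_ins: assumes q: "q dvd (1::'a::comm_ring_1)" and i: "1 \<le> i" "i < n"
 shows "length z = length y + 2 ==> r \<le> length y ==> set z \<subseteq> {1..n} ==>
  (\<Sum>t\<in>{1..n}. Fd q i (Suc r) l z (ins r t y)) = (if z ! r = z ! Suc r then Fd q i r l (del r z) y else 0)"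
proof (induction r arbitrary: z y l)
 case 0
 obtain u w zs where z: "z = u # w # zs" using 0
  by (metis Suc_length_conv add_2_eq_Suc')
 define p where "p = qinv q"
 have pq: "q * p = 1" "p * q = 1" using q by (auto simp: p_def qinv_right qinv_left)
 have G: "Fd q i (Suc 0) l z (ins 0 t y) =
  (if u = t then qpow q (int l * sw i True t) * (if w = t then qpow q (int l * sw i False t) * Fd q i 0 l zs y
    else if 0 < l \<and> low i False t w then - q * Fd q i 0 (l - 1) zs y else 0)
  else if 0 < l \<and> low i True t u then (if w = t then qpow q (int (l - 1) * sw i False t) * Fd q i 0 (l - 1) zs y
    else if 1 < l \<and> low i False t w then - q * Fd q i 0 (l - 2) zs y else 0) else 0)" for t
  unfolding z ins_0 by (auto simp: lc_def numeral_2_eq_2)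
 have s: "sw i False t = - sw i True t" for t by (auto simp: sw_def)
 have qq: "qpow q (int l * sw i True t) * (qpow q (- (int l * sw i True t)) * c) = c" for t c
  by (simp add: mult.assoc[symmetric] qpow_minus[OF q])
 have u: "u \<in> {1..n}" "w \<in> {1..n}" using 0 z by auto
 show ?case
 proof (cases "u = w")
  case True
  have "(\<Sum>t\<in>{1..n}. Fd q i (Suc 0) l z (ins 0 t y)) = Fd q i (Suc 0) l z (ins 0 u y)"
   by (rule sum_single) (use u True in \<open>auto simp: G low_def\<close>)
  thus ?thesis unfolding G using True by (simp add: z del_0 s qq)
 next
  case ne: False
  show ?thesis
  proof (cases "0 < l \<and> u = Suc i \<and> w = i")
   case True
   have "(\<Sum>t\<in>{1..n}. Fd q i (Suc 0) l z (ins 0 t y)) = Fd q i (Suc 0) l z (ins 0 (Suc i) y) + Fd q i (Suc 0) l z (ins 0 i y)"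
    by (rule sum_two) (use i True in \<open>auto simp: G low_def\<close>)
   also have "Fd q i (Suc 0) l z (ins 0 (Suc i) y) = - (qpow q (- int l) * q) * Fd q i 0 (l - 1) zs y"
    unfolding G using True by (simp add: low_def sw_def)
   also have "Fd q i (Suc 0) l z (ins 0 i y) = qpow q (- int (l - 1)) * Fd q i 0 (l - 1) zs y"
    unfolding G using True by (simp add: low_def sw_def)
   also have "qpow q (- int l) * q = qpow q (- int (l - 1))"
    using qpow_add[OF q, of "- int l" 1] True by (simp add: of_nat_diff)
   finally have "(\<Sum>t\<in>{1..n}. Fd q i (Suc 0) l z (ins 0 t y)) = 0" by simp
   thus ?thesis using ne by (simp add: z)
  next
   case False
   have "Fd q i (Suc 0) l z (ins 0 t y) = 0" for t unfolding G using ne False by (auto simp: low_def)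
   thus ?thesis using ne by (simp add: z)
  qed
 qed
next
 case (Suc r)
 obtain u zs y1 ys where zy: "z = u # zs" "y = y1 # ys" using Suc.prems by (cases z; cases y) auto
 have IH: "(\<Sum>t\<in>{1..n}. Fd q i (Suc r) l zs (ins r t ys)) = (if zs ! r = zs ! Suc r then Fd q i r l (del r zs) ys else 0)" for l
  by (rule Suc.IH) (use Suc.prems zy in auto)
 consider "u = y1" | "u \<noteq> y1" "0 < l \<and> low i True y1 u" | "u \<noteq> y1" "\<not> (0 < l \<and> low i True y1 u)" by blast
 thus ?case
  unfolding zy ins_Suc del_Suc by cases (auto simp: sum_distrib_left[symmetric] IH simp del: One_nat_def)
qed

text \<open>The evaluation v_t \<otimes> v_t^* to q^(2t) is equivariant. The weights come from the
  off-diagonal pair (i, i+1): its two contributions cancel because consecutive weights differ by the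
  factor q^2.\<close>

lemma Fd_ev: assumes q: "q dvd (1::'a::comm_ring_1)" and i: "1 \<le> i" "i < n"
 shows "length z = length x + 2 ==> r \<le> length x ==> set z \<subseteq> {1..n} ==>
  (\<Sum>t\<in>{1..n}. qpow q (2 * int t) * Fd q i (Suc r) l (ins r t x) z) = (if z ! r = z ! Suc r then qpow q (2 * int (z ! r)) * Fd q i r l x (del r z) else 0)"
proof (induction r arbitrary: z x l)
 case 0
 obtain u w zs where z: "z = u # w # zs" using 0
  by (metis Suc_length_conv add_2_eq_Suc')
 have G: "Fd q i (Suc 0) l (ins 0 t x) z =
  (if t = u then qpow q (int l * sw i True u) * (if t = w then qpow q (int l * sw i False w) * Fd q i 0 l x zs
    else if 0 < l \<and> low i False w t then - q * Fd q i 0 (l - 1) x zs else 0)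
  else if 0 < l \<and> low i True u t then (if t = w then qpow q (int (l - 1) * sw i False w) * Fd q i 0 (l - 1) x zs
    else if 1 < l \<and> low i False w t then - q * Fd q i 0 (l - 2) x zs else 0) else 0)" for t
  unfolding z ins_0 by (auto simp: lc_def numeral_2_eq_2)
 have s: "sw i False t = - sw i True t" for t by (auto simp: sw_def)
 have qq: "qpow q (int l * sw i True t) * (qpow q (- (int l * sw i True t)) * c) = c" for t c
  by (simp add: mult.assoc[symmetric] qpow_minus[OF q])
 have u: "u \<in> {1..n}" "w \<in> {1..n}" using 0 z by auto
 show ?case
 proof (cases "u = w")
  case True
  have "(\<Sum>t\<in>{1..n}. qpow q (2 * int t) * Fd q i (Suc 0) l (ins 0 t x) z) = qpow q (2 * int u) * Fd q i (Suc 0) l (ins 0 u x) z"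
   by (rule sum_single) (use u True in \<open>auto simp: G low_def\<close>)
  thus ?thesis unfolding G using True by (simp add: z del_0 s qq)
 next
  case ne: False
  show ?thesis
  proof (cases "0 < l \<and> u = i \<and> w = Suc i")
   case True
   then obtain k where k: "l = Suc k" by (cases l) auto
   have e: "qpow q (2 * int (Suc i)) = q * q * qpow q (2 * int i)"
    using qpow_add[OF q, of 2 "2 * int i"] by (simp add: qpow_def power2_eq_square)
   have "(\<Sum>t\<in>{1..n}. qpow q (2 * int t) * Fd q i (Suc 0) l (ins 0 t x) z) = qpow q (2 * int (Suc i)) * Fd q i (Suc 0) l (ins 0 (Suc i) x) z + qpow q (2 * int i) * Fd q i (Suc 0) l (ins 0 i x) z"
    by (rule sum_two) (use i True in \<open>auto simp: G low_def\<close>)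
   also have "... = 0" unfolding G e using True by (auto simp: low_def sw_def k qpow_of_nat algebra_simps simp flip: of_nat_Suc)
   finally show ?thesis using ne by (simp add: z)
  next
   case False
   have "Fd q i (Suc 0) l (ins 0 t x) z = 0" for t unfolding G using ne False by (auto simp: low_def)
   thus ?thesis using ne by (simp add: z)
  qed
 qed
next
 case (Suc r)
 obtain u zs x1 xs where zy: "z = u # zs" "x = x1 # xs" using Suc.prems by (cases z; cases x) auto
 have IH: "(\<Sum>t\<in>{1..n}. qpow q (2 * int t) * Fd q i (Suc r) l (ins r t xs) zs) = (if zs ! r = zs ! Suc r then qpow q (2 * int (zs ! r)) * Fd q i r l xs (del r zs) else 0)" for l
  by (rule Suc.IH) (use Suc.prems zy in auto)
 have e: "(\<Sum>t\<in>{1..n}. qpow q (2 * int t) * (c * Fd q i (Suc r) l (ins r t xs) zs)) = c * (\<Sum>t\<in>{1..n}. qpow q (2 * int t) * Fd q i (Suc r) l (ins r t xs) zs)" for l c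
  by (simp add: sum_distrib_left mult.left_commute)
 consider "x1 = u" | "x1 \<noteq> u" "0 < l \<and> low i True u x1" | "x1 \<noteq> u" "\<not> (0 < l \<and> low i True u x1)" by blast
 thus ?case
  unfolding zy ins_Suc del_Suc by cases (auto simp: e IH simp del: One_nat_def)
qed

section \<open>Matrices acting on coefficient functions\<close>

definition ap :: "nat => nat => 'a::comm_ring_1 mat => (nat list => 'a) => nat list => 'a" where
 "ap n m A v x = (\<Sum>y\<in>bset n m. A x y * v y)"

lemma ap_ap: "ap n m A (ap n m C v) = ap n m (mmul n m A C) v"
proof
 fix x
 have "ap n m A (ap n m C v) x = (\<Sum>y\<in>bset n m. \<Sum>z\<in>bset n m. A x y * C y z * v z)"
  by (simp add: ap_def sum_distrib_left mult.assoc)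
 also have "... = (\<Sum>z\<in>bset n m. \<Sum>y\<in>bset n m. A x y * C y z * v z)" by (rule sum.swap)
 also have "... = ap n m (mmul n m A C) v x" by (simp add: ap_def mmul_def sum_distrib_right)
 finally show "ap n m A (ap n m C v) x = ap n m (mmul n m A C) v x" .
qed

definition dlt :: "nat list => nat list => 'a::comm_ring_1" where "dlt y x = (if x = y then 1 else 0)"

lemma ap_dlt: "bas n m y ==> ap n m A (dlt y) x = A x y"
 unfolding ap_def by (subst sum_single[of _ y]) (auto simp: dlt_def)

section \<open>Quantum antisymmetrizers\<close>

fun inv :: "bool => nat list => nat" where
 "inv b [] = 0"
| "inv b (x # xs) = length (filter (\<lambda>y. lt b y x) xs) + inv b xs"

text \<open>The number of inversions between a block with letter set A and a block with letter set C
  standing to its right.\<close>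

definition icr :: "bool => nat set => nat set => nat" where
 "icr b A C = card {(a, c). a \<in> A \<and> c \<in> C \<and> lt b c a}"

text \<open>The coefficient of a word in a quantum exterior power. The scalar -q is the eigenvalue
  of the Hecke operators other than q^(-1).\<close>

definition asg :: "'a::comm_ring_1 => bool => nat list => 'a" where
 "asg q b x = (if distinct x then (- q) ^ inv b x else 0)"

definition io :: "'a::comm_ring_1 => bool => nat set => nat list => 'a" where
 "io q b Y x = (if set x = Y then asg q b x else 0)"

lemma icr_finite: "finite A ==> finite C ==> finite {(a, c). a \<in> A \<and> c \<in> C \<and> lt b c a}"
 by (rule finite_subset[of _ "A \<times> C"]) auto

lemma icr_empty [simp]: "icr b {} C = 0" "icr b A {} = 0" by (auto simp: icr_def)

lemma icr_insert: "finite A ==> finite C ==> x \<notin> A ==> icr b (insert x A) C = card {c \<in> C. lt b c x} + icr b A C"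
proof -
 assume f: "finite A" "finite C" "x \<notin> A"
 have "{(a, c). a \<in> insert x A \<and> c \<in> C \<and> lt b c a} = (\<lambda>c. (x, c)) ` {c \<in> C. lt b c x} \<union> {(a, c). a \<in> A \<and> c \<in> C \<and> lt b c a}" by auto
 moreover have "card ((\<lambda>c. (x, c)) ` {c \<in> C. lt b c x} \<union> {(a, c). a \<in> A \<and> c \<in> C \<and> lt b c a})
  = card ((\<lambda>c. (x, c)) ` {c \<in> C. lt b c x}) + card {(a, c). a \<in> A \<and> c \<in> C \<and> lt b c a}"
  using f by (intro card_Un_disjoint icr_finite) auto
 moreover have "card ((\<lambda>c. (x, c)) ` {c \<in> C. lt b c x}) = card {c \<in> C. lt b c x}" by (rule card_image) (auto simp: inj_on_def)
 ultimately show ?thesis by (simp add: icr_def)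
qed

lemma length_filter_card: "distinct xs ==> length (filter P xs) = card {y \<in> set xs. P y}"
 using distinct_card[of "filter P xs"] by simp

lemma inv_append: "distinct (xs @ ys) ==> inv b (xs @ ys) = inv b xs + inv b ys + icr b (set xs) (set ys)"
 by (induction xs) (simp_all add: icr_insert length_filter_card)

lemma io_length: "io q b Y x \<noteq> 0 ==> length x = card Y"
 by (auto simp: io_def asg_def distinct_card split: if_splits)

lemma asg_append: "asg q b (x @ y) = asg q b x * asg q b y * (if set x \<inter> set y = {} then (- q) ^ icr b (set x) (set y) else 0)"
 by (auto simp: asg_def inv_append power_add)

lemma io_Nil: "io q b {} x = (if x = [] then 1 else 0)" by (auto simp: io_def asg_def)

lemma icr_single: "icr b A {t} = card {y \<in> A. lt b t y}"
proof -
 have "{(a, c). a \<in> A \<and> c \<in> {t} \<and> lt b c a} = (\<lambda>y. (y, t)) ` {y \<in> A. lt b t y}" by auto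
 thus ?thesis by (simp add: icr_def card_image inj_on_def)
qed

lemma io_snoc: assumes "finite Y"
 shows "io q b Y (m @ [t]) = (if t \<in> Y then (- q) ^ card {y \<in> Y. lt b t y} * io q b (Y - {t}) m else 0)"
proof (cases "t \<in> Y \<and> set m = Y - {t}")
 case True
 have "inv b [t] = 0" by simp
 have "icr b (set m) {t} = card {y \<in> Y. lt b t y}"
 proof -
  have "{y \<in> set m. lt b t y} = {y \<in> Y. lt b t y}" using True by (auto simp: lt_def)
  thus ?thesis by (simp add: icr_single)
 qed
 thus ?thesis using True by (auto simp: io_def asg_append) (auto simp: asg_def)
next
 case False
 thus ?thesis by (auto simp: io_def asg_def)
qed

text \<open>The antisymmetric tensor of Y between the fixed words L and R.\<close>

definition V :: "'a::comm_ring_1 => bool => nat list => nat set => nat list => nat list => 'a" where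
 "V q b L Y R x = (if length x = length L + card Y + length R \<and> take (length L) x = L \<and> drop (length L + card Y) x = R
  then io q b Y (take (card Y) (drop (length L) x)) else 0)"

lemma V_app: "length l = length L ==> length m = card Y ==> length r = length R ==>
 V q b L Y R (l @ m @ r) = (if l = L \<and> r = R then io q b Y m else 0)"
 by (auto simp: V_def)

lemma V_len: "length x \<noteq> length L + card Y + length R ==> V q b L Y R x = 0" by (simp add: V_def)

lemma split3: "length x = a + b + c ==> \<exists>l m r. x = l @ m @ r \<and> length l = a \<and> length m = b \<and> length r = c"
 by (rule exI[of _ "take a x"], rule exI[of _ "take b (drop a x)"], rule exI[of _ "drop b (drop a x)"])
  (simp add: append_take_drop_id del: drop_drop)

text \<open>Laplace expansion along the last letter t; the exponent counts the letters of the block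
  that exceed t and hence form an inversion with it.\<close>

lemma V_snoc: assumes Y: "finite Y" "Y \<noteq> {}"
 shows "V q b L Y R x = (\<Sum>t\<in>Y. (- q) ^ card {y \<in> Y. lt b t y} * V q b L (Y - {t}) (t # R) x)"
proof -
 obtain a where a: "card Y = Suc a" using Y by (cases "card Y") auto
 have a': "t \<in> Y ==> card (Y - {t}) = a" for t using a Y by simp
 show ?thesis
 proof (cases "length x = length L + card Y + length R")
  case False
  thus ?thesis using a a' by (simp add: V_len)
 next
  case True
  hence "length x = length L + a + Suc (length R)" using a by simp
  from split3[OF this] obtain l m r' where x: "x = l @ m @ r'" "length l = length L" "length m = a" "length r' = Suc (length R)" by blast
  then obtain u r where r: "r' = u # r" "length r = length R" by (cases r') auto
  have L: "V q b L Y R x = (if l = L \<and> r = R then io q b Y (m @ [u]) else 0)"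
   using V_app[of l L "m @ [u]" Y r R q b] x r a by simp
  have T: "V q b L (Y - {t}) (t # R) x = (if l = L \<and> r = R \<and> u = t then io q b (Y - {t}) m else 0)" if "t \<in> Y" for t
   using V_app[of l L m "Y - {t}" r' "t # R" q b] x r a'[OF that] by auto
  have "(\<Sum>t\<in>Y. (- q) ^ card {y \<in> Y. lt b t y} * V q b L (Y - {t}) (t # R) x)
   = (\<Sum>t\<in>Y. if t = u then (if l = L \<and> r = R then (- q) ^ card {y \<in> Y. lt b u y} * io q b (Y - {u}) m else 0) else 0)"
   by (rule sum.cong) (auto simp: T)
  also have "... = V q b L Y R x" unfolding L io_snoc[OF Y(1)] using Y(1) by (auto simp: sum.delta)
  finally show ?thesis by simp
 qed
qed

lemma tau_V: assumes Y: "finite Y"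
 shows "tau b q (length L + card Y) (V q b L Y (t' # t # R)) x =
  (if t' = t then qinv q * V q b L Y (t' # t # R) x
  else V q b L Y (t # t' # R) x + (if lt b t' t then 0 else (qinv q - q) * V q b L Y (t' # t # R) x))"
proof (cases "length x = length L + card Y + Suc (Suc (length R))")
 case False
 have "length (swp x i j) = length x" for i j by (simp add: swp_def)
 thus ?thesis using False by (simp add: V_len tau_def)
next
 case True
 from split3[OF this] obtain l m r' where x: "x = l @ m @ r'" "length l = length L" "length m = card Y" "length r' = Suc (Suc (length R))" by blast
 then obtain u w r where r: "r' = u # w # r" "length r = length R" by (cases r'; cases "tl r'") auto
 let ?F = "\<lambda>t t' u w. V q b L Y (t' # t # R) (l @ m @ u # w # r)" and ?t = "tau b q (length L + card Y) (V q b L Y (t' # t # R))"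
 have v: "?F t t' u w = (if l = L \<and> u = t' \<and> w = t \<and> r = R then io q b Y m else 0)" for t t' u w
  using x r V_app[of l L m Y "u # w # r" "t' # t # R" q b] by simp
 have "?t ((l @ m) @ u # w # r) = (if u = w then qinv q * ?F t t' u w
  else ?F t t' w u + (if lt b u w then 0 else (qinv q - q) * ?F t t' u w))"
  using x tau_app[of "l @ m" "length L + card Y" b q "V q b L Y (t' # t # R)" u w r] by simp
 hence T: "?t x = (if u = w then qinv q * ?F t t' u w
  else ?F t t' w u + (if lt b u w then 0 else (qinv q - q) * ?F t t' u w))"
  unfolding x(1) r(1) by simp
 define c where "c = (if l = L \<and> r = R then io q b Y m else 0)"
 have v': "?F t t' u w = (if u = t' \<and> w = t then c else 0)" for t t' u w
  unfolding v c_def by simp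
 show ?thesis unfolding T unfolding x(1) r(1) v'
  by (cases "u = t'"; cases "w = t"; cases "u = t"; cases "w = t'") simp_all
qed

text \<open>The signed sum over minimal coset representatives of S_a in S_(a+1): unfolding gives 1 -
  q T + q^2 T' T - ..., with T the last Hecke operator and T' the one before it. Iterated, it gives
  \<open>zop\<close>, the sum of (-q)^length(w) T_w over S_a.\<close>

fun Cop :: "bool => 'a::comm_ring_1 => nat => nat => (nat list => 'a) => nat list => 'a" where
 "Cop b q 0 ofs g = g"
| "Cop b q (Suc a) ofs g = (\<lambda>x. g x - q * Cop b q a ofs (tau b q (ofs + a) g) x)"

lemma Cop_sum: "Cop b q a ofs (\<lambda>x. \<Sum>i\<in>S. c i * g i x) = (\<lambda>x. \<Sum>i\<in>S. c i * Cop b q a ofs (g i) x)"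
proof (induction a arbitrary: g)
 case (Suc a)
 have "tau b q (ofs + a) (\<lambda>x. \<Sum>i\<in>S. c i * g i x) = (\<lambda>x. \<Sum>i\<in>S. c i * tau b q (ofs + a) (g i) x)"
  by (rule ext) (simp add: tau_sum tau_scale)
 thus ?case using Suc by (simp add: sum_distrib_left right_diff_distrib sum_subtractf mult.left_commute)
qed simp

lemma Cop_add: "Cop b q a ofs (\<lambda>x. c * g x + d * h x) = (\<lambda>x. c * Cop b q a ofs g x + d * Cop b q a ofs h x)"
proof (induction a arbitrary: g h)
 case (Suc a)
 have "tau b q (ofs + a) (\<lambda>x. c * g x + d * h x) = (\<lambda>x. c * tau b q (ofs + a) g x + d * tau b q (ofs + a) h x)"
  by (rule ext) (simp add: tau_add tau_scale)
 thus ?case using Suc by (simp add: algebra_simps)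
qed simp

lemma Cop_scale: "Cop b q a ofs (\<lambda>x. c * g x) = (\<lambda>x. c * Cop b q a ofs g x)"
 using Cop_add[of b q a ofs c g 0 g] by simp

text \<open>Listing H in decreasing order, the number of larger elements runs through 0, 1, ...,
  card H - 1. It turns sums over letters into geometric series.\<close>

lemma sum_rank: assumes "finite H"
 shows "(\<Sum>t\<in>H. f (card {y \<in> H. lt b t y})) = (\<Sum>k<card H. f k :: 'a::comm_monoid_add)"
proof -
 have *: "(\<Sum>t\<in>insert x A. f (card {y \<in> insert x A. lt b t y})) = (\<Sum>k<card (insert x A). f k)"
  if A: "finite A" "\<forall>a\<in>A. lt b x a" and IH: "(\<Sum>t\<in>A. f (card {y \<in> A. lt b t y})) = (\<Sum>k<card A. f k)" for x A
 proof -
  have n: "x \<notin> A" using A by (auto simp: lt_def split: if_splits)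
  have "{y \<in> insert x A. lt b x y} = A" using A by (auto simp: lt_def split: if_splits)
  moreover have "{y \<in> insert x A. lt b t y} = {y \<in> A. lt b t y}" if "t \<in> A" for t
   using A(2) that by (auto simp: lt_def split: if_splits)
  ultimately show ?thesis using n A IH by (simp add: add.commute)
 qed
 show ?thesis
 proof (cases b)
  case True
  show ?thesis using assms
  proof (induction H rule: finite_linorder_min_induct)
   case (insert x A) thus ?case using *[of A x] True by (auto simp: lt_def)
  qed simp
 next
  case False
  show ?thesis using assms
  proof (induction H rule: finite_linorder_max_induct)
   case (insert x A) thus ?case using *[of A x] False by (auto simp: lt_def)
  qed simp
 qed
qed

lemma geo: "(1 - Q) * (\<Sum>k<h. Q ^ k) = 1 - (Q::'a::comm_ring_1) ^ h"
 by (simp add: one_diff_power_eq)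

text \<open>The sign with which the letter t is absorbed at the right end of the block Y.\<close>

definition mu :: "'a::comm_ring_1 => bool => nat set => nat => 'a" where
 "mu q b Y t = (if t \<in> Y then 0 else (- q) ^ card {y \<in> Y. lt b t y})"

lemma lt_irrefl [simp]: "\<not> lt b x x" by (simp add: lt_def)
lemma lt_linear: "x \<noteq> y ==> lt b x y \<longleftrightarrow> \<not> lt b y x" by (auto simp: lt_def)
lemma lt_trans: "lt b x y ==> lt b y z ==> lt b x z" by (auto simp: lt_def split: if_splits)

text \<open>Expand the block by its last letter s and let the last Hecke operator act on s and t.
  With h the number of letters of Y above t, the terms keeping the order s, t add up, by a geometric
  series in q^2, to 1 - q^(2h) times the original vector, plus q^(2h) times it if t lies in Y. For t
  in Y everything cancels. Otherwise the exchanged terms supply the rest of the expansion of the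
  enlarged block. No quantum factorial appears.\<close>

lemma Cop_V: assumes q: "q dvd (1::'a::comm_ring_1)"
 shows "finite Y ==> card Y = a ==> Cop b q a (length L) (V q b L Y (t # R)) = (\<lambda>x. mu q b Y t * V q b L (insert t Y) R x)"
proof (induction a arbitrary: Y t R)
 case 0
 hence "Y = {}" by simp
 have 0: "{y \<in> {t}. lt b t y} = {}" by auto
 have "V q b L {t} R x = V q b L {} (t # R) x" for x
  using V_snoc[of "{t}" q b L R x]
  by (simp only: sum.insert finite.emptyI empty_iff not_False_eq_True sum.empty 0 card.empty power_0 mult_1 add_0_right Diff_cancel finite.insertI insert_not_empty)
 thus ?case unfolding \<open>Y = {}\<close> by (simp add: mu_def fun_eq_iff)
next
 case (Suc a)
 note fin = Suc.prems(1)
 have ne: "Y \<noteq> {}" using Suc.prems by auto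
 let ?m = "\<lambda>s. card {y \<in> Y. lt b s y}"
 define d where "d s = (- q) ^ ?m s" for s
 define h where "h = card {y \<in> Y. lt b t y}"
 let ?W = "\<lambda>s. V q b L (insert t (Y - {s})) (s # R)"
 let ?X = "V q b L Y (t # R)"
 have cY: "s \<in> Y ==> card (Y - {s}) = a" for s using Suc.prems by simp
 have IH: "s \<in> Y ==> Cop b q a (length L) (V q b L (Y - {s}) (u # R')) = (\<lambda>x. mu q b (Y - {s}) u * V q b L (insert u (Y - {s})) R' x)" for s u R'
  by (rule Suc.IH) (use fin cY in auto)
 define k1 where "k1 s = (if s = t then qinv q else if lt b s t then 0 else qinv q - q)" for s
 define k2 where "k2 s = (if s = t then 0 else 1 :: 'a)" for s
 let ?C = "Cop b q (Suc a) (length L) ?X" and ?K = "\<lambda>x s. d s * (k2 s * (mu q b (Y - {s}) t * ?W s x))" and ?J = "\<lambda>z s. d s * (k1 s * (d s * z))"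
  and ?T = "\<lambda>x s. d s * (k1 s * V q b L (Y - {s}) (s # t # R) x + k2 s * V q b L (Y - {s}) (t # s # R) x)"
  and ?U = "\<lambda>x s. (- q) ^ card {y \<in> insert t Y. lt b s y} * V q b L (insert t Y - {s}) (s # R) x"
 have tX: "tau b q (length L + a) ?X = (\<lambda>x. \<Sum>s\<in>Y. ?T x s)"
 proof
  fix x
  have "?X = (\<lambda>x. \<Sum>s\<in>Y. d s * V q b L (Y - {s}) (s # t # R) x)"
   unfolding d_def by (rule ext) (rule V_snoc[OF fin ne])
  hence "tau b q (length L + a) ?X x = (\<Sum>s\<in>Y. d s * tau b q (length L + a) (V q b L (Y - {s}) (s # t # R)) x)"
   by (simp add: tau_sum tau_scale)
  also have "... = sum (?T x) Y"
  proof (intro sum.cong refl)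
   fix s assume s: "s \<in> Y"
   have "finite (Y - {s})" using fin by simp
   from tau_V[OF this, of b q L s t R x] show "d s * tau b q (length L + a) (V q b L (Y - {s}) (s # t # R)) x = ?T x s"
    unfolding cY[OF s] by (simp add: k1_def k2_def add.commute)
  qed
  finally show "tau b q (length L + a) ?X x = sum (?T x) Y" .
 qed
 have md: "s \<in> Y ==> mu q b (Y - {s}) s = d s" for s
 proof -
  have "{y \<in> Y - {s}. lt b s y} = {y \<in> Y. lt b s y}" by auto
  thus ?thesis by (simp add: mu_def d_def)
 qed
 have C: "?C x = ?X x - q * (\<Sum>s\<in>Y. d s * (k1 s * (d s * ?X x) + k2 s * (mu q b (Y - {s}) t * ?W s x)))" for x
 proof -
  have "s \<in> Y ==> insert s (Y - {s}) = Y" for s by auto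
  thus ?thesis by (simp add: tX Cop_sum Cop_add IH md cong: sum.cong)
 qed
 have qq: "q * (qinv q * z) = z" for z using qinv_right[OF q] by (simp add: mult.assoc[symmetric])
 have dd: "d s * (d s * z) = (q * q) ^ ?m s * z" for s z
  by (simp add: d_def mult.assoc[symmetric] power_mult_distrib[symmetric])
 define H where "H = {s \<in> Y. lt b t s}"
 let ?e = "\<lambda>z s. (if s = t then (q * q) ^ h * z else 0) + (if s \<in> H then (1 - q * q) * (q * q) ^ ?m s * z else 0)"
 have H: "finite H" "h = card H" using fin by (simp_all add: H_def h_def)
 have Hs: "s \<in> H ==> {y \<in> Y. lt b s y} = {y \<in> H. lt b s y}" for s by (auto simp: H_def intro: lt_trans)
 have sH: "(1 - q * q) * (\<Sum>s\<in>H. (q * q) ^ ?m s) = 1 - (q * q) ^ h"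
 proof -
  have "(\<Sum>s\<in>H. (q * q) ^ ?m s) = (\<Sum>s\<in>H. (q * q) ^ card {y \<in> H. lt b s y})"
   by (intro sum.cong refl) (simp only: Hs)
  also have "... = (\<Sum>k<h. (q * q) ^ k)" unfolding H(2) by (rule sum_rank[OF H(1)])
  finally show ?thesis by (simp add: geo)
 qed
 have s1: "q * sum (?J z) Y = (1 - (q * q) ^ h) * z + (if t \<in> Y then (q * q) ^ h * z else 0)" for z
 proof -
  have e: "q * (?J z s) = ?e z s" if "s \<in> Y" for s
  proof -
   have "q * (?J z s) = (q * k1 s) * (d s * (d s * z))" by (simp only: mult_ac)
   also have "q * k1 s = (if s = t then 1 else if s \<in> H then 1 - q * q else 0)"
    using that lt_linear[of s t b] qinv_right[OF q] by (auto simp: k1_def H_def right_diff_distrib)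
   finally show ?thesis using that unfolding dd by (auto simp: H_def h_def mult.assoc)
  qed
  have "q * sum (?J z) Y = sum (?e z) Y"
   unfolding sum_distrib_left by (rule sum.cong[OF refl e])
  also have "... = (if t \<in> Y then (q * q) ^ h * z else 0) + (\<Sum>s\<in>H. (1 - q * q) * (q * q) ^ ?m s * z)"
   using fin by (simp add: sum.distrib sum.delta sum.inter_filter[symmetric] H_def cong: conj_cong)
  also have "(\<Sum>s\<in>H. (1 - q * q) * (q * q) ^ ?m s * z) = ((1 - q * q) * (\<Sum>s\<in>H. (q * q) ^ ?m s)) * z"
   by (simp only: sum_distrib_left sum_distrib_right)
  finally show ?thesis unfolding sH by (simp add: add.commute)
 qed
 show ?case
 proof (rule ext)
  fix x
  let ?z = "?X x"
  have "?C x = ?z - q * sum (?J ?z) Y - q * sum (?K x) Y"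
   unfolding C by (simp add: distrib_left sum.distrib)
  also have "... = mu q b Y t * V q b L (insert t Y) R x"
  proof (cases "t \<in> Y")
   case True
   have "k2 s * (mu q b (Y - {s}) t * ?W s x) = 0" for s using True by (auto simp: k2_def mu_def)
   thus ?thesis unfolding s1 using True by (simp add: mu_def algebra_simps)
  next
   case False
   have e: "- (q * (?K x s)) = (- q) ^ h * (?U x s)" if s: "s \<in> Y" for s
   proof -
    have st: "s \<noteq> t" using s False by auto
    have W: "insert t (Y - {s}) = insert t Y - {s}" using st by auto
    \<comment> \<open>Exactly one of s and t exceeds the other, and exactly one of the two counts on
      the right sees this; it is the additional one on the left.\<close>
    have c: "Suc (?m s + card {y \<in> Y - {s}. lt b t y}) = h + card {y \<in> insert t Y. lt b s y}"
    proof (cases "lt b t s")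
     case True
     hence "{y \<in> insert t Y. lt b s y} = {y \<in> Y. lt b s y}" using lt_linear[OF st] by auto
     moreover have "{y \<in> Y. lt b t y} = insert s {y \<in> Y - {s}. lt b t y}" using True s by auto
     hence "h = Suc (card {y \<in> Y - {s}. lt b t y})" using fin by (simp add: h_def)
     ultimately show ?thesis by simp
    next
     case F: False
     hence "{y \<in> insert t Y. lt b s y} = insert t {y \<in> Y. lt b s y}" using lt_linear[OF st] by auto
     hence "card {y \<in> insert t Y. lt b s y} = Suc (?m s)" using fin False by simp
     moreover have "{y \<in> Y. lt b t y} = {y \<in> Y - {s}. lt b t y}" using F by auto
     ultimately show ?thesis by (simp add: h_def)
    qed
    have "- (q * (?K x s)) = (- q) ^ Suc (?m s + card {y \<in> Y - {s}. lt b t y}) * ?W s x"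
     using False st by (simp add: d_def k2_def mu_def power_add mult.assoc)
    also have "... = (- q) ^ h * ((- q) ^ card {y \<in> insert t Y. lt b s y} * ?W s x)" unfolding c by (simp add: power_add mult.assoc)
    finally show ?thesis unfolding W .
   qed
   have it: "insert t Y - {t} = Y" "{y \<in> insert t Y. lt b t y} = {y \<in> Y. lt b t y}" using False by auto
   have "- (q * sum (?K x) Y) = (\<Sum>s\<in>Y. (- q) ^ h * (?U x s))"
    unfolding sum_distrib_left sum_negf[symmetric] by (rule sum.cong[OF refl e])
   moreover have "V q b L (insert t Y) R x = (- q) ^ h * ?z + sum (?U x) Y"
    using V_snoc[of "insert t Y" q b L R x] fin False by (simp add: sum.insert[OF fin False] it h_def del: sum.insert insert_iff)
   moreover have "(q * q) ^ h = (- q) ^ h * (- q) ^ h" by (simp add: power_mult_distrib[symmetric])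
   moreover define S S2 where "S = sum (?K x) Y"
    and "S2 = sum (?U x) Y"
   ultimately have f: "- (q * S) = (- q) ^ h * S2" "V q b L (insert t Y) R x = (- q) ^ h * ?z + S2" "(q * q) ^ h = (- q) ^ h * (- q) ^ h"
    by (simp_all only: sum_distrib_left)
   have "?z - ((1 - (q * q) ^ h) * ?z + 0) - q * S = (- q) ^ h * (- q) ^ h * ?z + - (q * S)" unfolding f(3) by (simp add: algebra_simps)
   also have "... = (- q) ^ h * V q b L (insert t Y) R x" unfolding f(1) f(2) by (simp add: algebra_simps)
   finally show ?thesis unfolding s1 S_def[symmetric] using False by (simp add: mu_def h_def[symmetric])
  qed
  finally show "?C x = mu q b Y t * V q b L (insert t Y) R x" .
 qed
qed

fun zop :: "bool => 'a::comm_ring_1 => nat => nat => (nat list => 'a) => nat list => 'a" where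
 "zop b q 0 ofs g = g"
| "zop b q (Suc a) ofs g = Cop b q a ofs (zop b q a ofs g)"

lemma zop_sum: "zop b q a ofs (\<lambda>x. \<Sum>i\<in>S. c i * g i x) = (\<lambda>x. \<Sum>i\<in>S. c i * zop b q a ofs (g i) x)"
 by (induction a arbitrary: g) (simp_all add: Cop_sum)

text \<open>The image of a word depends, up to its sign, only on its letter set. This makes the
  matrix of the antisymmetrizer explicit.\<close>

lemma zop_dlt: assumes q: "q dvd (1::'a::comm_ring_1)"
 shows "length y = a ==> zop b q a (length L) (dlt (L @ y @ R)) = (\<lambda>x. asg q b y * V q b L (set y) R x)"
proof (induction a arbitrary: y R)
 case 0
 have "V q b L {} R x = dlt (L @ R) x" for x
 proof -
  have "x = L @ R \<longleftrightarrow> length x = length L + length R \<and> take (length L) x = L \<and> drop (length L) x = R"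
   by (metis append_eq_conv_conj append_take_drop_id length_append)
  thus ?thesis by (simp add: V_def dlt_def io_Nil)
 qed
 thus ?case using 0 by (simp add: asg_def fun_eq_iff)
next
 case (Suc a)
 then obtain y' t where y: "y = y' @ [t]" "length y' = a" by (metis length_Suc_conv_rev)
 have IH: "zop b q a (length L) (dlt (L @ y' @ (t # R))) = (\<lambda>x. asg q b y' * V q b L (set y') (t # R) x)"
  by (rule Suc.IH[OF y(2)])
 have "zop b q (Suc a) (length L) (dlt (L @ y @ R)) = Cop b q a (length L) (\<lambda>x. asg q b y' * V q b L (set y') (t # R) x)"
  using IH by (simp add: y)
 also have "... = (\<lambda>x. asg q b y * V q b L (set y) R x)"
 proof (cases "distinct y'")
  case True
  hence "card (set y') = a" using y distinct_card by fastforce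
  from Cop_V[OF q _ this, of b L t R]
  have "Cop b q a (length L) (\<lambda>x. asg q b y' * V q b L (set y') (t # R) x) = (\<lambda>x. asg q b y' * (mu q b (set y') t * V q b L (insert t (set y')) R x))"
   by (simp add: Cop_scale)
  moreover have "asg q b y' * mu q b (set y') t = asg q b y"
   using True y by (simp add: mu_def asg_append icr_single) (simp add: asg_def)
  ultimately show ?thesis using y by (simp add: fun_eq_iff mult.assoc[symmetric])
 next
  case False
  thus ?thesis using y Cop_scale[of b q a "length L" 0] by (simp add: asg_def)
 qed
 finally show ?case .
qed

subsection \<open>Block antisymmetrizers\<close>

fun zz :: "'a::comm_ring_1 => nat => (bool \<times> nat) list => (nat list => 'a) => nat list => 'a" where
 "zz q ofs [] g = g"
| "zz q ofs ((b, a) # k) g = zz q (ofs + a) k (zop b q a ofs g)"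

fun cf :: "'a::comm_ring_1 => (bool \<times> nat set) list => nat list => 'a" where
 "cf q [] x = (if x = [] then 1 else 0)"
| "cf q ((b, Y) # Ys) x = io q b Y (take (card Y) x) * cf q Ys (drop (card Y) x)"

fun asgs :: "'a::comm_ring_1 => (bool \<times> nat) list => nat list => 'a" where
 "asgs q [] y = 1"
| "asgs q ((b, a) # k) y = asg q b (take a y) * asgs q k (drop a y)"

fun rowsof :: "(bool \<times> nat) list => nat list => (bool \<times> nat set) list" where
 "rowsof [] y = []"
| "rowsof ((b, a) # k) y = (b, set (take a y)) # rowsof k (drop a y)"

definition szs :: "(bool \<times> nat set) list => (bool \<times> nat) list" where
 "szs Ys = map (\<lambda>(b, Y). (b, card Y)) Ys"
definition tot :: "(bool \<times> nat) list => nat" where "tot k = sum_list (map snd k)"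

lemma szs_simps [simp]: "szs [] = []" "szs ((b, Y) # Ys) = (b, card Y) # szs Ys" "szs (Xs @ Ys) = szs Xs @ szs Ys" by (simp_all add: szs_def)
lemma tot_simps [simp]: "tot [] = 0" "tot ((b, a) # k) = a + tot k" "tot (k @ k') = tot k + tot k'" by (simp_all add: tot_def)

text \<open>Row tensors of one shape have disjoint supports: a word belongs only to the list of
  letter sets of its blocks.\<close>

lemma cf_asgs: "length x = tot (szs Ys) ==> cf q Ys x = (if rowsof (szs Ys) x = Ys then asgs q (szs Ys) x else 0)"
proof (induction Ys arbitrary: x)
 case (Cons Y Ys)
 obtain b Z where Y: "Y = (b, Z)" by (cases Y)
 have "length (drop (card Z) x) = tot (szs Ys)" using Cons.prems Y by simp
 from Cons.IH[OF this] show ?case by (auto simp: Y io_def)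
qed simp

lemma asgs_szs: "length y = tot k ==> asgs q k y \<noteq> 0 ==> szs (rowsof k y) = k"
proof (induction k arbitrary: y)
 case (Cons bk k)
 obtain b a where bk: "bk = (b, a)" by (cases bk)
 have "distinct (take a y)" using Cons.prems bk by (auto simp: asg_def split: if_splits)
 hence "card (set (take a y)) = a" using Cons.prems bk by (simp add: distinct_card)
 moreover have "szs (rowsof k (drop a y)) = k" by (rule Cons.IH) (use Cons.prems bk in auto)
 ultimately show ?case by (simp add: bk)
qed simp

definition VV :: "'a::comm_ring_1 => nat list => (bool \<times> nat set) list => nat list => 'a" where
 "VV q L Ys x = (if take (length L) x = L then cf q Ys (drop (length L) x) else 0)"

definition arr :: "nat set => nat list set" where "arr Y = {m. distinct m \<and> set m = Y}"

lemma finite_arr: "finite Y ==> finite (arr Y)"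
proof -
 assume Y: "finite Y"
 have "arr Y \<subseteq> {xs. set xs \<subseteq> Y \<and> length xs \<le> card Y}" by (auto simp: arr_def distinct_card)
 thus ?thesis using finite_lists_length_le[OF Y] finite_subset by blast
qed

lemma V_arr: assumes "finite Y" shows "V q b L Y R x = (\<Sum>m\<in>arr Y. io q b Y m * dlt (L @ m @ R) x)"
proof (cases "length x = length L + card Y + length R")
 case True
 from split3[OF this] obtain l m r where x: "x = l @ m @ r" "length l = length L" "length m = card Y" "length r = length R" by blast
 have m: "m' \<in> arr Y ==> length m' = card Y" for m' by (auto simp: arr_def distinct_card)
 have "(\<Sum>m'\<in>arr Y. io q b Y m' * dlt (L @ m' @ R) x) = (\<Sum>m'\<in>arr Y. if m' = m then (if l = L \<and> r = R then io q b Y m else 0) else 0)"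
  by (rule sum.cong) (use x m in \<open>auto simp: dlt_def\<close>)
 also have "... = (if l = L \<and> r = R then io q b Y m else 0)"
  using finite_arr[OF assms] by (auto simp: sum.delta arr_def io_def asg_def)
 finally show ?thesis using x V_app[of l L m Y r R q b] by simp
next
 case False
 hence "dlt (L @ m @ R) x = (0::'a)" if "m \<in> arr Y" for m using that by (auto simp: dlt_def arr_def distinct_card)
 thus ?thesis using False by (simp add: V_len)
qed

lemma zz_sum: "zz q ofs k (\<lambda>x. \<Sum>i\<in>S. c i * g i x) = (\<lambda>x. \<Sum>i\<in>S. c i * zz q ofs k (g i) x)"
proof (induction k arbitrary: ofs g)
 case (Cons bk k) thus ?case by (cases bk) (simp add: zop_sum)
qed simp

lemma take_add_eq: "take (length L + length m) x = L @ m \<longleftrightarrow> take (length L) x = L \<and> take (length m) (drop (length L) x) = m"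
proof
 assume "take (length L + length m) x = L @ m"
 then obtain y where "x = (L @ m) @ y" using append_take_drop_id by metis
 thus "take (length L) x = L \<and> take (length m) (drop (length L) x) = m" by simp
qed (simp add: take_add)

text \<open>After the first block has been antisymmetrized it is expanded into words again; the
  remaining blocks then see a fixed prefix and the induction hypothesis applies to each
  word.\<close>

lemma zz_dlt: assumes q: "q dvd (1::'a::comm_ring_1)"
 shows "length y = tot k ==> zz q (length L) k (dlt (L @ y)) = (\<lambda>x. asgs q k y * VV q L (rowsof k y) x)"
proof (induction k arbitrary: L y)
 case Nil
 have "VV q L [] x = dlt L x" for x unfolding VV_def dlt_def using append_take_drop_id[of "length L" x] by auto
 thus ?case using Nil by (simp add: fun_eq_iff)
next
 case (Cons bk k)
 obtain b a where bk: "bk = (b, a)" by (cases bk)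
 define y1 y2 where "y1 = take a y" and "y2 = drop a y"
 have y: "y = y1 @ y2" "length y1 = a" "length y2 = tot k" using Cons.prems bk by (auto simp: y1_def y2_def)
 let ?Y = "set y1"
 have "zz q (length L) ((b, a) # k) (dlt (L @ y)) = zz q (length L + a) k (\<lambda>x. asg q b y1 * V q b L ?Y y2 x)"
  using zop_dlt[OF q y(2), of b L y2] by (simp add: y)
 also have "(\<lambda>x. asg q b y1 * V q b L ?Y y2 x) = (\<lambda>x. \<Sum>m\<in>arr ?Y. (asg q b y1 * io q b ?Y m) * dlt (L @ m @ y2) x)"
  by (rule ext) (simp add: V_arr sum_distrib_left mult.assoc)
 also have "zz q (length L + a) k ... = (\<lambda>x. \<Sum>m\<in>arr ?Y. (asg q b y1 * io q b ?Y m) * zz q (length L + a) k (dlt (L @ m @ y2)) x)"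
  by (rule zz_sum)
 also have "... = (\<lambda>x. asgs q ((b, a) # k) y * VV q L (rowsof ((b, a) # k) y) x)"
 proof (rule ext)
  fix x
  show "(\<Sum>m\<in>arr ?Y. (asg q b y1 * io q b ?Y m) * zz q (length L + a) k (dlt (L @ m @ y2)) x) = asgs q ((b, a) # k) y * VV q L (rowsof ((b, a) # k) y) x"
  proof (cases "distinct y1")
   case False
   thus ?thesis by (simp add: asg_def y1_def)
  next
   case True
   hence cY: "card ?Y = a" using y by (simp add: distinct_card)
   hence m: "m \<in> arr ?Y ==> length m = a" for m using distinct_card[of m] by (simp add: arr_def)
   have IH: "zz q (length L + a) k (dlt (L @ m @ y2)) x = asgs q k y2 * VV q (L @ m) (rowsof k y2) x" if "m \<in> arr ?Y" for m
    using Cons.IH[OF y(3), of "L @ m"] m[OF that] by simp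
   define mx where "mx = take a (drop (length L) x)"
   have VVm: "VV q (L @ m) (rowsof k y2) x = (if m = mx then (if take (length L) x = L then cf q (rowsof k y2) (drop a (drop (length L) x)) else 0) else 0)" if "m \<in> arr ?Y" for m
   proof -
    have "VV q (L @ m) (rowsof k y2) x = (if take (length L + a) x = L @ m then cf q (rowsof k y2) (drop (length L + a) x) else 0)"
     using m[OF that] by (simp add: VV_def)
    moreover have "take (length L + a) x = L @ m \<longleftrightarrow> take (length L) x = L \<and> m = mx"
     using take_add_eq[of L m x] unfolding m[OF that] mx_def by blast
    ultimately show ?thesis by (simp add: add.commute)
   qed
   have "(\<Sum>m\<in>arr ?Y. (asg q b y1 * io q b ?Y m) * zz q (length L + a) k (dlt (L @ m @ y2)) x)
    = (\<Sum>m\<in>arr ?Y. if m = mx then (asg q b y1 * io q b ?Y mx) * (asgs q k y2 * (if take (length L) x = L then cf q (rowsof k y2) (drop a (drop (length L) x)) else 0)) else 0)"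
    by (rule sum.cong) (simp_all add: IH VVm cong: if_cong)
   also have "... = (asg q b y1 * io q b ?Y mx) * (asgs q k y2 * (if take (length L) x = L then cf q (rowsof k y2) (drop a (drop (length L) x)) else 0))"
    using finite_arr[of ?Y] by (auto simp: sum.delta arr_def io_def asg_def)
   also have "... = asgs q ((b, a) # k) y * VV q L (rowsof ((b, a) # k) y) x"
    using cY by (simp add: VV_def mx_def y1_def[symmetric] y2_def[symmetric] mult_ac)
   finally show ?thesis .
  qed
 qed
 finally show ?case unfolding bk .
qed

subsection \<open>Matrices commuting with Hecke operators\<close>

definition cm :: "nat => nat => 'a::comm_ring_1 => 'a mat => bool => nat => bool" where
 "cm n m q M b a \<longleftrightarrow> (\<forall>x y. bas n m x --> bas n m y --> tau b q a (M x) y = tau b q a (\<lambda>x. M x y) x)"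

lemma swp_bas: "Suc a < m ==> bas n m x ==> bas n m (swp x a (Suc a))"
 by (auto simp: bas_def swp_def dest!: set_update_subset_insert[THEN subsetD])

lemma swp_swp: "Suc a < length x ==> swp (swp x a (Suc a)) a (Suc a) = x"
 by (simp add: swp_def list_update_swap)

lemma swp_nth: "Suc a < length x ==> swp x a (Suc a) ! a = x ! Suc a \<and> swp x a (Suc a) ! Suc a = x ! a"
 by (simp add: swp_def)

text \<open>The diagonal part is symmetric anyway, and the part that swaps two entries is reindexed
  by the swap, which is an involution.\<close>

lemma tau_sym: assumes a: "Suc a < m"
 shows "(\<Sum>y\<in>bset n m. f y * tau b q a g y) = (\<Sum>y\<in>bset n m. tau b q a f y * g y)"
proof -
 define s where "s y = swp y a (Suc a)" for y
 have inv: "bas n m y ==> bas n m (s y) \<and> s (s y) = y \<and> (s y ! a = y ! Suc a \<and> s y ! Suc a = y ! a)" for y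
  using a swp_bas[OF a] swp_swp[of a y] swp_nth[of a y] by (auto simp: s_def bas_length)
 have "(\<Sum>y\<in>bset n m. (if y ! a = y ! Suc a then 0 else f y * g (s y))) = (\<Sum>y\<in>bset n m. (if y ! a = y ! Suc a then 0 else f (s y) * g y))"
  by (rule sum.reindex_bij_witness[of _ s s]) (auto simp: inv)
 moreover define c where "c y = (if y ! a = y ! Suc a then qinv q else if lt b (y ! a) (y ! Suc a) then 0 else qinv q - q)" for y
 moreover have "f y * tau b q a g y = (if y ! a = y ! Suc a then 0 else f y * g (s y)) + c y * f y * g y" for y
  by (simp add: tau_def c_def s_def algebra_simps)
 moreover have "tau b q a f y * g y = (if y ! a = y ! Suc a then 0 else f (s y) * g y) + c y * f y * g y" for y
  by (simp add: tau_def c_def s_def algebra_simps)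
 ultimately show ?thesis by (simp add: sum.distrib)
qed

lemma tau_cong: "Suc a < m ==> (\<And>x. bas n m x ==> g x = h x) ==> bas n m x ==> tau b q a g x = tau b q a h x"
 by (simp add: tau_def swp_bas)

lemma ap_tau: assumes "cm n m q M b a" "Suc a < m" "bas n m x"
 shows "ap n m M (tau b q a v) x = tau b q a (ap n m M v) x"
proof -
 have "ap n m M (tau b q a v) x = (\<Sum>y\<in>bset n m. tau b q a (M x) y * v y)"
  unfolding ap_def by (rule tau_sym[OF assms(2)])
 also have "... = (\<Sum>y\<in>bset n m. v y * tau b q a (\<lambda>x. M x y) x)"
  using assms(1,3) by (auto simp: cm_def mult.commute intro!: sum.cong)
 also have "... = tau b q a (ap n m M v) x"
 proof -
  have "ap n m M v = (\<lambda>x. \<Sum>y\<in>bset n m. v y * M x y)" by (simp add: ap_def fun_eq_iff mult.commute)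
  thus ?thesis by (simp add: tau_sum tau_scale)
 qed
 finally show ?thesis .
qed

lemma ap_cong: "(\<And>y. bas n m y ==> v y = w y) ==> ap n m M v x = ap n m M w x"
 unfolding ap_def by (intro sum.cong refl) simp

lemma Cop_cong: "ofs + a < m \<or> a = 0 ==> (\<And>x. bas n m x ==> g x = h x) ==> bas n m x ==> Cop b q a ofs g x = Cop b q a ofs h x"
proof (induction a arbitrary: g h)
 case (Suc a)
 have "Suc (ofs + a) < m" using Suc.prems(1) by simp
 hence "\<And>x. bas n m x ==> tau b q (ofs + a) g x = tau b q (ofs + a) h x" using Suc.prems(2) by (rule tau_cong)
 hence "Cop b q a ofs (tau b q (ofs + a) g) x = Cop b q a ofs (tau b q (ofs + a) h) x"
  using Suc.prems by (intro Suc.IH) auto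
 thus ?case using Suc.prems by simp
qed simp

lemma zop_cong: "ofs + a \<le> m ==> (\<And>x. bas n m x ==> g x = h x) ==> bas n m x ==> zop b q a ofs g x = zop b q a ofs h x"
proof (induction a arbitrary: x)
 case (Suc a)
 have "\<And>x. bas n m x ==> zop b q a ofs g x = zop b q a ofs h x" using Suc by auto
 hence "Cop b q a ofs (zop b q a ofs g) x = Cop b q a ofs (zop b q a ofs h) x"
  by (rule Cop_cong[where n = n and m = m, rotated]) (use Suc.prems in auto)
 thus ?case by simp
qed simp

lemma ap_Cop: "(\<And>j. j < a ==> cm n m q M b (ofs + j)) ==> ofs + a < m \<or> a = 0 ==> bas n m x ==>
 ap n m M (Cop b q a ofs v) x = Cop b q a ofs (ap n m M v) x"
proof (induction a arbitrary: v)
 case (Suc a)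
 have m: "Suc (ofs + a) < m" using Suc.prems(2) by simp
 have "ap n m M (Cop b q (Suc a) ofs v) x = ap n m M v x - q * ap n m M (Cop b q a ofs (tau b q (ofs + a) v)) x"
  by (simp add: ap_def right_diff_distrib sum_subtractf sum_distrib_left mult.left_commute)
 also have "ap n m M (Cop b q a ofs (tau b q (ofs + a) v)) x = Cop b q a ofs (ap n m M (tau b q (ofs + a) v)) x"
  using Suc.prems by (intro Suc.IH) auto
 also have "... = Cop b q a ofs (tau b q (ofs + a) (ap n m M v)) x"
  using Suc.prems m by (intro Cop_cong ap_tau) auto
 finally show ?case by simp
qed simp

lemma ap_zop: "(\<And>j. Suc j < a ==> cm n m q M b (ofs + j)) ==> ofs + a \<le> m ==> bas n m x ==>
 ap n m M (zop b q a ofs v) x = zop b q a ofs (ap n m M v) x"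
proof (induction a arbitrary: x)
 case (Suc a)
 have IH: "\<And>x. bas n m x ==> ap n m M (zop b q a ofs v) x = zop b q a ofs (ap n m M v) x" using Suc by auto
 have "ap n m M (zop b q (Suc a) ofs v) x = Cop b q a ofs (ap n m M (zop b q a ofs v)) x"
  using Suc.prems by (simp add: ap_Cop)
 also have "... = Cop b q a ofs (zop b q a ofs (ap n m M v)) x"
  using Suc.prems IH by (intro Cop_cong) auto
 finally show ?case by simp
qed simp

text \<open>Demands \<open>P\<close> at neighbouring places inside each block and never across a
  block boundary, so only Hecke operators of the corresponding Young subgroup are involved.\<close>

fun ok :: "(bool => nat => bool) => nat => (bool \<times> nat) list => bool" where
 "ok P ofs [] = True"
| "ok P ofs ((b, a) # k) = ((\<forall>j. Suc j < a --> P b (ofs + j)) \<and> ok P (ofs + a) k)"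

lemma zz_cong: "ofs + tot k \<le> m ==> (\<And>x. bas n m x ==> g x = h x) ==> bas n m x ==> zz q ofs k g x = zz q ofs k h x"
proof (induction k arbitrary: ofs g h)
 case (Cons bk k)
 obtain b a where bk: "bk = (b, a)" by (cases bk)
 have "\<And>x. bas n m x ==> zop b q a ofs g x = zop b q a ofs h x" using Cons.prems bk by (intro zop_cong) auto
 thus ?case using Cons.IH[of "ofs + a" "zop b q a ofs g" "zop b q a ofs h"] Cons.prems by (simp add: bk)
qed simp

lemma ap_zz: "ok (cm n m q M) ofs k ==> ofs + tot k \<le> m ==> bas n m x ==> ap n m M (zz q ofs k v) x = zz q ofs k (ap n m M v) x"
proof (induction k arbitrary: ofs v)
 case (Cons bk k)
 obtain b a where bk: "bk = (b, a)" by (cases bk)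
 have "ap n m M (zz q ofs (bk # k) v) x = zz q (ofs + a) k (ap n m M (zop b q a ofs v)) x"
  using Cons by (simp add: bk)
 also have "... = zz q (ofs + a) k (zop b q a ofs (ap n m M v)) x"
  using Cons.prems by (intro zz_cong ap_zop) (auto simp: bk)
 finally show ?case by (simp add: bk)
qed simp

definition rws :: "nat => (bool \<times> nat) list => (bool \<times> nat set) list set" where
 "rws n k = {Ys. szs Ys = k \<and> (\<forall>(b, Y)\<in>set Ys. Y \<subseteq> {1..n})}"

definition Zm :: "'a::comm_ring_1 => (bool \<times> nat) list => 'a mat" where
 "Zm q k x y = asgs q k y * cf q (rowsof k y) x"

lemma Zm_commute: assumes q: "q dvd (1::'a::comm_ring_1)" and "ok (cm n m q M) 0 k" "tot k = m" and xy: "bas n m x" "bas n m y"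
 shows "mmul n m M (Zm q k) x y = mmul n m (Zm q k) M x y"
proof -
 have Z: "zz q 0 k (dlt w) = (\<lambda>x. Zm q k x w)" if "bas n m w" for w
  using zz_dlt[OF q, of w k "[]"] assms(3) bas_length[OF that] by (simp add: Zm_def VV_def)
 have "mmul n m M (Zm q k) x y = ap n m M (zz q 0 k (dlt y)) x" using Z[OF xy(2)] by (simp add: mmul_def ap_def)
 also have "... = zz q 0 k (ap n m M (dlt y)) x" using assms by (intro ap_zz) auto
 also have "... = zz q 0 k (\<lambda>x. \<Sum>w\<in>bset n m. M w y * dlt w x) x"
 proof (rule zz_cong[where n = n and m = m])
  fix x assume x: "bas n m x"
  have "(\<Sum>w\<in>bset n m. M w y * dlt w x) = M x y" using x by (subst sum_single[of _ x]) (auto simp: dlt_def)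
  thus "ap n m M (dlt y) x = (\<Sum>w\<in>bset n m. M w y * dlt w x)" using ap_dlt[OF xy(2)] by simp
 qed (use assms in auto)
 also have "... = mmul n m (Zm q k) M x y"
  unfolding zz_sum mmul_def by (intro sum.cong refl) (simp add: Z mult.commute)
 finally show ?thesis .
qed

lemma finite_rws: "finite (rws n k)"
proof -
 have "rws n k \<subseteq> {Ys. set Ys \<subseteq> UNIV \<times> Pow {1..n} \<and> length Ys = length k}" by (auto simp: rws_def szs_def)
 moreover have "finite (UNIV \<times> Pow {1..n} :: (bool \<times> nat set) set)" by simp
 ultimately show ?thesis using finite_lists_length_eq finite_subset by blast
qed

lemma rowsof_sub: "set y \<subseteq> {1..n} ==> (b, Y) \<in> set (rowsof k y) ==> Y \<subseteq> {1..n}"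
proof (induction k arbitrary: y)
 case (Cons bk k)
 obtain c a where bk: "bk = (c, a)" by (cases bk)
 show ?case using Cons.prems Cons.IH[of "drop a y"] set_take_subset[of a y] set_drop_subset[of a y] by (auto simp: bk)
qed simp

text \<open>The product of antisymmetrizers is a sum of symmetric matrices of rank one, one for each
  row list. This replaces the idempotents that would require quantum factorials to be
  invertible.\<close>

lemma Zm_sum: assumes "tot k = m" "bas n m x" "bas n m y"
 shows "Zm q k x y = (\<Sum>Y\<in>rws n k. cf q Y x * cf q Y y)"
proof (cases "asgs q k y = 0")
 case True
 have "cf q Y y = 0" if "Y \<in> rws n k" for Y using that True cf_asgs[of y Y q] assms bas_length by (auto simp: rws_def)
 thus ?thesis using True by (simp add: Zm_def)
next
 case False
 have s: "szs (rowsof k y) = k" by (rule asgs_szs) (use False assms bas_length in auto)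
 hence r: "rowsof k y \<in> rws n k" using rowsof_sub[of y n] assms by (auto simp: rws_def bas_def)
 have "cf q Y y = (if Y = rowsof k y then asgs q k y else 0)" if "Y \<in> rws n k" for Y
  using that cf_asgs[of y Y q] assms bas_length by (auto simp: rws_def)
 hence "(\<Sum>Y\<in>rws n k. cf q Y x * cf q Y y) = (\<Sum>Y\<in>rws n k. if Y = rowsof k y then cf q (rowsof k y) x * asgs q k y else 0)"
  by (intro sum.cong refl) auto
 thus ?thesis using r finite_rws[of n k] by (simp add: sum.delta Zm_def mult.commute)
qed

text \<open>Every block is sorted in its own order, so the word has sign 1. By \<open>cf_x0\<close>
  evaluation at these words is dual to the row tensors.\<close>

definition x0 :: "(bool \<times> nat set) list => nat list" where
 "x0 Ys = concat (map (\<lambda>(b, Y). if b then sorted_list_of_set Y else rev (sorted_list_of_set Y)) Ys)"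

lemma x0_simps [simp]: "x0 [] = []" "x0 ((b, Y) # Ys) = (if b then sorted_list_of_set Y else rev (sorted_list_of_set Y)) @ x0 Ys" "x0 (Xs @ Ys) = x0 Xs @ x0 Ys"
 by (simp_all add: x0_def)

lemma inv_sorted: "sorted_wrt (lt b) x ==> inv b x = 0"
 by (induction x) (auto simp: filter_empty_conv lt_def split: if_splits)

lemma sorted_lt: "finite Y ==> sorted_wrt (lt b) (if b then sorted_list_of_set Y else rev (sorted_list_of_set Y))"
proof -
 have "lt True = (<)" "lt False = (>)" by (auto simp: lt_def fun_eq_iff)
 thus ?thesis using strict_sorted_list_of_set[of Y] by (cases b) (auto simp: sorted_wrt_rev)
qed

lemma io_x0: "finite Y ==> io q b Y' (if b then sorted_list_of_set Y else rev (sorted_list_of_set Y)) = (if Y = Y' then 1 else 0)"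
 using inv_sorted[OF sorted_lt[of Y b]] by (auto simp: io_def asg_def)

lemma rws_Cons: "(b, Y) # Ys \<in> rws n ((b', a) # k) \<longleftrightarrow> b' = b \<and> card Y = a \<and> Y \<subseteq> {1..n} \<and> Ys \<in> rws n k" by (auto simp: rws_def)

lemma x0_bas: "Ys \<in> rws n k ==> bas n (tot k) (x0 Ys)"
proof (induction Ys arbitrary: k)
 case Nil thus ?case by (auto simp: rws_def)
next
 case (Cons Y Ys)
 obtain b Z where Y: "Y = (b, Z)" by (cases Y)
 obtain a k' where k: "k = (b, a) # k'" using Cons.prems Y by (auto simp: rws_def)
 have Z: "card Z = a" "Z \<subseteq> {1..n}" "Ys \<in> rws n k'" using Cons.prems unfolding Y k rws_Cons by auto
 hence "finite Z" using finite_subset by blast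
 thus ?case using Cons.IH[OF Z(3)] Z by (auto simp: Y k bas_def)
qed

lemma cf_x0: "Ys \<in> rws n k ==> Xs \<in> rws n k ==> cf q Xs (x0 Ys) = (if Xs = Ys then 1 else 0)"
proof (induction Ys arbitrary: k Xs)
 case Nil thus ?case by (auto simp: rws_def szs_def)
next
 case (Cons Y Ys)
 obtain b Z where Y: "Y = (b, Z)" by (cases Y)
 obtain a k' where k: "k = (b, a) # k'" using Cons.prems Y by (auto simp: rws_def)
 have Z: "card Z = a" "Z \<subseteq> {1..n}" "Ys \<in> rws n k'" using Cons.prems unfolding Y k rws_Cons by auto
 obtain W Xs' where Xs: "Xs = (b, W) # Xs'" using Cons.prems(2) unfolding k by (cases Xs) (auto simp: rws_def szs_def)
 have W: "card W = a" "Xs' \<in> rws n k'" using Cons.prems(2) unfolding Xs k rws_Cons by auto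
 have fZ: "finite Z" using Z finite_subset by blast
 have l: "length (if b then sorted_list_of_set Z else rev (sorted_list_of_set Z)) = card W" using Z W fZ by simp
 show ?case unfolding Xs Y using io_x0[OF fZ, of q b W] Cons.IH[OF Z(3) W(2)] l by (auto simp: append_eq_conv_conj)
qed

text \<open>For M commuting with the Hecke operators inside the blocks this is the coefficient of
  the row tensor X in the image under M of the row tensor Y (\<open>ap_cf\<close>).\<close>

definition DD :: "nat => nat => 'a::comm_ring_1 => 'a mat => (bool \<times> nat set) list => (bool \<times> nat set) list => 'a" where
 "DD n m q M X Y = ap n m M (cf q Y) (x0 X)"

context
 fixes n m :: nat and q :: "'a::comm_ring_1" and M :: "'a mat" and k :: "(bool \<times> nat) list"
 assumes q: "q dvd 1" and okk: "ok (cm n m q M) 0 k" and tk: "tot k = m"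
begin

text \<open>M commutes with the product of antisymmetrizers; insert the decomposition of the latter
  on both sides. Evaluation at the words \<open>x0\<close> then isolates single terms, so M is seen
  to preserve the span of the row tensors without any division.\<close>

lemma star: assumes "bas n m x" "bas n m y"
 shows "(\<Sum>Y\<in>rws n k. ap n m M (cf q Y) x * cf q Y y) = (\<Sum>X\<in>rws n k. cf q X x * (\<Sum>w\<in>bset n m. cf q X w * M w y))"
proof -
 have "mmul n m M (Zm q k) x y = (\<Sum>w\<in>bset n m. \<Sum>Y\<in>rws n k. M x w * cf q Y w * cf q Y y)"
  unfolding mmul_def by (intro sum.cong refl) (use assms tk in \<open>simp add: Zm_sum sum_distrib_left mult.assoc\<close>)
 also have "... = (\<Sum>Y\<in>rws n k. ap n m M (cf q Y) x * cf q Y y)"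
  unfolding ap_def by (subst sum.swap) (simp add: sum_distrib_right)
 finally have 1: "mmul n m M (Zm q k) x y = (\<Sum>Y\<in>rws n k. ap n m M (cf q Y) x * cf q Y y)" .
 have "mmul n m (Zm q k) M x y = (\<Sum>w\<in>bset n m. \<Sum>X\<in>rws n k. cf q X x * (cf q X w * M w y))"
  unfolding mmul_def by (intro sum.cong refl) (use assms tk in \<open>simp add: Zm_sum sum_distrib_right mult.assoc\<close>)
 also have "... = (\<Sum>X\<in>rws n k. cf q X x * (\<Sum>w\<in>bset n m. cf q X w * M w y))"
  by (subst sum.swap) (simp add: sum_distrib_left)
 finally have 2: "mmul n m (Zm q k) M x y = (\<Sum>X\<in>rws n k. cf q X x * (\<Sum>w\<in>bset n m. cf q X w * M w y))" .
 show ?thesis using Zm_commute[OF q okk tk assms] 1 2 by simp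
qed

lemma sum_x0: "Y' \<in> rws n k ==> (\<Sum>Y\<in>rws n k. g Y * cf q Y (x0 Y')) = g Y'"
 by (subst sum_single[of _ Y']) (auto simp: cf_x0 finite_rws)
lemma sum_x0': "Y' \<in> rws n k ==> (\<Sum>Y\<in>rws n k. cf q Y (x0 Y') * g Y) = g Y'"
 by (subst sum_single[of _ Y']) (auto simp: cf_x0 finite_rws)

lemma DD_row: assumes "X \<in> rws n k" "Y \<in> rws n k"
 shows "DD n m q M X Y = (\<Sum>w\<in>bset n m. cf q X w * M w (x0 Y))"
 using star[of "x0 X" "x0 Y"] assms x0_bas[of _ n k] tk by (simp add: sum_x0 sum_x0' DD_def)

lemma ap_cf: assumes "bas n m x" "Y \<in> rws n k"
 shows "ap n m M (cf q Y) x = (\<Sum>X\<in>rws n k. cf q X x * DD n m q M X Y)"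
proof -
 have "ap n m M (cf q Y) x = (\<Sum>X\<in>rws n k. cf q X x * (\<Sum>w\<in>bset n m. cf q X w * M w (x0 Y)))"
  using star[of x "x0 Y"] assms x0_bas[of _ n k] tk by (simp add: sum_x0)
 also have "... = (\<Sum>X\<in>rws n k. cf q X x * DD n m q M X Y)" by (intro sum.cong refl) (simp add: DD_row assms)
 finally show ?thesis .
qed

lemma row_cf: assumes "X \<in> rws n k" "bas n m y"
 shows "(\<Sum>w\<in>bset n m. cf q X w * M w y) = (\<Sum>Y\<in>rws n k. DD n m q M X Y * cf q Y y)"
 using star[of "x0 X" y] assms x0_bas[of _ n k] tk by (simp add: sum_x0' DD_def)

end

section \<open>The commutant and its restriction along the wall\<close>

definition hk :: "nat => 'a::comm_ring_1 => nat => nat => 'a mat => bool" where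
 "hk n q r s M \<longleftrightarrow> (\<forall>a. Suc a < r --> cm n (r + s) q M True a) \<and> (\<forall>a. r \<le> a \<and> Suc a < r + s --> cm n (r + s) q M False a)"

lemma ins_bas: "r \<le> m ==> t \<in> {1..n} ==> bas n m y ==> bas n (Suc (Suc m)) (ins r t y)"
 by (auto simp: bas_def ins_def dest: in_set_takeD in_set_dropD)
lemma del_bas: "r \<le> m ==> bas n (Suc (Suc m)) z ==> bas n m (del r z)"
 by (auto simp: bas_def del_def dest: in_set_takeD in_set_dropD)
lemma del_ins: "r \<le> length y ==> del r (ins r t y) = y" by (simp add: del_def ins_def)
lemma ins_del: "Suc r < length z ==> z ! r = z ! Suc r ==> ins r (z ! r) (del r z) = z"
proof -
 assume r: "Suc r < length z" "z ! r = z ! Suc r"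
 have "drop r z = z ! r # z ! Suc r # drop (Suc (Suc r)) z" using Cons_nth_drop_Suc[of r z] Cons_nth_drop_Suc[of "Suc r" z] r(1) by (metis Suc_lessD)
 hence "take r z @ z ! r # z ! Suc r # drop (Suc (Suc r)) z = z" by (metis append_take_drop_id)
 thus ?thesis using r by (simp add: del_def ins_def min_def)
qed
lemma nth_bas: "bas n m x ==> p < m ==> x ! p \<in> {1..n}"
 unfolding bas_def by (metis nth_mem subsetD)
lemma ins_nth: "r \<le> length y ==> ins r t y ! r = t \<and> ins r t y ! Suc r = t"
 by (simp add: ins_def nth_append)

lemma sum_mid: assumes "r \<le> m"
 shows "(\<Sum>z\<in>bset n (Suc (Suc m)). if z ! r = z ! Suc r then g z else 0) = (\<Sum>y\<in>bset n m. \<Sum>t\<in>{1..n}. g (ins r t y))"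
proof -
 have "(\<Sum>z\<in>bset n (Suc (Suc m)). if z ! r = z ! Suc r then g z else 0) = (\<Sum>z\<in>{z\<in>bset n (Suc (Suc m)). z ! r = z ! Suc r}. g z)"
  by (rule sum.inter_filter[symmetric]) simp
 also have "... = (\<Sum>(y, t)\<in>bset n m \<times> {1..n}. g (ins r t y))"
  by (rule sum.reindex_bij_witness[of _ "\<lambda>(y, t). ins r t y" "\<lambda>z. (del r z, z ! r)"])
   (use assms ins_del[of r] nth_bas[of n "Suc (Suc m)" _ "Suc r"] in \<open>auto simp: del_ins ins_nth bas_length del_bas ins_bas simp del: One_nat_def\<close>)
 finally show ?thesis by (simp add: sum.cartesian_product)
qed

text \<open>The operator E without its scalar q^(-n-1): evaluation at the wall followed by creation
  of a pair there.\<close>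

definition Eop :: "nat => 'a::comm_ring_1 => nat => (nat list => 'a) => nat list => 'a" where
 "Eop n q r g x = (if x ! r = x ! Suc r then \<Sum>t\<in>{1..n}. qpow q (2 * int t) * g (ins r t (del r x)) else 0)"

definition iota :: "nat => (nat list => 'a::comm_ring_1) => nat list => 'a" where
 "iota r g z = (if z ! r = z ! Suc r then g (del r z) else 0)"

definition cop :: "nat => 'a::comm_ring_1 => nat => (nat list => 'a) => nat list => 'a" where
 "cop n q r g x = (\<Sum>t\<in>{1..n}. qpow q (2 * int t) * g (ins r t x))"

text \<open>N is the restriction of M to the image of the creation operator, and also the map induced
 by M along the evaluation.\<close>

definition Wr :: "nat => 'a::comm_ring_1 => nat => nat => 'a mat => 'a mat => bool" where
 "Wr n q r s M N \<longleftrightarrow> supp n (r + s) N \<and>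
  (\<forall>z y. bas n (Suc (Suc (r + s))) z --> bas n (r + s) y --> (\<Sum>t\<in>{1..n}. M z (ins r t y)) = iota r (\<lambda>x. N x y) z) \<and>
  (\<forall>x z. bas n (r + s) x --> bas n (Suc (Suc (r + s))) z --> cop n q r (\<lambda>w. M w z) x = iota r (\<lambda>y. qpow q (2 * int (z ! r)) * N x y) z)"

lemma ap_iota: "ap n (Suc (Suc (r + s))) M (iota r g) z = ap n (r + s) (\<lambda>z y. \<Sum>t\<in>{1..n}. M z (ins r t y)) g z"
proof -
 have "ap n (Suc (Suc (r + s))) M (iota r g) z = (\<Sum>w\<in>bset n (Suc (Suc (r + s))). if w ! r = w ! Suc r then M z w * g (del r w) else 0)"
  by (simp add: ap_def iota_def if_distrib cong: if_cong)
 also have "... = (\<Sum>y\<in>bset n (r + s). \<Sum>t\<in>{1..n}. M z (ins r t y) * g (del r (ins r t y)))" by (rule sum_mid) simp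
 finally show ?thesis by (simp add: ap_def del_ins bas_length sum_distrib_right)
qed

lemma cop_ap: "cop n q r (ap n m M g) x = ap n m (\<lambda>x w. cop n q r (\<lambda>x. M x w) x) g x"
 unfolding cop_def ap_def sum_distrib_left sum_distrib_right mult.assoc by (rule sum.swap)

lemma ap_cop: "ap n (r + s) N (cop n q r g) x = ap n (Suc (Suc (r + s))) (\<lambda>x w. iota r (\<lambda>y. qpow q (2 * int (w ! r)) * N x y) w) g x"
proof -
 have "ap n (Suc (Suc (r + s))) (\<lambda>x w. iota r (\<lambda>y. qpow q (2 * int (w ! r)) * N x y) w) g x
  = (\<Sum>w\<in>bset n (Suc (Suc (r + s))). if w ! r = w ! Suc r then qpow q (2 * int (w ! r)) * N x (del r w) * g w else 0)"
  unfolding ap_def by (intro sum.cong refl) (simp add: iota_def)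
 also have "... = (\<Sum>y\<in>bset n (r + s). \<Sum>t\<in>{1..n}. qpow q (2 * int (ins r t y ! r)) * N x (del r (ins r t y)) * g (ins r t y))" by (rule sum_mid) simp
 finally show ?thesis
  unfolding ap_def cop_def sum_distrib_left by (simp add: del_ins ins_nth bas_length mult_ac)
qed

lemma Wr_iota: assumes "Wr n q r s M N" "bas n (Suc (Suc (r + s))) z"
 shows "ap n (Suc (Suc (r + s))) M (iota r g) z = iota r (ap n (r + s) N g) z"
 unfolding ap_iota using assms by (simp add: ap_def Wr_def iota_def)

lemma Wr_cop: assumes "Wr n q r s M N" "bas n (r + s) x"
 shows "cop n q r (ap n (Suc (Suc (r + s))) M g) x = ap n (r + s) N (cop n q r g) x"
 unfolding cop_ap ap_cop using assms by (simp add: ap_def Wr_def)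

lemma WrI: assumes "supp n (r + s) N"
 and i: "\<And>g z. bas n (Suc (Suc (r + s))) z ==> ap n (Suc (Suc (r + s))) M (iota r g) z = iota r (ap n (r + s) N g) z"
 and c: "\<And>g x. bas n (r + s) x ==> cop n q r (ap n (Suc (Suc (r + s))) M g) x = ap n (r + s) N (cop n q r g) x"
 shows "Wr n q r s M N"
 unfolding Wr_def
proof (intro conjI allI impI assms(1))
 fix z y assume "bas n (Suc (Suc (r + s))) z" "bas n (r + s) y"
 thus "(\<Sum>t\<in>{1..n}. M z (ins r t y)) = iota r (\<lambda>x. N x y) z"
  using i[of z "dlt y"] unfolding ap_iota by (simp add: ap_dlt iota_def)
next
 fix x z assume "bas n (r + s) x" "bas n (Suc (Suc (r + s))) z"
 thus "cop n q r (\<lambda>w. M w z) x = iota r (\<lambda>y. qpow q (2 * int (z ! r)) * N x y) z"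
  using c[of x "dlt z"] unfolding cop_ap ap_cop by (simp add: ap_dlt)
qed

lemma Eop_eq: "Eop n q r g = iota r (cop n q r g)" by (simp add: Eop_def iota_def cop_def fun_eq_iff)

lemma iota_cong: "r \<le> m ==> (\<And>y. bas n m y ==> g y = h y) ==> bas n (Suc (Suc m)) z ==> iota r g z = iota r h z"
 by (simp add: iota_def del_bas)
lemma cop_cong: "r \<le> m ==> (\<And>y. bas n (Suc (Suc m)) y ==> g y = h y) ==> bas n m x ==> cop n q r g x = cop n q r h x"
 unfolding cop_def by (intro sum.cong refl) (simp add: ins_bas)

lemma Wr_Eop: assumes "Wr n q r s M N" "bas n (Suc (Suc (r + s))) z"
 shows "ap n (Suc (Suc (r + s))) M (Eop n q r g) z = Eop n q r (ap n (Suc (Suc (r + s))) M g) z"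
proof -
 have "ap n (Suc (Suc (r + s))) M (Eop n q r g) z = iota r (ap n (r + s) N (cop n q r g)) z"
  unfolding Eop_eq by (rule Wr_iota[OF assms])
 also have "... = iota r (cop n q r (ap n (Suc (Suc (r + s))) M g)) z"
  by (rule iota_cong[where m = "r + s" and n = n]) (use assms in \<open>auto simp: Wr_cop[OF assms(1)]\<close>)
 finally show ?thesis by (simp add: Eop_eq)
qed

context
 fixes q :: "'a::comm_ring_1" and n :: nat
 assumes q: "q dvd 1" and n: "1 \<le> n"
begin

lemma qpow_cancel: "qpow q a * x = qpow q a * y ==> x = y"
 using qpow_minus[OF q, of a] by (metis (no_types, lifting) mult.assoc mult.commute mult_1)

text \<open>\<open>Eop\<close> is creation after evaluation. Probing the commutation at words with
  the pair (1, 1) at the wall removes one of these two maps at a time, the weight q^2 of this pair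
  being a unit. So a single matrix N serves both properties in \<open>Wr\<close>.\<close>

lemma Eop_Wr: assumes E: "\<And>g z. bas n (Suc (Suc (r + s))) z ==> ap n (Suc (Suc (r + s))) M (Eop n q r g) z = Eop n q r (ap n (Suc (Suc (r + s))) M g) z"
 shows "\<exists>N. Wr n q r s M N"
proof -
 let ?m = "Suc (Suc (r + s))"
 define A where "A z y = (\<Sum>t\<in>{1..n}. M z (ins r t y))" for z y
 define C where "C x z = cop n q r (\<lambda>w. M w z) x" for x z
 define N where "N x y = (if bas n (r + s) x \<and> bas n (r + s) y then A (ins r 1 x) y else 0)" for x y
 have one: "1 \<in> {1..n}" using n by simp
 have i: "bas n ?m (ins r 1 x)" "ins r 1 x ! r = 1" "ins r 1 x ! Suc r = 1" "del r (ins r 1 x) = x" if "bas n (r + s) x" for x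
  using ins_bas[OF _ one that, of r] that by (simp_all add: del_ins ins_nth bas_length)
 have EM: "iota r (\<lambda>y. qpow q (2 * int (w ! r)) * A z y) w = iota r (\<lambda>x. C x w) z" if zw: "bas n ?m z" "bas n ?m w" for z w
  using E[OF zw(1), of "dlt w"] zw(2) unfolding Eop_eq ap_iota ap_cop cop_ap by (simp add: ap_dlt A_def C_def)
 have d: "bas n ?m z ==> bas n (r + s) (del r z)" for z by (rule del_bas) simp_all
 have C: "C x z = iota r (\<lambda>y. qpow q (2 * int (z ! r)) * N x y) z" if "bas n (r + s) x" "bas n ?m z" for x z
  using EM[OF i(1)[OF that(1)] that(2)] i[OF that(1)] d[OF that(2)] that(1) by (simp add: iota_def N_def split: if_splits)
 have A: "A z y = iota r (\<lambda>x. N x y) z" if "bas n ?m z" "bas n (r + s) y" for z y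
 proof -
  have "qpow q (2 * int 1) * A z y = iota r (\<lambda>x. C x (ins r 1 y)) z" using EM[OF that(1) i(1)[OF that(2)]] i[OF that(2)] by (simp add: iota_def)
  also have "... = qpow q (2 * int 1) * iota r (\<lambda>x. N x y) z"
   using C[OF d[OF that(1)] i(1)[OF that(2)]] i[OF that(2)] by (simp add: iota_def)
  finally show ?thesis by (rule qpow_cancel)
 qed
 have "Wr n q r s M N" unfolding Wr_def using A C by (auto simp: A_def C_def supp_def N_def)
 thus ?thesis by blast
qed

lemma Wr_eq: assumes "Wr n q r s M N" "bas n (r + s) x" "bas n (r + s) y" shows "N x y = (\<Sum>t\<in>{1..n}. M (ins r 1 x) (ins r t y))"
proof -
 have "bas n (Suc (Suc (r + s))) (ins r 1 x)" using ins_bas[of r "r + s" 1 n x] n assms by simp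
 thus ?thesis using assms by (simp add: Wr_def iota_def ins_nth del_ins bas_length)
qed

lemma brS_tau: assumes "1 \<le> i" "i < r"
 shows "bas n (r + s) z ==> bas n (r + s) y ==> brS n q r s i z y = tau True q (i - 1) (dlt z) y"
 using assms by (auto simp: brS_def tau_def dlt_def Let_def lt_def)

lemma brSh_tau: assumes "1 \<le> j" "j < s"
 shows "bas n (r + s) z ==> bas n (r + s) y ==> brSh n q r s j z y = tau False q (r + j - 1) (dlt z) y"
 using assms by (auto simp: brSh_def tau_def dlt_def Let_def lt_def)

lemma mmul_tau: assumes a: "Suc a < m" and B: "\<And>z y. bas n m z ==> bas n m y ==> Bm z y = tau b q a (dlt z) y" and Bs: "supp n m Bm" and M: "supp n m M"
 shows "mmul n m M Bm = mmul n m Bm M \<longleftrightarrow> cm n m q M b a"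
proof -
 have 1: "mmul n m M Bm x y = tau b q a (M x) y" if "bas n m x" "bas n m y" for x y
 proof -
  have "mmul n m M Bm x y = tau b q a (\<lambda>w. \<Sum>z\<in>bset n m. M x z * dlt z w) y"
   unfolding mmul_def tau_sum tau_scale by (intro sum.cong refl) (simp add: B that)
  also have "... = tau b q a (M x) y"
  proof (rule tau_cong[OF a _ that(2)])
   fix w assume "bas n m w"
   thus "(\<Sum>z\<in>bset n m. M x z * dlt z w) = M x w" by (subst sum_single[of _ w]) (auto simp: dlt_def)
  qed
  finally show ?thesis .
 qed
 have 2: "mmul n m Bm M x y = tau b q a (\<lambda>x. M x y) x" if "bas n m x" "bas n m y" for x y
 proof -
  have "mmul n m Bm M x y = (\<Sum>z\<in>bset n m. tau b q a (dlt x) z * M z y)" unfolding mmul_def by (intro sum.cong refl) (simp add: B that)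
  also have "... = (\<Sum>z\<in>bset n m. dlt x z * tau b q a (\<lambda>x. M x y) z)" by (rule tau_sym[OF a, symmetric])
  also have "... = tau b q a (\<lambda>x. M x y) x" by (subst sum_single[of _ x]) (use that in \<open>auto simp: dlt_def\<close>)
  finally show ?thesis .
 qed
 have s: "supp n m (mmul n m M Bm)" "supp n m (mmul n m Bm M)" using Bs M by (auto intro: supp_mmul)
 show ?thesis
 proof
  assume "mmul n m M Bm = mmul n m Bm M" thus "cm n m q M b a" using 1 2 by (simp add: cm_def)
 next
  assume c: "cm n m q M b a"
  show "mmul n m M Bm = mmul n m Bm M"
  proof (intro ext)
   fix x y show "mmul n m M Bm x y = mmul n m Bm M x y"
    using 1[of x y] 2[of x y] c s by (cases "bas n m x \<and> bas n m y") (auto simp: cm_def supp_def)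
  qed
 qed
qed

lemma brE_eq: assumes "bas n (Suc r + Suc s) z" "bas n (Suc r + Suc s) y"
 shows "brE n q (Suc r) (Suc s) z y = qpow q (- int n - 1) * Eop n q r (dlt y) z"
proof -
 have l: "length z = Suc (Suc (r + s))" "length y = Suc (Suc (r + s))" using assms bas_length by auto
 have yr: "y ! r \<in> {1..n}" using nth_bas[OF assms(2)] by simp
 show ?thesis
 proof (cases "z ! r = z ! Suc r \<and> y ! r = y ! Suc r")
  case False
  have "dlt y (ins r t (del r z)) = (0::'a)" if "y ! r \<noteq> y ! Suc r" for t
   using that ins_nth[of r "del r z" t] l by (auto simp: dlt_def del_def)
  hence "Eop n q r (dlt y) z = (0::'a)" using False by (auto simp: Eop_def)
  thus ?thesis using False by (auto simp: brE_def)
 next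
  case True
  have e: "(\<forall>p < Suc r + Suc s. p \<noteq> Suc r - 1 \<and> p \<noteq> Suc r --> z ! p = y ! p) \<longleftrightarrow> del r z = del r y"
  proof
   assume L: "\<forall>p < Suc r + Suc s. p \<noteq> Suc r - 1 \<and> p \<noteq> Suc r --> z ! p = y ! p"
   have "take r z = take r y" using L l by (intro nth_equalityI) auto
   moreover have "drop (r + 2) z = drop (r + 2) y" using L l by (intro nth_equalityI) auto
   ultimately show "del r z = del r y" by (simp add: del_def)
  next
   assume R: "del r z = del r y"
   hence t: "take r z = take r y" "drop (r + 2) z = drop (r + 2) y" using l by (auto simp: del_def)
   show "\<forall>p < Suc r + Suc s. p \<noteq> Suc r - 1 \<and> p \<noteq> Suc r --> z ! p = y ! p"
   proof (intro allI impI)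
    fix p assume p: "p < Suc r + Suc s" "p \<noteq> Suc r - 1 \<and> p \<noteq> Suc r"
    show "z ! p = y ! p"
    proof (cases "p < r")
     case True
     hence "take r z ! p = z ! p" "take r y ! p = y ! p" by simp_all
     thus ?thesis using t by simp
    next
     case False
     hence "r + 2 \<le> p" using p by simp
     then obtain d where d: "p = r + 2 + d" by (metis le_Suc_ex)
     hence "drop (r + 2) z ! d = z ! p" "drop (r + 2) y ! d = y ! p" using l p by (simp_all add: nth_drop)
     thus ?thesis using t by metis
    qed
   qed
  qed
  have i: "ins r t (del r z) = y \<longleftrightarrow> t = y ! r \<and> del r z = del r y" for t
  proof
   assume "ins r t (del r z) = y"
   thus "t = y ! r \<and> del r z = del r y" using ins_nth[of r "del r z" t] del_ins[of r "del r z" t] l by (auto simp: del_def)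
  next
   assume "t = y ! r \<and> del r z = del r y" thus "ins r t (del r z) = y" using ins_del[of r y] True l by simp
  qed
  have "Eop n q r (dlt y) z = (\<Sum>t\<in>{1..n}. if t = y ! r then (if del r z = del r y then qpow q (2 * int (y ! r)) else 0) else 0)"
   unfolding Eop_def using True by (auto simp: dlt_def i intro!: sum.cong simp del: sum.delta)
  also have "... = (if del r z = del r y then qpow q (2 * int (y ! r)) else 0)" using yr by (simp add: sum.delta)
  finally have E: "Eop n q r (dlt y) z = (if del r z = del r y then qpow q (2 * int (y ! r)) else 0)" .
  have "2 * int (y ! r) - int n - 1 = (- int n - 1) + 2 * int (y ! r)" by simp
  hence "qpow q (2 * int (y ! r) - int n - 1) = qpow q (- int n - 1) * qpow q (2 * int (y ! r))" by (simp only: qpow_add[OF q])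
  thus ?thesis unfolding E brE_def e using True assms by auto
 qed
qed

lemma Eop_sum: "Eop n q r (\<lambda>x. \<Sum>i\<in>S. c i * g i x) z = (\<Sum>i\<in>S. c i * Eop n q r (g i) z)"
proof -
 have "(\<Sum>t\<in>{1..n}. qpow q (2 * int t) * (\<Sum>i\<in>S. c i * g i (h t))) = (\<Sum>i\<in>S. c i * (\<Sum>t\<in>{1..n}. qpow q (2 * int t) * g i (h t)))" for h
  unfolding sum_distrib_left by (subst sum.swap) (simp add: mult.left_commute)
 thus ?thesis by (simp add: Eop_def)
qed

lemma Eop_cong: "(\<And>x. bas n (Suc (Suc (r + s))) x ==> g x = h x) ==> bas n (Suc (Suc (r + s))) z ==> Eop n q r g z = Eop n q r h z"
 unfolding Eop_def by (auto intro!: sum.cong simp: ins_bas del_bas)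

lemma mmul_E: assumes M: "supp n (Suc r + Suc s) M"
 shows "mmul n (Suc r + Suc s) M (brE n q (Suc r) (Suc s)) = mmul n (Suc r + Suc s) (brE n q (Suc r) (Suc s)) M \<longleftrightarrow> (\<exists>N. Wr n q r s M N)"
proof -
 let ?m = "Suc (Suc (r + s))" and ?E = "brE n q (Suc r) (Suc s)" and ?c = "qpow q (- int n - 1)"
 have m: "Suc r + Suc s = ?m" by simp
 have E: "\<And>z y. bas n ?m z ==> bas n ?m y ==> ?E z y = ?c * Eop n q r (dlt y) z" using brE_eq[of r s] by simp
 have 1: "mmul n ?m M ?E x y = ?c * ap n ?m M (Eop n q r (dlt y)) x" if "bas n ?m x" "bas n ?m y" for x y
  unfolding mmul_def ap_def sum_distrib_left by (intro sum.cong refl) (simp add: E that mult.left_commute)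
 have d: "bas n ?m x ==> (\<Sum>z\<in>bset n ?m. g z * dlt z x) = g x" for g :: "nat list => 'a" and x
  by (subst sum_single[of _ x]) (auto simp: dlt_def)
 have 2: "mmul n ?m ?E M x y = ?c * Eop n q r (\<lambda>x. M x y) x" if "bas n ?m x" "bas n ?m y" for x y
 proof -
  have "mmul n ?m ?E M x y = (\<Sum>z\<in>bset n ?m. ?c * (M z y * Eop n q r (dlt z) x))"
   unfolding mmul_def by (intro sum.cong refl) (simp add: E that mult.left_commute mult.commute)
  also have "... = ?c * Eop n q r (\<lambda>x. \<Sum>z\<in>bset n ?m. M z y * dlt z x) x" unfolding Eop_sum sum_distrib_left ..
  also have "Eop n q r (\<lambda>x. \<Sum>z\<in>bset n ?m. M z y * dlt z x) x = Eop n q r (\<lambda>x. M x y) x"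
   by (rule Eop_cong[where s = s]) (use that d in auto)
  finally show ?thesis .
 qed
 have sE: "supp n ?m ?E" by (auto simp: supp_def brE_def)
 show ?thesis unfolding m
 proof
  assume ME: "mmul n ?m M ?E = mmul n ?m ?E M"
  have "ap n ?m M (Eop n q r g) z = Eop n q r (ap n ?m M g) z" if z: "bas n ?m z" for g z
  proof -
   have k: "ap n ?m M (Eop n q r (dlt y)) z = Eop n q r (\<lambda>x. M x y) z" if "bas n ?m y" for y
    using ME 1[OF z that] 2[OF z that] qpow_cancel[of "- int n - 1"] by simp
   have "ap n ?m M (Eop n q r g) z = ap n ?m M (Eop n q r (\<lambda>x. \<Sum>y\<in>bset n ?m. g y * dlt y x)) z"
    by (intro ap_cong Eop_cong[where s = s]) (use d in auto)
   also have "... = (\<Sum>y\<in>bset n ?m. g y * ap n ?m M (Eop n q r (dlt y)) z)"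
    unfolding Eop_sum ap_def sum_distrib_left by (subst sum.swap) (simp add: mult.left_commute)
   also have "... = (\<Sum>y\<in>bset n ?m. g y * Eop n q r (\<lambda>x. M x y) z)" by (intro sum.cong refl) (simp add: k)
   also have "... = Eop n q r (ap n ?m M g) z"
   proof -
    have "ap n ?m M g = (\<lambda>x. \<Sum>y\<in>bset n ?m. g y * M x y)" by (simp add: ap_def mult.commute fun_eq_iff)
    thus ?thesis by (simp only: Eop_sum)
   qed
   finally show ?thesis .
  qed
  thus "\<exists>N. Wr n q r s M N" by (rule Eop_Wr)
 next
  assume "\<exists>N. Wr n q r s M N"
  then obtain N where N: "Wr n q r s M N" ..
  have "Eop n q r (ap n ?m M (dlt y)) x = Eop n q r (\<lambda>x. M x y) x" if "bas n ?m x" "bas n ?m y" for x y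
   by (rule Eop_cong[where s = s]) (use that ap_dlt in auto)
  hence "mmul n ?m M ?E x y = mmul n ?m ?E M x y" if "bas n ?m x" "bas n ?m y" for x y
   using 1[OF that] 2[OF that] Wr_Eop[OF N that(1)] that by simp
  moreover have "supp n ?m (mmul n ?m M ?E)" "supp n ?m (mmul n ?m ?E M)" using sE M by (auto intro: supp_mmul)
  ultimately show "mmul n ?m M ?E = mmul n ?m ?E M" by (auto simp: supp_def fun_eq_iff) metis
 qed
qed

text \<open>The form in which membership is used from here on: commutation with E has become the
  existence of an induced matrix one level down, and the scalar q^(-n-1) has disappeared.\<close>

lemma qSchur_iff: "M \<in> qSchur n q r s \<longleftrightarrow> supp n (r + s) M \<and> hk n q r s M \<and> (\<forall>r' s'. r = Suc r' \<and> s = Suc s' --> (\<exists>N. Wr n q r' s' M N))"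
proof (cases "supp n (r + s) M")
 case False thus ?thesis by (auto simp: qSchur_def supp_def)
next
 case M: True
 have 1: "(\<forall>i. 1 \<le> i \<and> i < r --> mmul n (r + s) M (brS n q r s i) = mmul n (r + s) (brS n q r s i) M) \<longleftrightarrow> (\<forall>a. Suc a < r --> cm n (r + s) q M True a)"
 proof -
  have "mmul n (r + s) M (brS n q r s i) = mmul n (r + s) (brS n q r s i) M \<longleftrightarrow> cm n (r + s) q M True (i - 1)" if "1 \<le> i" "i < r" for i
   by (rule mmul_tau) (use that brS_tau M in \<open>auto simp: supp_def brS_def\<close>)
  thus ?thesis by (metis Suc_le_eq diff_Suc_1 le_add_diff_inverse le_numeral_extra(4) plus_1_eq_Suc zero_less_Suc One_nat_def)
 qed
 have 2: "(\<forall>i. 1 \<le> i \<and> i < s --> mmul n (r + s) M (brSh n q r s i) = mmul n (r + s) (brSh n q r s i) M) \<longleftrightarrow> (\<forall>a. r \<le> a \<and> Suc a < r + s --> cm n (r + s) q M False a)"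
 proof -
  have e: "mmul n (r + s) M (brSh n q r s i) = mmul n (r + s) (brSh n q r s i) M \<longleftrightarrow> cm n (r + s) q M False (r + i - 1)" if "1 \<le> i" "i < s" for i
   by (rule mmul_tau) (use that brSh_tau M in \<open>auto simp: supp_def brSh_def\<close>)
  show ?thesis
  proof (intro iffI allI impI)
   fix a assume L: "\<forall>i. 1 \<le> i \<and> i < s --> mmul n (r + s) M (brSh n q r s i) = mmul n (r + s) (brSh n q r s i) M" and a: "r \<le> a \<and> Suc a < r + s"
   hence "1 \<le> Suc a - r" "Suc a - r < s" by auto
   hence "cm n (r + s) q M False (r + (Suc a - r) - 1)" using L e by blast
   thus "cm n (r + s) q M False a" using a by simp
  next
   fix i assume R: "\<forall>a. r \<le> a \<and> Suc a < r + s --> cm n (r + s) q M False a" and i: "1 \<le> i \<and> i < s"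
   hence "cm n (r + s) q M False (r + i - 1)" by auto
   thus "mmul n (r + s) M (brSh n q r s i) = mmul n (r + s) (brSh n q r s i) M" using e i by blast
  qed
 qed
 have 3: "(1 \<le> r \<and> 1 \<le> s --> mmul n (r + s) M (brE n q r s) = mmul n (r + s) (brE n q r s) M) \<longleftrightarrow> (\<forall>r' s'. r = Suc r' \<and> s = Suc s' --> (\<exists>N. Wr n q r' s' M N))"
 proof (cases "1 \<le> r \<and> 1 \<le> s")
  case True
  then obtain r' s' where "r = Suc r'" "s = Suc s'" by (metis One_nat_def Suc_le_D)
  thus ?thesis using mmul_E[of r' s' M] M by simp
 next
  case False thus ?thesis by auto
 qed
 show ?thesis unfolding qSchur_def mem_Collect_eq 1 2 3 hk_def using M by (auto simp: supp_def)
qed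

end

section \<open>The induced matrix one level down lies in the smaller commutant\<close>

lemma cmI: assumes a: "Suc a < m" and h: "\<And>g x. bas n m x ==> ap n m M (tau b q a g) x = tau b q a (ap n m M g) x"
 shows "cm n m q M b a"
 unfolding cm_def
proof (intro allI impI)
 fix x y assume xy: "bas n m x" "bas n m y"
 have "ap n m M (tau b q a (dlt y)) x = (\<Sum>z\<in>bset n m. tau b q a (M x) z * dlt y z)"
  unfolding ap_def by (rule tau_sym[OF a])
 also have "... = tau b q a (M x) y" by (subst sum_single[of _ y]) (use xy in \<open>auto simp: dlt_def\<close>)
 finally have 1: "ap n m M (tau b q a (dlt y)) x = tau b q a (M x) y" .
 have "tau b q a (ap n m M (dlt y)) x = tau b q a (\<lambda>x. M x y) x"
  by (rule tau_cong[OF a _ xy(1)]) (rule ap_dlt[OF xy(2)])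
 thus "tau b q a (M x) y = tau b q a (\<lambda>x. M x y) x" using h[OF xy(1), of "dlt y"] 1 by simp
qed

lemma del_swp1: assumes "Suc a < r" "Suc r < length z"
 shows "swp z a (Suc a) ! r = z ! r" "swp z a (Suc a) ! Suc r = z ! Suc r" "del r (swp z a (Suc a)) = swp (del r z) a (Suc a)"
  "del r z ! a = z ! a" "del r z ! Suc a = z ! Suc a"
 using assms by (simp_all add: swp_def del_def nth_append list_update_append take_update_swap)

lemma del_swp2: assumes "r \<le> a" "Suc (Suc (Suc a)) < length z"
 shows "swp z (Suc (Suc a)) (Suc (Suc (Suc a))) ! r = z ! r" "swp z (Suc (Suc a)) (Suc (Suc (Suc a))) ! Suc r = z ! Suc r"
  "del r (swp z (Suc (Suc a)) (Suc (Suc (Suc a)))) = swp (del r z) a (Suc a)"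
  "del r z ! a = z ! Suc (Suc a)" "del r z ! Suc a = z ! Suc (Suc (Suc a))"
proof -
 have l: "length (take r z) = r" using assms by simp
 show "swp z (Suc (Suc a)) (Suc (Suc (Suc a))) ! r = z ! r" "swp z (Suc (Suc a)) (Suc (Suc (Suc a))) ! Suc r = z ! Suc r"
  using assms by (simp_all add: swp_def)
 show n: "del r z ! a = z ! Suc (Suc a)" "del r z ! Suc a = z ! Suc (Suc (Suc a))"
  using assms by (simp_all add: del_def nth_append)
 have "Suc (Suc a) - Suc (Suc r) = a - r" "Suc (Suc (Suc a)) - Suc (Suc r) = Suc a - r" by simp_all
 thus "del r (swp z (Suc (Suc a)) (Suc (Suc (Suc a)))) = swp (del r z) a (Suc a)"
  unfolding swp_def n unfolding del_def using assms by (simp add: list_update_append drop_update_swap)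
qed

lemma iota_tau1: "Suc a < r ==> Suc r < length z ==> tau b q a (iota r g) z = iota r (tau b q a g) z"
 by (simp add: tau_def iota_def del_swp1)
lemma iota_tau2: "r \<le> a ==> Suc (Suc (Suc a)) < length z ==> tau b q (Suc (Suc a)) (iota r g) z = iota r (tau b q a g) z"
 by (simp add: tau_def iota_def del_swp2)

context
 fixes q :: "'a::comm_ring_1" and n :: nat
 assumes q: "q dvd 1" and n: "1 \<le> n"
begin

text \<open>Hecke operators away from the wall pair commute with its creation; places on the dual
  side are shifted by two. Any created pair can be read off at the letter 1, so commutation passes
  from M to N.\<close>

lemma Wr_hk: assumes M: "hk n q (Suc r) (Suc s) M" and W: "Wr n q r s M N" shows "hk n q r s N"
proof -
 let ?m = "Suc (Suc (r + s))"
 have *: "cm n (r + s) q N b a" if a: "Suc a < r + s" and c: "cm n ?m q M b a'" and a': "Suc a' < ?m"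
  and i: "\<And>g z. bas n ?m z ==> tau b q a' (iota r g) z = iota r (tau b q a g) z" for b a a'
 proof (rule cmI[OF a])
  fix g x assume x: "bas n (r + s) x"
  define z where "z = ins r 1 x"
  have z: "bas n ?m z" unfolding z_def using ins_bas[of r "r + s" 1 n x] n x by simp
  have iz: "iota r h z = h x" for h using x by (simp add: iota_def z_def ins_nth del_ins bas_length)
  have "ap n (r + s) N (tau b q a g) x = iota r (ap n (r + s) N (tau b q a g)) z" by (simp add: iz)
  also have "... = ap n ?m M (iota r (tau b q a g)) z" using Wr_iota[OF W] z by simp
  also have "... = ap n ?m M (tau b q a' (iota r g)) z" by (rule ap_cong) (simp add: i)
  also have "... = tau b q a' (ap n ?m M (iota r g)) z" by (rule ap_tau[OF c a' z])
  also have "... = tau b q a' (iota r (ap n (r + s) N g)) z" by (rule tau_cong[OF a' _ z]) (use Wr_iota[OF W] in simp)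
  also have "... = tau b q a (ap n (r + s) N g) x" by (simp add: i[OF z] iz)
  finally show "ap n (r + s) N (tau b q a g) x = tau b q a (ap n (r + s) N g) x" .
 qed
 show ?thesis unfolding hk_def
 proof (intro conjI allI impI)
  fix a assume a: "Suc a < r"
  show "cm n (r + s) q N True a"
   by (rule *[of a True a]) (use a M in \<open>auto simp: hk_def bas_length intro!: iota_tau1\<close>)
 next
  fix a assume a: "r \<le> a \<and> Suc a < r + s"
  show "cm n (r + s) q N False a"
   by (rule *[of a False "Suc (Suc a)"]) (use a M in \<open>auto simp: hk_def bas_length intro!: iota_tau2\<close>)
 qed
qed

text \<open>The inverse Hecke operator on the dual side, from the quadratic relation tau^2 = 1 +
  (q^(-1) - q) tau.\<close>

definition taui :: "nat => (nat list => 'a) => nat list => 'a" where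
 "taui a g y = tau False q a g y + (q - qinv q) * g y"

lemma ap_taui: assumes "cm n m q M False a" "Suc a < m" "bas n m x"
 shows "ap n m M (taui a v) x = taui a (ap n m M v) x"
proof -
 have "ap n m M (taui a v) x = ap n m M (tau False q a v) x + (q - qinv q) * ap n m M v x"
  by (simp add: ap_def taui_def distrib_left sum.distrib sum_distrib_left mult.left_commute)
 thus ?thesis using ap_tau[OF assms] by (simp add: taui_def)
qed

lemma telescope: "b < a ==> (\<Sum>j\<in>{b<..<a}. qpow q (2 * int j) * (q - qinv q)) = qpow q (2 * int a - 1) - qpow q (2 * int b + 1)"
proof (induction a)
 case (Suc a)
 show ?case
 proof (cases "b < a")
  case True
  have "{b<..<Suc a} = insert a {b<..<a}" using True by auto
  moreover have "qpow q (2 * int a) * (q - qinv q) = qpow q (2 * int a + 1) - qpow q (2 * int a - 1)"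
   using qpow_Suc[OF q, of "2 * int a"] qpow_pred[OF q, of "2 * int a"] by (simp only: right_diff_distrib mult.commute[of _ "qpow q (2 * int a)"])
  moreover have "2 * int (Suc a) - 1 = 2 * int a + 1" by simp
  ultimately show ?thesis using Suc.IH[OF True] by (simp only: sum.insert finite_greaterThanLessThan greaterThanLessThan_iff less_irrefl simp_thms)
    (simp add: algebra_simps)
 next
  case False
  hence "a = b" using Suc.prems by simp
  moreover have "{b<..<Suc b} = {}" by auto
  moreover have "2 * int (Suc b) - 1 = 2 * int b + 1" by simp
  ultimately show ?thesis by (simp only: sum.empty diff_self)
 qed
qed simp

text \<open>Creating a pair, braiding the neighbours past it and evaluating in the middle is the
 operator E one level down.\<close>

lemma wall_identity: assumes u: "length u = r" and ab: "a \<in> {1..n}" "b \<in> {1..n}"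
 shows "cop n q (Suc r) (tau True q r (taui (Suc (Suc r)) (iota (Suc r) g))) (u @ a # b # v) = Eop n q r g (u @ a # b # v)"
proof -
 define G where "G c f = g (u @ c # f # v)" for c f
 have io: "iota (Suc r) g (u @ c # d # e # f # v) = (if d = e then G c f else 0)" for c d e f
  using u by (simp add: iota_def nth_append del_def G_def)
 define h' where "h' = taui (Suc (Suc r)) (iota (Suc r) g)"
 have h': "h' (u @ c # d # e # f # v) = (if e = f then (if d = e then q * G c f else 0)
   else (if d = f then G c e else 0) + (if f < e \<and> d = e then (q - qinv q) * G c f else 0))" for c d e f
 proof -
  have t: "tau False q (Suc (Suc r)) (iota (Suc r) g) ((u @ [c, d]) @ e # f # v) = (if e = f then qinv q * iota (Suc r) g ((u @ [c, d]) @ e # f # v)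
  else iota (Suc r) g ((u @ [c, d]) @ f # e # v) + (if lt False e f then 0 else (qinv q - q) * iota (Suc r) g ((u @ [c, d]) @ e # f # v)))"
   by (rule tau_app) (simp add: u)
  show ?thesis using t unfolding h'_def taui_def by (auto simp: io lt_def algebra_simps)
 qed
 have h: "tau True q r h' (u @ a # j # j # b # v) = (if a = j then qinv q * h' (u @ a # a # a # b # v)
  else h' (u @ j # a # j # b # v) + (if a < j then 0 else (qinv q - q) * h' (u @ a # j # j # b # v)))" for j
  using tau_app[OF u, of True q h' a j "j # b # v"] by (simp add: lt_def)
 have c: "cop n q (Suc r) (tau True q r h') (u @ a # b # v) = (\<Sum>j\<in>{1..n}. qpow q (2 * int j) * tau True q r h' (u @ a # j # j # b # v))"
  using u by (simp add: cop_def ins_def)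
 have E: "Eop n q r g (u @ a # b # v) = (if a = b then \<Sum>j\<in>{1..n}. qpow q (2 * int j) * G j j else 0)"
  using u by (simp add: Eop_def ins_def del_def nth_append G_def)
 have qq: "q * qinv q = 1" "qinv q * q = 1" using q by (auto simp: qinv_right qinv_left)
 show ?thesis
 proof (cases "a = b")
  case True
  have "tau True q r h' (u @ a # j # j # b # v) = G j j" for j
   unfolding h h' using True qq by (auto simp: mult.assoc[symmetric])
  thus ?thesis unfolding h'_def[symmetric] c E using True by simp
 next
  case ab': False
  define k where "k = (q - qinv q) * G a b"
  \<comment> \<open>For a \<noteq> b there is a contribution only if b < a, and then only from the
    letters j between b and a. The sum weighted by q^(2j) telescopes: the interior letters cancel
    the two end terms.\<close>
  have t: "tau True q r h' (u @ a # j # j # b # v) = (if b < a then (if j = a then qinv q * k else 0) - (if j = b then q * k else 0) - (if b < j \<and> j < a then (q - qinv q) * k else 0) else 0)" for j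
   unfolding h h' using ab' by (auto simp: k_def algebra_simps)
  show ?thesis
  proof (cases "b < a")
   case False
   thus ?thesis unfolding h'_def[symmetric] c E t using ab' by simp
  next
   case ba: True
   have "(\<Sum>j\<in>{1..n}. qpow q (2 * int j) * tau True q r h' (u @ a # j # j # b # v))
    = (\<Sum>j\<in>{1..n}. (if j = a then qpow q (2 * int a) * (qinv q * k) else 0) - (if j = b then qpow q (2 * int b) * (q * k) else 0) - (if j \<in> {b<..<a} then qpow q (2 * int j) * (q - qinv q) * k else 0))"
    by (rule sum.cong) (use ba in \<open>auto simp: t mult.assoc\<close>)
   also have "... = qpow q (2 * int a) * (qinv q * k) - qpow q (2 * int b) * (q * k) - (\<Sum>j\<in>{1..n}. if j \<in> {b<..<a} then qpow q (2 * int j) * (q - qinv q) * k else 0)"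
    using ab by (simp add: sum_subtractf sum.delta)
   also have "(\<Sum>j\<in>{1..n}. if j \<in> {b<..<a} then qpow q (2 * int j) * (q - qinv q) * k else 0) = (\<Sum>j\<in>{b<..<a}. qpow q (2 * int j) * (q - qinv q) * k)"
    using ab by (intro sum.mono_neutral_cong_right) auto
   also have "... = (qpow q (2 * int a - 1) - qpow q (2 * int b + 1)) * k" by (simp only: telescope[OF ba, symmetric] sum_distrib_right)
   finally have "(\<Sum>j\<in>{1..n}. qpow q (2 * int j) * tau True q r h' (u @ a # j # j # b # v)) = 0"
    unfolding qpow_Suc[OF q] qpow_pred[OF q] by (simp add: algebra_simps)
   thus ?thesis unfolding h'_def[symmetric] c E using ab' by simp
  qed
 qed
qed

lemma split_two: assumes "bas n (Suc (Suc (r + s))) x"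
 obtains u a b v where "x = u @ a # b # v" "length u = r" "a \<in> {1..n}" "b \<in> {1..n}"
proof -
 have l: "length x = Suc (Suc (r + s))" using assms bas_length by blast
 have "x = take r x @ x ! r # x ! Suc r # drop (Suc (Suc r)) x"
  using l by (metis Cons_nth_drop_Suc Suc_lessD add_Suc_right append_take_drop_id less_add_Suc1 not_less_eq)
 thus ?thesis using that l nth_bas[OF assms, of r] nth_bas[OF assms, of "Suc r"] by auto
qed

text \<open>Commutation of N with the smaller E is not among the hypotheses on M. It follows because
  that E is creation, two Hecke moves next to the wall pair, and evaluation: M passes through the
  Hecke moves and turns into N at the other two maps.\<close>

lemma Wr_next: assumes M: "hk n q (Suc (Suc r)) (Suc (Suc s)) M" and W: "Wr n q (Suc r) (Suc s) M N"
 shows "\<exists>N'. Wr n q r s N N'"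
proof (rule Eop_Wr[OF q n])
 fix g z assume z: "bas n (Suc (Suc (r + s))) z"
 let ?k = "Suc (Suc (r + s))" and ?m = "Suc (Suc (Suc (Suc (r + s))))"
 let ?X = "\<lambda>g. tau True q r (taui (Suc (Suc r)) g)"
 have cT: "cm n ?m q M True r" and cF: "cm n ?m q M False (Suc (Suc r))" using M by (auto simp: hk_def)
 have I: "cop n q (Suc r) (?X (iota (Suc r) g)) x = Eop n q r g x" if bx: "bas n ?k x" for g x
 proof -
  obtain u a b v where "x = u @ a # b # v" "length u = r" "a \<in> {1..n}" "b \<in> {1..n}" using split_two[OF bx] .
  thus ?thesis using wall_identity by metis
 qed
 have W1: "bas n ?m z ==> ap n ?m M (iota (Suc r) g) z = iota (Suc r) (ap n ?k N g) z" for z g using Wr_iota[OF W, of z g] by simp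
 have W2: "bas n ?k x ==> cop n q (Suc r) (ap n ?m M g) x = ap n ?k N (cop n q (Suc r) g) x" for x g using Wr_cop[OF W, of x g] by simp
 have X: "ap n ?m M (?X g) y = ?X (ap n ?m M g) y" if "bas n ?m y" for g y
 proof -
  have "ap n ?m M (?X g) y = tau True q r (ap n ?m M (taui (Suc (Suc r)) g)) y" by (rule ap_tau[OF cT _ that]) simp
  also have "... = ?X (ap n ?m M g) y" by (rule tau_cong[where n = n and m = ?m]) (use that ap_taui[OF cF] in auto)
  finally show ?thesis .
 qed
 have Xc: "?X g y = ?X h y" if gh: "\<And>x. bas n ?m x ==> g x = h x" and y: "bas n ?m y" for g h y
 proof (rule tau_cong[where n = n and m = ?m])
  fix x assume x: "bas n ?m x"
  have "tau False q (Suc (Suc r)) g x = tau False q (Suc (Suc r)) h x" by (rule tau_cong[where n = n and m = ?m]) (use gh x in auto)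
  thus "taui (Suc (Suc r)) g x = taui (Suc (Suc r)) h x" using gh[OF x] by (simp add: taui_def)
 qed (use y in auto)
 have "ap n ?k N (Eop n q r g) z = ap n ?k N (cop n q (Suc r) (?X (iota (Suc r) g))) z" by (rule ap_cong) (simp add: I)
 also have "... = cop n q (Suc r) (ap n ?m M (?X (iota (Suc r) g))) z" by (simp add: W2[OF z])
 also have "... = cop n q (Suc r) (?X (iota (Suc r) (ap n ?k N g))) z"
 proof (rule cop_cong[where m = ?k and n = n])
  fix y assume y: "bas n (Suc (Suc ?k)) y"
  have "ap n ?m M (?X (iota (Suc r) g)) y = ?X (ap n ?m M (iota (Suc r) g)) y" using X y by simp
  also have "... = ?X (iota (Suc r) (ap n ?k N g)) y" by (rule Xc) (use W1 y in auto)
  finally show "ap n ?m M (?X (iota (Suc r) g)) y = ?X (iota (Suc r) (ap n ?k N g)) y" .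
 qed (use z in auto)
 also have "... = Eop n q r (ap n ?k N g) z" by (rule I[OF z])
 finally show "ap n ?k N (Eop n q r g) z = Eop n q r (ap n ?k N g) z" .
qed

definition nx :: "nat => nat => 'a mat => 'a mat" where
 "nx r s M x y = (if bas n (r + s) x \<and> bas n (r + s) y then \<Sum>t\<in>{1..n}. M (ins r 1 x) (ins r t y) else 0)"

lemma Wr_nx: assumes "Wr n q r s M N" shows "nx r s M = N"
proof (intro ext)
 fix x y show "nx r s M x y = N x y"
  using Wr_eq[OF q n assms, of x y] assms by (cases "bas n (r + s) x \<and> bas n (r + s) y") (auto simp: nx_def Wr_def supp_def)
qed

lemma nx_qSchur: assumes "M \<in> qSchur n q (Suc r) (Suc s)"
 shows "Wr n q r s M (nx r s M)" "nx r s M \<in> qSchur n q r s"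
proof -
 have M: "supp n (Suc r + Suc s) M" "hk n q (Suc r) (Suc s) M" "\<exists>N. Wr n q r s M N" using assms by (auto simp: qSchur_iff[OF q n])
 thus W: "Wr n q r s M (nx r s M)" using Wr_nx by blast
 have "\<exists>N'. Wr n q r' s' (nx r s M) N'" if "r = Suc r'" "s = Suc s'" for r' s'
  using Wr_next[of r' s' M "nx r s M"] M W that by simp
 thus "nx r s M \<in> qSchur n q r s" using Wr_hk[OF M(2) W] W by (auto simp: qSchur_iff[OF q n] Wr_def)
qed

fun lv :: "nat => nat => nat => 'a mat => 'a mat" where
 "lv r s 0 M = M"
| "lv r s (Suc k) M = lv (r - 1) (s - 1) k (nx (r - 1) (s - 1) M)"

lemma lv_qSchur: "M \<in> qSchur n q r s ==> k \<le> r ==> k \<le> s ==> lv r s k M \<in> qSchur n q (r - k) (s - k)"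
proof (induction k arbitrary: r s M)
 case (Suc k)
 obtain r' s' where rs: "r = Suc r'" "s = Suc s'" using Suc.prems by (metis Suc_le_D)
 show ?case using Suc.IH[OF nx_qSchur(2)[of M r' s']] Suc.prems by (simp add: rs)
qed simp

lemma lv_lv: "lv r s (k + c) M = lv (r - k) (s - k) c (lv r s k M)"
 by (induction k arbitrary: r s M) simp_all

definition iotac :: "nat => nat => (nat list => 'a) => nat list => 'a" where
 "iotac r c g z = (if take c (drop r z) = rev (take c (drop (r + c) z)) then g (take r z @ drop (r + c + c) z) else 0)"

lemma iotac_app: "length l = r ==> length t = c ==> length t' = c ==> iotac r c g (l @ t @ t' @ v) = (if t = rev t' then g (l @ v) else 0)"
 by (simp add: iotac_def)

lemma split4: assumes "length x = r + a + a' + c" obtains l t t' v where "x = l @ t @ t' @ v" "length l = r" "length t = a" "length t' = a'" "length v = c"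
proof -
 from split3[of x r a "a' + c"] assms obtain l t w where "x = l @ t @ w" "length l = r" "length t = a" "length w = a' + c" by auto
 moreover from split3[of w a' c 0] this obtain t' v where "w = t' @ v" "length t' = a'" "length v = c" by auto
 ultimately show ?thesis using that by blast
qed

lemma iotac_Suc: "length z = r + Suc c + Suc c + s ==> iotac r (Suc c) g z = iota (r + c) (iotac r c g) z"
proof -
 assume "length z = r + Suc c + Suc c + s"
 then obtain l t t' v where z: "z = l @ t @ t' @ v" "length l = r" "length t = Suc c" "length t' = Suc c" by (rule split4)
 obtain t1 a where t: "t = t1 @ [a]" "length t1 = c" using z by (metis length_Suc_conv_rev)
 obtain b t2 where t': "t' = b # t2" "length t2 = c" using z by (metis length_Suc_conv)
 have "iota (r + c) (iotac r c g) (l @ t1 @ a # b # t2 @ v) = (if a = b then iotac r c g (l @ t1 @ t2 @ v) else 0)"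
  using z t t' by (simp add: iota_def del_def nth_append)
 moreover have "iotac r (Suc c) g (l @ (t1 @ [a]) @ (b # t2) @ v) = (if t1 @ [a] = rev (b # t2) then g (l @ v) else 0)"
  by (rule iotac_app) (use z t t' in auto)
 ultimately show ?thesis using iotac_app[of l r t1 c t2 g v] z t t' by simp
qed

lemma lv_iotac: "M \<in> qSchur n q (r + c) (s + c) ==> bas n (r + c + (s + c)) z ==>
 ap n (r + c + (s + c)) M (iotac r c g) z = iotac r c (ap n (r + s) (lv (r + c) (s + c) c M) g) z"
proof (induction c arbitrary: M z)
 case 0
 thus ?case by (simp add: iotac_def)
next
 case (Suc c)
 let ?k = "r + c + (s + c)"
 let ?N = "nx (r + c) (s + c) M"
 have M: "M \<in> qSchur n q (Suc (r + c)) (Suc (s + c))" using Suc.prems by simp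
 have l: "bas n (Suc (Suc ?k)) x ==> length x = r + Suc c + Suc c + s" for x using bas_length by fastforce
 have e: "r + Suc c + (s + Suc c) = Suc (Suc ?k)" by simp
 have z: "bas n (Suc (Suc ?k)) z" using Suc.prems by simp
 have "ap n (Suc (Suc ?k)) M (iotac r (Suc c) g) z = ap n (Suc (Suc ?k)) M (iota (r + c) (iotac r c g)) z"
  by (rule ap_cong) (simp add: iotac_Suc[OF l])
 also have "... = iota (r + c) (ap n ?k ?N (iotac r c g)) z" using Wr_iota[OF nx_qSchur(1)[OF M]] z by simp
 also have "... = iota (r + c) (iotac r c (ap n (r + s) (lv (r + c) (s + c) c ?N) g)) z"
  by (rule iota_cong[where m = ?k and n = n]) (use Suc.IH[OF nx_qSchur(2)[OF M]] z in auto)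
 also have "... = iotac r (Suc c) (ap n (r + s) (lv (r + Suc c) (s + Suc c) (Suc c) M) g) z"
  by (simp add: iotac_Suc[OF l[OF z]])
 finally show ?case unfolding e .
qed

end

section \<open>Elements of the commutant\<close>

context
 fixes q :: "'a::comm_ring_1" and n :: nat
 assumes q: "q dvd 1" and n: "1 \<le> n"
begin

lemma cm_mmul: assumes "Suc a < m" "cm n m q A b a" "cm n m q C b a" shows "cm n m q (mmul n m A C) b a"
proof (rule cmI[OF assms(1)])
 fix g x assume x: "bas n m x"
 have "ap n m (mmul n m A C) (tau b q a g) x = ap n m A (ap n m C (tau b q a g)) x" by (simp add: ap_ap)
 also have "... = ap n m A (tau b q a (ap n m C g)) x" by (rule ap_cong) (rule ap_tau[OF assms(3,1)])
 also have "... = tau b q a (ap n m (mmul n m A C) g) x" using ap_tau[OF assms(2,1) x] by (simp add: ap_ap)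
 finally show "ap n m (mmul n m A C) (tau b q a g) x = tau b q a (ap n m (mmul n m A C) g) x" .
qed

lemma hk_mmul: "hk n q r s A ==> hk n q r s C ==> hk n q r s (mmul n (r + s) A C)"
 unfolding hk_def by (auto intro!: cm_mmul)

lemma Wr_mmul: assumes A: "Wr n q r s A A'" and C: "Wr n q r s C C'"
 shows "Wr n q r s (mmul n (Suc (Suc (r + s))) A C) (mmul n (r + s) A' C')"
proof (rule WrI)
 let ?m = "Suc (Suc (r + s))"
 show "supp n (r + s) (mmul n (r + s) A' C')" using A C by (auto simp: Wr_def supp_mmul)
 fix g z assume z: "bas n ?m z"
 have "ap n ?m A (ap n ?m C (iota r g)) z = ap n ?m A (iota r (ap n (r + s) C' g)) z" by (rule ap_cong) (rule Wr_iota[OF C])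
 thus "ap n ?m (mmul n ?m A C) (iota r g) z = iota r (ap n (r + s) (mmul n (r + s) A' C') g) z"
  unfolding ap_ap[symmetric] Wr_iota[OF A z] .
next
 let ?m = "Suc (Suc (r + s))"
 fix g x assume x: "bas n (r + s) x"
 have "ap n (r + s) A' (cop n q r (ap n ?m C g)) x = ap n (r + s) A' (ap n (r + s) C' (cop n q r g)) x" by (rule ap_cong) (rule Wr_cop[OF C])
 thus "cop n q r (ap n ?m (mmul n ?m A C) g) x = ap n (r + s) (mmul n (r + s) A' C') (cop n q r g) x"
  unfolding ap_ap[symmetric] Wr_cop[OF A x] .
qed

lemma qSchur_mult: assumes "A \<in> qSchur n q r s" "C \<in> qSchur n q r s" shows "mmul n (r + s) A C \<in> qSchur n q r s"
proof -
 have "\<exists>N. Wr n q r' s' (mmul n (r + s) A C) N" if rs: "r = Suc r'" "s = Suc s'" for r' s'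
 proof -
  obtain A' C' where "Wr n q r' s' A A'" "Wr n q r' s' C C'" using assms rs unfolding qSchur_iff[OF q n] by blast
  from Wr_mmul[OF this] show ?thesis using rs by auto
 qed
 thus ?thesis using assms by (auto simp: qSchur_iff[OF q n] hk_mmul supp_mmul)
qed

lemma nx_mult: assumes "A \<in> qSchur n q (Suc r) (Suc s)" "C \<in> qSchur n q (Suc r) (Suc s)"
 shows "nx n r s (mmul n (Suc r + Suc s) A C) = mmul n (r + s) (nx n r s A) (nx n r s C)"
 using Wr_nx[OF q n Wr_mmul[OF nx_qSchur(1)[OF q n assms(1)] nx_qSchur(1)[OF q n assms(2)]]] by simp

lemma qSchur_add: assumes "A \<in> qSchur n q r s" "C \<in> qSchur n q r s" shows "(\<lambda>x y. A x y + C x y) \<in> qSchur n q r s"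
proof -
 have "hk n q r s (\<lambda>x y. A x y + C x y)" using assms by (auto simp: qSchur_iff[OF q n] hk_def cm_def tau_add)
 moreover have "\<exists>N. Wr n q r' s' (\<lambda>x y. A x y + C x y) N" if rs: "r = Suc r'" "s = Suc s'" for r' s'
 proof -
  obtain A' C' where "Wr n q r' s' A A'" "Wr n q r' s' C C'" using assms rs unfolding qSchur_iff[OF q n] by blast
  hence "Wr n q r' s' (\<lambda>x y. A x y + C x y) (\<lambda>x y. A' x y + C' x y)"
   by (auto simp: Wr_def iota_def cop_def supp_def sum.distrib distrib_left)
  thus ?thesis by blast
 qed
 ultimately show ?thesis using assms by (auto simp: qSchur_iff[OF q n] supp_def)
qed

lemma qSchur_smult: assumes "A \<in> qSchur n q r s" shows "(\<lambda>x y. c * A x y) \<in> qSchur n q r s"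
proof -
 have "hk n q r s (\<lambda>x y. c * A x y)" using assms by (auto simp: qSchur_iff[OF q n] hk_def cm_def tau_scale)
 moreover have "\<exists>N. Wr n q r' s' (\<lambda>x y. c * A x y) N" if rs: "r = Suc r'" "s = Suc s'" for r' s'
 proof -
  obtain A' where "Wr n q r' s' A A'" using assms rs unfolding qSchur_iff[OF q n] by blast
  hence "Wr n q r' s' (\<lambda>x y. c * A x y) (\<lambda>x y. c * A' x y)"
   by (auto simp: Wr_def iota_def cop_def supp_def sum_distrib_left[symmetric] mult.left_commute[of _ c])
  thus ?thesis by blast
 qed
 ultimately show ?thesis using assms by (auto simp: qSchur_iff[OF q n] supp_def)
qed

subsection \<open>Diagonal matrices\<close>

definition dg :: "nat => nat => (nat list => 'a) => 'a mat" where
 "dg r s d x y = (if bas n (r + s) x \<and> x = y then d x else 0)"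

text \<open>A function of the index that only depends on the number of occurrences of each letter in the
 V-part minus the number of occurrences in the dual part.\<close>

definition sym :: "(nat => nat list => 'a) => bool" where
 "sym d \<longleftrightarrow> (\<forall>r x a. Suc a < length x \<and> (Suc a < r \<or> r \<le> a) --> d r (swp x a (Suc a)) = d r x)
  \<and> (\<forall>r x t. r \<le> length x --> d (Suc r) (ins r t x) = d r x)"

lemma ap_dg: "bas n (r + s) x ==> ap n (r + s) (dg r s d) g x = d x * g x"
 unfolding ap_def by (subst sum_single[of _ x]) (auto simp: dg_def)

lemma dg_cm: assumes "Suc a < r + s" "\<And>x. bas n (r + s) x ==> d (swp x a (Suc a)) = d x"
 shows "cm n (r + s) q (dg r s d) b a"
proof (rule cmI[OF assms(1)])
 fix g x assume x: "bas n (r + s) x"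
 have "tau b q a (ap n (r + s) (dg r s d) g) x = tau b q a (\<lambda>x. d x * g x) x" by (rule tau_cong[OF assms(1) _ x]) (rule ap_dg)
 thus "ap n (r + s) (dg r s d) (tau b q a g) x = tau b q a (ap n (r + s) (dg r s d) g) x"
  using x assms(2)[OF x] by (simp add: ap_dg tau_def algebra_simps)
qed

lemma dg_Wr: assumes d: "sym d" shows "Wr n q r s (dg (Suc r) (Suc s) (d (Suc r))) (dg r s (d r))"
proof (rule WrI)
 have D: "bas n (Suc (Suc (r + s))) z ==> ap n (Suc (Suc (r + s))) (dg (Suc r) (Suc s) (d (Suc r))) g z = d (Suc r) z * g z" for g z
  using ap_dg[of "Suc r" "Suc s" z] by simp
 have di: "bas n (r + s) x ==> d (Suc r) (ins r t x) = d r x" for x t using d bas_length[of n "r + s" x] by (simp add: sym_def)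
 show "supp n (r + s) (dg r s (d r))" by (auto simp: supp_def dg_def)
 fix g x
 {
  assume z: "bas n (Suc (Suc (r + s))) x"
  hence "x ! r = x ! Suc r ==> d (Suc r) x = d r (del r x)" using di[of "del r x" "x ! r"] del_bas[of r "r + s" n x] ins_del[of r x] by (simp add: bas_length)
  thus "ap n (Suc (Suc (r + s))) (dg (Suc r) (Suc s) (d (Suc r))) (iota r g) x = iota r (ap n (r + s) (dg r s (d r)) g) x"
   using z del_bas[of r "r + s" n x] by (simp add: D iota_def ap_dg)
 next
  assume x: "bas n (r + s) x"
  thus "cop n q r (ap n (Suc (Suc (r + s))) (dg (Suc r) (Suc s) (d (Suc r))) g) x = ap n (r + s) (dg r s (d r)) (cop n q r g) x"
   by (simp add: ap_dg cop_def D ins_bas di sum_distrib_left mult.left_commute cong: sum.cong_simp)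
 }
qed

lemma dg_qSchur: assumes d: "sym d" shows "dg r s (d r) \<in> qSchur n q r s"
proof -
 have "hk n q r s (dg r s (d r))" unfolding hk_def using d by (auto intro!: dg_cm simp: sym_def bas_length)
 moreover have "supp n (r + s) (dg r s (d r))" by (auto simp: supp_def dg_def)
 ultimately show ?thesis using dg_Wr[OF d] by (auto simp: qSchur_iff[OF q n])
qed

lemma dg_left: "bas n (r + s) x ==> mmul n (r + s) (dg r s d) A x y = d x * A x y"
 unfolding mmul_def by (subst sum_single[of _ x]) (auto simp: dg_def)

fun lsum :: "(bool => nat => int) => nat => nat list => int" where
 "lsum f r [] = 0"
| "lsum f r (y # ys) = f (0 < r) y + lsum f (r - 1) ys"

lemma lsum_swp: "Suc a < length x ==> Suc a < r \<or> r \<le> a ==> lsum f r (swp x a (Suc a)) = lsum f r x"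
proof (induction a arbitrary: x r)
 case 0
 then obtain u w y where "x = u # w # y" by (cases x; cases "tl x") auto
 moreover have "(0 < r) = (0 < r - 1)" using 0 by auto
 ultimately show ?case by (simp add: swp_0)
next
 case (Suc a)
 then obtain u y where x: "x = u # y" by (cases x) auto
 have "Suc a < length y" "Suc a < r - 1 \<or> r - 1 \<le> a" using Suc.prems x by auto
 from Suc.IH[OF this] show ?case unfolding x by (simp add: swp_Cons)
qed

lemma lsum_ins: "(\<And>t. f True t + f False t = 0) ==> r \<le> length x ==> lsum f (Suc r) (ins r t x) = lsum f r x"
proof (induction r arbitrary: x)
 case 0
 have "lsum f 0 (t # x) = f False t + lsum f 0 x" by simp
 thus ?case using 0 by (simp add: ins_0)
next
 case (Suc r)
 then obtain u y where x: "x = u # y" by (cases x) auto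
 thus ?case using Suc by (simp add: ins_Suc)
qed

lemma wt_lsum: "wt i r x = lsum (sw i) r x" by (induction x arbitrary: r) simp_all
lemma dw_lsum: "dw r x = lsum (\<lambda>b y. if b then 0 else int y) r x" by (induction x arbitrary: r) simp_all

lemma sym_lsum: "(\<And>t. f True t + f False t = 0) ==> sym (\<lambda>r x. h (lsum f r x))"
 unfolding sym_def by (simp add: lsum_swp lsum_ins)

lemma sw_sum: "sw i True t + sw i False t = 0" by (simp add: sw_def)
lemma sym_wt: "sym (\<lambda>r x. h (wt i r x))" unfolding wt_lsum by (rule sym_lsum) (rule sw_sum)

lemma mx_qh_dg: "mx_qh n q r s h = dg r s (\<lambda>x. qpow q (lsum (\<lambda>b y. if b then h y else - h y) r x))"
proof (intro ext)
 fix x y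
 have P: "length x = length y ==> (\<Prod>p<length y. fqh q r h p (x ! p) (y ! p)) = (if x = y then qpow q (lsum (\<lambda>b y. if b then h y else - h y) r x) else 0)"
 proof (induction x y arbitrary: r rule: list_induct2)
  case (Cons x xs y ys)
  have S: "fqh q r h (Suc p) = fqh q (r - 1) h p" for p by (auto simp: fqh_def fun_eq_iff)
  have "(\<Prod>p<length (y # ys). fqh q r h p ((x # xs) ! p) ((y # ys) ! p)) = fqh q r h 0 x y * (if xs = ys then qpow q (lsum (\<lambda>b y. if b then h y else - h y) (r - 1) xs) else 0)"
   by (simp add: prod.lessThan_Suc_shift S Cons.IH del: prod.lessThan_Suc)
  thus ?case by (auto simp: fqh_def vqh_def dqh_def qpow_add[OF q])
 qed simp
 show "mx_qh n q r s h x y = dg r s (\<lambda>x. qpow q (lsum (\<lambda>b y. if b then h y else - h y) r x)) x y"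
 proof (cases "bas n (r + s) x \<and> bas n (r + s) y")
  case True
  hence "length x = r + s" "length y = r + s" by (auto simp: bas_length)
  thus ?thesis using True P by (auto simp: mx_qh_def tens_def dg_def)
 qed (auto simp: mx_qh_def tens_def dg_def)
qed

lemma mx_qh_qSchur: "mx_qh n q r s h \<in> qSchur n q r s"
 unfolding mx_qh_dg using dg_qSchur[OF sym_lsum[of "\<lambda>b y. if b then h y else - h y" "qpow q"], of r s] by simp

lemma mx_K_dg: "mx_K n q r s i z = dg r s (\<lambda>x. qpow q (z * wt i r x))"
 by (auto simp: mx_K_eq[OF q] dg_def fun_eq_iff)

lemma mx_K_qh: "mx_K n q r s i z = mx_qh n q r s (\<lambda>y. z * sw i True y)"
proof -
 have "lsum (\<lambda>b y. if b then z * sw i True y else - (z * sw i True y)) r x = z * lsum (sw i) r x" for x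
 proof (induction x arbitrary: r)
  case (Cons y x)
  have "sw i False y = - sw i True y" by (simp add: sw_def)
  thus ?case using Cons by (simp add: distrib_left)
 qed simp
 thus ?thesis by (simp add: mx_K_dg mx_qh_dg wt_lsum)
qed

subsection \<open>Divided powers and the twisted transpose\<close>

lemma FM_Wr: assumes i: "1 \<le> i" "i < n" shows "Wr n q r s (FM n q (Suc r) (Suc s) i l) (FM n q r s i l)"
proof -
 let ?m = "Suc (Suc (r + s))"
 have b: "bas n ?m z ==> set z \<subseteq> {1..n} \<and> length z = ?m" "bas n (r + s) y ==> length y = r + s" for z y by (auto simp: bas_def)
 have "(\<Sum>t\<in>{1..n}. FM n q (Suc r) (Suc s) i l z (ins r t y)) = iota r (\<lambda>x. FM n q r s i l x y) z"
  if zy: "bas n ?m z" "bas n (r + s) y" for z y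
 proof -
  have "(\<Sum>t\<in>{1..n}. FM n q (Suc r) (Suc s) i l z (ins r t y)) = (\<Sum>t\<in>{1..n}. Fd q i (Suc r) l z (ins r t y))"
   by (intro sum.cong refl) (use zy ins_bas[of r "r + s" _ n y] in \<open>simp add: FM_def\<close>)
  thus ?thesis using Fd_ins[OF q i, of z y r l] zy b del_bas[of r "r + s" n z] by (simp add: FM_def iota_def)
 qed
 moreover have "cop n q r (\<lambda>w. FM n q (Suc r) (Suc s) i l w z) x = iota r (\<lambda>y. qpow q (2 * int (z ! r)) * FM n q r s i l x y) z"
  if xz: "bas n (r + s) x" "bas n ?m z" for x z
 proof -
  have "cop n q r (\<lambda>w. FM n q (Suc r) (Suc s) i l w z) x = (\<Sum>t\<in>{1..n}. qpow q (2 * int t) * Fd q i (Suc r) l (ins r t x) z)"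
   unfolding cop_def by (intro sum.cong refl) (use xz ins_bas[of r "r + s" _ n x] in \<open>simp add: FM_def\<close>)
  thus ?thesis using Fd_ev[OF q i, of z x r l] xz b del_bas[of r "r + s" n z] by (simp add: FM_def iota_def)
 qed
 ultimately show ?thesis unfolding Wr_def using supp_FM by auto
qed

lemma FM_qSchur: assumes i: "1 \<le> i" "i < n" shows "FM n q r s i l \<in> qSchur n q r s"
proof -
 have "cm n (r + s) q (FM n q r s i l) b a" if "Suc a < r + s" "b \<and> Suc a < r \<or> \<not> b \<and> r \<le> a" for a b
 proof -
  have *: "tau b q a (FM n q r s i l x) y = tau b q a (Fd q i r l x) y" "tau b q a (\<lambda>x. FM n q r s i l x y) x = tau b q a (\<lambda>x. Fd q i r l x y) x"
   if "bas n (r + s) x" "bas n (r + s) y" for x y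
   by (rule tau_cong[where n = n and m = "r + s"]; use that \<open>Suc a < r + s\<close> in \<open>simp add: FM_def\<close>)+
  show ?thesis unfolding cm_def
  proof (intro allI impI)
   fix x y assume xy: "bas n (r + s) x" "bas n (r + s) y"
   show "tau b q a (FM n q r s i l x) y = tau b q a (\<lambda>x. FM n q r s i l x y) x"
    unfolding *[OF xy] by (rule Fd_tau[OF q]) (use xy that in \<open>auto simp: bas_length\<close>)
  qed
 qed
 hence "hk n q r s (FM n q r s i l)" by (simp add: hk_def)
 moreover have "\<exists>N. Wr n q r' s' (FM n q r s i l) N" if "r = Suc r'" "s = Suc s'" for r' s'
  using FM_Wr[OF i, of r' s' l] that by blast
 ultimately show ?thesis using supp_FM by (auto simp: qSchur_iff[OF q n])
qed

lemma FM_nx: "1 \<le> i ==> i < n ==> nx n r s (FM n q (Suc r) (Suc s) i l) = FM n q r s i l"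
 by (rule Wr_nx[OF q n FM_Wr])

text \<open>An anti-automorphism of the matrix algebra that exchanges f_i^(l) and e_i^(l) up to
  powers of K_i. The plain transpose would not preserve the commutant, as creation and evaluation
  carry different weights.\<close>

definition TT :: "nat => 'a mat => 'a mat" where "TT r M x y = tw q r x y * M y x"

lemma tw_unit: "tw q r x y * tw q r y x = 1" by (simp add: tw_mult[OF q]) (simp add: tw_def)

lemma TT_TT: "TT r (TT r M) = M"
 by (intro ext) (simp add: TT_def mult.assoc[symmetric] tw_unit)

lemma tw_swp: "Suc a < length x ==> Suc a < r \<or> r \<le> a ==> tw q r y (swp x a (Suc a)) = tw q r y x"
 "Suc a < length x ==> Suc a < r \<or> r \<le> a ==> tw q r (swp x a (Suc a)) y = tw q r x y"
 by (simp_all add: tw_def dw_lsum lsum_swp)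

lemma dw_ins: "r \<le> length x ==> dw (Suc r) (ins r t x) = int t + dw r x"
proof (induction r arbitrary: x)
 case (Suc r) thus ?case by (cases x) (simp_all add: ins_Suc)
qed (simp add: ins_0)

lemma TT_cm: assumes a: "Suc a < r + s" "Suc a < r \<or> r \<le> a" and M: "cm n (r + s) q M b a" shows "cm n (r + s) q (TT r M) b a"
 unfolding cm_def
proof (intro allI impI)
 fix x y assume xy: "bas n (r + s) x" "bas n (r + s) y"
 hence l: "Suc a < length x" "Suc a < length y" using a bas_length by auto
 have 1: "tau b q a (TT r M x) y = tw q r x y * tau b q a (\<lambda>y. M y x) y"
  using tw_swp(1)[OF l(2) a(2)] by (simp add: tau_def TT_def algebra_simps)
 have 2: "tau b q a (\<lambda>x. TT r M x y) x = tw q r x y * tau b q a (M y) x"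
  using tw_swp(2)[OF l(1) a(2)] by (simp add: tau_def TT_def algebra_simps)
 show "tau b q a (TT r M x) y = tau b q a (\<lambda>x. TT r M x y) x" unfolding 1 2 using M xy by (simp add: cm_def)
qed

text \<open>Transposition exchanges creation, with weights 1, and evaluation, with weights q^(2t).
  Inserting the pair t raises \<open>dw\<close> by t, so the twist supplies exactly the missing
  factor.\<close>

lemma TT_Wr: assumes W: "Wr n q r s M N" shows "Wr n q r s (TT (Suc r) M) (TT r N)"
proof -
 let ?m = "Suc (Suc (r + s))"
 have di: "bas n (r + s) y ==> dw (Suc r) (ins r t y) = int t + dw r y" for t y using dw_ins[of r y t] bas_length by force
 have dd: "dw (Suc r) z = int (z ! r) + dw r (del r z)" if "bas n ?m z" "z ! r = z ! Suc r" for z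
  using ins_del[of r z] dw_ins[of r "del r z" "z ! r"] that bas_length[OF that(1)] bas_length[OF del_bas[OF _ that(1), of r]] by simp
 have 1: "(\<Sum>t\<in>{1..n}. TT (Suc r) M z (ins r t y)) = qpow q (2 * (dw r y - dw (Suc r) z)) * cop n q r (\<lambda>w. M w z) y" if "bas n (r + s) y" for z y
  unfolding cop_def sum_distrib_left
  by (intro sum.cong refl) (simp add: TT_def tw_def di[OF that] mult.assoc[symmetric] qpow_add[OF q, symmetric] algebra_simps)
 have 2: "cop n q r (\<lambda>w. TT (Suc r) M w z) x = qpow q (2 * (dw (Suc r) z - dw r x)) * (\<Sum>t\<in>{1..n}. M z (ins r t x))" if "bas n (r + s) x" for x z
  unfolding cop_def sum_distrib_left
  by (intro sum.cong refl) (simp add: TT_def tw_def di[OF that] mult.assoc[symmetric] qpow_add[OF q, symmetric] algebra_simps)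
 show ?thesis unfolding Wr_def
 proof (intro conjI allI impI)
  show "supp n (r + s) (TT r N)" using W by (auto simp: supp_def TT_def Wr_def)
  fix z y assume zy: "bas n ?m z" "bas n (r + s) y"
  have w: "cop n q r (\<lambda>w. M w z) y = iota r (\<lambda>x. qpow q (2 * int (z ! r)) * N y x) z" using W zy unfolding Wr_def by blast
  show "(\<Sum>t\<in>{1..n}. TT (Suc r) M z (ins r t y)) = iota r (\<lambda>x. TT r N x y) z"
   unfolding 1[OF zy(2)] w using dd[OF zy(1)] by (simp add: iota_def TT_def tw_def mult.assoc[symmetric] qpow_add[OF q, symmetric] algebra_simps)
 next
  fix x z assume xz: "bas n (r + s) x" "bas n ?m z"
  have w: "(\<Sum>t\<in>{1..n}. M z (ins r t x)) = iota r (\<lambda>y. N y x) z" using W xz unfolding Wr_def by blast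
  show "cop n q r (\<lambda>w. TT (Suc r) M w z) x = iota r (\<lambda>y. qpow q (2 * int (z ! r)) * TT r N x y) z"
   unfolding 2[OF xz(1)] w using dd[OF xz(2)] by (simp add: iota_def TT_def tw_def mult.assoc[symmetric] qpow_add[OF q, symmetric] algebra_simps)
 qed
qed

lemma TT_qSchur: assumes "M \<in> qSchur n q r s" shows "TT r M \<in> qSchur n q r s"
proof -
 have "hk n q r s (TT r M)" using assms unfolding hk_def qSchur_iff[OF q n] by (auto intro!: TT_cm)
 moreover have "\<exists>N. Wr n q r' s' (TT r M) N" if rs: "r = Suc r'" "s = Suc s'" for r' s'
 proof -
  obtain A' where "Wr n q r' s' M A'" using assms rs unfolding qSchur_iff[OF q n] by blast
  thus ?thesis using TT_Wr rs by blast
 qed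
 ultimately show ?thesis using assms by (auto simp: qSchur_iff[OF q n] supp_def TT_def)
qed

lemma TT_nx: "M \<in> qSchur n q (Suc r) (Suc s) ==> nx n r s (TT (Suc r) M) = TT r (nx n r s M)"
 using Wr_nx[OF q n TT_Wr[OF nx_qSchur(1)[OF q n]]] by blast

lemma EM_TT: "EM n q r s i l = mmul n (r + s) (dg r s (\<lambda>x. qpow q (- (int l * (wt i r x - int l))))) (TT r (FM n q r s i l))"
proof (intro ext)
 fix x y
 show "EM n q r s i l x y = mmul n (r + s) (dg r s (\<lambda>x. qpow q (- (int l * (wt i r x - int l))))) (TT r (FM n q r s i l)) x y"
 proof (cases "bas n (r + s) x")
  case True
  thus ?thesis by (auto simp: dg_left EM_def FM_def TT_def Ed_def tw_def)
 next
  case False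
  thus ?thesis by (auto simp: EM_def mmul_def dg_def)
 qed
qed

lemma EM_qSchur: assumes i: "1 \<le> i" "i < n" shows "EM n q r s i l \<in> qSchur n q r s"
 unfolding EM_TT
 by (intro qSchur_mult TT_qSchur FM_qSchur i dg_qSchur[OF sym_wt[of "\<lambda>w. qpow q (- (int l * (w - int l)))"]])

lemma one_qSchur: "mid n (r + s) \<in> qSchur n q r s"
proof -
 have "sym (\<lambda>r x. 1)" by (simp add: sym_def)
 moreover have "dg r s ((\<lambda>r x. 1) r) = mid n (r + s)" by (auto simp: dg_def mid_def fun_eq_iff)
 ultimately show ?thesis using dg_qSchur by metis
qed

lemma alg_qSchur: assumes "\<And>A. A \<in> G ==> A \<in> qSchur n q r s" and "A \<in> alg_gen n (r + s) G" shows "A \<in> qSchur n q r s"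
 using assms(2)
proof induction
 case (gen A) thus ?case by (rule assms(1))
qed (auto intro: one_qSchur qSchur_add qSchur_smult qSchur_mult)

lemma rho_U_sub: "rho_U n q r s \<subseteq> qSchur n q r s"
proof
 fix A assume "A \<in> rho_U n q r s"
 thus "A \<in> qSchur n q r s" unfolding rho_U_def
  by (rule alg_qSchur[rotated]) (auto simp: mx_e_div_eq[OF q] mx_f_div_eq[OF q] simp del: One_nat_def intro: mx_qh_qSchur EM_qSchur FM_qSchur)
qed

lemma rho_U'_sub: "rho_U' n q r s \<subseteq> rho_U n q r s"
proof
 fix A assume "A \<in> rho_U' n q r s"
 thus "A \<in> rho_U n q r s" unfolding rho_U'_def rho_U_def
  by (rule alg_gen_mono[rotated]) (auto simp: mx_K_qh intro!: alg_gen.gen)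
qed

lemma FM_rho: "1 \<le> i ==> i < n ==> FM n q r s i l \<in> rho_U' n q r s"
 unfolding rho_U'_def by (rule alg_gen.gen) (use mx_f_div_eq[OF q, of i n r s l] in \<open>blast intro: sym\<close>)
lemma EM_rho: "1 \<le> i ==> i < n ==> EM n q r s i l \<in> rho_U' n q r s"
 unfolding rho_U'_def by (rule alg_gen.gen) (use mx_e_div_eq[OF q, of i n r s l] in \<open>blast intro: sym\<close>)
lemma mult_rho: "A \<in> rho_U' n q r s ==> C \<in> rho_U' n q r s ==> mmul n (r + s) A C \<in> rho_U' n q r s"
 unfolding rho_U'_def by (rule alg_gen.mult)

text \<open>It is e_i^(l) times a scalar and a power of K_i, hence it stays inside the image of the
  smaller algebra.\<close>

lemma TT_FM_rho: assumes i: "1 \<le> i" "i < n" shows "TT r (FM n q r s i l) \<in> rho_U' n q r s"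
proof -
 have D: "dg r s (\<lambda>x. qpow q (int l * (wt i r x - int l))) \<in> rho_U' n q r s"
 proof -
  have K: "dg r s (\<lambda>x. qpow q (int k * wt i r x)) \<in> rho_U' n q r s" for k
  proof (induction k)
   case 0
   have "dg r s (\<lambda>x. 1) = mid n (r + s)" by (auto simp: dg_def mid_def fun_eq_iff)
   thus ?case by (simp add: rho_U'_def alg_gen.one)
  next
   case (Suc k)
   have "dg r s (\<lambda>x. qpow q (int (Suc k) * wt i r x)) = mmul n (r + s) (mx_K n q r s i 1) (dg r s (\<lambda>x. qpow q (int k * wt i r x)))"
   proof (intro ext)
    fix x y show "dg r s (\<lambda>x. qpow q (int (Suc k) * wt i r x)) x y = mmul n (r + s) (mx_K n q r s i 1) (dg r s (\<lambda>x. qpow q (int k * wt i r x))) x y"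
     unfolding mx_K_dg
    proof (cases "bas n (r + s) x")
     case True
     have "qpow q (int (Suc k) * wt i r x) = qpow q (1 * wt i r x) * qpow q (int k * wt i r x)"
      by (simp only: qpow_add[OF q, symmetric]) (simp add: algebra_simps)
     thus "dg r s (\<lambda>x. qpow q (int (Suc k) * wt i r x)) x y = mmul n (r + s) (dg r s (\<lambda>x. qpow q (1 * wt i r x))) (dg r s (\<lambda>x. qpow q (int k * wt i r x))) x y"
      unfolding dg_left[OF True] by (cases "x = y"; cases "bas n (r + s) y") (simp_all only: dg_def mult_zero_right if_False if_True simp_thms True)
    qed (simp add: dg_def mmul_def)
   qed
   moreover have "mx_K n q r s i 1 \<in> rho_U' n q r s" unfolding rho_U'_def by (rule alg_gen.gen) (use i in auto)
   ultimately show ?case using mult_rho Suc by simp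
  qed
  have "dg r s (\<lambda>x. qpow q (int l * (wt i r x - int l))) = (\<lambda>x y. qpow q (- (int l * int l)) * dg r s (\<lambda>x. qpow q (int l * wt i r x)) x y)"
   by (auto simp: dg_def fun_eq_iff qpow_add[OF q, symmetric] algebra_simps)
  thus ?thesis using K[of l] unfolding rho_U'_def by (simp only:) (rule alg_gen.smult)
 qed
 have "TT r (FM n q r s i l) = mmul n (r + s) (dg r s (\<lambda>x. qpow q (int l * (wt i r x - int l)))) (EM n q r s i l)"
 proof (intro ext)
  fix x y
  show "TT r (FM n q r s i l) x y = mmul n (r + s) (dg r s (\<lambda>x. qpow q (int l * (wt i r x - int l)))) (EM n q r s i l) x y"
  proof (cases "bas n (r + s) x")
   case True
   thus ?thesis using qpow_minus[OF q, of "int l * (wt i r x - int l)"]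
    by (auto simp: dg_left EM_def FM_def TT_def Ed_def tw_def mult.assoc[symmetric])
  next
   case False
   thus ?thesis by (auto simp: TT_def FM_def mmul_def dg_def)
  qed
 qed
 thus ?thesis using mult_rho[OF D EM_rho[OF i]] by simp
qed

end

section \<open>The straightening rule for two rows\<close>

text \<open>A pair of subsets A, B of an initial segment is encoded by a word in the letters 1 (only in B),
 2 (only in A), 3 (in both), 4 (in neither). Exchanging elements between the two rows is the lowering
 operator of U(gl_2) acting on such words, with q replaced by a unit Q.\<close>

definition s2 :: "nat => int" where "s2 = sw 1 True"

lemma s2_simps: "s2 (Suc 0) = 1" "s2 2 = -1" "s2 3 = 0" "s2 4 = 0" by (simp_all add: s2_def sw_def numeral_2_eq_2)

definition ht :: "nat list => int" where "ht x = sum_list (map s2 x)"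

lemma ht_simps [simp]: "ht [] = 0" "ht (x # xs) = s2 x + ht xs" "ht (xs @ ys) = ht xs + ht ys" by (simp_all add: ht_def)

definition sim :: "nat => nat => bool" where "sim a b \<longleftrightarrow> a = b \<or> {a, b} \<subseteq> {1, 2}"

text \<open>For d = 0: the words agree up to exchanging letters 1 and 2, and each prefix of y is at
  least as high as that of x. The argument d carries the height difference of the letters already
  read.\<close>

fun le4 :: "int => nat list => nat list => bool" where
 "le4 d [] [] = True"
| "le4 d (x # xs) (y # ys) = (sim x y \<and> 0 \<le> d + s2 y - s2 x \<and> le4 (d + s2 y - s2 x) xs ys)"
| "le4 d [] (y # ys) = False"
| "le4 d (x # xs) [] = False"

fun ballot :: "int => nat list => bool" where
 "ballot d [] = True"
| "ballot d (x # xs) = (0 \<le> d + s2 x \<and> ballot (d + s2 x) xs)"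

lemma le4_length: "le4 d x y ==> length x = length y" by (induction d x y rule: le4.induct) auto

lemma le4_snoc: "le4 d (xs @ [a]) (ys @ [b]) \<longleftrightarrow> le4 d xs ys \<and> sim a b \<and> 0 \<le> d + ht ys - ht xs + s2 b - s2 a"
proof (cases "length xs = length ys")
 case True
 thus ?thesis by (induction xs ys arbitrary: d rule: list_induct2) (auto simp: algebra_simps)
next
 case False
 thus ?thesis using le4_length[of d xs ys] le4_length[of d "xs @ [a]" "ys @ [b]"] by auto
qed

lemma ballot_snoc: "ballot d (xs @ [a]) \<longleftrightarrow> ballot d xs \<and> 0 \<le> d + ht xs + s2 a"
 by (induction xs arbitrary: d) (auto simp: algebra_simps)

lemma ballot_ht: "ballot d xs ==> 0 \<le> d ==> 0 \<le> d + ht xs"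
proof (induction xs arbitrary: d)
 case (Cons a xs)
 hence "0 \<le> d + s2 a + ht xs" by auto
 thus ?case by simp
qed simp

lemma le4_trans: "le4 d x y ==> le4 d' y z ==> le4 (d + d') x z"
proof (induction d x y arbitrary: d' z rule: le4.induct)
 case (2 d x xs y ys)
 then obtain w ws where z: "z = w # ws" by (cases z) auto
 have "le4 ((d + s2 y - s2 x) + (d' + s2 w - s2 y)) xs ws"
  by (rule "2.IH") (use "2.prems" z in \<open>simp_all only: le4.simps\<close>)
 moreover have "(d + s2 y - s2 x) + (d' + s2 w - s2 y) = d + d' + s2 w - s2 x" by simp
 ultimately have "le4 (d + d' + s2 w - s2 x) xs ws" by metis
 thus ?case using 2 z by (auto simp: sim_def)
next
 case (1 d)
 thus ?case by (cases z) auto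
qed auto

lemma wt_ht: "length y \<le> r ==> wt 1 r y = ht y"
 by (induction y arbitrary: r) (auto simp: s2_def)

lemma low1: "low (Suc 0) True y x \<longleftrightarrow> y = 1 \<and> x = 2" by (auto simp: low_def)

lemma Fd_le4: "Fd Q 1 r l x y \<noteq> 0 ==> length y \<le> r ==> 0 \<le> d ==> le4 d x y"
proof (induction x y arbitrary: r l d rule: list_induct2')
 case (4 x xs y ys)
 have r: "0 < r" using 4 by auto
 consider "x = y" | "x \<noteq> y" "low 1 True y x" "Fd Q 1 (r - 1) (l - 1) xs ys \<noteq> 0"
  using "4.prems" r by (auto split: if_splits dest!: mult_not_zero)
 thus ?case
 proof cases
  case 1
  hence "Fd Q 1 (r - 1) l xs ys \<noteq> 0" using "4.prems" by (auto dest!: mult_not_zero)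
  thus ?thesis using "4.IH"[of "r - 1" l d] 4 1 by (auto simp: sim_def)
 next
  case 2
  thus ?thesis using "4.IH"[of "r - 1" "l - 1" "d + 2"] 4 by (auto simp: sim_def low1 s2_simps)
 qed
qed auto

text \<open>The defining recursion reads words from the left, whereas straightening works from the
  right end. When the last letter is lowered, the letters before it contribute a power of K.\<close>

lemma Fd_snoc: assumes Q: "Q dvd (1::'a::comm_ring_1)"
 shows "length xs = length ys ==> length ys < r ==> Fd Q 1 r l (xs @ [x]) (ys @ [y]) =
  (if x = y then Fd Q 1 r l xs ys else if 0 < l \<and> low 1 True y x then qpow Q (ht ys - int (l - 1)) * Fd Q 1 r (l - 1) xs ys else 0)"
proof (induction xs ys arbitrary: r l rule: list_induct2)
 case Nil
 thus ?case by (auto simp: lc_def qpow_def)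
next
 case (Cons u us v vs)
 have IH: "Fd Q 1 (r - 1) l (us @ [x]) (vs @ [y]) =
  (if x = y then Fd Q 1 (r - 1) l us vs else if 0 < l \<and> low 1 True y x then qpow Q (ht vs - int (l - 1)) * Fd Q 1 (r - 1) (l - 1) us vs else 0)" for l
  by (rule Cons.IH) (use Cons.prems in auto)
 have r: "0 < r" using Cons.prems by simp
 show ?case
 proof (cases "u = v")
  case True
  have "qpow Q (int l * s2 v) * (qpow Q (ht vs - int (l - 1)) * X) = qpow Q (s2 v + ht vs - int (l - 1)) * (qpow Q (int (l - 1) * s2 v) * X)" if "0 < l" for X
   using that by (simp add: mult.assoc[symmetric] qpow_add[OF Q, symmetric]) (simp add: of_nat_diff algebra_simps)
  thus ?thesis using True r IH[of l] by (simp add: s2_def[symmetric] del: One_nat_def)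
 next
  case False
  show ?thesis
  proof (cases "0 < l \<and> low 1 True v u")
   case T: True
   hence s: "s2 v = 1" by (auto simp: low1 s2_simps)
   have "qpow Q (ht vs - int (l - 1 - 1)) = qpow Q (s2 v + ht vs - int (l - 1))" if "0 < l - 1"
    by (rule arg_cong[of _ _ "qpow Q"]) (use s that in \<open>simp add: of_nat_diff\<close>)
   moreover have "l - 1 = 0 ==> x \<noteq> y ==> low 1 True y x ==> us = us" by simp
   ultimately show ?thesis using False r IH[of "l - 1"] T by (simp add: lc_def del: One_nat_def of_nat_diff)
  next
   case F: False
   thus ?thesis using False r by auto
  qed
 qed
qed

text \<open>P is a linear functional given by its values on words; it is required to annihilate
  f^(c) y for c \<ge> 1 and for all words y above z0 whose image has the weight of z0. Limiting y to
  words above z0 is what lets the condition be inherited in the induction.\<close>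

definition Rel :: "'a::comm_ring_1 => (nat list => 'a) => nat list => bool" where
 "Rel Q P z0 \<longleftrightarrow> (\<forall>c y. 1 \<le> c --> bas 4 (length z0) y --> le4 0 z0 y --> ht y = ht z0 + 2 * int c -->
   (\<Sum>x\<in>bset 4 (length z0). P x * Fd Q 1 (length z0) c x y) = 0)"

lemma Fd_r: "length y \<le> r ==> length y \<le> r' ==> Fd Q i r l x y = Fd Q i r' l x y"
proof (induction x y arbitrary: r r' l rule: list_induct2')
 case (4 x xs y ys)
 have "Fd Q i (r - 1) l xs ys = Fd Q i (r' - 1) l xs ys" for l by (rule "4.IH") (use "4.prems" in auto)
 moreover have "(0 < r) = (0 < r')" using "4.prems" by auto
 ultimately show ?case by (simp only: Fd.simps)
qed auto

lemma Rel_up: "Rel Q P z0 ==> le4 0 z0 y ==> ht y = ht z0 ==> Rel Q P y"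
 unfolding Rel_def using le4_trans[of 0 z0 y 0] le4_length[of 0 z0 y] by auto

lemma bset_snoc: "(\<Sum>x\<in>bset n (Suc m). f x) = (\<Sum>x\<in>bset n m. \<Sum>a\<in>{1..n}. f (x @ [a]))"
proof -
 have "(\<Sum>x\<in>bset n m. \<Sum>a\<in>{1..n}. f (x @ [a])) = (\<Sum>(x, a)\<in>bset n m \<times> {1..n}. f (x @ [a]))" by (simp add: sum.cartesian_product)
 also have "... = (\<Sum>x\<in>bset n (Suc m). f x)"
  by (rule sum.reindex_bij_witness[of _ "\<lambda>x. (butlast x, last x)" "\<lambda>(x, a). x @ [a]"])
   (auto simp: bas_def in_set_butlastD dest!: length_Suc_conv_rev[THEN iffD1])
 finally show ?thesis by simp
qed

lemma bas_snoc: "bas n (Suc m) (x @ [a]) \<longleftrightarrow> bas n m x \<and> a \<in> {1..n}" by (auto simp: bas_def)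

definition FZ :: "'a::comm_ring_1 => nat => int => nat list => nat list => 'a" where
 "FZ Q r k x y = (if k < 0 then 0 else Fd Q 1 r (nat k) x y)"

definition EZ :: "'a::comm_ring_1 => nat => int => nat list => nat list => 'a" where
 "EZ Q r k x y = qpow Q (- (k * (ht x - k))) * FZ Q r k y x"

text \<open>The operator f^(c+d) e^(c). Integer indices, with negative divided powers read as zero,
  keep the recursion in the last letter free of case distinctions.\<close>

definition FE :: "'a::comm_ring_1 => nat => nat => int => int => nat list => nat list => 'a" where
 "FE Q r m c d x y = (\<Sum>z\<in>bset 4 m. FZ Q r (c + d) x z * EZ Q r c z y)"

lemma FZ_ht: "FZ Q r k x y \<noteq> 0 ==> length y \<le> r ==> ht y = ht x + 2 * k"
 using Fd_wt[of Q 1 r "nat k" x y] Fd_length[of Q 1 r "nat k" x y] wt_ht[of x r] wt_ht[of y r] by (auto simp: FZ_def split: if_splits)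

lemma EZ_ht: "EZ Q r k x y \<noteq> 0 ==> length x \<le> r ==> ht x = ht y + 2 * k"
 unfolding EZ_def by (auto dest!: mult_not_zero FZ_ht)

context
 fixes Q :: "'a::comm_ring_1" and r :: nat
 assumes Q: "Q dvd 1"
begin

lemma FZ_snoc: "length xs = length ys ==> length ys < r ==> FZ Q r k (xs @ [x]) (ys @ [y]) =
  (if x = y then FZ Q r k xs ys else if low 1 True y x then qpow Q (ht ys - (k - 1)) * FZ Q r (k - 1) xs ys else 0)"
 by (auto simp: FZ_def Fd_snoc[OF Q, unfolded One_nat_def] nat_diff_distrib' of_nat_diff)

lemma EZ_snoc: assumes "length xs = length ys" "length ys < r"
 shows "EZ Q r k (xs @ [x]) (ys @ [y]) =
  (if x = y then qpow Q (- (k * s2 y)) * EZ Q r k xs ys else if low 1 True x y then EZ Q r (k - 1) xs ys else 0)"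
proof -
 have "qpow Q (- (k * (ht xs + 1 - k))) * (qpow Q (ht xs - (k - 1)) * X) = qpow Q (- ((k - 1) * (ht xs - (k - 1)))) * X" for X
  by (simp add: mult.assoc[symmetric] qpow_add[OF Q, symmetric]) (simp add: algebra_simps)
 moreover have "qpow Q (- (k * (ht xs + s2 x - k))) * X = qpow Q (- (k * s2 x)) * (qpow Q (- (k * (ht xs - k))) * X)" for X
  by (simp add: mult.assoc[symmetric] qpow_add[OF Q, symmetric]) (simp add: algebra_simps)
 ultimately show ?thesis using assms by (auto simp: EZ_def FZ_snoc low1 s2_simps)
qed

lemma FE_snoc: assumes xy: "bas 4 m x" "bas 4 m y" and m: "m < r" and ab: "a \<in> {1..4}" "b \<in> {1..4}"
 shows "FE Q r (Suc m) c d (x @ [a]) (y @ [b]) =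
 (if a = b then qpow Q (- (c * s2 a)) * FE Q r m c d x y else 0)
 + (if a = 1 \<and> b = 2 then FE Q r m (c - 1) (d + 1) x y else 0)
 + (if a = 2 \<and> b = 1 then qpow Q (ht y + 1 - d) * FE Q r m c (d - 1) x y else 0)
 + (if a = 2 \<and> b = 2 then qpow Q (ht y + c - d - 1) * FE Q r m (c - 1) d x y else 0)"
proof -
 have "(\<Sum>e\<in>{1..4}. FZ Q r (c + d) (x @ [a]) (z @ [e]) * EZ Q r c (z @ [e]) (y @ [b])) =
 (if a = b then qpow Q (- (c * s2 a)) * (FZ Q r (c + d) x z * EZ Q r c z y) else 0)
 + (if a = 1 \<and> b = 2 then FZ Q r (c - 1 + (d + 1)) x z * EZ Q r (c - 1) z y else 0)
 + (if a = 2 \<and> b = 1 then qpow Q (ht y + 1 - d) * (FZ Q r (c + (d - 1)) x z * EZ Q r c z y) else 0)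
 + (if a = 2 \<and> b = 2 then qpow Q (ht y + c - d - 1) * (FZ Q r (c - 1 + d) x z * EZ Q r (c - 1) z y) else 0)"
  if z: "bas 4 m z" for z
 proof -
  have L: "length x = m" "length y = m" "length z = m" using xy z by (auto simp: bas_length)
  have S: "{1..4::nat} = {1, 2, 3, 4}" by auto
  have F: "FZ Q r (c + d) (x @ [a]) (z @ [e]) =
   (if a = e then FZ Q r (c + d) x z else if e = 1 \<and> a = 2 then qpow Q (ht z - (c + d - 1)) * FZ Q r (c + d - 1) x z else 0)" for e
   using L m by (simp add: FZ_snoc low1)
  have E: "EZ Q r c (z @ [e]) (y @ [b]) =
   (if e = b then qpow Q (- (c * s2 b)) * EZ Q r c z y else if e = 1 \<and> b = 2 then EZ Q r (c - 1) z y else 0)" for e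
   using L m by (simp add: EZ_snoc low1)
  have A: "c - 1 + (d + 1) = c + d" "c + (d - 1) = c + d - 1" "c - 1 + d = c + d - 1" by simp_all
  have ab': "a = 1 \<or> a = 2 \<or> a = 3 \<or> a = 4" "b = 1 \<or> b = 2 \<or> b = 3 \<or> b = 4" using ab by auto
  have 1: "qpow Q (ht z - (c + d - 1)) * X * (qpow Q (- c) * EZ Q r c z y) = qpow Q (ht y + 1 - d) * (X * EZ Q r c z y)" for X
  proof (cases "EZ Q r c z y = 0")
   case False
   hence h: "ht z = ht y + 2 * c" using EZ_ht L m by (metis less_imp_le)
   have e: "ht y + 1 - d = (ht z - (c + d - 1)) + (- c)" by (simp add: h)
   show ?thesis unfolding e qpow_add[OF Q] by (simp add: mult_ac)
  qed simp
  have 2: "qpow Q (ht z - (c + d - 1)) * X * EZ Q r (c - 1) z y = qpow Q (ht y + c - d - 1) * (X * EZ Q r (c - 1) z y)" for X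
  proof (cases "EZ Q r (c - 1) z y = 0")
   case False
   hence h: "ht z = ht y + 2 * (c - 1)" using EZ_ht L m by (metis less_imp_le)
   have e: "ht z - (c + d - 1) = ht y + c - d - 1" by (simp add: h)
   show ?thesis unfolding e by (simp only: mult_ac)
  qed simp
  show ?thesis unfolding S F E A using ab' by (elim disjE; simp add: s2_simps 1 2; simp add: mult_ac)
 qed
 thus ?thesis unfolding FE_def bset_snoc by (cases "a = 2 \<and> b = 2"; auto simp: sum.distrib sum_distrib_left cong: sum.cong_simp)
qed

lemma sum_shift: assumes "f 0 = 0" "f (Suc N) = (0::'a)" shows "(\<Sum>c\<le>N. f c) = (\<Sum>c\<le>N. f (Suc c))"
 using sum.atMost_Suc[of f N] sum.atMost_Suc_shift[of f N] assms by simp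

lemma FE_0: assumes "m < c" shows "FE Q r m (int c) d x y = 0"
proof -
 have "EZ Q r (int c) z y = 0" if "bas 4 m z" for z
  using Fd_length[of Q 1 r c y z] assms bas_length[OF that] by (cases "Fd Q 1 r c y z = 0") (auto simp: EZ_def FZ_def)
 thus ?thesis by (simp add: FE_def)
qed

text \<open>For d = 0, weight -1 and u = 0 it says that the alternating sum of f^(c) e^(c) vanishes,
  which is the instance applied below. The parameters d and u make the induction close: removing a
  last letter 1 or 2 shifts d, u or the weight by one.\<close>

lemma alternating_FE: "bas 4 m x ==> bas 4 m y ==> m \<le> r ==> m \<le> N ==> 0 \<le> u ==> u < d - ht y ==>
 (\<Sum>c\<le>N. (-1) ^ c * (qpow Q ((d - ht y - 1 - 2 * u) * int c) * FE Q r m (int c) d x y)) = 0"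
proof (induction m arbitrary: x y d u)
 case 0
 thus ?case by (intro sum.neutral) (auto simp: FE_def FZ_def)
next
 case (Suc m)
 let ?T = "\<lambda>d t x y. \<Sum>c\<le>N. (-1) ^ c * (qpow Q (t * int c) * FE Q r m (int c) d x y)"
 let ?H = "\<lambda>c d. FE Q r m (int c) d"
 obtain x1 a y1 b where xy: "x = x1 @ [a]" "y = y1 @ [b]" using Suc.prems(1,2) bas_length by (metis length_Suc_conv_rev)
 have b: "bas 4 m x1" "bas 4 m y1" "a \<in> {1..4}" "b \<in> {1..4}" using Suc.prems(1,2) by (auto simp: xy bas_snoc)
 define t where "t = d - ht y - 1 - 2 * u"
 have IH: "?T d' t' x1 y1 = 0" if "0 \<le> u'" "u' < d' - ht y1" "t' = d' - ht y1 - 1 - 2 * u'" for d' t' u'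
  using Suc.IH[of x1 y1 u' d'] b that Suc.prems by simp
 have mr: "m < r" using Suc.prems by simp
 note S = FE_snoc[OF b(1,2) mr b(3,4)]
 have sh: "(\<Sum>c\<le>N. (-1) ^ c * (qpow Q (s * int c + e) * FE Q r m (int c - 1) d' x1 y1)) = - (qpow Q (s + e) * ?T d' s x1 y1)" for d' s e
 proof -
  have "FE Q r m (- 1) d' x1 y1 = 0" "FE Q r m (int N) d' x1 y1 = 0"
   using FE_0[of m N] Suc.prems by (auto simp: FE_def EZ_def FZ_def)
  hence "(\<Sum>c\<le>N. (-1) ^ c * (qpow Q (s * int c + e) * FE Q r m (int c - 1) d' x1 y1))
   = (\<Sum>c\<le>N. (-1) ^ Suc c * (qpow Q (s * int (Suc c) + e) * FE Q r m (int (Suc c) - 1) d' x1 y1))"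
   by (intro sum_shift) auto
  also have "... = - (qpow Q (s + e) * ?T d' s x1 y1)"
   by (simp add: sum_distrib_left sum_negf[symmetric] qpow_add[OF Q] algebra_simps)
  finally show ?thesis .
 qed
 have "?case \<longleftrightarrow> (\<Sum>c\<le>N. (-1) ^ c * (qpow Q (t * int c) * FE Q r (Suc m) (int c) d (x1 @ [a]) (y1 @ [b]))) = 0"
  by (simp add: xy t_def)
 moreover have "..."
 proof -
  consider "a = 1" "b = 2" | "a = 2" "b = 1" | "a = 2" "b = 2" | "a = 1" "b = 1" | "a = b" "a \<in> {3, 4}" | "a \<noteq> b" "\<not> {a, b} \<subseteq> {1, 2}"
   using b(3,4) by fastforce
  thus ?thesis
  proof cases
   case 1
   thus ?thesis using sh[of t 0 "d + 1"] IH[of u "d + 1" t] Suc.prems unfolding S by (simp add: t_def xy s2_simps)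
  next
   case 2
   have "(\<Sum>c\<le>N. (-1) ^ c * (qpow Q (t * int c) * FE Q r (Suc m) (int c) d (x1 @ [a]) (y1 @ [b])))
    = qpow Q (ht y1 + 1 - d) * ?T (d - 1) t x1 y1"
    using 2 unfolding S by (simp add: sum_distrib_left mult_ac)
   thus ?thesis using 2 IH[of u "d - 1" t] Suc.prems by (simp add: t_def xy s2_simps)
  next
   case 3
   have "(\<Sum>c\<le>N. (-1) ^ c * (qpow Q (t * int c) * FE Q r (Suc m) (int c) d (x1 @ [a]) (y1 @ [b])))
    = ?T d (t + 1) x1 y1 + (\<Sum>c\<le>N. (-1) ^ c * (qpow Q ((t + 1) * int c + (ht y1 - d - 1)) * FE Q r m (int c - 1) d x1 y1))"
    unfolding S sum.distrib[symmetric]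
   proof (intro sum.cong refl)
    fix c
    have E: "qpow Q ((t + 1) * int c) = qpow Q (t * int c) * qpow Q (int c)"
     "qpow Q ((t + 1) * int c + (ht y1 - d - 1)) = qpow Q (t * int c) * qpow Q (ht y1 + int c - d - 1)"
     by (simp_all add: qpow_add[OF Q, symmetric] algebra_simps)
    show "(-1) ^ c * (qpow Q (t * int c) * ((if a = b then qpow Q (- (int c * s2 a)) * FE Q r m (int c) d x1 y1 else 0)
     + (if a = 1 \<and> b = 2 then FE Q r m (int c - 1) (d + 1) x1 y1 else 0)
     + (if a = 2 \<and> b = 1 then qpow Q (ht y1 + 1 - d) * FE Q r m (int c) (d - 1) x1 y1 else 0)
     + (if a = 2 \<and> b = 2 then qpow Q (ht y1 + int c - d - 1) * FE Q r m (int c - 1) d x1 y1 else 0)))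
     = (-1) ^ c * (qpow Q ((t + 1) * int c) * FE Q r m (int c) d x1 y1)
      + (-1) ^ c * (qpow Q ((t + 1) * int c + (ht y1 - d - 1)) * FE Q r m (int c - 1) d x1 y1)"
     unfolding E using 3 by (simp add: s2_simps distrib_left mult_ac)
   qed
   also have "... = (1 - qpow Q (t + ht y1 - d)) * ?T d (t + 1) x1 y1"
    unfolding sh by (simp add: algebra_simps)
   \<comment> \<open>For u = 0, where the induction hypothesis has no u - 1 to offer, the scalar
     factor is 1 - Q^0.\<close>
   also have "... = 0"
   proof (cases "u = 0")
    case True
    hence "t + ht y1 - d = 0" using 3 by (simp add: t_def xy s2_simps)
    thus ?thesis by simp
   next
    case False
    thus ?thesis using IH[of "u - 1" d "t + 1"] 3 Suc.prems by (simp add: t_def xy s2_simps)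
   qed
   finally show ?thesis .
  next
   case 4
   have "qpow Q (t * int c) * (qpow Q (- int c) * X) = qpow Q ((t - 1) * int c) * X" for c X
    by (simp add: mult.assoc[symmetric] qpow_add[OF Q, symmetric] left_diff_distrib)
   thus ?thesis using 4 IH[of "u + 1" d "t - 1"] Suc.prems unfolding S by (simp add: t_def xy s2_simps)
  next
   case 5
   thus ?thesis using IH[of u d t] Suc.prems unfolding S by (auto simp: t_def xy s2_simps)
  next
   case 6
   thus ?thesis unfolding S by (intro sum.neutral) auto
  qed
 qed
 ultimately show ?case by blast
qed

end

text \<open>In weight -1 the alternating sum of f^(c) e^(c) is zero and its term for c = 0 is the
  identity. Hence every word is a combination of images of f^(c) with c \<ge> 1, and P annihilates
  those.\<close>

lemma weight_m1: assumes Q: "Q dvd (1::'a::comm_ring_1)" and R: "Rel Q P z0" and y: "bas 4 (length z0) y" "le4 0 z0 y" "ht z0 = -1" "ht y = -1"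
 shows "P y = 0"
proof -
 define m where "m = length z0"
 let ?S = "\<lambda>c. \<Sum>x\<in>bset 4 m. P x * FE Q m m (int c) 0 x y"
 have I: "(\<Sum>c\<le>m. (-1) ^ c * FE Q m m (int c) 0 x y) = 0" if "bas 4 m x" for x
  using alternating_FE[OF Q that, of y m m 0 0] y by (simp add: m_def[symmetric])
 have S: "?S c = (\<Sum>z\<in>bset 4 m. (\<Sum>x\<in>bset 4 m. P x * Fd Q 1 m c x z) * EZ Q m (int c) z y)" for c
  unfolding FE_def sum_distrib_left sum_distrib_right by (subst sum.swap) (simp add: FZ_def mult_ac)
 have 0: "?S c = 0" if c: "c \<noteq> 0" for c
 proof (unfold S, rule sum.neutral, rule ballI)
  fix z assume z: "z \<in> bset 4 m"
  show "(\<Sum>x\<in>bset 4 m. P x * Fd Q 1 m c x z) * EZ Q m (int c) z y = 0"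
  proof (cases "EZ Q m (int c) z y = 0")
   case False
   hence F: "Fd Q 1 m c y z \<noteq> 0" unfolding EZ_def FZ_def by (auto dest!: mult_not_zero)
   have "le4 0 y z" using Fd_le4[OF F, of 0] z by (simp add: bas_length)
   hence "le4 0 z0 z" using le4_trans[OF y(2), of 0 z] by simp
   moreover have "ht z = ht z0 + 2 * int c" using EZ_ht[OF False] z y by (simp add: bas_length)
   ultimately show ?thesis using R z c unfolding Rel_def m_def by auto
  qed simp
 qed
 have "?S 0 = (\<Sum>c\<le>m. (-1) ^ c * ?S c)" by (subst sum_single[of _ 0]) (use 0 in auto)
 also have "... = (\<Sum>x\<in>bset 4 m. P x * (\<Sum>c\<le>m. (-1) ^ c * FE Q m m (int c) 0 x y))"
  unfolding sum_distrib_left by (subst sum.swap) (simp add: mult_ac)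
 also have "... = 0" using I by simp
 finally have "?S 0 = 0" .
 moreover have "FE Q m m 0 0 x y = (if x = y then 1 else 0)" if "bas 4 m x" for x
  unfolding FE_def by (subst sum_single[of _ y]) (use y that in \<open>auto simp: FZ_def EZ_def Fd_0 bas_length m_def\<close>)
 ultimately show ?thesis using y sum_single[of "bset 4 m" y "\<lambda>x. P x * FE Q m m 0 0 x y"] by (auto simp: m_def)
qed

lemma Fd_sum_snoc: assumes Q: "Q dvd (1::'a::comm_ring_1)" and y: "bas 4 m y" and b: "b \<in> {1..4}"
 shows "(\<Sum>x\<in>bset 4 (Suc m). P x * Fd Q 1 (Suc m) c x (y @ [b])) = (\<Sum>x\<in>bset 4 m. P (x @ [b]) * Fd Q 1 m c x y)
  + (if 0 < c \<and> b = 1 then qpow Q (ht y - int (c - 1)) * (\<Sum>x\<in>bset 4 m. P (x @ [2]) * Fd Q 1 m (c - 1) x y) else 0)"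
proof -
 have "(\<Sum>a\<in>{1..4}. P (x @ [a]) * Fd Q 1 (Suc m) c (x @ [a]) (y @ [b])) = P (x @ [b]) * Fd Q 1 m c x y
   + (if 0 < c \<and> b = 1 then qpow Q (ht y - int (c - 1)) * (P (x @ [2]) * Fd Q 1 m (c - 1) x y) else 0)" if x: "bas 4 m x" for x
 proof -
  have S: "Fd Q 1 (Suc m) c (x @ [a]) (y @ [b]) =
  (if a = b then Fd Q 1 m c x y else if 0 < c \<and> low 1 True b a then qpow Q (ht y - int (c - 1)) * Fd Q 1 m (c - 1) x y else 0)" for a
   using Fd_snoc[OF Q, of x y "Suc m" c a b] x y Fd_r[of y "Suc m" m Q 1] by (simp add: bas_length del: One_nat_def)
  have "(\<Sum>a\<in>{1..4}. P (x @ [a]) * Fd Q 1 (Suc m) c (x @ [a]) (y @ [b]))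
   = (\<Sum>a\<in>{1..4}. (if a = b then P (x @ [b]) * Fd Q 1 m c x y else 0) + (if a = 2 then (if 0 < c \<and> b = 1 then qpow Q (ht y - int (c - 1)) * (P (x @ [2]) * Fd Q 1 m (c - 1) x y) else 0) else 0))"
   unfolding S by (intro sum.cong refl) (auto simp: low1 mult_ac)
  thus ?thesis using b by (simp add: sum.distrib sum.delta)
 qed
 thus ?thesis unfolding bset_snoc by (simp add: sum.distrib sum_distrib_left if_distrib cong: if_cong)
qed

text \<open>Induction from the right end. Dropping the last letter preserves the relations, but for
  a last letter 1 the vanishing at certain words ending in 2 is needed beforehand. A ballot word
  fails to stay ballot only when a 2 is added at height 0; the result has weight -1 and is covered
  by \<open>weight_m1\<close>.\<close>

theorem straightening: assumes Q: "Q dvd (1::'a::comm_ring_1)"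
 shows "bas 4 m z0 ==> Rel Q P z0 ==> (\<And>b. bas 4 m b ==> le4 0 z0 b ==> ht b = ht z0 ==> ballot 0 b ==> P b = 0) ==> P z0 = 0"
proof (induction m arbitrary: z0 P)
 case 0
 thus ?case by simp
next
 case (Suc m)
 have restr: "Rel Q (\<lambda>x. P (x @ [a])) x1" if x1: "bas 4 m x1" and a: "a \<in> {1..4}" and R: "Rel Q P (x1 @ [a])"
  and one: "a = 1 ==> (\<And>x. bas 4 m x ==> le4 0 x1 x ==> ht x = ht x1 + 2 ==> P (x @ [2]) = 0)" for x1 a
  unfolding Rel_def
 proof (intro allI impI)
  fix c y assume c: "1 \<le> c" and y: "bas 4 (length x1) y" "le4 0 x1 y" "ht y = ht x1 + 2 * int c"
  have l: "length x1 = m" using x1 by (rule bas_length)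
  have R': "(\<Sum>x\<in>bset 4 (Suc m). P x * Fd Q 1 (Suc m) c x z) = 0" if "1 \<le> c" "bas 4 (Suc m) z" "le4 0 (x1 @ [a]) z" "ht z = ht (x1 @ [a]) + 2 * int c" for c z
   using R that l unfolding Rel_def by simp
  have 1: "(\<Sum>x\<in>bset 4 (Suc m). P x * Fd Q 1 (Suc m) c x (y @ [a])) = 0"
   by (rule R') (use c y a l in \<open>auto simp: bas_snoc le4_snoc sim_def\<close>)
  \<comment> \<open>Splitting off a last letter 1 produces words ending in 2. For c = 1 these are
    handled by the assumption \<open>one\<close>, for c > 1 by the relation with c - 1.\<close>
  have 2: "(\<Sum>x\<in>bset 4 m. P (x @ [2]) * Fd Q 1 m (c - 1) x y) = 0" if a1: "a = 1"
  proof (cases "c = 1")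
   case True
   have "(\<Sum>x\<in>bset 4 m. P (x @ [2]) * Fd Q 1 m 0 x y) = P (y @ [2])"
    by (subst sum_single[of _ y]) (use y l in \<open>auto simp: Fd_0 bas_length\<close>)
   thus ?thesis using one[OF a1, of y] True y l by simp
  next
   case False
   have "(\<Sum>x\<in>bset 4 (Suc m). P x * Fd Q 1 (Suc m) (c - 1) x (y @ [2])) = 0"
    by (rule R') (use c y a l False a1 in \<open>auto simp: bas_snoc le4_snoc sim_def s2_simps of_nat_diff\<close>)
   thus ?thesis using Fd_sum_snoc[OF Q, of m y 2 P "c - 1"] y l by simp
  qed
  show "(\<Sum>x\<in>bset 4 (length x1). P (x @ [a]) * Fd Q 1 (length x1) c x y) = 0"
   using 1 2 Fd_sum_snoc[OF Q, of m y a P c] y l a by (simp split: if_splits)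
 qed
 have minus: "P (x1 @ [2]) = 0" if x1: "bas 4 m x1" and R: "Rel Q P (x1 @ [2])"
  and B: "\<And>b. bas 4 (Suc m) b ==> le4 0 (x1 @ [2]) b ==> ht b = ht (x1 @ [2]) ==> ballot 0 b ==> P b = 0" for x1
 proof (rule Suc.IH[OF x1, of "\<lambda>x. P (x @ [2])"])
  show "Rel Q (\<lambda>x. P (x @ [2])) x1" by (rule restr[OF x1 _ R]) auto
  fix b assume b: "bas 4 m b" "le4 0 x1 b" "ht b = ht x1" "ballot 0 b"
  have L: "le4 0 (x1 @ [2]) (b @ [2])" "bas 4 (Suc m) (b @ [2])" using b by (auto simp: le4_snoc sim_def bas_snoc)
  show "P (b @ [2]) = 0"
  proof (cases "ht b = 0")
   case True
   have l: "length x1 = m" using x1 by (rule bas_length)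
   show ?thesis by (rule weight_m1[OF Q R]) (use L b True l in \<open>auto simp: s2_simps\<close>)
  next
   case False
   hence "0 < ht b" using ballot_ht[OF b(4)] by simp
   thus ?thesis using B[of "b @ [2]"] L b by (auto simp: ballot_snoc s2_simps)
  qed
 qed
 obtain x1 a where z0: "z0 = x1 @ [a]" using Suc.prems(1) bas_length by (metis length_Suc_conv_rev)
 have x1: "bas 4 m x1" and a: "a \<in> {1..4}" using Suc.prems(1) by (auto simp: z0 bas_snoc)
 show ?case
 proof (cases "a = 2")
  case True
  thus ?thesis using minus[OF x1] Suc.prems z0 by auto
 next
  case False
  show ?thesis unfolding z0
  proof (rule Suc.IH[OF x1, of "\<lambda>x. P (x @ [a])"])
   show "Rel Q (\<lambda>x. P (x @ [a])) x1"
   proof (rule restr[OF x1 a])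
    show "Rel Q P (x1 @ [a])" using Suc.prems z0 by simp
    fix x assume a1: "a = 1" and x: "bas 4 m x" "le4 0 x1 x" "ht x = ht x1 + 2"
    have L: "le4 0 z0 (x @ [2])" "ht (x @ [2]) = ht z0" using x a1 by (auto simp: z0 le4_snoc sim_def s2_simps)
    show "P (x @ [2]) = 0"
    proof (rule minus[OF x(1)])
     show "Rel Q P (x @ [2])" by (rule Rel_up[OF Suc.prems(2) L])
     fix b assume b: "bas 4 (Suc m) b" "le4 0 (x @ [2]) b" "ht b = ht (x @ [2])" "ballot 0 b"
     show "P b = 0" by (rule Suc.prems(3)) (use b L le4_trans[OF L(1) b(2)] in auto)
    qed
   qed
   fix b assume b: "bas 4 m b" "le4 0 x1 b" "ht b = ht x1" "ballot 0 b"
   show "P (b @ [a]) = 0"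
   proof (rule Suc.prems(3))
    have "a = 1 \<or> a = 3 \<or> a = 4" using a False by auto
    hence "0 \<le> s2 a" by (auto simp: s2_simps)
    thus "ballot 0 (b @ [a])" using b ballot_ht[OF b(4)] by (simp add: ballot_snoc)
   qed (use b a in \<open>auto simp: z0 bas_snoc le4_snoc sim_def\<close>)
  qed
 qed
qed

section \<open>Pairs of subsets as words in four letters\<close>

definition lett :: "nat set => nat set => nat => nat" where
 "lett A B x = (if x \<in> A then if x \<in> B then 3 else 2 else if x \<in> B then 1 else 4)"
definition enc :: "nat set => nat set => nat => nat list" where
 "enc A B n = map (lett A B) [1..<Suc n]"

lemma enc_0 [simp]: "enc A B 0 = []" by (simp add: enc_def)
lemma enc_Suc: "enc A B (Suc n) = enc A B n @ [lett A B (Suc n)]" by (simp add: enc_def)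
lemma enc_bas: "bas 4 n (enc A B n)" by (auto simp: enc_def bas_def lett_def)
lemma enc_length [simp]: "length (enc A B n) = n" by (simp add: enc_def)
lemma enc_cong: "A \<inter> {1..n} = A' \<inter> {1..n} ==> B \<inter> {1..n} = B' \<inter> {1..n} ==> enc A B n = enc A' B' n"
 unfolding enc_def
proof (rule map_cong[OF refl])
 fix x assume e: "A \<inter> {1..n} = A' \<inter> {1..n}" "B \<inter> {1..n} = B' \<inter> {1..n}" and "x \<in> set [1..<Suc n]"
 hence "x \<in> {1..n}" by auto
 hence "x \<in> A \<longleftrightarrow> x \<in> A'" "x \<in> B \<longleftrightarrow> x \<in> B'" using e by blast+
 thus "lett A B x = lett A' B' x" by (simp add: lett_def)
qed

definition dcA :: "nat list => nat set" where "dcA x = {j \<in> {1..length x}. x ! (j - 1) \<in> {2, 3}}"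
definition dcB :: "nat list => nat set" where "dcB x = {j \<in> {1..length x}. x ! (j - 1) \<in> {1, 3}}"

lemma enc_nth: "j < n ==> enc A B n ! j = lett A B (Suc j)" by (simp add: enc_def del: upt_Suc)

lemma dc_enc: "A \<subseteq> {1..n} ==> dcA (enc A B n) = A" "B \<subseteq> {1..n} ==> dcB (enc A B n) = B"
proof -
 have j: "j \<in> {1..n} ==> enc A B n ! (j - 1) = lett A B j" for j by (cases j) (auto simp: enc_nth)
 have a: "lett A B j \<in> {2, 3} \<longleftrightarrow> j \<in> A" "lett A B j \<in> {1, 3} \<longleftrightarrow> j \<in> B" for j by (simp_all add: lett_def)
 have "dcA (enc A B n) = {j \<in> {1..n}. lett A B j \<in> {2, 3}}" using j by (auto simp only: dcA_def enc_length)
 thus "A \<subseteq> {1..n} ==> dcA (enc A B n) = A" unfolding a by blast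
 have "dcB (enc A B n) = {j \<in> {1..n}. lett A B j \<in> {1, 3}}" using j by (auto simp only: dcB_def enc_length)
 thus "B \<subseteq> {1..n} ==> dcB (enc A B n) = B" unfolding a by blast
qed

lemma enc_dc: assumes "bas 4 n x" shows "enc (dcA x) (dcB x) n = x"
proof (rule nth_equalityI)
 have l: "length x = n" using assms by (rule bas_length)
 thus "length (enc (dcA x) (dcB x) n) = length x" by simp
 fix j assume "j < length (enc (dcA x) (dcB x) n)"
 hence j: "j < n" by simp
 have "x ! j \<in> {1..4}" using nth_bas[OF assms j] .
 hence "x ! j = 1 \<or> x ! j = 2 \<or> x ! j = 3 \<or> x ! j = 4" by auto
 thus "enc (dcA x) (dcB x) n ! j = x ! j" using j l by (auto simp: enc_nth lett_def dcA_def dcB_def)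
qed

lemma int_Suc: "A \<inter> {1..Suc n} = (if Suc n \<in> A then insert (Suc n) (A \<inter> {1..n}) else A \<inter> {1..n})"
 by (auto simp: le_Suc_eq)

lemma card_Suc: "card (A \<inter> {1..Suc n}) = card (A \<inter> {1..n}) + (if Suc n \<in> A then 1 else 0)"
 unfolding int_Suc by simp

text \<open>The column condition of a standard tableau with B the row above A, expressed by counting
  in prefixes instead of enumerating entries.\<close>

definition gle :: "nat => nat set => nat set => bool" where
 "gle n A B \<longleftrightarrow> (\<forall>x\<le>n. card (A \<inter> {1..x}) \<le> card (B \<inter> {1..x}))"

lemma s2_lett: "s2 (lett A B x) = (if x \<in> B then 1 else 0) - (if x \<in> A then 1 else 0)"
 by (simp add: lett_def s2_simps)

lemma ht_enc: "ht (enc A B n) = int (card (B \<inter> {1..n})) - int (card (A \<inter> {1..n}))"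
 by (induction n) (simp_all add: enc_Suc s2_lett card_Suc del: One_nat_def)

lemma ballot_enc: "ballot 0 (enc A B n) \<longleftrightarrow> gle n A B"
proof (induction n)
 case (Suc n)
 have "gle n A B \<and> card (A \<inter> {1..Suc n}) \<le> card (B \<inter> {1..Suc n}) \<longleftrightarrow> gle (Suc n) A B"
  unfolding gle_def by (metis le_Suc_eq)
 moreover have "0 \<le> ht (enc A B n) + s2 (lett A B (Suc n)) \<longleftrightarrow> card (A \<inter> {1..Suc n}) \<le> card (B \<inter> {1..Suc n})"
  unfolding ht_enc s2_lett card_Suc by auto
 ultimately show ?case using Suc by (simp add: enc_Suc ballot_snoc)
qed (simp add: gle_def)

lemma le4_enc: "le4 0 (enc A0 B0 n) (enc A B n) ==> x \<le> n ==>
 card (A \<inter> {1..x}) + card (B \<inter> {1..x}) = card (A0 \<inter> {1..x}) + card (B0 \<inter> {1..x}) \<and> card (B0 \<inter> {1..x}) \<le> card (B \<inter> {1..x})"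
proof (induction n arbitrary: x)
 case (Suc n)
 have L: "le4 0 (enc A0 B0 n) (enc A B n)" "sim (lett A0 B0 (Suc n)) (lett A B (Suc n))"
  "0 \<le> ht (enc A B (Suc n)) - ht (enc A0 B0 (Suc n))"
  using Suc.prems(1) by (auto simp: enc_Suc le4_snoc)
 show ?case
 proof (cases "x = Suc n")
  case True
  have "card (A \<inter> {1..n}) + card (B \<inter> {1..n}) = card (A0 \<inter> {1..n}) + card (B0 \<inter> {1..n})" using Suc.IH[OF L(1), of n] by simp
  moreover have "(if Suc n \<in> A then 1 else 0) + (if Suc n \<in> B then 1 else 0) = (if Suc n \<in> A0 then 1 else 0) + (if Suc n \<in> B0 then 1 else (0::nat))"
   using L(2) by (auto simp: sim_def lett_def split: if_splits)
  ultimately have "card (A \<inter> {1..Suc n}) + card (B \<inter> {1..Suc n}) = card (A0 \<inter> {1..Suc n}) + card (B0 \<inter> {1..Suc n})"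
   unfolding card_Suc by linarith
  thus ?thesis using L(3) unfolding True ht_enc by auto
 next
  case False
  thus ?thesis using Suc.IH[OF L(1), of x] Suc.prems by simp
 qed
qed simp

lemma Fd_enc: "Fd Q 1 n c x (enc A B n) \<noteq> 0 ==> Q dvd (1::'a::comm_ring_1) ==>
 \<exists>C. C \<subseteq> B - A \<and> C \<subseteq> {1..n} \<and> card C = c \<and> x = enc (A \<union> C) (B - C) n"
proof (induction n arbitrary: c x)
 case 0
 thus ?case by (cases x) (auto split: if_splits)
next
 case (Suc n)
 have "length x = Suc n" using Fd_length[OF Suc.prems(1)] by simp
 then obtain u a where x: "x = u @ [a]" "length u = n" by (metis length_Suc_conv_rev)
 let ?b = "lett A B (Suc n)"
 have S: "Fd Q 1 (Suc n) c x (enc A B (Suc n)) = (if a = ?b then Fd Q 1 n c u (enc A B n)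
   else if 0 < c \<and> low 1 True ?b a then qpow Q (ht (enc A B n) - int (c - 1)) * Fd Q 1 n (c - 1) u (enc A B n) else 0)"
  using Fd_snoc[OF Suc.prems(2), of u "enc A B n" "Suc n" c a ?b] x Fd_r[of "enc A B n" "Suc n" n Q 1]
  by (simp add: enc_Suc del: One_nat_def)
 consider "a = ?b" "Fd Q 1 n c u (enc A B n) \<noteq> 0" | "0 < c" "low 1 True ?b a" "Fd Q 1 n (c - 1) u (enc A B n) \<noteq> 0"
  using Suc.prems(1) unfolding S by (auto split: if_splits dest!: mult_not_zero)
 thus ?case
 proof cases
  case 1
  then obtain C where C: "C \<subseteq> B - A" "C \<subseteq> {1..n}" "card C = c" "u = enc (A \<union> C) (B - C) n" using Suc by blast
  moreover have "lett (A \<union> C) (B - C) (Suc n) = ?b" using C by (auto simp: lett_def)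
  ultimately show ?thesis using x 1 by (intro exI[of _ C]) (auto simp: enc_Suc)
 next
  case 2
  then obtain C where C: "C \<subseteq> B - A" "C \<subseteq> {1..n}" "card C = c - 1" "u = enc (A \<union> C) (B - C) n" using Suc by blast
  have b: "Suc n \<in> B - A" "a = 2" using 2(2) by (auto simp: low1 lett_def split: if_splits)
  have "card (insert (Suc n) C) = c" using C 2 finite_subset[OF C(2)] by (subst card_insert_disjoint) auto
  moreover have "enc (A \<union> insert (Suc n) C) (B - insert (Suc n) C) n = enc (A \<union> C) (B - C) n" by (rule enc_cong) auto
  moreover have "lett (A \<union> insert (Suc n) C) (B - insert (Suc n) C) (Suc n) = 2" by (simp add: lett_def)
  ultimately show ?thesis using x C b by (intro exI[of _ "insert (Suc n) C"]) (auto simp: enc_Suc)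
 qed
qed

lemma icr_top: assumes "A \<subseteq> {1..Suc n}" "C \<subseteq> {1..Suc n}"
 shows "icr True A C = icr True (A - {Suc n}) (C - {Suc n}) + (if Suc n \<in> A then card (C - {Suc n}) else 0)"
proof -
 have f: "finite A" "finite C" using assms finite_subset by auto
 have 1: "icr True X C = icr True X (C - {Suc n})" if "X \<subseteq> {1..Suc n}" for X
  unfolding icr_def by (rule arg_cong[where f = card]) (use that in \<open>auto simp: lt_def\<close>)
 show ?thesis
 proof (cases "Suc n \<in> A")
  case True
  hence "icr True A C = icr True (insert (Suc n) (A - {Suc n})) C" by (simp add: insert_absorb)
  also have "... = card {c \<in> C. lt True c (Suc n)} + icr True (A - {Suc n}) C" using f by (subst icr_insert) auto
  also have "{c \<in> C. lt True c (Suc n)} = C - {Suc n}" using assms by (auto simp: lt_def)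
  finally show ?thesis using 1[of "A - {Suc n}"] True assms by auto
 next
  case False
  thus ?thesis using 1[of A] assms by simp
 qed
qed

text \<open>Up to a power of Q depending only on card A and card C, the matrix entry is the
  inversion statistic produced by splitting and merging antisymmetric rows. This identifies the
  exchange relations with the action of U(gl_2).\<close>

lemma Fd_stat: assumes Q: "Q dvd (1::'a::comm_ring_1)"
 shows "A \<subseteq> {1..n} ==> B \<subseteq> {1..n} ==> C \<subseteq> B - A ==>
 Q ^ (card A * card C) * Fd Q 1 n (card C) (enc (A \<union> C) (B - C) n) (enc A B n) = Q ^ (icr True C (B - C) + icr True A C)"
proof (induction n arbitrary: A B C)
 case 0
 thus ?case by simp
next
 case (Suc n)
 define t A1 B1 C1 where "t = Suc n" and "A1 = A - {t}" and "B1 = B - {t}" and "C1 = C - {t}"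
 have CS: "C \<subseteq> {1..Suc n}" "B - C \<subseteq> {1..Suc n}" using Suc.prems by blast+
 have fin: "finite A" "finite B" "finite C" using Suc.prems CS finite_subset[OF _ finite_atLeastAtMost] by metis+
 have sub: "A1 \<subseteq> {1..n}" "B1 \<subseteq> {1..n}" "C1 \<subseteq> B1 - A1" using Suc.prems by (auto simp: A1_def B1_def C1_def t_def le_Suc_eq subset_iff)
 note IH = Suc.IH[OF sub]
 have e: "enc A B n = enc A1 B1 n" "enc (A \<union> C) (B - C) n = enc (A1 \<union> C1) (B1 - C1) n"
  by (rule enc_cong; auto simp: A1_def B1_def C1_def t_def)+
 have S: "Fd Q 1 (Suc n) c (enc (A \<union> C) (B - C) (Suc n)) (enc A B (Suc n)) = (if lett (A \<union> C) (B - C) t = lett A B t then Fd Q 1 n c (enc (A1 \<union> C1) (B1 - C1) n) (enc A1 B1 n)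
   else if 0 < c \<and> low 1 True (lett A B t) (lett (A \<union> C) (B - C) t) then qpow Q (ht (enc A1 B1 n) - int (c - 1)) * Fd Q 1 n (c - 1) (enc (A1 \<union> C1) (B1 - C1) n) (enc A1 B1 n) else 0)" for c
  using Fd_snoc[OF Q, of "enc (A \<union> C) (B - C) n" "enc A B n" "Suc n" c] Fd_r[of "enc A B n" "Suc n" n Q 1]
  by (simp add: enc_Suc e[symmetric] t_def del: One_nat_def)
 have i1: "icr True C (B - C) = icr True C1 (B1 - C1) + (if t \<in> C then card (B1 - C1) else 0)"
 proof -
  have "B - C - {t} = B1 - C1" by (auto simp: B1_def C1_def)
  thus ?thesis using icr_top[OF CS] by (simp add: C1_def t_def)
 qed
 have i2: "icr True A C = icr True A1 C1 + (if t \<in> A then card C1 else 0)"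
  using icr_top[OF Suc.prems(1) CS(1)] by (simp add: A1_def C1_def t_def)
 show ?case
 proof (cases "t \<in> C")
  case True
  hence tA: "t \<in> B" "t \<notin> A" "A1 = A" using Suc.prems by (auto simp: A1_def)
  have cC: "card C = Suc (card C1)" using True fin card_Suc_Diff1[of C t] by (simp add: C1_def)
  have l: "lett A B t = 1" "lett (A \<union> C) (B - C) t = 2" using tA True by (auto simp: lett_def)
  have "ht (enc A1 B1 n) = int (card B1) - int (card A1)" using sub by (simp add: ht_enc Int_absorb2 del: One_nat_def)
  moreover have "card B1 = card (B1 - C1) + card C1"
  proof -
   have "finite C1" "C1 \<subseteq> B1" "finite B1" using fin sub by (auto simp: C1_def B1_def)
   thus ?thesis using card_Diff_subset[of C1 B1] card_mono[of B1 C1] by simp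
  qed
  ultimately have h: "int (card A1) + (ht (enc A1 B1 n) - int (card C1)) = int (card (B1 - C1))" by simp
  have "Q ^ (card A * card C) * Fd Q 1 (Suc n) (card C) (enc (A \<union> C) (B - C) (Suc n)) (enc A B (Suc n))
   = Q ^ (card A1 * Suc (card C1)) * (qpow Q (ht (enc A1 B1 n) - int (card C1)) * Fd Q 1 n (card C1) (enc (A1 \<union> C1) (B1 - C1) n) (enc A1 B1 n))"
   unfolding S l cC tA by (simp add: low1)
  also have "... = (Q ^ card A1 * qpow Q (ht (enc A1 B1 n) - int (card C1))) * (Q ^ (card A1 * card C1) * Fd Q 1 n (card C1) (enc (A1 \<union> C1) (B1 - C1) n) (enc A1 B1 n))"
   by (simp add: power_add mult_ac)
  also have "Q ^ card A1 * qpow Q (ht (enc A1 B1 n) - int (card C1)) = Q ^ card (B1 - C1)"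
   unfolding qpow_of_nat[symmetric] qpow_add[OF Q, symmetric] h ..
  finally show ?thesis unfolding IH using True tA by (simp add: i1 i2 power_add mult_ac)
 next
  case False
  have l: "lett (A \<union> C) (B - C) t = lett A B t" using False by (simp add: lett_def)
  have C: "C1 = C" using False by (simp add: C1_def)
  have cA: "card A = card A1 + (if t \<in> A then 1 else 0)" using fin card_Suc_Diff1[of A t] by (auto simp: A1_def)
  have "Q ^ (card A * card C) * Fd Q 1 (Suc n) (card C) (enc (A \<union> C) (B - C) (Suc n)) (enc A B (Suc n))
   = Q ^ (if t \<in> A then card C1 else 0) * (Q ^ (card A1 * card C1) * Fd Q 1 n (card C1) (enc (A1 \<union> C1) (B1 - C1) n) (enc A1 B1 n))"
   unfolding S cA by (simp add: l C power_add algebra_simps)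
  thus ?thesis unfolding IH using False by (simp add: i1 i2 power_add mult_ac)
 qed
qed

text \<open>The straightening rule read on pairs of rows. The prefix conditions offered in
  \<open>bal\<close> come from \<open>le4\<close>: the total content is conserved and B only gains.
  They drive the choice of a potential later on.\<close>

theorem pair_straightening: fixes P :: "nat set => nat set => 'a::comm_ring_1"
 assumes Q: "Q dvd 1" and A0: "A0 \<subseteq> {1..n}" and B0: "B0 \<subseteq> {1..n}"
 and rel: "\<And>c A B. 1 \<le> c ==> A \<subseteq> {1..n} ==> B \<subseteq> {1..n} ==> card A + c = card A0 ==> card B = card B0 + c ==>
  (\<Sum>C\<in>{C. C \<subseteq> B - A \<and> card C = c}. Q ^ (icr True C (B - C) + icr True A C) * P (A \<union> C) (B - C)) = 0"
 and bal: "\<And>A B. A \<subseteq> {1..n} ==> B \<subseteq> {1..n} ==> card A = card A0 ==> card B = card B0 ==> gle n A B ==>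
  (\<And>x. x \<le> n ==> card (A \<inter> {1..x}) + card (B \<inter> {1..x}) = card (A0 \<inter> {1..x}) + card (B0 \<inter> {1..x}) \<and> card (B0 \<inter> {1..x}) \<le> card (B \<inter> {1..x})) ==> P A B = 0"
 shows "P A0 B0 = 0"
proof -
 define p where "p x = P (dcA x) (dcB x)" for x
 let ?z = "enc A0 B0 n"
 have dcs: "dcA y \<subseteq> {1..n}" "dcB y \<subseteq> {1..n}" if "bas 4 n y" for y using bas_length[OF that] by (auto simp: dcA_def dcB_def)
 have cards: "card (dcA y) + card (dcB y) = card A0 + card B0" "ht y = int (card (dcB y)) - int (card (dcA y))" if y: "bas 4 n y" "le4 0 ?z y" for y
 proof -
  have "le4 0 ?z (enc (dcA y) (dcB y) n)" using y enc_dc[OF y(1)] by simp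
  from le4_enc[OF this, of n] show "card (dcA y) + card (dcB y) = card A0 + card B0"
   using dcs[OF y(1)] A0 B0 by (simp add: Int_absorb2 del: One_nat_def)
  show "ht y = int (card (dcB y)) - int (card (dcA y))"
   using ht_enc[of "dcA y" "dcB y" n] enc_dc[OF y(1)] dcs[OF y(1)] by (simp add: Int_absorb2 del: One_nat_def)
 qed
 have h0: "ht ?z = int (card B0) - int (card A0)" using A0 B0 by (simp add: ht_enc Int_absorb2 del: One_nat_def)
 have "p ?z = 0"
 proof (rule straightening[OF Q enc_bas])
  show "Rel Q p ?z" unfolding Rel_def enc_length
  proof (intro allI impI)
   fix c y assume c: "1 \<le> c" and y: "bas 4 n y" "le4 0 ?z y" "ht y = ht ?z + 2 * int c"
   define A B where "A = dcA y" and "B = dcB y"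
   have AB: "A \<subseteq> {1..n}" "B \<subseteq> {1..n}" "y = enc A B n" using dcs[OF y(1)] enc_dc[OF y(1)] by (auto simp: A_def B_def)
   have cd: "card A + c = card A0" "card B = card B0 + c" using cards[OF y(1,2)] y(3) h0 unfolding A_def B_def by linarith+
   let ?S = "{C. C \<subseteq> B - A \<and> card C = c}" and ?g = "\<lambda>C. enc (A \<union> C) (B - C) n"
   have fB: "finite B" using AB finite_subset by auto
   have inj: "inj_on ?g ?S"
   proof (rule inj_onI)
    fix C D assume C: "C \<in> ?S" "D \<in> ?S" "?g C = ?g D"
    have "dcB (?g C) = B - C" "dcB (?g D) = B - D" using AB by (auto intro!: dc_enc(2))
    thus "C = D" using C by auto
   qed
   have "(\<Sum>x\<in>bset 4 n. p x * Fd Q 1 n c x y) = (\<Sum>x\<in>?g ` ?S. p x * Fd Q 1 n c x y)"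
   proof (rule sum.mono_neutral_right)
    show "?g ` ?S \<subseteq> bset 4 n" by (auto simp: enc_bas)
    show "\<forall>x\<in>bset 4 n - ?g ` ?S. p x * Fd Q 1 n c x y = 0"
    proof
     fix x assume x: "x \<in> bset 4 n - ?g ` ?S"
     show "p x * Fd Q 1 n c x y = 0"
     proof (rule ccontr)
      assume "p x * Fd Q 1 n c x y \<noteq> 0"
      hence "Fd Q 1 n c x (enc A B n) \<noteq> 0" using AB(3) by auto
      from Fd_enc[OF this Q] show False using x by auto
     qed
    qed
   qed simp
   also have "... = (\<Sum>C\<in>?S. P (A \<union> C) (B - C) * Fd Q 1 n c (?g C) (enc A B n))"
   proof (subst sum.reindex[OF inj], intro sum.cong refl)
    fix C assume C: "C \<in> ?S"
    have "dcA (?g C) = A \<union> C" "dcB (?g C) = B - C" using AB C by (auto intro!: dc_enc)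
    thus "((\<lambda>x. p x * Fd Q 1 n c x y) \<circ> ?g) C = P (A \<union> C) (B - C) * Fd Q 1 n c (?g C) (enc A B n)"
     using AB(3) by (simp add: p_def)
   qed
   finally have E: "(\<Sum>x\<in>bset 4 n. p x * Fd Q 1 n c x y) = (\<Sum>C\<in>?S. P (A \<union> C) (B - C) * Fd Q 1 n c (?g C) (enc A B n))" .
   have "Q ^ (card A * c) * (\<Sum>x\<in>bset 4 n. p x * Fd Q 1 n c x y) = (\<Sum>C\<in>?S. Q ^ (icr True C (B - C) + icr True A C) * P (A \<union> C) (B - C))"
    unfolding E sum_distrib_left
   proof (intro sum.cong refl)
    fix C assume "C \<in> ?S"
    hence C: "C \<subseteq> B - A" "card C = c" by auto
    show "Q ^ (card A * c) * (P (A \<union> C) (B - C) * Fd Q 1 n c (?g C) (enc A B n)) = Q ^ (icr True C (B - C) + icr True A C) * P (A \<union> C) (B - C)"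
     using Fd_stat[OF Q AB(1,2) C(1)] unfolding C(2) by (simp only: mult.assoc[symmetric] mult.commute[of _ "Fd Q 1 n c (?g C) (enc A B n)"])
   qed
   also have "... = 0" by (rule rel[OF c AB(1,2) cd])
   finally have "Q ^ (card A * c) * (\<Sum>x\<in>bset 4 n. p x * Fd Q 1 n c x y) = 0" .
   moreover have "qpow Q (- int (card A * c)) * Q ^ (card A * c) = 1"
    unfolding qpow_of_nat[symmetric] qpow_add[OF Q, symmetric] by (simp add: qpow_def)
   ultimately show "(\<Sum>x\<in>bset 4 n. p x * Fd Q 1 n c x y) = 0"
    using mult.assoc[of "qpow Q (- int (card A * c))" "Q ^ (card A * c)" "\<Sum>x\<in>bset 4 n. p x * Fd Q 1 n c x y"] by (simp only: mult_1 mult_zero_right)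
  qed
  fix b assume b: "bas 4 n b" "le4 0 ?z b" "ht b = ht ?z" "ballot 0 b"
  have e: "enc (dcA b) (dcB b) n = b" by (rule enc_dc[OF b(1)])
  show "p b = 0" unfolding p_def
  proof (rule bal[OF dcs[OF b(1)]])
   show "card (dcA b) = card A0" "card (dcB b) = card B0" using cards[OF b(1,2)] b(3) h0 by linarith+
   show "gle n (dcA b) (dcB b)" using b(4) ballot_enc[of "dcA b" "dcB b" n] e by simp
   fix x assume "x \<le> n"
   thus "card (dcA b \<inter> {1..x}) + card (dcB b \<inter> {1..x}) = card (A0 \<inter> {1..x}) + card (B0 \<inter> {1..x}) \<and> card (B0 \<inter> {1..x}) \<le> card (dcB b \<inter> {1..x})"
    using le4_enc[of A0 B0 n "dcA b" "dcB b" x] b(2) e by simp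
  qed
 qed
 thus ?thesis using A0 B0 by (simp add: p_def dc_enc)
qed

section \<open>Relations between the coefficients\<close>

lemma cf_append: "cf q (Xs @ Ys) x = cf q Xs (take (tot (szs Xs)) x) * cf q Ys (drop (tot (szs Xs)) x)"
proof (induction Xs arbitrary: x)
 case (Cons X Xs)
 thus ?case by (cases X) (simp add: drop_take mult.assoc add.commute)
qed simp

lemma cf_app: "length x = tot (szs Xs) ==> cf q (Xs @ Ys) (x @ y) = cf q Xs x * cf q Ys y"
 by (simp add: cf_append)

lemma asgs_append: "asgs q (k1 @ k2) y = asgs q k1 (take (tot k1) y) * asgs q k2 (drop (tot k1) y)"
proof (induction k1 arbitrary: y)
 case (Cons X Xs)
 thus ?case by (cases X) (simp add: drop_take mult.assoc add.commute)
qed simp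

lemma rowsof_append: "rowsof (k1 @ k2) y = rowsof k1 (take (tot k1) y) @ rowsof k2 (drop (tot k1) y)"
proof (induction k1 arbitrary: y)
 case (Cons X Xs)
 thus ?case by (cases X) (simp add: drop_take add.commute)
qed simp

lemma rws_append: "Xs \<in> rws n (k1 @ k2) \<longleftrightarrow> (\<exists>us vs. Xs = us @ vs \<and> us \<in> rws n k1 \<and> vs \<in> rws n k2)"
proof
 assume X: "Xs \<in> rws n (k1 @ k2)"
 hence "map (\<lambda>(b, Y). (b, card Y)) Xs = k1 @ k2" by (simp add: rws_def szs_def)
 then obtain us vs where "Xs = us @ vs" "map (\<lambda>(b, Y). (b, card Y)) us = k1" "map (\<lambda>(b, Y). (b, card Y)) vs = k2"
  by (auto simp: map_eq_append_conv)
 thus "\<exists>us vs. Xs = us @ vs \<and> us \<in> rws n k1 \<and> vs \<in> rws n k2"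
  using X by (intro exI[of _ us] exI[of _ vs]) (simp add: rws_def szs_def ball_Un)
next
 assume "\<exists>us vs. Xs = us @ vs \<and> us \<in> rws n k1 \<and> vs \<in> rws n k2"
 thus "Xs \<in> rws n (k1 @ k2)" by (force simp: rws_def ball_Un)
qed

lemma rws_app: "us \<in> rws n k1 ==> vs \<in> rws n k2 ==> us @ vs \<in> rws n (k1 @ k2)" unfolding rws_append by blast

lemma rws_Cons': "Xs \<in> rws n ((b, a) # k) \<longleftrightarrow> (\<exists>Y vs. Xs = (b, Y) # vs \<and> card Y = a \<and> Y \<subseteq> {1..n} \<and> vs \<in> rws n k)"
proof
 assume "Xs \<in> rws n ((b, a) # k)"
 thus "\<exists>Y vs. Xs = (b, Y) # vs \<and> card Y = a \<and> Y \<subseteq> {1..n} \<and> vs \<in> rws n k" by (cases Xs) (auto simp: rws_def szs_def)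
qed (auto simp: rws_Cons)

lemma rws_szs: "us \<in> rws n k ==> szs us = k" by (simp add: rws_def)

lemma x0_self: assumes "us \<in> rws n k"
 shows "length (x0 us) = tot k" "rowsof k (x0 us) = us" "asgs q k (x0 us) = 1"
proof -
 show l: "length (x0 us) = tot k" using x0_bas[OF assms] by (rule bas_length)
 show r: "rowsof k (x0 us) = us" using assms
 proof (induction us arbitrary: k)
  case Nil thus ?case by (simp add: rws_def)
 next
  case (Cons X us)
  obtain b Y where X: "X = (b, Y)" by (cases X)
  obtain a k' where k: "k = (b, a) # k'" using Cons.prems X by (auto simp: rws_def)
  have Y: "card Y = a" "Y \<subseteq> {1..n}" "us \<in> rws n k'" using Cons.prems unfolding X k rws_Cons by auto
  have f: "finite Y" using Y finite_subset by blast
  show ?case using Cons.IH[OF Y(3)] f Y by (simp add: X k)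
 qed
 show "asgs q k (x0 us) = 1"
  using cf_x0[OF assms assms, of q] cf_asgs[of "x0 us" us q] l r rws_szs[OF assms] by simp
qed

lemma asgs_x0: "us \<in> rws n k1 ==> asgs q (k1 @ k2) (x0 us @ y) = asgs q k2 y"
 by (simp add: asgs_append x0_self)
lemma rowsof_x0: "us \<in> rws n k1 ==> rowsof (k1 @ k2) (x0 us @ y) = us @ rowsof k2 y"
 by (simp add: rowsof_append x0_self)

definition sl :: "bool => nat set => nat list" where
 "sl b A = (if b then sorted_list_of_set A else rev (sorted_list_of_set A))"

lemma sl: assumes "finite A" shows "set (sl b A) = A" "length (sl b A) = card A" "asg q b (sl b A) = 1"
proof -
 show "set (sl b A) = A" "length (sl b A) = card A" using assms by (simp_all add: sl_def)
 show "asg q b (sl b A) = 1" using inv_sorted[OF sorted_lt[OF assms]] assms by (simp add: asg_def sl_def)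
qed

lemma x0_sl: "x0 ((b, Y) # Ys) = sl b Y @ x0 Ys" by (simp add: sl_def)

lemma io_split: assumes Y: "finite Y" and x: "length x = c" and y: "length y = card Y - c" and c: "c \<le> card Y"
 shows "io q b Y (x @ y) = (\<Sum>C\<in>{C. C \<subseteq> Y \<and> card C = c}. (- q) ^ icr b C (Y - C) * (io q b C x * io q b (Y - C) y))"
proof -
 have f: "finite {C. C \<subseteq> Y \<and> card C = c}" using Y by simp
 show ?thesis
 proof (cases "set x \<union> set y = Y \<and> set x \<inter> set y = {} \<and> distinct x")
  case True
  hence C: "set x \<in> {C. C \<subseteq> Y \<and> card C = c}" "Y - set x = set y" using x by (auto simp: distinct_card)
  have "(\<Sum>C\<in>{C. C \<subseteq> Y \<and> card C = c}. (- q) ^ icr b C (Y - C) * (io q b C x * io q b (Y - C) y))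
   = (- q) ^ icr b (set x) (Y - set x) * (io q b (set x) x * io q b (Y - set x) y)"
   by (rule sum_single[OF f C(1)]) (auto simp: io_def)
  thus ?thesis using True C by (simp add: io_def asg_append)
 next
  case False
  have "(- q) ^ icr b C (Y - C) * (io q b C x * io q b (Y - C) y) = 0" if "C \<subseteq> Y \<and> card C = c" for C
   using False that by (auto simp: io_def asg_def)
  hence "(\<Sum>C\<in>{C. C \<subseteq> Y \<and> card C = c}. (- q) ^ icr b C (Y - C) * (io q b C x * io q b (Y - C) y)) = 0" by (intro sum.neutral) blast
  moreover have "io q b Y (x @ y) = 0" using False by (auto simp: io_def asg_append asg_def)
  ultimately show ?thesis by simp
 qed
qed

text \<open>Laplace expansion: an antisymmetric row is a signed sum over the ways to cut its letter
  set into two adjacent antisymmetric rows.\<close>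

lemma cf_split: assumes Y: "finite Y" "c \<le> card Y" and x: "length x = tot (szs (us @ (b, Y) # vs))"
 shows "cf q (us @ (b, Y) # vs) x = (\<Sum>C\<in>{C. C \<subseteq> Y \<and> card C = c}. (- q) ^ icr b C (Y - C) * cf q (us @ (b, C) # (b, Y - C) # vs) x)"
proof -
 from x Y have "length x = tot (szs us) + c + ((card Y - c) + tot (szs vs))" by simp
 from split3[OF this] obtain x1 x2 x34 where X: "x = x1 @ x2 @ x34" "length x1 = tot (szs us)" "length x2 = c" "length x34 = (card Y - c) + tot (szs vs)" by blast
 from split3[of x34 "card Y - c" "tot (szs vs)" 0] X obtain x3 x4 where X': "x34 = x3 @ x4" "length x3 = card Y - c" "length x4 = tot (szs vs)" by auto
 have 1: "cf q (us @ (b, Y) # vs) x = cf q us x1 * (io q b Y (x2 @ x3) * cf q vs x4)"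
  using X X' Y by (simp add: cf_app)
 have 2: "cf q (us @ (b, C) # (b, Y - C) # vs) x = cf q us x1 * ((io q b C x2 * io q b (Y - C) x3) * cf q vs x4)" if "C \<subseteq> Y \<and> card C = c" for C
 proof -
  have "finite C" using that Y(1) finite_subset by blast
  hence "card (Y - C) = card Y - c" using that by (simp add: card_Diff_subset)
  thus ?thesis using X X' that by (simp add: cf_app mult.assoc)
 qed
 have "cf q (us @ (b, Y) # vs) x = (\<Sum>C\<in>{C. C \<subseteq> Y \<and> card C = c}. cf q us x1 * (((- q) ^ icr b C (Y - C) * (io q b C x2 * io q b (Y - C) x3)) * cf q vs x4))"
  unfolding 1 io_split[OF Y(1) X(3) X'(2) Y(2)] by (simp add: sum_distrib_left sum_distrib_right)
 also have "... = (\<Sum>C\<in>{C. C \<subseteq> Y \<and> card C = c}. (- q) ^ icr b C (Y - C) * cf q (us @ (b, C) # (b, Y - C) # vs) x)"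
  by (intro sum.cong refl) (simp add: 2 mult_ac)
 finally show ?thesis .
qed

text \<open>Every row functional of shape k is to be a combination of those of the finer shape k';
  stated through common zeros, so that no coefficients have to be carried along.\<close>

definition rfn :: "nat => nat => 'a::comm_ring_1 => (bool \<times> nat) list => (bool \<times> nat) list => bool" where
 "rfn n m q k k' \<longleftrightarrow> (\<forall>g. (\<forall>X\<in>rws n k'. (\<Sum>w\<in>bset n m. cf q X w * g w) = 0) --> (\<forall>X\<in>rws n k. (\<Sum>w\<in>bset n m. cf q X w * g w) = 0))"

lemma rfn_trans: "rfn n m q k k' ==> rfn n m q k' k'' ==> rfn n m q k k''" unfolding rfn_def by blast

lemma rfn_split: assumes m: "tot (k1 @ (b, a + c) # k2) = m"
 shows "rfn n m q (k1 @ (b, a + c) # k2) (k1 @ (b, a) # (b, c) # k2)"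
 unfolding rfn_def
proof (intro allI impI ballI)
 fix g X assume g: "\<forall>X\<in>rws n (k1 @ (b, a) # (b, c) # k2). (\<Sum>w\<in>bset n m. cf q X w * g w) = 0"
  and "X \<in> rws n (k1 @ (b, a + c) # k2)"
 then obtain us Y vs where X: "X = us @ (b, Y) # vs" "us \<in> rws n k1" "card Y = a + c" "Y \<subseteq> {1..n}" "vs \<in> rws n k2"
  unfolding rws_append rws_Cons' by blast
 have f: "finite Y" using X finite_subset by blast
 let ?S = "{C. C \<subseteq> Y \<and> card C = a}"
 have z: "(\<Sum>w\<in>bset n m. cf q (us @ (b, C) # (b, Y - C) # vs) w * g w) = 0" if "C \<in> ?S" for C
 proof -
  have "finite C" using that f finite_subset by blast
  hence "card (Y - C) = c" using that X by (simp add: card_Diff_subset)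
  hence "us @ (b, C) # (b, Y - C) # vs \<in> rws n (k1 @ (b, a) # (b, c) # k2)"
   by (intro rws_app X) (use that X in \<open>auto simp: rws_Cons\<close>)
  thus ?thesis using g by blast
 qed
 have "(\<Sum>w\<in>bset n m. cf q X w * g w) = (\<Sum>w\<in>bset n m. \<Sum>C\<in>?S. (- q) ^ icr b C (Y - C) * (cf q (us @ (b, C) # (b, Y - C) # vs) w * g w))"
 proof (intro sum.cong refl)
  fix w assume "w \<in> bset n m"
  hence "length w = tot (szs (us @ (b, Y) # vs))" using m X rws_szs[OF X(2)] rws_szs[OF X(5)] by (simp add: bas_length)
  from cf_split[OF f _ this, of a q] show "cf q X w * g w = (\<Sum>C\<in>?S. (- q) ^ icr b C (Y - C) * (cf q (us @ (b, C) # (b, Y - C) # vs) w * g w))"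
   using X by (simp add: sum_distrib_right mult.assoc)
 qed
 also have "... = (\<Sum>C\<in>?S. (- q) ^ icr b C (Y - C) * (\<Sum>w\<in>bset n m. cf q (us @ (b, C) # (b, Y - C) # vs) w * g w))"
  by (subst sum.swap) (simp add: sum_distrib_left)
 also have "... = 0" by (rule sum.neutral) (simp add: z)
 finally show "(\<Sum>w\<in>bset n m. cf q X w * g w) = 0" .
qed

lemma ok_append: "ok P ofs (k1 @ k2) \<longleftrightarrow> ok P ofs k1 \<and> ok P (ofs + tot k1) k2"
proof (induction k1 arbitrary: ofs)
 case (Cons X k1)
 thus ?case by (cases X) (simp add: add.assoc)
qed simp

lemma ok_split: "ok P ofs (k1 @ (b, a + c) # k2) ==> ok P ofs (k1 @ (b, a) # (b, c) # k2)"
 by (auto simp: ok_append add.assoc dest: spec[of _ "a + _"])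

context
 fixes n m :: nat and q :: "'a::comm_ring_1" and N :: "'a mat"
 assumes q: "q dvd 1" and n: "1 \<le> n"
begin

text \<open>The row functional of X on the column y of N. Unlike in \<open>DD\<close>, y is any
  word, in particular one whose blocks are finer than the shape of X.\<close>

definition RX :: "(bool \<times> nat set) list => nat list => 'a" where
 "RX X y = (\<Sum>w\<in>bset n m. cf q X w * N w y)"

lemma RX_eq: assumes k: "ok (cm n m q N) 0 k" "tot k = m" and X: "X \<in> rws n k" and y: "bas n m y"
 shows "RX X y = asgs q k y * DD n m q N X (rowsof k y)"
proof -
 have "RX X y = (\<Sum>Y\<in>rws n k. DD n m q N X Y * cf q Y y)" unfolding RX_def by (rule row_cf[OF q k X y])
 also have "... = asgs q k y * DD n m q N X (rowsof k y)"
 proof (cases "asgs q k y = 0")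
  case True
  have "cf q Y y = 0" if "Y \<in> rws n k" for Y using that True cf_asgs[of y Y q] k y by (auto simp: rws_def bas_length)
  thus ?thesis using True by simp
 next
  case False
  have s: "szs (rowsof k y) = k" by (rule asgs_szs) (use False k y in \<open>auto simp: bas_length\<close>)
  hence r: "rowsof k y \<in> rws n k" using rowsof_sub[of y n] y by (auto simp: rws_def bas_def)
  have "cf q Y y = (if Y = rowsof k y then asgs q k y else 0)" if "Y \<in> rws n k" for Y
   using that cf_asgs[of y Y q] k y by (auto simp: rws_def bas_length)
  hence "(\<Sum>Y\<in>rws n k. DD n m q N X Y * cf q Y y) = (\<Sum>Y\<in>rws n k. if Y = rowsof k y then DD n m q N X (rowsof k y) * asgs q k y else 0)"
   by (intro sum.cong refl) auto
  thus ?thesis using r by (simp add: sum.delta finite_rws mult.commute)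
 qed
 finally show ?thesis .
qed

text \<open>A vector killed by N is expanded in row tensors of a shape k' finer than that of X. This
  gives a relation for all row functionals of shape k', and refinement transfers it to X.\<close>

lemma RX_sum: assumes k': "ok (cm n m q N) 0 k'" "tot k' = m" and rf: "rfn n m q k k'" and X: "X \<in> rws n k"
 and Y: "\<And>j. j \<in> J ==> Y j \<in> rws n k'" and v: "\<And>x. bas n m x ==> v x = (\<Sum>j\<in>J. c j * cf q (Y j) x)"
 and kill: "\<And>x. bas n m x ==> ap n m N v x = 0"
 shows "(\<Sum>j\<in>J. c j * RX X (x0 (Y j))) = 0"
proof -
 define g where "g w = (\<Sum>j\<in>J. c j * N w (x0 (Y j)))" for w
 have sw: "(\<Sum>w\<in>bset n m. cf q Z w * g w) = (\<Sum>j\<in>J. c j * RX Z (x0 (Y j)))" for Z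
  unfolding g_def RX_def sum_distrib_left by (subst sum.swap) (simp add: mult.left_commute)
 have "(\<Sum>w\<in>bset n m. cf q Z w * g w) = 0" if Z: "Z \<in> rws n k'" for Z
 proof -
  have "(\<Sum>j\<in>J. c j * RX Z (x0 (Y j))) = (\<Sum>j\<in>J. c j * ap n m N (cf q (Y j)) (x0 Z))"
   by (intro sum.cong refl) (use DD_row[OF q k' Z] Y in \<open>simp add: RX_def DD_def\<close>)
  also have "... = ap n m N (\<lambda>x. \<Sum>j\<in>J. c j * cf q (Y j) x) (x0 Z)"
   unfolding ap_def sum_distrib_left by (subst sum.swap) (simp add: mult.left_commute)
  also have "... = ap n m N v (x0 Z)" by (rule ap_cong) (simp add: v)
  also have "... = 0" using kill x0_bas[OF Z] k' by simp
  finally show ?thesis by (simp add: sw)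
 qed
 hence "\<forall>X\<in>rws n k'. (\<Sum>w\<in>bset n m. cf q X w * g w) = 0" by simp
 hence "\<forall>X\<in>rws n k. (\<Sum>w\<in>bset n m. cf q X w * g w) = 0"
  by (rule rf[unfolded rfn_def, THEN spec, of g, THEN mp])
 thus ?thesis using X by (simp add: sw)
qed

text \<open>A word sorted in the two blocks A and C is read with a shape in which they form one
  block: it acquires the crossing sign, or vanishes if a letter repeats.\<close>

lemma RX_merge: assumes k: "ok (cm n m q N) 0 (k1 @ (b, a + c) # k2)" "tot (k1 @ (b, a + c) # k2) = m" and X: "X \<in> rws n (k1 @ (b, a + c) # k2)"
 and us: "us \<in> rws n k1" and vs: "vs \<in> rws n k2" and A: "A \<subseteq> {1..n}" "card A = a" and C: "C \<subseteq> {1..n}" "card C = c"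
 shows "RX X (x0 (us @ (b, A) # (b, C) # vs)) = (if A \<inter> C = {} then (- q) ^ icr b A C * DD n m q N X (us @ (b, A \<union> C) # vs) else 0)"
proof -
 have f: "finite A" "finite C" using A C finite_subset by auto
 let ?y = "x0 us @ (sl b A @ sl b C) @ x0 vs"
 have y: "x0 (us @ (b, A) # (b, C) # vs) = ?y" using x0_sl by (simp add: x0_sl del: x0_simps(2))
 have l: "length (sl b A @ sl b C) = a + c" using f A C by (simp add: sl)
 have "us @ (b, A) # (b, C) # vs \<in> rws n (k1 @ (b, a) # (b, c) # k2)" by (intro rws_app us) (use vs A C in \<open>simp add: rws_Cons\<close>)
 from x0_bas[OF this] have b: "bas n m ?y" using k(2) unfolding y by (simp add: add.assoc)
 have 1: "asgs q (k1 @ (b, a + c) # k2) ?y = asg q b (sl b A @ sl b C)"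
  using l x0_self(1)[OF vs] by (simp add: asgs_x0[OF us] x0_self(3)[OF vs] del: append_assoc)
 have 2: "rowsof (k1 @ (b, a + c) # k2) ?y = us @ (b, A \<union> C) # vs"
  using l x0_self(1,2)[OF vs] f by (simp add: rowsof_x0[OF us] sl del: append_assoc)
 show ?thesis unfolding y RX_eq[OF k X b] 1 2 using f by (simp add: asg_append sl)
qed

lemma RX_merge2: assumes k: "ok (cm n m q N) 0 (k1 @ (b, a + c) # (b', c + a') # k2)" "tot (k1 @ (b, a + c) # (b', c + a') # k2) = m"
 and X: "X \<in> rws n (k1 @ (b, a + c) # (b', c + a') # k2)"
 and us: "us \<in> rws n k1" and vs: "vs \<in> rws n k2" and A: "A \<subseteq> {1..n}" "card A = a" and C: "C \<subseteq> {1..n}" "card C = c" and B: "B \<subseteq> {1..n}" "card B = a'"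
 shows "RX X (x0 (us @ (b, A) # (b, C) # (b', C) # (b', B) # vs)) =
  (if A \<inter> C = {} \<and> C \<inter> B = {} then (- q) ^ (icr b A C + icr b' C B) * DD n m q N X (us @ (b, A \<union> C) # (b', C \<union> B) # vs) else 0)"
proof -
 have f: "finite A" "finite C" "finite B" using finite_subset[OF A(1)] finite_subset[OF C(1)] finite_subset[OF B(1)] by simp_all
 let ?y = "x0 us @ (sl b A @ sl b C) @ (sl b' C @ sl b' B) @ x0 vs"
 have y: "x0 (us @ (b, A) # (b, C) # (b', C) # (b', B) # vs) = ?y" by (simp add: x0_sl del: x0_simps(2))
 have l: "length (sl b A @ sl b C) = a + c" "length (sl b' C @ sl b' B) = c + a'" using f A C B by (simp_all add: sl)
 have "us @ (b, A) # (b, C) # (b', C) # (b', B) # vs \<in> rws n (k1 @ (b, a) # (b, c) # (b', c) # (b', a') # k2)" by (intro rws_app us) (use vs A B C in \<open>simp add: rws_Cons\<close>)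
 from x0_bas[OF this] have b: "bas n m ?y" using k(2) unfolding y by (simp add: add.assoc)
 have 1: "asgs q (k1 @ (b, a + c) # (b', c + a') # k2) ?y = asg q b (sl b A @ sl b C) * asg q b' (sl b' C @ sl b' B)"
  using l x0_self(1)[OF vs] by (simp add: asgs_x0[OF us] x0_self(3)[OF vs] del: append_assoc)
 have 2: "rowsof (k1 @ (b, a + c) # (b', c + a') # k2) ?y = us @ (b, A \<union> C) # (b', C \<union> B) # vs"
  using l x0_self(1,2)[OF vs] f by (simp add: rowsof_x0[OF us] sl del: append_assoc)
 show ?thesis unfolding y RX_eq[OF k X b] 1 2 using f by (simp add: asg_append sl power_add)
qed

text \<open>A relation of Garnir type. The second row B of the killed tensor has c entries too many;
  cut it into C and B - C, and merge C with the row A on its left.\<close>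

lemma rel_right: assumes k: "ok (cm n m q N) 0 (k1 @ (b, a + c) # (b, b') # k2)" "tot (k1 @ (b, a + c) # (b, b') # k2) = m"
 and X: "X \<in> rws n (k1 @ (b, a + c) # (b, b') # k2)"
 and us: "us \<in> rws n k1" and vs: "vs \<in> rws n k2" and A: "A \<subseteq> {1..n}" "card A = a" and B: "B \<subseteq> {1..n}" "card B = c + b'"
 and kill: "\<And>x. bas n m x ==> ap n m N (cf q (us @ (b, A) # (b, B) # vs)) x = 0"
 shows "(\<Sum>C\<in>{C. C \<subseteq> B - A \<and> card C = c}. (- q) ^ (icr b C (B - C) + icr b A C) * DD n m q N X (us @ (b, A \<union> C) # (b, B - C) # vs)) = 0"
proof -
 let ?k = "k1 @ (b, a + c) # (b, b') # k2"
  and ?D = "\<lambda>C. (- q) ^ (icr b C (B - C) + icr b A C) * DD n m q N X (us @ (b, A \<union> C) # (b, B - C) # vs)"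
  and ?v = "\<lambda>C. us @ (b, A) # (b, C) # (b, B - C) # vs"
 let ?R = "\<lambda>C. (- q) ^ icr b C (B - C) * RX X (x0 (?v C))" and ?w = "us @ (b, A) # (b, B) # vs"
 let ?S = "{C. C \<subseteq> B \<and> card C = c}" and ?k' = "k1 @ (b, a) # (b, c) # (b, b') # k2"
 have f: "finite B" "finite A" using A B finite_subset by auto
 have cB: "C \<in> ?S ==> card (B - C) = b'" for C using f B card_Diff_subset[of C B] finite_subset[of C B] by auto
 have "(\<Sum>C\<in>?S. ?R C) = 0"
 proof (rule RX_sum[where k = ?k and k' = ?k'])
  show "ok (cm n m q N) 0 ?k'" by (rule ok_split[OF k(1)])
  show "tot ?k' = m" using k(2) by simp
  show "rfn n m q ?k ?k'" by (rule rfn_split[OF k(2)])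
  show "ap n m N (cf q ?w) x = 0" if "bas n m x" for x using kill[OF that] .
  fix x assume x: "bas n m x"
  show "cf q ?w x = (\<Sum>C\<in>?S. (- q) ^ icr b C (B - C) * cf q (?v C) x)"
   using cf_split[OF f(1), of c x "us @ [(b, A)]" b vs q] B x k(2) rws_szs[OF us] rws_szs[OF vs] A by (simp add: bas_length add.assoc)
 next
  fix C assume C: "C \<in> ?S"
  thus "?v C \<in> rws n ?k'"
   by (intro rws_app us) (use vs A B cB[OF C] in \<open>auto simp: rws_Cons\<close>)
 qed (rule X)
 also have "(\<Sum>C\<in>?S. ?R C)
  = (\<Sum>C\<in>?S. if A \<inter> C = {} then ?D C else 0)"
 proof (intro sum.cong refl)
  fix C assume C: "C \<in> ?S"
  have "(b, B - C) # vs \<in> rws n ((b, b') # k2)" using C B vs cB[OF C] by (auto simp: rws_Cons')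
  moreover have "C \<subseteq> {1..n}" "card C = c" using C B by auto
  ultimately show "?R C = (if A \<inter> C = {} then ?D C else 0)"
   using RX_merge[OF k X us _ A, of "(b, B - C) # vs" C] by (simp add: power_add)
 qed
 also have "... = (\<Sum>C\<in>{C. C \<subseteq> B - A \<and> card C = c}. ?D C)"
  by (rule sum.mono_neutral_cong_right) (use f in auto)
 finally show ?thesis .
qed

text \<open>The mirror image, with the surplus in the first row. It is used on the dual side, where
  complements turn a surplus of the second row into one of the first.\<close>

lemma rel_left: assumes k: "ok (cm n m q N) 0 (k1 @ (b, a) # (b, c + b') # k2)" "tot (k1 @ (b, a) # (b, c + b') # k2) = m"
 and X: "X \<in> rws n (k1 @ (b, a) # (b, c + b') # k2)"
 and us: "us \<in> rws n k1" and vs: "vs \<in> rws n k2" and A: "A \<subseteq> {1..n}" "card A = a + c" and B: "B \<subseteq> {1..n}" "card B = b'"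
 and kill: "\<And>x. bas n m x ==> ap n m N (cf q (us @ (b, A) # (b, B) # vs)) x = 0"
 shows "(\<Sum>C\<in>{C. C \<subseteq> A - B \<and> card C = c}. (- q) ^ (icr b (A - C) C + icr b C B) * DD n m q N X (us @ (b, A - C) # (b, C \<union> B) # vs)) = 0"
proof -
 let ?k = "k1 @ (b, a) # (b, c + b') # k2"
  and ?D = "\<lambda>C. (- q) ^ (icr b (A - C) C + icr b C B) * DD n m q N X (us @ (b, A - C) # (b, C \<union> B) # vs)"
  and ?v = "\<lambda>C. us @ (b, A - C) # (b, C) # (b, B) # vs"
 let ?R = "\<lambda>C. (- q) ^ icr b (A - C) C * RX X (x0 (?v C))" and ?w = "us @ (b, A) # (b, B) # vs"
 let ?S = "{C. C \<subseteq> A \<and> card C = c}" and ?k' = "k1 @ (b, a) # (b, c) # (b, b') # k2"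
 have f: "finite B" "finite A" using A B finite_subset by auto
 have cA: "C \<in> ?S ==> card (A - C) = a" for C using f A card_Diff_subset[of C A] finite_subset[of C A] by auto
 have cA': "C \<subseteq> A \<and> card C = a ==> card (A - C) = c" for C using f A card_Diff_subset[of C A] finite_subset[of C A] by auto
 have "(\<Sum>C\<in>?S. ?R C) = 0"
 proof (rule RX_sum[where k = ?k and k' = ?k'])
  have k3: "?k = (k1 @ [(b, a)]) @ (b, c + b') # k2" "?k' = (k1 @ [(b, a)]) @ (b, c) # (b, b') # k2" by simp_all
  show "ok (cm n m q N) 0 ?k'" unfolding k3(2) by (rule ok_split) (use k(1) in simp)
  show "tot ?k' = m" using k(2) by simp
  show "rfn n m q ?k ?k'" unfolding k3 by (rule rfn_split) (use k(2) in simp)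
  show "ap n m N (cf q ?w) x = 0" if "bas n m x" for x using kill[OF that] .
  fix x assume x: "bas n m x"
  have "cf q ?w x = (\<Sum>C\<in>{C. C \<subseteq> A \<and> card C = a}. (- q) ^ icr b C (A - C) * cf q (us @ (b, C) # (b, A - C) # (b, B) # vs) x)"
   by (rule cf_split[OF f(2)]) (use B x k(2) rws_szs[OF us] rws_szs[OF vs] A in \<open>simp_all add: bas_length add.assoc\<close>)
  \<comment> \<open>The expansion is indexed by the part that stays on the left; C denotes the part
    that moves.\<close>
  also have "... = (\<Sum>C\<in>?S. (- q) ^ icr b (A - C) C * cf q (?v C) x)"
   by (rule sum.reindex_bij_witness[of _ "\<lambda>C. A - C" "\<lambda>C. A - C"]) (use cA cA' in \<open>auto simp: double_diff\<close>)
  finally show "cf q ?w x = (\<Sum>C\<in>?S. (- q) ^ icr b (A - C) C * cf q (?v C) x)" .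
 next
  fix C assume C: "C \<in> ?S"
  thus "?v C \<in> rws n ?k'"
   by (intro rws_app us) (use vs A B cA[OF C] in \<open>auto simp: rws_Cons\<close>)
 qed (rule X)
 also have "(\<Sum>C\<in>?S. ?R C)
  = (\<Sum>C\<in>?S. if C \<inter> B = {} then ?D C else 0)"
 proof (intro sum.cong refl)
  fix C assume C: "C \<in> ?S"
  have u: "us @ [(b, A - C)] \<in> rws n (k1 @ [(b, a)])" by (intro rws_app us) (use C A cA[OF C] in \<open>auto simp: rws_Cons' rws_def\<close>)
  have C': "C \<subseteq> {1..n}" "card C = c" using C A by auto
  have "RX X (x0 ((us @ [(b, A - C)]) @ (b, C) # (b, B) # vs)) = (if C \<inter> B = {} then (- q) ^ icr b C B * DD n m q N X ((us @ [(b, A - C)]) @ (b, C \<union> B) # vs) else 0)"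
   by (rule RX_merge[OF _ _ _ u vs C' B]) (use k X in auto)
  thus "?R C = (if C \<inter> B = {} then ?D C else 0)"
   by (simp add: power_add del: x0_simps)
 qed
 also have "... = (\<Sum>C\<in>{C. C \<subseteq> A - B \<and> card C = c}. ?D C)"
  by (rule sum.mono_neutral_cong_right) (use f in auto)
 finally show ?thesis .
qed

lemma zop_zero: "zop b q a ofs (\<lambda>x. 0) = (\<lambda>x. 0 :: 'a)"
 using zop_sum[of b q a ofs "\<lambda>i. 0" "\<lambda>i x. 0" "{} :: nat set"] by simp

text \<open>Antisymmetrizing only the V-half of c nested pairs already makes both halves
  antisymmetric, because one half is the reversal of the other.\<close>

lemma zop_iotac: assumes x: "x = l @ t @ t' @ v" "bas n m x" "length l = ofs" "length t = c" "length t' = c"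
 shows "zop True q c ofs (iotac ofs c g) x = io q True (set t') t * asg q False t' * g (l @ v)"
proof -
 have m: "ofs + c \<le> m" using x bas_length[OF x(2)] by simp
 \<comment> \<open>Reversing the word is compensated by the reversed order on the dual side, so both
   halves have the same sign.\<close>
 have rs: "asg q True (rev t') = asg q False t'"
 proof -
  have "inv True (rev xs) = inv False xs" if "distinct xs" for xs using that
  proof (induction xs)
   case (Cons a xs)
   hence "distinct (rev xs @ [a])" by simp
   from inv_append[OF this, of True] have "inv True (rev (a # xs)) = inv True (rev xs) + icr True (set xs) {a}" by simp
   moreover have "icr True (set xs) {a} = card {y \<in> set xs. lt False y a}" by (simp add: icr_single lt_def)
   ultimately show ?case using Cons by (simp add: length_filter_card)
  qed simp
  thus ?thesis by (simp add: asg_def)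
 qed
 have "zop True q c ofs (iotac ofs c g) x = zop True q c ofs (\<lambda>x. \<Sum>w\<in>bset n m. iotac ofs c g w * dlt w x) x"
 proof (rule zop_cong[OF m _ x(2)])
  fix y assume y: "bas n m y"
  show "iotac ofs c g y = (\<Sum>w\<in>bset n m. iotac ofs c g w * dlt w y)"
   by (subst sum_single[of _ y]) (use y in \<open>auto simp: dlt_def\<close>)
 qed
 also have "... = (\<Sum>w\<in>bset n m. iotac ofs c g w * zop True q c ofs (dlt w) x)" by (simp add: zop_sum)
 also have "... = iotac ofs c g (l @ rev t' @ t' @ v) * zop True q c ofs (dlt (l @ rev t' @ t' @ v)) x"
 proof (rule sum_single)
  show "l @ rev t' @ t' @ v \<in> bset n m" using x by (auto simp: bas_def)
  fix w assume w: "w \<in> bset n m" "w \<noteq> l @ rev t' @ t' @ v"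
  have "length w = ofs + c + (m - ofs - c)" using w m bas_length by auto
  from split3[OF this] obtain l1 y w2 where W: "w = l1 @ y @ w2" "length l1 = ofs" "length y = c" "length w2 = m - ofs - c" by blast
  have Z: "zop True q c ofs (dlt w) x = asg q True y * V q True l1 (set y) w2 x"
   using zop_dlt[OF q W(3), of True l1 w2] W by simp
  show "iotac ofs c g w * zop True q c ofs (dlt w) x = 0"
  proof (cases "distinct y")
   case True
   hence "V q True l1 (set y) w2 x = (if l = l1 \<and> t' @ v = w2 then io q True (set y) t else 0)"
    unfolding x(1) by (intro V_app) (use x W bas_length[OF x(2)] in \<open>auto simp: distinct_card\<close>)
   moreover have "iotac ofs c g (l @ y @ t' @ v) = 0" if "y \<noteq> rev t'"
    using iotac_app[OF q n, of l ofs y c t' g v] x W that by simp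
   moreover have "y \<noteq> rev t'" if "l = l1" "t' @ v = w2" using w(2) W(1) that by auto
   ultimately have "iotac ofs c g w = 0 \<or> V q True l1 (set y) w2 x = 0" using W(1) by auto
   thus ?thesis unfolding Z by auto
  qed (simp add: Z asg_def)
 qed simp
 also have "iotac ofs c g (l @ rev t' @ t' @ v) = g (l @ v)" using iotac_app[OF q n, of l ofs "rev t'" c t' g v] x by simp
 also have "zop True q c ofs (dlt (l @ rev t' @ t' @ v)) x = asg q True (rev t') * V q True l (set t') (t' @ v) x"
  using zop_dlt[OF q, of "rev t'" c True l "t' @ v"] x by simp
 also have "asg q True (rev t') * V q True l (set t') (t' @ v) x = asg q False t' * io q True (set t') t"
 proof (cases "distinct t'")
  case True
  hence "V q True l (set t') (t' @ v) x = io q True (set t') t"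
   unfolding x(1) by (subst V_app) (use x in \<open>auto simp: distinct_card\<close>)
  thus ?thesis by (simp add: rs)
 qed (simp add: asg_def)
 finally show ?thesis by (simp add: mult_ac)
qed

text \<open>The exchange at the wall. Creating c pairs between the rows A and B and antisymmetrizing
  yields the sum of all tensors with equal new rows C on both sides; N kills it, and the new rows
  merge with A and with B.\<close>

lemma rel_wall: assumes k: "ok (cm n m q N) 0 (k1 @ (True, a + c) # (False, c + a') # k2)" "tot (k1 @ (True, a + c) # (False, c + a') # k2) = m"
 and X: "X \<in> rws n (k1 @ (True, a + c) # (False, c + a') # k2)"
 and us: "us \<in> rws n k1" and vs: "vs \<in> rws n k2" and A: "A \<subseteq> {1..n}" "card A = a" and B: "B \<subseteq> {1..n}" "card B = a'"
 and kill: "\<And>x. bas n m x ==> ap n m N (iotac (tot k1 + a) c (cf q (us @ (True, A) # (False, B) # vs))) x = 0"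
 and N: "\<And>j. Suc j < c ==> cm n m q N True (tot k1 + a + j)"
 shows "(\<Sum>C\<in>{C. C \<subseteq> {1..n} - B - A \<and> card C = c}. (- q) ^ (icr True A C + icr False C B) * DD n m q N X (us @ (True, A \<union> C) # (False, C \<union> B) # vs)) = 0"
proof -
 let ?k = "k1 @ (True, a + c) # (False, c + a') # k2"
  and ?D = "\<lambda>C. (- q) ^ (icr True A C + icr False C B) * DD n m q N X (us @ (True, A \<union> C) # (False, C \<union> B) # vs)"
  and ?v = "\<lambda>C. us @ (True, A) # (True, C) # (False, C) # (False, B) # vs"
 let ?R = "\<lambda>C. 1 * RX X (x0 (?v C))"
 let ?S = "{C. C \<subseteq> {1..n} \<and> card C = c}" and ?k' = "k1 @ (True, a) # (True, c) # (False, c) # (False, a') # k2"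
 let ?r = "tot k1 + a"
 define g where "g = cf q (us @ (True, A) # (False, B) # vs)"
 define v where "v = zop True q c ?r (iotac ?r c g)"
 have f: "finite B" "finite A" using A B finite_subset by auto
 have mm: "m = ?r + c + c + (a' + tot k2)" using k(2) by simp
 have "(\<Sum>C\<in>?S. ?R C) = 0"
 proof (rule RX_sum[where k = ?k and k' = ?k'])
  let ?k2 = "k1 @ (True, a) # (True, c) # (False, c + a') # k2"
  have k3: "?k2 = (k1 @ [(True, a), (True, c)]) @ (False, c + a') # k2" "?k' = (k1 @ [(True, a), (True, c)]) @ (False, c) # (False, a') # k2" by simp_all
  have o2: "ok (cm n m q N) 0 ?k2" by (rule ok_split[OF k(1)])
  show "ok (cm n m q N) 0 ?k'" unfolding k3(2) by (rule ok_split) (use o2 in simp)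
  show "tot ?k' = m" using k(2) by simp
  have "rfn n m q ?k ?k2" by (rule rfn_split[OF k(2)])
  moreover have "rfn n m q ?k2 ?k'" unfolding k3 by (rule rfn_split) (use k(2) in simp)
  ultimately show "rfn n m q ?k ?k'" by (rule rfn_trans)
  show "ap n m N v x = 0" if x: "bas n m x" for x
  proof -
   have "ap n m N v x = zop True q c ?r (ap n m N (iotac ?r c g)) x" unfolding v_def by (rule ap_zop) (use N mm x in auto)
   also have "... = zop True q c ?r (\<lambda>x. 0) x" by (rule zop_cong[OF _ _ x]) (use mm kill in \<open>auto simp: g_def\<close>)
   finally show ?thesis by (simp add: zop_zero)
  qed
  fix x assume x: "bas n m x"
  have "length x = ?r + c + c + (a' + tot k2)" using mm bas_length[OF x] by simp
  then obtain l t t' w where X4: "x = l @ t @ t' @ w" "length l = ?r" "length t = c" "length t' = c" "length w = a' + tot k2" by (rule split4[OF q n])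
  let ?F = "\<lambda>C. cf q (us @ [(True, A)]) l * (io q True C t * io q False C t' * cf q ((False, B) # vs) w)"
  have st: "set t' \<subseteq> {1..n}" using x X4 by (auto simp: bas_def)
  have L: "length l = tot (szs (us @ [(True, A)]))" using X4 rws_szs[OF us] A by simp
  have G: "g (l @ w) = cf q (us @ [(True, A)]) l * cf q ((False, B) # vs) w"
   unfolding g_def using cf_app[OF L, of q "(False, B) # vs" w] by simp
  have C4: "cf q (?v C) x = ?F C" if "card C = c" for C
   using cf_app[OF L, of q "(True, C) # (False, C) # (False, B) # vs" "t @ t' @ w"] X4 that by (simp add: mult.assoc)
  have "(\<Sum>C\<in>?S. 1 * cf q (?v C) x) = (\<Sum>C\<in>?S. ?F C)"
   by (intro sum.cong refl) (simp add: C4)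
  also have "... = io q True (set t') t * asg q False t' * g (l @ w)"
  proof (cases "distinct t'")
   case True
   hence "set t' \<in> ?S" using st X4 by (simp add: distinct_card)
   hence "(\<Sum>C\<in>?S. ?F C)
    = cf q (us @ [(True, A)]) l * (io q True (set t') t * io q False (set t') t' * cf q ((False, B) # vs) w)"
    by (intro sum_single) (auto simp: io_def)
   thus ?thesis by (simp add: G io_def mult_ac)
  next
   case False
   hence "io q False C t' = 0" "asg q False t' = 0" for C by (simp_all add: asg_def io_def)
   thus ?thesis by simp
  qed
  also have "... = v x" unfolding v_def by (rule zop_iotac[OF X4(1) x X4(2-4), symmetric])
  finally show "v x = (\<Sum>C\<in>?S. 1 * cf q (?v C) x)" by simp
 next
  fix C assume C: "C \<in> ?S"
  thus "?v C \<in> rws n ?k'"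
   by (intro rws_app us) (use vs A B in \<open>auto simp: rws_Cons\<close>)
 qed (rule X)
 also have "(\<Sum>C\<in>?S. ?R C)
  = (\<Sum>C\<in>?S. if A \<inter> C = {} \<and> C \<inter> B = {} then ?D C else 0)"
 proof (intro sum.cong refl)
  fix C assume "C \<in> ?S"
  hence C: "C \<subseteq> {1..n}" "card C = c" by auto
  show "?R C = (if A \<inter> C = {} \<and> C \<inter> B = {} then ?D C else 0)"
   unfolding mult_1 by (rule RX_merge2[OF k X us vs A C B])
 qed
 also have "... = (\<Sum>C\<in>{C. C \<subseteq> {1..n} - B - A \<and> card C = c}. ?D C)"
  by (rule sum.mono_neutral_cong_right) (use f in auto)
 finally show ?thesis .
qed

end

section \<open>Elements are determined by their standard coefficients\<close>

text \<open>Row lists are encoded by lists of subsets of {1..n} of length r + s; the last s entries stand for the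
 complements of the dual rows. The wall is between the entries r - 1 and r, so the first rows of the two
 tableaux are the entries next to the wall.\<close>

fun rw :: "nat => nat => nat set list => (bool \<times> nat set) list" where
 "rw n r [] = []"
| "rw n r (Z # zs) = (if 0 < r then (True, Z) else (False, {1..n} - Z)) # rw n (r - 1) zs"

fun kp :: "nat => nat => nat list => (bool \<times> nat) list" where
 "kp n r [] = []"
| "kp n r (c # k) = (if 0 < r then (True, c) else (False, n - c)) # kp n (r - 1) k"

fun sT :: "nat => nat list => nat" where
 "sT r [] = 0"
| "sT r (c # k) = (if 0 < r then c else 0) + sT (r - 1) k"

fun sF :: "nat => nat => nat list => nat" where
 "sF n r [] = 0"
| "sF n r (c # k) = (if 0 < r then 0 else n - c) + sF n (r - 1) k"

text \<open>The order on shapes for the descending induction: moving c entries from one row to the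
  next raises it by c.\<close>

fun hh :: "nat => nat list => nat" where
 "hh p [] = 0"
| "hh p (c # k) = p * c + hh (Suc p) k"

lemma rw_append: "rw n r (zs @ zs') = rw n r zs @ rw n (r - length zs) zs'" by (induction zs arbitrary: r) simp_all
lemma kp_append: "kp n r (k @ k') = kp n r k @ kp n (r - length k) k'" by (induction k arbitrary: r) simp_all
lemma sT_append: "sT r (k @ k') = sT r k + sT (r - length k) k'" by (induction k arbitrary: r) simp_all
lemma sF_append: "sF n r (k @ k') = sF n r k + sF n (r - length k) k'" by (induction k arbitrary: r) simp_all
lemma hh_append: "hh p (k @ k') = hh p k + hh (p + length k) k'" by (induction k arbitrary: p) simp_all
lemma sT_0 [simp]: "sT 0 k = 0" by (induction k) simp_all
lemma sF_long: "length k \<le> r ==> sF n r k = 0" by (induction k arbitrary: r) auto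
lemma tot_kp: "tot (kp n r k) = sT r k + sF n r k" by (induction k arbitrary: r) simp_all

definition subs :: "nat => nat set list => bool" where "subs n zs \<longleftrightarrow> (\<forall>Z\<in>set zs. Z \<subseteq> {1..n})"

lemma rw_rws: "subs n zs ==> rw n r zs \<in> rws n (kp n r (map card zs))"
proof (induction zs arbitrary: r)
 case Nil thus ?case by (simp add: rws_def)
next
 case (Cons Z zs)
 hence Z: "Z \<subseteq> {1..n}" by (simp add: subs_def)
 hence "card ({1..n} - Z) = n - card Z" using card_Diff_subset[OF finite_subset[OF Z finite_atLeastAtMost] Z] by simp
 thus ?case using Cons Z by (auto simp: rws_Cons subs_def)
qed

lemma rws_kp: "X \<in> rws n (kp n r k) ==> (\<And>c. c \<in> set k ==> c \<le> n) ==> \<exists>zs. X = rw n r zs \<and> map card zs = k \<and> subs n zs"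
proof (induction k arbitrary: X r)
 case Nil thus ?case by (auto simp: rws_def szs_def subs_def)
next
 case (Cons c k)
 obtain b Y vs where X: "X = (b, Y) # vs" "Y \<subseteq> {1..n}" "vs \<in> rws n (kp n (r - 1) k)" "b = (0 < r)" "card Y = (if 0 < r then c else n - c)"
  using Cons.prems(1) by (auto simp: rws_Cons' split: if_splits)
 obtain zs where zs: "vs = rw n (r - 1) zs" "map card zs = k" "subs n zs" using Cons.IH[OF X(3)] Cons.prems(2) by auto
 have f: "finite Y" using X(2) finite_subset by blast
 define Z where "Z = (if 0 < r then Y else {1..n} - Y)"
 have "card ({1..n} - Y) = n - card Y" using card_Diff_subset[OF f X(2)] by simp
 hence "card Z = c" using X(5) Cons.prems(2)[of c] by (auto simp: Z_def)
 moreover have "X = rw n r (Z # zs)" using X zs by (auto simp: Z_def double_diff)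
 moreover have "subs n (Z # zs)" using zs X by (auto simp: subs_def Z_def)
 ultimately show ?case using zs by (intro exI[of _ "Z # zs"]) simp
qed

lemma ok_kp: "(\<And>a. ofs \<le> a ==> Suc a < ofs + sT r k ==> P True a) ==> (\<And>a. ofs + sT r k \<le> a ==> Suc a < ofs + sT r k + sF n r k ==> P False a) ==>
 ok P ofs (kp n r k)"
proof (induction k arbitrary: r ofs)
 case (Cons c k)
 show ?case
 proof (cases "0 < r")
  case True
  have "ok P (ofs + c) (kp n (r - 1) k)" by (rule Cons.IH) (use Cons.prems True in \<open>auto simp: add.assoc\<close>)
  thus ?thesis using True Cons.prems(1) by auto
 next
  case False
  have "ok P (ofs + (n - c)) (kp n (r - 1) k)" by (rule Cons.IH) (use Cons.prems False in auto)
  thus ?thesis using False Cons.prems(2) by auto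
 qed
qed simp

subsection \<open>Counting\<close>

lemma icr_flip: "icr False A C = icr True C A"
proof -
 have "{(a, c). a \<in> A \<and> c \<in> C \<and> lt False c a} = prod.swap ` {(a, c). a \<in> C \<and> c \<in> A \<and> lt True c a}" by (auto simp: lt_def)
 thus ?thesis by (simp add: icr_def card_image)
qed

lemma icr_unL: assumes "finite A" "finite A'" "finite C" "A \<inter> A' = {}" shows "icr b (A \<union> A') C = icr b A C + icr b A' C"
proof -
 have "{(a, c). a \<in> A \<union> A' \<and> c \<in> C \<and> lt b c a} = {(a, c). a \<in> A \<and> c \<in> C \<and> lt b c a} \<union> {(a, c). a \<in> A' \<and> c \<in> C \<and> lt b c a}" by auto
 thus ?thesis unfolding icr_def using assms icr_finite by (subst card_Un_disjoint[symmetric]) auto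
qed

lemma icr_unR: assumes "finite C" "finite C'" "finite A" "C \<inter> C' = {}" shows "icr b A (C \<union> C') = icr b A C + icr b A C'"
proof -
 have "{(a, c). a \<in> A \<and> c \<in> C \<union> C' \<and> lt b c a} = {(a, c). a \<in> A \<and> c \<in> C \<and> lt b c a} \<union> {(a, c). a \<in> A \<and> c \<in> C' \<and> lt b c a}" by auto
 thus ?thesis unfolding icr_def using assms icr_finite by (subst card_Un_disjoint[symmetric]) auto
qed

lemma icr_both: assumes "finite A" "finite C" shows "icr True A C + icr True C A + card (A \<inter> C) = card A * card C"
proof -
 let ?X = "{(a, c). a \<in> A \<and> c \<in> C \<and> c < a}" and ?Y = "{(a, c). a \<in> A \<and> c \<in> C \<and> a < c}" and ?Z = "(\<lambda>x. (x, x)) ` (A \<inter> C)"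
 have f: "finite ?X" "finite ?Y" "finite ?Z" by (rule finite_subset[of _ "A \<times> C"]; use assms in auto)+
 have "A \<times> C = (?X \<union> ?Y) \<union> ?Z" by (auto simp: image_iff)
 hence "card A * card C = card ((?X \<union> ?Y) \<union> ?Z)" by (metis card_cartesian_product)
 also have "... = card (?X \<union> ?Y) + card ?Z" by (rule card_Un_disjoint) (use f in auto)
 also have "card (?X \<union> ?Y) = card ?X + card ?Y" by (rule card_Un_disjoint) (use f in auto)
 also have "card ?Z = card (A \<inter> C)" by (rule card_image) (auto simp: inj_on_def)
 also have "card ?X = icr True A C" by (simp add: icr_def lt_def)
 also have "card ?Y = icr True C A" using icr_flip[of A C] by (simp add: icr_def lt_def)
 finally show ?thesis by simp
qed

lemma icr_full: "finite C ==> C \<subseteq> {1..n} ==> icr True {1..n} C + \<Sum>C = n * card C"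
proof (induction C rule: finite_induct)
 case (insert c C)
 have "icr True {1..n} (insert c C) = icr True {1..n} {c} + icr True {1..n} C"
  using icr_unR[of "{c}" C "{1..n}" True] insert by simp
 moreover have "icr True {1..n} {c} = n - c"
 proof -
  have "{y \<in> {1..n}. lt True c y} = {Suc c..n}" by (auto simp: lt_def)
  thus ?thesis by (simp add: icr_single)
 qed
 ultimately show ?case using insert by (simp add: algebra_simps)
qed simp

text \<open>The exponent for complemented rows differs from that for the rows themselves by a
  quantity depending only on n and on cardinalities. It is constant along the sum over C and can be
  extracted as a unit.\<close>

lemma stat_dual: assumes A: "A \<subseteq> {1..n}" and B: "B \<subseteq> {1..n}" and C: "C \<subseteq> B - A"
 shows "icr False ({1..n} - A - C) C + icr False C ({1..n} - B) + card A * card C + card (B - C) * card C + card C * card C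
  = n * card C + (icr True C (B - C) + icr True A C)"
proof -
 have f: "finite A" "finite B" "finite C" using A B C finite_subset[of _ "{1..n}"] by (auto intro: finite_subset[of C B])
 have c1: "icr True C {1..n} = icr True C ({1..n} - A - C) + icr True C A + icr True C C"
 proof -
  have "{1..n} = (({1..n} - A - C) \<union> A) \<union> C" using A B C by blast
  hence "icr True C {1..n} = icr True C ((({1..n} - A - C) \<union> A) \<union> C)" by simp
  also have "... = icr True C ({1..n} - A - C) + icr True C A + icr True C C"
   using C f by (subst icr_unR; (subst icr_unR)?) auto
  finally show ?thesis .
 qed
 have c2: "icr True {1..n} C = icr True ({1..n} - B) C + icr True (B - C) C + icr True C C"
 proof -
  have "{1..n} = (({1..n} - B) \<union> (B - C)) \<union> C" using A B C by blast
  hence "icr True {1..n} C = icr True ((({1..n} - B) \<union> (B - C)) \<union> C) C" by simp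
  also have "... = icr True ({1..n} - B) C + icr True (B - C) C + icr True C C"
   using C f by (subst icr_unL; (subst icr_unL)?) auto
  finally show ?thesis .
 qed
 have b1: "icr True {1..n} C + icr True C {1..n} + card C = n * card C"
 proof -
  have "{1..n} \<inter> C = C" using B C by blast
  thus ?thesis using icr_both[of "{1..n}" C] f by simp
 qed
 have b2: "icr True C C + icr True C C + card C = card C * card C" using icr_both[of C C] f by simp
 have b3: "icr True A C + icr True C A = card A * card C"
 proof -
  have "A \<inter> C = {}" using C by blast
  thus ?thesis using icr_both[of A C] f by simp
 qed
 have b4: "icr True (B - C) C + icr True C (B - C) = card (B - C) * card C"
 proof -
  have "(B - C) \<inter> C = {}" by blast
  thus ?thesis using icr_both[of "B - C" C] f by simp
 qed
 show ?thesis unfolding icr_flip using c1 c2 b1 b2 b3 b4 by linarith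
qed

text \<open>At the wall only one of the two rows is complemented, and the discrepancy also contains
  the entry sum of C. This part varies with C; it is the reason for the factor
  \<open>gz\<close>.\<close>

lemma stat_wall: assumes A: "A \<subseteq> {1..n}" and B: "B \<subseteq> {1..n}" and C: "C \<subseteq> B - A"
 shows "icr True A C + icr False C ({1..n} - B) + \<Sum>C + card (B - C) * card C + (card C * card C - card C) div 2
  = n * card C + (icr True C (B - C) + icr True A C)"
proof -
 have f: "finite A" "finite B" "finite C" using A B C finite_subset[of _ "{1..n}"] by (auto intro: finite_subset[of C B])
 have c2: "icr True {1..n} C = icr True ({1..n} - B) C + icr True (B - C) C + icr True C C"
 proof -
  have "{1..n} = (({1..n} - B) \<union> (B - C)) \<union> C" using A B C by blast
  hence "icr True {1..n} C = icr True ((({1..n} - B) \<union> (B - C)) \<union> C) C" by simp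
  also have "... = icr True ({1..n} - B) C + icr True (B - C) C + icr True C C"
   using C f by (subst icr_unL; (subst icr_unL)?) auto
  finally show ?thesis .
 qed
 have b1: "icr True {1..n} C + \<Sum>C = n * card C" by (rule icr_full[OF f(3)]) (use A B C in auto)
 have b2: "icr True C C + icr True C C + card C = card C * card C" using icr_both[of C C] f by simp
 have b4: "icr True (B - C) C + icr True C (B - C) = card (B - C) * card C"
 proof -
  have "(B - C) \<inter> C = {}" by blast
  thus ?thesis using icr_both[of "B - C" C] f by simp
 qed
 have "icr True C C = (card C * card C - card C) div 2" using b2 by linarith
 thus ?thesis unfolding icr_flip using c2 b1 b4 by linarith
qed

lemma unit_cancel: "u dvd 1 ==> u * x = 0 ==> x = (0 :: 'a::comm_ring_1)"
proof -
 assume u: "u dvd 1" "u * x = 0"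
 then obtain v where "1 = u * v" by (auto simp: dvd_def)
 hence "x = v * (u * x)" by (metis mult.left_commute mult.right_neutral mult.commute)
 thus "x = 0" using u by simp
qed

subsection \<open>Relations\<close>

context
 fixes q :: "'a::comm_ring_1" and n :: nat
 assumes q: "q dvd 1" and n: "1 \<le> n"
begin

text \<open>The shape k lives at level c, after contraction of c pairs: its V-rows hold r - c
  entries and its dual rows s - c. By \<open>level_eq\<close> a shape has at most one level.\<close>

definition lvl :: "nat => nat => nat list => nat => bool" where
 "lvl r s k c \<longleftrightarrow> length k = r + s \<and> (\<forall>x\<in>set k. x \<le> n) \<and> sT r k + c = r \<and> sF n r k + c = s"

definition Dz :: "nat => nat => nat list => nat => 'a mat => (bool \<times> nat set) list => (bool \<times> nat set) list => 'a" where
 "Dz r s k c M X Y = DD n (sT r k + sF n r k) q (lv n r s c M) X Y"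

definition van :: "nat => nat => 'a mat => nat list => bool" where
 "van r s M k \<longleftrightarrow> (\<forall>c. lvl r s k c --> (\<forall>X\<in>rws n (kp n r k). \<forall>Y\<in>rws n (kp n r k). Dz r s k c M X Y = 0))"

lemma lvl_qSchur: assumes "M \<in> qSchur n q r s" "lvl r s k c"
 shows "lv n r s c M \<in> qSchur n q (sT r k) (sF n r k)" "ok (cm n (sT r k + sF n r k) q (lv n r s c M)) 0 (kp n r k)"
proof -
 have "r - c = sT r k" "s - c = sF n r k" "c \<le> r" "c \<le> s" using assms(2) by (auto simp: lvl_def)
 thus N: "lv n r s c M \<in> qSchur n q (sT r k) (sF n r k)" using lv_qSchur[OF q n assms(1), of c] by simp
 hence "hk n q (sT r k) (sF n r k) (lv n r s c M)" by (simp add: qSchur_iff[OF q n])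
 thus "ok (cm n (sT r k + sF n r k) q (lv n r s c M)) 0 (kp n r k)" by (intro ok_kp) (auto simp: hk_def)
qed

lemma van_kill: assumes "M \<in> qSchur n q r s" "lvl r s k c" "van r s M k" "Y \<in> rws n (kp n r k)" "bas n (sT r k + sF n r k) x"
 shows "ap n (sT r k + sF n r k) (lv n r s c M) (cf q Y) x = 0"
proof -
 have "ap n (sT r k + sF n r k) (lv n r s c M) (cf q Y) x = (\<Sum>X\<in>rws n (kp n r k). cf q X x * Dz r s k c M X Y)"
  unfolding Dz_def by (rule ap_cf[OF q lvl_qSchur(2)[OF assms(1,2)] tot_kp assms(5,4)])
 also have "... = 0" using assms(2-4) by (intro sum.neutral) (auto simp: van_def)
 finally show ?thesis .
qed

text \<open>A unit attached to the last row before the wall. It absorbs the entry sum in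
  \<open>stat_wall\<close>, so that the wall relation takes the form of all the others.\<close>

definition gz :: "nat => nat => nat set => 'a" where
 "gz r p A = (if Suc p = r then qpow (- q) (- int (\<Sum>A)) else 1)"

lemma mq: "- q dvd 1" using q by simp

text \<open>The tensor with rows A and B has a shape k' with larger \<open>hh\<close>, so it is
  killed by the induced element. Inside V this feeds \<open>rel_right\<close>, inside the dual part
  \<open>rel_left\<close>, and at the wall \<open>rel_wall\<close>, where k' sits c levels deeper.
  After extraction of a unit the three cases agree.\<close>

lemma relation:
 assumes M: "M \<in> qSchur n q r s" and k: "k = k1 @ a0 # b0 # k2" "lvl r s k l" and hi: "\<And>k'. hh 0 k < hh 0 k' ==> van r s M k'"
  and z1: "subs n z1" "map card z1 = k1" and z2: "subs n z2" "map card z2 = k2"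
  and A: "A \<subseteq> {1..n}" "card A + c = a0" and B: "B \<subseteq> {1..n}" "card B = b0 + c" and c: "1 \<le> c" and X: "X \<in> rws n (kp n r k)"
 shows "(\<Sum>C\<in>{C. C \<subseteq> B - A \<and> card C = c}. (- q) ^ (icr True C (B - C) + icr True A C) * (gz r (length z1) (A \<union> C) * Dz r s k l M X (rw n r (z1 @ (A \<union> C) # (B - C) # z2)))) = 0"
  (is "sum ?G ?S = 0")
proof -
 let ?p = "length z1" and ?A' = "{1..n} - A" and ?B' = "{1..n} - B" and ?u = "rw n r z1" and ?v = "\<lambda>i. rw n i z2"
 define k' where "k' = k1 @ card A # card B # k2"
 define N where "N = lv n r s l M"
 define m where "m = sT r k + sF n r k"
 have lk1: "length k1 = ?p" using z1 by auto
 have f: "finite A" "finite B" using A B finite_subset by auto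
 have Bn: "card B \<le> n" using card_mono[OF _ B(1)] by simp
 have hk': "hh 0 k' = hh 0 k + c" unfolding k k'_def A(2)[symmetric] B(2) by (simp add: hh_append lk1 algebra_simps)
 hence van: "van r s M k'" using hi c by simp
 have len: "length k' = r + s" "\<forall>x\<in>set k'. x \<le> n" and a: "a0 \<le> n" "b0 \<le> n" using k A Bn unfolding k'_def lvl_def by auto
 have us: "?u \<in> rws n (kp n r k1)" using rw_rws[OF z1(1), of r] z1(2) by simp
 have vs: "?v r' \<in> rws n (kp n r' k2)" for r' using rw_rws[OF z2(1), of r'] z2(2) by simp
 have okN: "ok (cm n m q N) 0 (kp n r k)" "N \<in> qSchur n q (sT r k) (sF n r k)" using lvl_qSchur[OF M k(2)] by (simp_all add: N_def m_def)
 have C: "C \<subseteq> B - A" "card C = c" "card (B - C) = b0" "finite C" if "C \<in> ?S" for C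
  using that card_Diff_subset[of C B] finite_subset[of C B] f B by auto
 have tk: "tot (kp n r k) = m" unfolding m_def by (rule tot_kp)
 consider (VV) "Suc ?p < r" | (W) "Suc ?p = r" | (FF) "r \<le> ?p" by linarith
 thus ?thesis
 proof cases
  case VV
  let ?w = "?v (r - ?p - 2)"
  have e: "kp n r k = kp n r k1 @ (True, card A + c) # (True, b0) # kp n (r - ?p - 2) k2"
   "kp n r k' = kp n r k1 @ (True, card A) # (True, card B) # kp n (r - ?p - 2) k2"
   using VV A unfolding k k'_def by (simp_all add: kp_append lk1)
  have s: "sT r k' = sT r k" "sF n r k' = sF n r k" using VV A B unfolding k k'_def by (simp_all add: sT_append sF_append lk1)
  hence lv': "lvl r s k' l" using len k(2) by (simp add: lvl_def)
  have R: "rw n r (z1 @ A' # B' # z2) = ?u @ (True, A') # (True, B') # ?w" for A' B'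
   using VV by (simp add: rw_append)
  have "(\<Sum>C\<in>?S. (- q) ^ (icr True C (B - C) + icr True A C) * DD n m q N X (?u @ (True, A \<union> C) # (True, B - C) # ?w)) = 0"
  proof (rule rel_right[OF q n okN(1)[unfolded e] tk[unfolded e] X[unfolded e] us vs A(1) refl B(1)])
   show "card B = c + b0" using B by simp
   fix x assume x: "bas n m x"
   have "?u @ (True, A) # (True, B) # ?w \<in> rws n (kp n r k')"
    unfolding e by (intro rws_app us) (use A B vs in \<open>simp add: rws_Cons\<close>)
   from van_kill[OF M lv' van this, of x] x show "ap n m N (cf q (?u @ (True, A) # (True, B) # ?w)) x = 0"
    by (simp add: s m_def N_def)
  qed
  thus ?thesis using VV by (simp add: gz_def R Dz_def m_def N_def)
 next
  case FF
  let ?D = "\<lambda>C. DD n m q N X (?u @ (False, ?A' - C) # (False, C \<union> ?B') # ?v 0)" and ?e = "\<lambda>C. icr False (?A' - C) C + icr False C ?B'"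
   and ?z = "int (n * c) - int (card A * c + b0 * c + c * c)"
  have cA: "card ?A' = (n - a0) + c" "card ?B' = n - b0 - c" using card_Diff_subset[OF f(1) A(1)] card_Diff_subset[OF f(2) B(1)] A B a by simp_all
  have e: "kp n r k = kp n r k1 @ (False, n - a0) # (False, c + (n - b0 - c)) # kp n 0 k2"
   "kp n r k' = kp n r k1 @ (False, n - card A) # (False, n - card B) # kp n 0 k2"
   using FF A B Bn unfolding k k'_def by (simp_all add: kp_append lk1)
  have s: "sT r k' = sT r k" "sF n r k' = sF n r k" using FF A B Bn a unfolding k k'_def by (auto simp: sT_append sF_append lk1)
  hence lv': "lvl r s k' l" using len k(2) by (simp add: lvl_def)
  have R: "rw n r (z1 @ A' # B' # z2) = ?u @ (False, {1..n} - A') # (False, {1..n} - B') # ?v 0" for A' B'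
   using FF by (simp add: rw_append)
  have SS: "{C. C \<subseteq> ?A' - ?B' \<and> card C = c} = ?S" using B by auto
  have "(\<Sum>C\<in>{C. C \<subseteq> ?A' - ?B' \<and> card C = c}. (- q) ^ ?e C * ?D C) = 0"
  proof (rule rel_left[OF q n okN(1)[unfolded e] tk[unfolded e] X[unfolded e] us vs _ cA(1) _ cA(2)])
   fix x assume x: "bas n m x"
   have "?u @ (False, ?A') # (False, ?B') # ?v 0 \<in> rws n (kp n r k')"
    unfolding e by (intro rws_app us) (use cA A B Bn vs a in \<open>auto simp: rws_Cons\<close>)
   from van_kill[OF M lv' van this, of x] x show "ap n m N (cf q (?u @ (False, ?A') # (False, ?B') # ?v 0)) x = 0"
    by (simp add: s m_def N_def)
  qed auto
  also have "(\<Sum>C\<in>{C. C \<subseteq> ?A' - ?B' \<and> card C = c}. (- q) ^ ?e C * ?D C) = (\<Sum>C\<in>?S. qpow (- q) ?z * ?G C)"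
   unfolding SS
  proof (intro sum.cong refl)
   fix C assume CS: "C \<in> ?S"
   have "?e C + card A * c + b0 * c + c * c = n * c + (icr True C (B - C) + icr True A C)"
    using stat_dual[OF A(1) B(1) C(1)[OF CS]] C[OF CS] by simp
   hence x: "int (?e C) = ?z + int (icr True C (B - C) + icr True A C)" by linarith
   have E: "(- q) ^ ?e C = qpow (- q) ?z * (- q) ^ (icr True C (B - C) + icr True A C)"
    unfolding qpow_of_nat[symmetric] qpow_add[OF mq, symmetric] x ..
   have s1: "?A' - C = {1..n} - (A \<union> C)" "C \<union> ?B' = {1..n} - (B - C)" using CS B by auto
   show "(- q) ^ ?e C * ?D C = qpow (- q) ?z * ?G C"
    unfolding E R unfolding s1 using FF by (simp add: gz_def Dz_def m_def N_def mult.assoc)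
  qed
  finally show ?thesis unfolding sum_distrib_left[symmetric] by (rule unit_cancel[OF qpow_unit[OF mq]])
 next
  case W
  let ?D = "\<lambda>C. DD n m q N X (?u @ (True, A \<union> C) # (False, C \<union> ?B') # ?v 0)" and ?e = "\<lambda>C. icr True A C + icr False C ?B'"
   and ?z = "int (n * c) - int (b0 * c + (c * c - c) div 2) + int (\<Sum>A)" and ?g = "cf q (?u @ (True, A) # (False, ?B') # ?v 0)"
   and ?r = "sT r k'" and ?s = "sF n r k'"
  have rp: "r - ?p = 1" "0 < r" using W by auto
  have cB: "card ?B' = n - b0 - c" using card_Diff_subset[OF f(2) B(1)] B a by simp
  have e: "kp n r k = kp n r k1 @ (True, card A + c) # (False, c + (n - b0 - c)) # kp n 0 k2"
   "kp n r k' = kp n r k1 @ (True, card A) # (False, n - card B) # kp n 0 k2"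
   using rp A B Bn unfolding k k'_def by (simp_all add: kp_append lk1)
  have t1: "tot (kp n r k1) = sT r k1" using sF_long[of k1 r n] lk1 W by (simp add: tot_kp)
  have s: "?r + c = sT r k" "?s + c = sF n r k" "?r = tot (kp n r k1) + card A"
   using rp A B Bn a unfolding k k'_def t1 by (auto simp: sT_append sF_append lk1)
  hence lv': "lvl r s k' (l + c)" using len k(2) by (auto simp: lvl_def)
  have R: "rw n r (z1 @ A' # B' # z2) = ?u @ (True, A') # (False, {1..n} - B') # ?v 0" for A' B'
   using rp by (simp add: rw_append)
  have SS: "{C. C \<subseteq> {1..n} - ?B' - A \<and> card C = c} = ?S" using B by auto
  have lN: "lv n r s (l + c) M = lv n (sT r k) (sF n r k) c N"
  proof -
   have "r - l = sT r k" "s - l = sF n r k" using k(2) by (auto simp: lvl_def)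
   thus ?thesis using lv_lv[OF q n, of r s l c M] by (simp add: N_def)
  qed
  have "(\<Sum>C\<in>{C. C \<subseteq> {1..n} - ?B' - A \<and> card C = c}. (- q) ^ ?e C * ?D C) = 0"
  proof (rule rel_wall[OF q n okN(1)[unfolded e] tk[unfolded e] X[unfolded e] us vs A(1) refl _ cB])
   have Y: "?u @ (True, A) # (False, ?B') # ?v 0 \<in> rws n (kp n r k')"
    unfolding e by (intro rws_app us) (use cB A B Bn vs a in \<open>auto simp: rws_Cons\<close>)
   fix x assume x: "bas n m x"
   have N': "N \<in> qSchur n q (?r + c) (?s + c)" using okN(2) unfolding s(1,2)[symmetric] .
   have mm: "m = ?r + c + (?s + c)" unfolding m_def s(1,2)[symmetric] by simp
   have ln: "length x = ?r + c + (c + ?s)" using x mm by (simp add: bas_length)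
   have "ap n m N (iotac ?r c ?g) x = iotac ?r c (ap n (?r + ?s) (lv n (?r + c) (?s + c) c N) ?g) x"
    using lv_iotac[OF q n N'] x unfolding mm by simp
   also have "... = 0"
   proof -
    have b: "bas n (?r + ?s) (take ?r x @ drop (?r + c + c) x)"
     using x ln set_take_subset[of ?r x] set_drop_subset[of "?r + c + c" x] by (auto simp: bas_def)
    have "ap n (?r + ?s) (lv n r s (l + c) M) ?g (take ?r x @ drop (?r + c + c) x) = 0"
     by (rule van_kill[OF M lv' van Y b])
    thus ?thesis unfolding lN s(1,2)[symmetric] by (simp add: iotac_def[OF q n])
   qed
   finally show "ap n m N (iotac (tot (kp n r k1) + card A) c ?g) x = 0" by (simp add: s)
  next
   fix j assume "Suc j < c"
   thus "cm n m q N True (tot (kp n r k1) + card A + j)" using okN(2) s unfolding qSchur_iff[OF q n] hk_def m_def by auto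
  qed auto
  also have "(\<Sum>C\<in>{C. C \<subseteq> {1..n} - ?B' - A \<and> card C = c}. (- q) ^ ?e C * ?D C) = (\<Sum>C\<in>?S. qpow (- q) ?z * ?G C)"
   unfolding SS
  proof (intro sum.cong refl)
   fix C assume CS: "C \<in> ?S"
   have SAC: "\<Sum>(A \<union> C) = \<Sum>A + \<Sum>C" using C[OF CS] f by (intro sum.union_disjoint) auto
   have "?e C + \<Sum>C + b0 * c + (c * c - c) div 2 = n * c + (icr True C (B - C) + icr True A C)"
    using stat_wall[OF A(1) B(1) C(1)[OF CS]] C[OF CS] by simp
   \<comment> \<open>The entry sum of C is completed to that of A \<union> C, the row that
     \<open>gz\<close> sees; the entry sum of A goes into the constant.\<close>
   hence x: "int (?e C) = ?z + (int (icr True C (B - C) + icr True A C) + - int (\<Sum>(A \<union> C)))" unfolding SAC by linarith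
   have E: "(- q) ^ ?e C = qpow (- q) ?z * ((- q) ^ (icr True C (B - C) + icr True A C) * gz r ?p (A \<union> C))"
    using W unfolding gz_def qpow_of_nat[symmetric] x by (simp only: if_True simp_thms qpow_add[OF mq])
   have s1: "C \<union> ?B' = {1..n} - (B - C)" using CS B by auto
   show "(- q) ^ ?e C * ?D C = qpow (- q) ?z * ?G C"
    unfolding E R unfolding s1 by (simp add: Dz_def m_def N_def mult.assoc)
  qed
  finally show ?thesis unfolding sum_distrib_left[symmetric] by (rule unit_cancel[OF qpow_unit[OF mq]])
 qed
qed

end

section \<open>Straightening of whole row lists\<close>

definition stdz :: "nat => nat set list => bool" where
 "stdz n = successively (gle n)"

definition SZ :: "nat => nat set => nat" where "SZ n Z = (\<Sum>x\<le>n. card (Z \<inter> {1..x}))"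

fun pt :: "nat => nat => nat set list => nat" where
 "pt n p [] = 0"
| "pt n p (Z # zs) = p * SZ n Z + pt n (Suc p) zs"

lemma pt_append: "pt n p (z1 @ z2) = pt n p z1 + pt n (p + length z1) z2" by (induction z1 arbitrary: p) simp_all

definition zset :: "nat => nat list => nat set list set" where "zset n k = {zs. subs n zs \<and> map card zs = k}"

lemma finite_zset: "finite (zset n k)"
proof -
 have "zset n k \<subseteq> {zs. set zs \<subseteq> Pow {1..n} \<and> length zs = length k}" by (auto simp: zset_def subs_def)
 thus ?thesis using finite_lists_length_eq[of "Pow {1..n}" "length k"] finite_subset by auto
qed

lemma obtain_max: assumes "finite S" "x \<in> S" obtains y where "y \<in> S" "\<And>z. z \<in> S ==> (f z :: nat) \<le> f y"
proof -
 have "Max (f ` S) \<in> f ` S" using assms by (intro Max_in) auto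
 then obtain y where "y \<in> S" "f y = Max (f ` S)" by auto
 thus ?thesis using that[of y] assms Max_ge[of "f ` S"] by auto
qed

lemma dw_append: "dw r (x @ y) = dw r x + dw (r - length x) y" by (induction x arbitrary: r) auto
lemma dw_long: "length x \<le> r ==> dw r x = 0" by (induction x arbitrary: r) auto
lemma dw_zero: "dw 0 x = int (sum_list x)" by (induction x) auto

fun dX :: "(bool \<times> nat set) list => int" where
 "dX [] = 0"
| "dX ((b, Y) # Ys) = (if b then 0 else int (\<Sum>Y)) + dX Ys"

text \<open>All words in the support of a row tensor carry the same letters on the dual side, so the
  twist of \<open>TT\<close> is constant on it.\<close>

lemma cf_dw: "X \<in> rws n (kp n r k) ==> cf q X w \<noteq> (0::'a::comm_ring_1) ==> dw (sT r k) w = dX X"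
proof (induction k arbitrary: r X w)
 case Nil
 thus ?case by (auto simp: rws_def szs_def split: if_splits)
next
 case (Cons c k)
 obtain b Y vs where X: "X = (b, Y) # vs" "Y \<subseteq> {1..n}" "vs \<in> rws n (kp n (r - 1) k)" "b = (0 < r)" "card Y = (if 0 < r then c else n - c)"
  using Cons.prems(1) by (auto simp: rws_Cons' split: if_splits)
 define u v where "u = take (card Y) w" and "v = drop (card Y) w"
 have w: "w = u @ v" by (simp add: u_def v_def)
 have nz: "io q b Y u \<noteq> 0" "cf q vs v \<noteq> 0" using Cons.prems(2) X by (auto simp: u_def v_def)
 have lu: "length u = card Y" by (rule io_length[OF nz(1)])
 have IH: "dw (sT (r - 1) k) v = dX vs" by (rule Cons.IH[OF X(3) nz(2)])
 show ?case
 proof (cases "0 < r")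
  case True
  hence "dw (sT r (c # k)) w = dw (c + sT (r - 1) k) u + dw (c + sT (r - 1) k - length u) v" by (simp add: w dw_append)
  thus ?thesis using IH X True lu by (simp add: dw_long)
 next
  case False
  have "distinct u" "set u = Y" using nz(1) by (auto simp: io_def asg_def split: if_splits)
  hence "sum_list u = \<Sum>Y" by (simp add: distinct_sum_list_conv_Sum)
  thus ?thesis using IH X False by (simp add: w dw_append dw_zero)
 qed
qed

fun sg :: "bool list => nat list => (bool \<times> nat set) list" where
 "sg (b # bs) (y # ys) = (b, {y}) # sg bs ys"
| "sg _ _ = []"

lemma sg: assumes "length bs = length x"
 shows "x0 (sg bs x) = x" "cf q (sg bs x) w = dlt x w" "set x \<subseteq> {1..n} ==> sg bs x \<in> rws n (map (\<lambda>b. (b, 1)) bs)"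
proof -
 show "x0 (sg bs x) = x" using assms by (induction bs x rule: list_induct2) simp_all
 show "cf q (sg bs x) w = dlt x w" using assms
 proof (induction bs x arbitrary: w rule: list_induct2)
  case (Cons b bs y ys)
  have "io q b {y} (take 1 w) = (if take 1 w = [y] then 1 else 0)"
   by (cases w) (auto simp: io_def asg_def)
  thus ?case using Cons by (cases w) (auto simp: dlt_def)
 qed (simp add: dlt_def)
 show "set x \<subseteq> {1..n} ==> sg bs x \<in> rws n (map (\<lambda>b. (b, 1)) bs)" using assms
  by (induction bs x rule: list_induct2) (auto simp: rws_Cons, auto simp: rws_def)
qed

context
 fixes q :: "'a::comm_ring_1" and n :: nat
 assumes q: "q dvd 1" and n: "1 \<le> n"
begin

text \<open>Take a row list of maximal potential among those with nonzero coefficient. It is not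
  standard, so some adjacent pair violates \<open>gle\<close>. Each pair that
  \<open>pair_straightening\<close> still asks about yields a list of larger potential, which has
  coefficient zero by maximality.\<close>

lemma column_zero: assumes M: "M \<in> qSchur n q r s" and k: "lvl n r s k l" and hi: "\<And>k'. hh 0 k < hh 0 k' ==> van q n r s M k'"
 and X: "X \<in> rws n (kp n r k)" and std: "\<And>zs. zs \<in> zset n k ==> stdz n zs ==> Dz q n r s k l M X (rw n r zs) = 0"
 and zs: "zs \<in> zset n k"
 shows "Dz q n r s k l M X (rw n r zs) = 0"
proof (rule ccontr)
 define Bad where "Bad = {zs \<in> zset n k. Dz q n r s k l M X (rw n r zs) \<noteq> 0}"
 assume "Dz q n r s k l M X (rw n r zs) \<noteq> 0"
 hence "zs \<in> Bad" using zs by (simp add: Bad_def)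
 moreover have "finite Bad" using finite_zset by (simp add: Bad_def)
 ultimately obtain y where y: "y \<in> Bad" "\<And>z. z \<in> Bad ==> pt n 0 z \<le> pt n 0 y" using obtain_max[of Bad zs "pt n 0"] by blast
 have yz: "subs n y" "map card y = k" "Dz q n r s k l M X (rw n r y) \<noteq> 0" using y(1) by (auto simp: Bad_def zset_def)
 hence "\<not> stdz n y" using std[of y] by (auto simp: zset_def)
 then obtain p where p: "Suc p < length y" "\<not> gle n (y ! p) (y ! Suc p)" by (auto simp: stdz_def successively_conv_nth)
 define z1 A0 B0 z2 where "z1 = take p y" and "A0 = y ! p" and "B0 = y ! Suc p" and "z2 = drop (Suc (Suc p)) y"
 have Y: "y = z1 @ A0 # B0 # z2" using p by (simp add: z1_def A0_def B0_def z2_def Cons_nth_drop_Suc)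
 have l1: "length z1 = p" using p by (simp add: z1_def)
 have sub: "subs n z1" "subs n z2" "A0 \<subseteq> {1..n}" "B0 \<subseteq> {1..n}" using yz(1) by (auto simp: Y subs_def)
 have kk: "k = map card z1 @ card A0 # card B0 # map card z2" using yz(2) Y by simp
 have "gz q r (length z1) A0 * Dz q n r s k l M X (rw n r (z1 @ A0 # B0 # z2)) = 0"
 proof (rule pair_straightening[OF mq[OF q n] sub(3,4)])
  fix c A B assume "1 \<le> c" "A \<subseteq> {1..n}" "B \<subseteq> {1..n}" "card A + c = card A0" "card B = card B0 + c"
  thus "(\<Sum>C\<in>{C. C \<subseteq> B - A \<and> card C = c}. (- q) ^ (icr True C (B - C) + icr True A C) * (gz q r (length z1) (A \<union> C) * Dz q n r s k l M X (rw n r (z1 @ (A \<union> C) # (B - C) # z2)))) = 0"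
   by (intro relation[OF q n M kk k hi sub(1) refl sub(2) refl _ _ _ _ _ X]) auto
 next
  fix A B assume AB: "A \<subseteq> {1..n}" "B \<subseteq> {1..n}" "card A = card A0" "card B = card B0" and g: "gle n A B"
   and x: "\<And>x. x \<le> n ==> card (A \<inter> {1..x}) + card (B \<inter> {1..x}) = card (A0 \<inter> {1..x}) + card (B0 \<inter> {1..x}) \<and> card (B0 \<inter> {1..x}) \<le> card (B \<inter> {1..x})"
  have "SZ n A + SZ n B = SZ n A0 + SZ n B0" unfolding SZ_def sum.distrib[symmetric] by (rule sum.cong) (use x in auto)
  moreover have "SZ n B0 < SZ n B" unfolding SZ_def
  proof (rule sum_strict_mono_ex1)
   show "\<forall>y\<in>{..n}. card (B0 \<inter> {1..y}) \<le> card (B \<inter> {1..y})" using x by auto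
   obtain y where y: "y \<le> n" "card (B0 \<inter> {1..y}) < card (A0 \<inter> {1..y})" using p(2) unfolding gle_def A0_def B0_def by (auto simp: not_le)
   moreover have "card (A \<inter> {1..y}) \<le> card (B \<inter> {1..y})" using g y by (auto simp: gle_def)
   ultimately have "card (B0 \<inter> {1..y}) < card (B \<inter> {1..y})" using x[of y] by linarith
   thus "\<exists>y\<in>{..n}. card (B0 \<inter> {1..y}) < card (B \<inter> {1..y})" using y by blast
  qed simp
  \<comment> \<open>The pair keeps its total and the later position weighs one more, so precisely
    the gain of the second row is seen.\<close>
  ultimately have "p * SZ n A0 + Suc p * SZ n B0 < p * SZ n A + Suc p * SZ n B"
  proof -
   assume 1: "SZ n A + SZ n B = SZ n A0 + SZ n B0" and 2: "SZ n B0 < SZ n B"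
   have "p * SZ n A + Suc p * SZ n B = p * (SZ n A + SZ n B) + SZ n B" by (simp add: algebra_simps)
   moreover have "p * SZ n A0 + Suc p * SZ n B0 = p * (SZ n A0 + SZ n B0) + SZ n B0" by (simp add: algebra_simps)
   ultimately show ?thesis using 1 2 by simp
  qed
  hence "pt n 0 y < pt n 0 (z1 @ A # B # z2)" unfolding Y by (simp add: pt_append l1)
  hence "z1 @ A # B # z2 \<notin> Bad" using y(2)[of "z1 @ A # B # z2"] by auto
  moreover have "z1 @ A # B # z2 \<in> zset n k" using AB sub by (auto simp: zset_def kk subs_def)
  ultimately show "gz q r (length z1) A * Dz q n r s k l M X (rw n r (z1 @ A # B # z2)) = 0" by (simp add: Bad_def)
 qed
 moreover have "gz q r (length z1) A0 dvd 1" using qpow_unit[OF mq[OF q n]] by (simp add: gz_def[OF q n])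
 ultimately show False using unit_cancel yz(3) Y by metis
qed

lemma lv_TT: "M \<in> qSchur n q r s ==> c \<le> r ==> c \<le> s ==> lv n r s c (TT q r M) = TT q (r - c) (lv n r s c M)"
proof (induction c arbitrary: r s M)
 case 0 thus ?case by (simp add: lv.simps[OF q n])
next
 case (Suc c)
 obtain r' s' where rs: "r = Suc r'" "s = Suc s'" using Suc.prems by (metis Suc_le_D)
 show ?case using Suc.IH[OF nx_qSchur(2)[OF q n, of M r' s']] TT_nx[OF q n, of M r' s'] Suc.prems by (simp add: rs lv.simps[OF q n])
qed

lemma Dz_TT: assumes M: "M \<in> qSchur n q r s" and k: "lvl n r s k l" and X: "X \<in> rws n (kp n r k)" and Y: "Y \<in> rws n (kp n r k)"
 shows "Dz q n r s k l (TT q r M) Y X = tw q (sT r k) (x0 Y) (x0 X) * Dz q n r s k l M X Y"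
proof -
 define N where "N = lv n r s l M"
 have r: "r - l = sT r k" "l \<le> r" "l \<le> s" using k by (auto simp: lvl_def[OF q n])
 have T: "lv n r s l (TT q r M) = TT q (sT r k) N" using lv_TT[OF M r(2,3)] r(1) by (simp add: N_def)
 have "Dz q n r s k l (TT q r M) Y X = (\<Sum>w\<in>bset n (sT r k + sF n r k). tw q (sT r k) (x0 Y) w * N w (x0 Y) * cf q X w)"
  unfolding Dz_def[OF q n] DD_def T ap_def TT_def[OF q n] ..
 also have "... = (\<Sum>w\<in>bset n (sT r k + sF n r k). tw q (sT r k) (x0 Y) (x0 X) * (cf q X w * N w (x0 Y)))"
 proof (intro sum.cong refl)
  fix w
  show "tw q (sT r k) (x0 Y) w * N w (x0 Y) * cf q X w = tw q (sT r k) (x0 Y) (x0 X) * (cf q X w * N w (x0 Y))"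
  proof (cases "cf q X w = 0")
   case False
   hence "(1::'a) \<noteq> 0" by (metis mult_1 mult_zero_left)
   hence "cf q X (x0 X) \<noteq> 0" using cf_x0[OF X X, of q] by simp
   hence "dw (sT r k) w = dw (sT r k) (x0 X)" using cf_dw[OF X] False by metis
   thus ?thesis by (simp add: tw_def mult_ac)
  qed simp
 qed
 also have "... = tw q (sT r k) (x0 Y) (x0 X) * Dz q n r s k l M X Y"
  using DD_row[OF q lvl_qSchur(2)[OF q n M k] tot_kp X Y] by (simp add: Dz_def[OF q n] N_def sum_distrib_left)
 finally show ?thesis .
qed

lemma van_TT: assumes "M \<in> qSchur n q r s" "van q n r s M k" shows "van q n r s (TT q r M) k"
 using assms Dz_TT[OF assms(1)] by (auto simp: van_def[OF q n])

text \<open>Take a shape of maximal \<open>hh\<close> at which some coefficient survives.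
  \<open>column_zero\<close> straightens the second index; the twisted transpose exchanges the two
  indices, and the same argument then treats the first one.\<close>

lemma van_all: assumes M: "M \<in> qSchur n q r s"
 and std: "\<And>k l zs zs'. lvl n r s k l ==> zs \<in> zset n k ==> zs' \<in> zset n k ==> stdz n zs ==> stdz n zs' ==> Dz q n r s k l M (rw n r zs) (rw n r zs') = 0"
 shows "van q n r s M k"
proof (rule ccontr)
 define Bad where "Bad = {k. \<not> van q n r s M k}"
 assume "\<not> van q n r s M k"
 hence k: "k \<in> Bad" by (simp add: Bad_def)
 have "Bad \<subseteq> {k. set k \<subseteq> {..n} \<and> length k = r + s}" by (auto simp: Bad_def van_def[OF q n] lvl_def[OF q n])
 hence "finite Bad" using finite_lists_length_eq[of "{..n}" "r + s"] finite_subset by auto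
 then obtain y where y: "y \<in> Bad" "\<And>z. z \<in> Bad ==> hh 0 z \<le> hh 0 y" using obtain_max[OF _ k, of "hh 0"] by blast
 have hi: "van q n r s M k'" if "hh 0 y < hh 0 k'" for k' using y(2)[of k'] that by (auto simp: Bad_def)
 obtain l X Y where l: "lvl n r s y l" and XY: "X \<in> rws n (kp n r y)" "Y \<in> rws n (kp n r y)" "Dz q n r s y l M X Y \<noteq> 0"
  using y(1) by (auto simp: Bad_def van_def[OF q n])
 have ex: "Z \<in> rws n (kp n r y) ==> \<exists>zs\<in>zset n y. Z = rw n r zs" for Z
  using rws_kp[of Z n r y] l by (auto simp: lvl_def[OF q n] zset_def)
 have rz: "zs \<in> zset n y ==> rw n r zs \<in> rws n (kp n r y)" for zs using rw_rws[of n zs r] by (auto simp: zset_def)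
 have 1: "Dz q n r s y l M (rw n r zs) Z = 0" if z: "zs \<in> zset n y" "stdz n zs" "Z \<in> rws n (kp n r y)" for zs Z
 proof -
  obtain zs' where "zs' \<in> zset n y" "Z = rw n r zs'" using ex[OF z(3)] by blast
  thus ?thesis using column_zero[OF M l hi rz[OF z(1)]] std[OF l z(1)] z(2) by simp
 qed
 have 2: "Dz q n r s y l (TT q r M) Y (rw n r zs) = 0" if "zs \<in> zset n y" for zs
 proof (rule column_zero[OF TT_qSchur[OF q n M] l _ XY(2) _ that])
  fix k' assume "hh 0 y < hh 0 k'"
  thus "van q n r s (TT q r M) k'" by (intro van_TT[OF M] hi)
 next
  fix zs assume z: "zs \<in> zset n y" "stdz n zs"
  show "Dz q n r s y l (TT q r M) Y (rw n r zs) = 0" using Dz_TT[OF M l rz[OF z(1)] XY(2)] 1[OF z XY(2)] by simp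
 qed
 obtain zs where zs: "zs \<in> zset n y" "X = rw n r zs" using ex[OF XY(1)] by blast
 have "tw q (sT r y) (x0 Y) (x0 X) * Dz q n r s y l M X Y = 0" using 2[OF zs(1)] Dz_TT[OF M l XY(1,2)] zs by simp
 moreover have "tw q (sT r y) (x0 Y) (x0 X) dvd 1" unfolding tw_def by (rule qpow_unit[OF q])
 ultimately show False using unit_cancel XY(3) by blast
qed

theorem standard_injective: assumes M: "M \<in> qSchur n q r s"
 and std: "\<And>k l zs zs'. lvl n r s k l ==> zs \<in> zset n k ==> zs' \<in> zset n k ==> stdz n zs ==> stdz n zs' ==> Dz q n r s k l M (rw n r zs) (rw n r zs') = 0"
 shows "M x y = 0"
proof (cases "bas n (r + s) x \<and> bas n (r + s) y")
 case False
 thus ?thesis using M by (auto simp: qSchur_iff[OF q n] supp_def)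
next
 case True
 \<comment> \<open>All rows are singletons; on the dual side their complements have n - 1 elements.
   Nothing is contracted, row tensors are basis vectors, and the coefficients are the entries of
   M.\<close>
 define k where "k = replicate r 1 @ replicate s (n - 1)"
 define bs where "bs = replicate r True @ replicate s False"
 have sTr: "sT (r + d) (replicate r 1) = r" "sF n (r + d) (replicate r 1) = 0" "kp n (r + d) (replicate r 1) = replicate r (True, 1)" for d
  by (induction r) simp_all
 have s0: "sF n 0 (replicate s (n - 1)) = s" "kp n 0 (replicate s (n - 1)) = replicate s (False, 1)"
  using n by (induction s) simp_all
 have kp: "kp n r k = map (\<lambda>b. (b, 1)) bs" using sTr[of 0] s0 by (simp add: k_def kp_append bs_def)
 have sk: "sT r k = r" "sF n r k = s" using sTr[of 0] s0 by (simp_all add: k_def sT_append sF_append)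
 have l: "lvl n r s k 0" unfolding lvl_def[OF q n] sk using n by (auto simp: k_def)
 have lb: "length bs = r + s" by (simp add: bs_def)
 have X: "sg bs z \<in> rws n (kp n r k)" if "bas n (r + s) z" for z
  unfolding kp by (rule sg(3)) (use that lb in \<open>auto simp: bas_def\<close>)
 have "van q n r s M k" by (rule van_all[OF M std])
 hence "Dz q n r s k 0 M (sg bs x) (sg bs y) = 0" using l X True by (simp add: van_def[OF q n])
 moreover have "Dz q n r s k 0 M (sg bs x) (sg bs y) = ap n (r + s) M (dlt y) x"
 proof -
  have "length bs = length x" "length bs = length y" using True lb by (auto simp: bas_length)
  hence "x0 (sg bs x) = x" "cf q (sg bs y) = dlt y" by (auto simp: sg fun_eq_iff)
  thus ?thesis by (simp add: Dz_def[OF q n] DD_def sk lv.simps[OF q n])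
 qed
 ultimately show ?thesis using True by (simp add: ap_dlt)
qed

end

section \<open>The action of divided powers on rows\<close>

text \<open>The support of \<open>Fd\<close>. It does not mention the ring, and on it the entries
  are units (\<open>Fd_lwr\<close>).\<close>

fun lwr :: "nat => nat => nat => nat list => nat list => bool" where
 "lwr i r l [] [] = (l = 0)"
| "lwr i r l (x # xs) (y # ys) = (if x = y then lwr i (r - 1) l xs ys else 0 < l \<and> low i (0 < r) y x \<and> lwr i (r - 1) (l - 1) xs ys)"
| "lwr i r l [] (y # ys) = False"
| "lwr i r l (x # xs) [] = False"

lemma lwr_length: "lwr i r l x y ==> length x = length y"
 by (induction i r l x y rule: lwr.induct) (auto split: if_splits)

lemma Fd_lwr: assumes q: "q dvd (1::'a::comm_ring_1)"
 shows "\<not> lwr i r l x y ==> Fd q i r l x y = 0" "lwr i r l x y ==> Fd q i r l x y dvd 1"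
proof -
 show "\<not> lwr i r l x y ==> Fd q i r l x y = 0" by (induction i r l x y rule: lwr.induct) auto
 have m: "u dvd 1 ==> v dvd 1 ==> u * v dvd (1::'a)" for u v using mult_dvd_mono[of u 1 v 1] by simp
 show "lwr i r l x y ==> Fd q i r l x y dvd 1"
 proof (induction i r l x y rule: lwr.induct)
  case (2 i r l x xs y ys)
  have "lc q (0 < r) dvd 1" using q by (simp add: lc_def)
  thus ?case using 2 qpow_unit[OF q] by (auto intro!: m split: if_splits)
 qed auto
qed

lemma lwr_append: "length u = length w ==> lwr i r l (u @ v) (w @ z) \<longleftrightarrow> (\<exists>l1 l2. l = l1 + l2 \<and> lwr i r l1 u w \<and> lwr i (r - length u) l2 v z)"
proof (induction u w arbitrary: r l rule: list_induct2)
 case (Cons x xs y ys)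
 have S: "(\<exists>l1 l2. l = l1 + l2 \<and> (0 < l1 \<and> c \<and> P (l1 - 1)) \<and> Q l2) \<longleftrightarrow> 0 < l \<and> c \<and> (\<exists>l1 l2. l - 1 = l1 + l2 \<and> P l1 \<and> Q l2)" for P Q c and l :: nat
 proof
  assume "0 < l \<and> c \<and> (\<exists>l1 l2. l - 1 = l1 + l2 \<and> P l1 \<and> Q l2)"
  then obtain l1 l2 where "0 < l" "c" "l - 1 = l1 + l2" "P l1" "Q l2" by blast
  thus "\<exists>l1 l2. l = l1 + l2 \<and> (0 < l1 \<and> c \<and> P (l1 - 1)) \<and> Q l2" by (intro exI[of _ "Suc l1"] exI[of _ l2]) auto
 next
  assume "\<exists>l1 l2. l = l1 + l2 \<and> (0 < l1 \<and> c \<and> P (l1 - 1)) \<and> Q l2"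
  then obtain l1 l2 where "l = l1 + l2" "0 < l1" "c" "P (l1 - 1)" "Q l2" by blast
  thus "0 < l \<and> c \<and> (\<exists>l1 l2. l - 1 = l1 + l2 \<and> P l1 \<and> Q l2)" by (intro conjI exI[of _ "l1 - 1"] exI[of _ l2]) auto
 qed
 show ?case using Cons.IH S[of l "low i (0 < r) y x" "\<lambda>l1. lwr i (r - 1) l1 xs ys" "\<lambda>l2. lwr i (r - 1 - length xs) l2 v z"]
  by (cases "x = y") auto
qed simp

definition hi :: "bool => nat => nat" where "hi b i = (if b then i else Suc i)"
definition lo :: "bool => nat => nat" where "lo b i = (if b then Suc i else i)"
definition rs :: "bool => nat => nat => nat" where "rs b i z = (if z = lo b i then hi b i else z)"

lemma rs_lo [simp]: "rs b i (lo b i) = hi b i" by (simp add: rs_def)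
lemma rs_other: "z \<noteq> lo b i ==> rs b i z = z" by (simp add: rs_def)
lemma map_rs_id: "lo b i \<notin> set xs ==> map (rs b i) xs = xs" by (auto simp: rs_def intro!: map_idI)

lemma low_hl: "low i b y x \<longleftrightarrow> y = hi b i \<and> x = lo b i" by (simp add: low_def hi_def lo_def)
lemma hi_lo [simp]: "hi b i \<noteq> lo b i" "lo b i \<noteq> hi b i" by (simp_all add: hi_def lo_def)

text \<open>A block without repetitions contains the relevant letter at most once, so f_i moves at
  most one entry per row and f_i^(l) alters exactly l rows.\<close>

lemma lwr_seg: "lwr i r l u w ==> (b \<and> length u \<le> r \<or> \<not> b \<and> r = 0) ==> distinct u ==> distinct w ==>
 l = 0 \<and> w = u \<or> l = 1 \<and> lo b i \<in> set u \<and> hi b i \<notin> set u \<and> w = map (rs b i) u"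
proof (induction i r l u w rule: lwr.induct)
 case (2 i r l x xs y ys)
 have fl: "b \<and> length xs \<le> r - 1 \<or> \<not> b \<and> r - 1 = 0" "(0 < r) = b" using "2.prems"(2) by auto
 show ?case
 proof (cases "x = y")
  case True
  hence "l = 0 \<and> ys = xs \<or> l = 1 \<and> lo b i \<in> set xs \<and> hi b i \<notin> set xs \<and> ys = map (rs b i) xs"
   using 2 fl by auto
  thus ?thesis
  proof
   assume h: "l = 1 \<and> lo b i \<in> set xs \<and> hi b i \<notin> set xs \<and> ys = map (rs b i) xs"
   hence "hi b i \<in> set ys" by (auto simp: rs_def image_iff intro!: bexI[of _ "lo b i"])
   hence "x \<noteq> hi b i" using True "2.prems" by auto
   moreover have "x \<noteq> lo b i" using h "2.prems" by auto
   ultimately show ?thesis using h True by (auto simp: rs_def)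
  qed (use True in simp)
 next
  case False
  hence l: "0 < l" "y = hi b i" "x = lo b i" "lwr i (r - 1) (l - 1) xs ys" using "2.prems"(1) fl by (auto simp: low_hl)
  hence "l - 1 = 0 \<and> ys = xs \<or> l - 1 = 1 \<and> lo b i \<in> set xs \<and> hi b i \<notin> set xs \<and> ys = map (rs b i) xs"
   using 2 fl False by auto
  moreover have "lo b i \<notin> set xs" using l "2.prems" by auto
  ultimately have h: "l = 1" "ys = xs" using l by auto
  have "map (rs b i) xs = xs" using \<open>lo b i \<notin> set xs\<close> by (rule map_rs_id)
  hence "y # ys = map (rs b i) (x # xs)" using h l(2,3) by simp
  moreover have "hi b i \<notin> set (x # xs)" using h l(2,3) "2.prems"(4) by auto
  ultimately show ?thesis using h(1) l(3) by auto
 qed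
qed auto

lemma lwr_refl: "lwr i r 0 u u" by (induction u arbitrary: r) auto

lemma lwr_map: "distinct u ==> lo b i \<in> set u ==> (b \<and> length u \<le> r \<or> \<not> b \<and> r = 0) ==> lwr i r 1 u (map (rs b i) u)"
proof (induction u arbitrary: r)
 case (Cons x xs)
 have fl: "b \<and> length xs \<le> r - 1 \<or> \<not> b \<and> r - 1 = 0" "(0 < r) = b" using Cons.prems(3) by auto
 show ?case
 proof (cases "x = lo b i")
  case True
  hence "map (rs b i) xs = xs" using Cons.prems by (intro map_rs_id) auto
  hence "map (rs b i) (x # xs) = hi b i # xs" using True by simp
  thus ?thesis using True fl lwr_refl[of i "r - 1" xs] by (simp add: low_hl)
 next
  case False
  thus ?thesis using Cons fl by (auto simp: rs_other)
 qed
qed simp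

lemma map_sl: assumes "finite A" "lo b i \<in> A" "hi b i \<notin> A"
 shows "map (rs b i) (sl b A) = sl b (insert (hi b i) (A - {lo b i}))"
proof -
 have im: "rs b i ` A = insert (hi b i) (A - {lo b i})" using assms by (auto simp: rs_def image_iff)
 have mono: "rs b i x < rs b i y" if "x \<in> A" "y \<in> A" "x < y" for x y
 proof -
  have "x \<noteq> hi b i" "y \<noteq> hi b i" using that assms by auto
  thus ?thesis using that by (auto simp: rs_def hi_def lo_def split: if_splits)
 qed
 have "sorted_wrt (<) (map (rs b i) (sorted_list_of_set A))"
  unfolding sorted_wrt_map
  by (rule sorted_wrt_mono_rel[OF _ strict_sorted_list_of_set]) (use mono assms in auto)
 hence "sorted_list_of_set (rs b i ` A) = map (rs b i) (sorted_list_of_set A)"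
  using sorted_list_of_set.idem_if_sorted_distinct[of "map (rs b i) (sorted_list_of_set A)"] assms strict_sorted_iff by auto
 thus ?thesis unfolding im by (cases b) (simp_all add: sl_def rev_map)
qed

text \<open>Xs arises from Ys by replacing i with i + 1 in exactly l rows. On the dual side f_i
  turns i + 1 into i, which is the same replacement in the complement.\<close>

fun mvs :: "nat => nat => nat set list => nat set list => bool" where
 "mvs i l [] [] = (l = 0)"
| "mvs i l (X # Xs) (Y # Ys) = (if X = Y then mvs i l Xs Ys else 0 < l \<and> i \<in> Y \<and> Suc i \<notin> Y \<and> X = insert (Suc i) (Y - {i}) \<and> mvs i (l - 1) Xs Ys)"
| "mvs i l [] (Y # Ys) = False"
| "mvs i l (X # Xs) [] = False"

text \<open>Replacing i by i + 1 does not disturb the sorted order, so among the words of the row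
  tensor only the sorted one reaches the sorted target. A coefficient of f_i^(l) at row lists is
  thus one matrix entry, and nothing can cancel.\<close>

lemma low_rows: assumes i: "1 \<le> i" "i < n"
 shows "subs n zX ==> subs n zY ==> map card zX = map card zY ==> cf q (rw n r zY) w \<noteq> (0::'a::comm_ring_1) ==>
  lwr i (sT r (map card zX)) l (x0 (rw n r zX)) w ==> w = x0 (rw n r zY) \<and> mvs i l zX zY"
proof (induction zX arbitrary: zY r l w)
 case Nil
 thus ?case by (cases w) (auto split: if_splits)
next
 case (Cons Z zX)
 obtain Z' zY' where zY: "zY = Z' # zY'" using Cons.prems(3) by (cases zY) auto
 have sub: "Z \<subseteq> {1..n}" "Z' \<subseteq> {1..n}" "subs n zX" "subs n zY'" "card Z = card Z'" "map card zX = map card zY'"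
  using Cons.prems by (auto simp: zY subs_def)
 define b where "b = (0 < r)"
 define A B where "A = (if b then Z else {1..n} - Z)" and "B = (if b then Z' else {1..n} - Z')"
 have fin: "finite A" "finite B" using sub finite_subset by (auto simp: A_def B_def)
 have cards: "card A = card B" using card_Diff_subset[of Z "{1..n}"] card_Diff_subset[of Z' "{1..n}"] sub finite_subset[of _ "{1..n}"] by (auto simp: A_def B_def)
 have RX: "x0 (rw n r (Z # zX)) = sl b A @ x0 (rw n (r - 1) zX)" "rw n r zY = (b, B) # rw n (r - 1) zY'"
  by (simp_all add: A_def B_def b_def sl_def zY)
 define w1 w2 where "w1 = take (card B) w" and "w2 = drop (card B) w"
 have w: "w = w1 @ w2" by (simp add: w1_def w2_def)
 have nz: "io q b B w1 \<noteq> 0" "cf q (rw n (r - 1) zY') w2 \<noteq> 0" using Cons.prems(4) unfolding RX by (auto simp: w1_def w2_def)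
 have l1: "length w1 = card B" by (rule io_length[OF nz(1)])
 have d1: "distinct w1" "set w1 = B" using nz(1) by (auto simp: io_def asg_def split: if_splits)
 have la: "length (sl b A) = length w1" using fin cards l1 by (simp add: sl)
 obtain p1 p2 where p: "l = p1 + p2" "lwr i (sT r (map card (Z # zX))) p1 (sl b A) w1"
   "lwr i (sT r (map card (Z # zX)) - card A) p2 (x0 (rw n (r - 1) zX)) w2"
  using Cons.prems(5) unfolding RX w lwr_append[OF la] using fin by (auto simp: sl)
 have s2: "sT r (map card (Z # zX)) - card A = sT (r - 1) (map card zX)" by (auto simp: A_def b_def)
 have IH: "w2 = x0 (rw n (r - 1) zY') \<and> mvs i p2 zX zY'"
  by (rule Cons.IH[OF sub(3,4,6) nz(2)]) (use p(3) s2 in simp)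
 have "b \<and> length (sl b A) \<le> sT r (map card (Z # zX)) \<or> \<not> b \<and> sT r (map card (Z # zX)) = 0"
  using fin by (auto simp: sl b_def A_def)
 from lwr_seg[OF p(2) this _ d1(1)] have "p1 = 0 \<and> w1 = sl b A \<or> p1 = 1 \<and> lo b i \<in> A \<and> hi b i \<notin> A \<and> w1 = map (rs b i) (sl b A)"
  using fin by (auto simp: sl sl_def)
 thus ?case
 proof
  assume h: "p1 = 0 \<and> w1 = sl b A"
  hence "A = B" using d1 fin by (simp add: sl)
  hence "Z = Z'" using sub by (auto simp: A_def B_def split: if_splits)
  have "w = x0 (rw n r zY)" using IH h \<open>A = B\<close> by (simp add: w RX(2) x0_sl del: x0_simps(2))
  moreover have "mvs i l (Z # zX) zY" using IH h p(1) \<open>Z = Z'\<close> by (simp add: zY)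
  ultimately show ?thesis ..
 next
  assume h: "p1 = 1 \<and> lo b i \<in> A \<and> hi b i \<notin> A \<and> w1 = map (rs b i) (sl b A)"
  hence w1: "w1 = sl b (insert (hi b i) (A - {lo b i}))" using map_sl[OF fin(1)] by simp
  hence BA: "B = insert (hi b i) (A - {lo b i})" using d1 fin by (simp add: sl)
  have "i \<in> Z' \<and> Suc i \<notin> Z' \<and> Z = insert (Suc i) (Z' - {i})"
  proof (cases b)
   case True
   thus ?thesis using BA h by (auto simp: A_def B_def hi_def lo_def)
  next
   case False
   have AB: "Z = {1..n} - A" "Z' = {1..n} - B" using sub False by (auto simp: A_def B_def double_diff)
   have "{i, Suc i} \<subseteq> {1..n}" using i by auto
   thus ?thesis using BA h False unfolding AB by (auto simp: hi_def lo_def)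
  qed
  hence "mvs i l (Z # zX) zY" using IH h p(1) by (auto simp: zY)
  moreover have "w = x0 (rw n r zY)" using IH w1 BA by (simp add: w RX(2) x0_sl del: x0_simps(2))
  ultimately show ?thesis by blast
 qed
qed

lemma mvs_low: assumes i: "1 \<le> i" "i < n"
 shows "subs n zX ==> subs n zY ==> mvs i l zX zY ==> lwr i (sT r (map card zX)) l (x0 (rw n r zX)) (x0 (rw n r zY))"
proof (induction zX arbitrary: zY r l)
 case Nil
 thus ?case by (cases zY) auto
next
 case (Cons Z zX)
 obtain Z' zY' where zY: "zY = Z' # zY'" using Cons.prems(3) by (cases zY) auto
 have sub: "Z \<subseteq> {1..n}" "Z' \<subseteq> {1..n}" "subs n zX" "subs n zY'" using Cons.prems by (auto simp: zY subs_def)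
 define b where "b = (0 < r)"
 define A B where "A = (if b then Z else {1..n} - Z)" and "B = (if b then Z' else {1..n} - Z')"
 have fin: "finite A" "finite B" using sub finite_subset by (auto simp: A_def B_def)
 have RX: "x0 (rw n r (Z # zX)) = sl b A @ x0 (rw n (r - 1) zX)" "x0 (rw n r zY) = sl b B @ x0 (rw n (r - 1) zY')"
  by (simp_all add: A_def B_def b_def sl_def zY)
 have s2: "sT r (map card (Z # zX)) - card A = sT (r - 1) (map card zX)" by (auto simp: A_def b_def)
 have fl: "b \<and> length (sl b A) \<le> sT r (map card (Z # zX)) \<or> \<not> b \<and> sT r (map card (Z # zX)) = 0"
  using fin by (auto simp: sl b_def A_def)
 have ds: "distinct (sl b A)" by (simp add: sl_def)
 show ?case
 proof (cases "Z = Z'")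
  case True
  hence m: "mvs i l zX zY'" using Cons.prems(3) zY by simp
  have "A = B" using True by (simp add: A_def B_def)
  thus ?thesis using Cons.IH[OF sub(3,4) m, of "r - 1"] s2 fin unfolding RX
   by (subst lwr_append, simp, intro exI[of _ 0] exI[of _ l]) (auto simp: sl lwr_refl)
 next
  case False
  hence m: "0 < l" "i \<in> Z'" "Suc i \<notin> Z'" "Z = insert (Suc i) (Z' - {i})" "mvs i (l - 1) zX zY'" using Cons.prems(3) zY by auto
  have h: "lo b i \<in> A" "hi b i \<notin> A" "B = insert (hi b i) (A - {lo b i})"
  proof -
   have "{i, Suc i} \<subseteq> {1..n}" using i by auto
   thus "lo b i \<in> A" "hi b i \<notin> A" "B = insert (hi b i) (A - {lo b i})"
    using m sub by (cases b; auto simp: A_def B_def hi_def lo_def)+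
  qed
  have "lwr i (sT r (map card (Z # zX))) 1 (sl b A) (map (rs b i) (sl b A))"
   by (rule lwr_map[OF ds _ fl]) (use h fin in \<open>simp add: sl\<close>)
  hence S: "lwr i (sT r (map card (Z # zX))) 1 (sl b A) (sl b B)"
   unfolding map_sl[OF fin(1) h(1,2)] h(3)[symmetric] .
  hence "length (sl b A) = length (sl b B)" by (rule lwr_length)
  hence "lwr i (sT r (map card (Z # zX))) l (sl b A @ x0 (rw n (r - 1) zX)) (sl b B @ x0 (rw n (r - 1) zY')) \<longleftrightarrow>
   (\<exists>l1 l2. l = l1 + l2 \<and> lwr i (sT r (map card (Z # zX))) l1 (sl b A) (sl b B) \<and> lwr i (sT r (map card (Z # zX)) - length (sl b A)) l2 (x0 (rw n (r - 1) zX)) (x0 (rw n (r - 1) zY')))"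
   by (rule lwr_append)
  moreover have "lwr i (sT r (map card (Z # zX)) - length (sl b A)) (l - 1) (x0 (rw n (r - 1) zX)) (x0 (rw n (r - 1) zY'))"
   using Cons.IH[OF sub(3,4) m(5), of "r - 1"] s2 sl(2)[OF fin(1), of b] by metis
  moreover have "l = 1 + (l - 1)" using m(1) by simp
  ultimately show ?thesis unfolding RX using S by blast
 qed
qed

lemma mvs_card: "mvs i l zX zY ==> subs n zY ==> map card zX = map card zY"
proof (induction i l zX zY rule: mvs.induct)
 case (2 i l X Xs Y Ys)
 have "finite Y" using 2 finite_subset[of Y "{1..n}"] by (auto simp: subs_def)
 hence "card X = card Y" using 2 card_Suc_Diff1[of Y i] by (auto split: if_splits)
 thus ?case using 2 by (auto simp: subs_def split: if_splits)
qed auto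

context
 fixes q :: "'a::comm_ring_1" and n :: nat
 assumes q: "q dvd 1" and n: "1 \<le> n"
begin

lemma lv_mult: "A \<in> qSchur n q r s ==> C \<in> qSchur n q r s ==> c \<le> r ==> c \<le> s ==>
 lv n r s c (mmul n (r + s) A C) = mmul n (r - c + (s - c)) (lv n r s c A) (lv n r s c C)"
proof (induction c arbitrary: r s A C)
 case 0 thus ?case by (simp add: lv.simps[OF q n])
next
 case (Suc c)
 obtain r' s' where rs: "r = Suc r'" "s = Suc s'" using Suc.prems by (metis Suc_le_D)
 have "nx n r' s' (mmul n (r + s) A C) = mmul n (r' + s') (nx n r' s' A) (nx n r' s' C)"
  using nx_mult[OF q n, of A r' s' C] Suc.prems rs by simp
 thus ?case using Suc.IH[OF nx_qSchur(2)[OF q n, of A r' s'] nx_qSchur(2)[OF q n, of C r' s']] Suc.prems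
  by (simp add: rs lv.simps[OF q n])
qed

lemma lv_FM: assumes i: "1 \<le> i" "i < n" shows "c \<le> r ==> c \<le> s ==> lv n r s c (FM n q r s i l) = FM n q (r - c) (s - c) i l"
proof (induction c arbitrary: r s)
 case 0 thus ?case by (simp add: lv.simps[OF q n])
next
 case (Suc c)
 obtain r' s' where rs: "r = Suc r'" "s = Suc s'" using Suc.prems by (metis Suc_le_D)
 thus ?case using Suc FM_nx[OF q n i, of r' s' l] by (simp add: lv.simps[OF q n])
qed

lemma lvl_sub: "lvl n r s k l ==> l \<le> r \<and> l \<le> s \<and> r - l = sT r k \<and> s - l = sF n r k" by (auto simp: lvl_def[OF q n])

lemma ap_lin: "ap n m A (\<lambda>w. \<Sum>W\<in>S. f W w * c W) x = (\<Sum>W\<in>S. ap n m A (f W) x * c W)"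
 unfolding ap_def sum_distrib_left sum_distrib_right by (subst sum.swap) (simp add: mult.assoc)

text \<open>The row tensors of one shape span a module preserved by the induced elements, and
  passing to the level is multiplicative; so the coefficients multiply like matrices.\<close>

lemma Dz_mult: assumes A: "A \<in> qSchur n q r s" and C: "C \<in> qSchur n q r s" and k: "lvl n r s k l"
 and X: "X \<in> rws n (kp n r k)" and Y: "Y \<in> rws n (kp n r k)"
 shows "Dz q n r s k l (mmul n (r + s) A C) X Y = (\<Sum>W\<in>rws n (kp n r k). Dz q n r s k l A X W * Dz q n r s k l C W Y)"
proof -
 let ?m = "sT r k + sF n r k"
 define A' C' where "A' = lv n r s l A" and "C' = lv n r s l C"
 have L: "lv n r s l (mmul n (r + s) A C) = mmul n ?m A' C'"
 proof -
  have e: "l \<le> r" "l \<le> s" "r - l = sT r k" "s - l = sF n r k" using lvl_sub[OF k] by auto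
  show ?thesis using lv_mult[OF A C e(1,2)] unfolding e(3,4) A'_def C'_def .
 qed
 have "Dz q n r s k l (mmul n (r + s) A C) X Y = ap n ?m A' (ap n ?m C' (cf q Y)) (x0 X)"
  by (simp add: Dz_def[OF q n] DD_def L ap_ap)
 also have "... = ap n ?m A' (\<lambda>w. \<Sum>W\<in>rws n (kp n r k). cf q W w * DD n ?m q C' W Y) (x0 X)"
  by (rule ap_cong) (simp add: ap_cf[OF q lvl_qSchur(2)[OF q n C k] tot_kp _ Y] C'_def)
 also have "... = (\<Sum>W\<in>rws n (kp n r k). DD n ?m q A' X W * DD n ?m q C' W Y)"
  by (simp add: ap_lin DD_def)
 finally show ?thesis by (simp add: Dz_def[OF q n] A'_def C'_def)
qed

lemma Dz_FM: assumes i: "1 \<le> i" "i < n" and k: "lvl n r s k l" and zX: "zX \<in> zset n k" and zY: "zY \<in> zset n k"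
 shows "Dz q n r s k l (FM n q r s i c) (rw n r zX) (rw n r zY) = Fd q i (sT r k) c (x0 (rw n r zX)) (x0 (rw n r zY))"
proof -
 let ?m = "sT r k + sF n r k" and ?x = "x0 (rw n r zX)" and ?y = "x0 (rw n r zY)"
 have X: "rw n r zX \<in> rws n (kp n r k)" and Y: "rw n r zY \<in> rws n (kp n r k)" using rw_rws[of n zX r] rw_rws[of n zY r] zX zY by (simp_all add: zset_def)
 have b: "bas n ?m ?x" "bas n ?m ?y" using x0_bas[OF X] x0_bas[OF Y] by (simp_all add: tot_kp)
 have L: "lv n r s l (FM n q r s i c) = FM n q (sT r k) (sF n r k) i c" using lv_FM[OF i] lvl_sub[OF k] by simp
 have "Dz q n r s k l (FM n q r s i c) (rw n r zX) (rw n r zY) = (\<Sum>w\<in>bset n ?m. FM n q (sT r k) (sF n r k) i c ?x w * cf q (rw n r zY) w)"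
  by (simp add: Dz_def[OF q n] DD_def L ap_def)
 also have "... = FM n q (sT r k) (sF n r k) i c ?x ?y * cf q (rw n r zY) ?y"
 proof (rule sum_single)
  fix w assume w: "w \<in> bset n ?m" "w \<noteq> ?y"
  show "FM n q (sT r k) (sF n r k) i c ?x w * cf q (rw n r zY) w = 0"
  proof (rule ccontr)
   assume "\<not> ?thesis"
   hence nz: "FM n q (sT r k) (sF n r k) i c ?x w \<noteq> 0" "cf q (rw n r zY) w \<noteq> 0" by (auto dest: mult_not_zero)
   hence "Fd q i (sT r k) c ?x w \<noteq> 0" by (auto simp: FM_def split: if_splits)
   hence "lwr i (sT r k) c ?x w" using Fd_lwr(1)[OF q] by blast
   thus False using low_rows[OF i _ _ _ nz(2), of zX c] zX zY w by (auto simp: zset_def)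
  qed
 qed (use b in auto)
 finally show ?thesis using cf_x0[OF Y Y, of q] b by (simp add: FM_def)
qed

lemma Dz_FM_mvs: assumes i: "1 \<le> i" "i < n" and k: "lvl n r s k l" and zX: "zX \<in> zset n k" and zY: "zY \<in> zset n k"
 shows "\<not> mvs i c zX zY ==> Dz q n r s k l (FM n q r s i c) (rw n r zX) (rw n r zY) = 0"
  "mvs i c zX zY ==> Dz q n r s k l (FM n q r s i c) (rw n r zX) (rw n r zY) dvd 1"
proof -
 have Y: "rw n r zY \<in> rws n (kp n r k)" using rw_rws[of n zY r] zY by (simp add: zset_def)
 note E = Dz_FM[OF i k zX zY]
 show "\<not> mvs i c zX zY ==> Dz q n r s k l (FM n q r s i c) (rw n r zX) (rw n r zY) = 0"
 proof (rule ccontr)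
  assume m: "\<not> mvs i c zX zY" and "Dz q n r s k l (FM n q r s i c) (rw n r zX) (rw n r zY) \<noteq> 0"
  hence F: "Fd q i (sT r k) c (x0 (rw n r zX)) (x0 (rw n r zY)) \<noteq> 0" by (simp add: E)
  hence "(1::'a) \<noteq> 0" by (metis mult_1 mult_zero_left)
  hence "cf q (rw n r zY) (x0 (rw n r zY)) \<noteq> 0" using cf_x0[OF Y Y, of q] by simp
  moreover have "lwr i (sT r k) c (x0 (rw n r zX)) (x0 (rw n r zY))" using F Fd_lwr(1)[OF q] by blast
  ultimately show False using low_rows[OF i, of zX zY q r "x0 (rw n r zY)" c] zX zY m by (auto simp: zset_def)
 qed
 show "mvs i c zX zY ==> Dz q n r s k l (FM n q r s i c) (rw n r zX) (rw n r zY) dvd 1"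
  unfolding E using mvs_low[OF i, of zX zY c r] zX zY by (intro Fd_lwr(2)[OF q]) (auto simp: zset_def)
qed

end

section \<open>A triangular family of elements\<close>

text \<open>A standard tableau t is turned step by step into the tableau H with rows {1..c}: step (j, i) replaces
 the j-th smallest entry i + 1 by i in every row in which that entry exceeds i. Reversing the
 steps yields a product of divided powers that sends H to t plus terms of smaller potential.\<close>

definition ac :: "nat set list => nat => nat => nat" where
 "ac zs j i = length (filter (\<lambda>Z. card (Z \<inter> {1..i}) < j \<and> j \<le> card Z) zs)"

text \<open>The columns, counted from 1, of the entries that move: the entry i of Y is its card (Y
  \<inter> {1..i})-th smallest one.\<close>

fun jsf :: "nat => nat set list => nat set list => nat list" where
 "jsf i (X # Xs) (Y # Ys) = (if X = Y then [] else [card (Y \<inter> {1..i})]) @ jsf i Xs Ys"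
| "jsf i _ _ = []"

lemma ac_simps [simp]: "ac [] j i = 0" "ac (Z # zs) j i = (if card (Z \<inter> {1..i}) < j \<and> j \<le> card Z then 1 else 0) + ac zs j i"
 by (simp_all add: ac_def)

lemma move_card: assumes "finite Y" "i \<in> Y" "Suc i \<notin> Y" "1 \<le> i"
 shows "card (insert (Suc i) (Y - {i}) \<inter> {1..i'}) = (if i' = i then card (Y \<inter> {1..i}) - 1 else card (Y \<inter> {1..i'}))"
proof -
 consider "i' < i" | "i' = i" | "i < i'" by linarith
 thus ?thesis
 proof cases
  case 1
  hence "insert (Suc i) (Y - {i}) \<inter> {1..i'} = Y \<inter> {1..i'}" by auto
  thus ?thesis using 1 by simp
 next
  case 2
  hence "insert (Suc i) (Y - {i}) \<inter> {1..i'} = (Y \<inter> {1..i}) - {i}" by auto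
  thus ?thesis using 2 assms by (simp add: card_Diff_singleton)
 next
  case 3
  hence "insert (Suc i) (Y - {i}) \<inter> {1..i'} = insert (Suc i) ((Y \<inter> {1..i'}) - {i})" by auto
  moreover have "card (insert (Suc i) ((Y \<inter> {1..i'}) - {i})) = Suc (card ((Y \<inter> {1..i'}) - {i}))" using assms by simp
  moreover have "Suc (card ((Y \<inter> {1..i'}) - {i})) = card (Y \<inter> {1..i'})" using assms 3 by (intro card_Suc_Diff1) auto
  ultimately show ?thesis using 3 by simp
 qed
qed

text \<open>\<open>ac zs j i\<close> counts the rows whose j-th smallest entry exceeds i. Moving
  such an entry from i to i + 1 changes this single number, so these numbers record the
  moves.\<close>

lemma mvs_ac: "mvs i l Xs Ys ==> subs n Ys ==> 1 \<le> i ==>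
 ac Xs j' i' = ac Ys j' i' + (if i' = i then length (filter (\<lambda>x. x = j') (jsf i Xs Ys)) else 0) \<and> length (jsf i Xs Ys) = l"
proof (induction i l Xs Ys rule: mvs.induct)
 case (2 i l X Xs Y Ys)
 have f: "finite Y" using 2 finite_subset[of Y "{1..n}"] by (auto simp: subs_def)
 show ?case
 proof (cases "X = Y")
  case True
  thus ?thesis using 2 by (auto simp: subs_def)
 next
  case False
  hence m: "0 < l" "i \<in> Y" "Suc i \<notin> Y" "X = insert (Suc i) (Y - {i})" "mvs i (l - 1) Xs Ys" using "2.prems" by auto
  have c: "card X = card Y" unfolding m(4) using f m card_Suc_Diff1[of Y i] by simp
  have p: "0 < card (Y \<inter> {1..i})" using f m "2.prems"(3) by (auto simp: card_gt_0_iff)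
  have le: "card (Y \<inter> {1..i}) \<le> card Y" using f by (intro card_mono) auto
  have IH: "ac Xs j' i' = ac Ys j' i' + (if i' = i then length (filter (\<lambda>x. x = j') (jsf i Xs Ys)) else 0) \<and> length (jsf i Xs Ys) = l - 1"
   using 2 False m by (auto simp: subs_def)
  show ?thesis using IH False m(1) p le move_card[OF f m(2,3) "2.prems"(3), of i'] unfolding m(4)[symmetric] by (auto simp: c)
 qed
qed auto

lemma mvs_rows: "mvs i l Xs Ys ==> X \<in> set Xs ==> \<exists>Y\<in>set Ys. X = Y \<or> i \<in> Y \<and> Suc i \<notin> Y \<and> X = insert (Suc i) (Y - {i})"
 by (induction i l Xs Ys rule: mvs.induct) (auto split: if_splits)

lemma jsf_rows: "mvs i l Xs Ys ==> x \<in> set (jsf i Xs Ys) ==> \<exists>Y\<in>set Ys. i \<in> Y \<and> x = card (Y \<inter> {1..i})"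
 by (induction i l Xs Ys rule: mvs.induct) (auto split: if_splits)

text \<open>The weight n + 1 - j decreases with the column j. A step meant for column j that moves
  an entry in a later column therefore gains less potential, and equality forces the intended
  column.\<close>

definition PP :: "nat => nat set list => nat" where
 "PP n zs = (\<Sum>i\<in>{1..<n}. \<Sum>j\<in>{1..i}. (n + 1 - j) * ac zs j i)"
definition PS :: "nat => (nat \<times> nat) list => (nat => nat => nat) => nat" where
 "PS n S \<alpha> = (\<Sum>i\<in>{1..<n}. \<Sum>j\<in>{1..i}. (n + 1 - j) * (if (j, i) \<in> set S then \<alpha> j i else 0))"

lemma sum_count: "set js \<subseteq> {1..i::nat} ==> (\<Sum>j\<in>{1..i}. f j * length (filter (\<lambda>x. x = j) js)) = (sum_list (map f js) :: nat)"
proof (induction js)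
 case (Cons a js)
 have "f j * length (filter (\<lambda>x. x = j) (a # js)) = (if j = a then f a else 0) + f j * length (filter (\<lambda>x. x = j) js)" for j by simp
 hence "(\<Sum>j\<in>{1..i}. f j * length (filter (\<lambda>x. x = j) (a # js))) = (\<Sum>j\<in>{1..i}. if j = a then f a else 0) + (\<Sum>j\<in>{1..i}. f j * length (filter (\<lambda>x. x = j) js))"
  by (simp only: sum.distrib)
 thus ?case using Cons by (simp add: sum.delta)
qed simp

lemma PP_move: assumes m: "mvs i l Xs Ys" and s: "subs n Ys" and i: "1 \<le> i" "i < n" and js: "set (jsf i Xs Ys) \<subseteq> {1..i}"
 shows "PP n Xs = PP n Ys + sum_list (map (\<lambda>j. n + 1 - j) (jsf i Xs Ys))"
proof -
 have "PP n Xs = (\<Sum>i'\<in>{1..<n}. \<Sum>j\<in>{1..i'}. (n + 1 - j) * ac Ys j i' + (if i' = i then (n + 1 - j) * length (filter (\<lambda>x. x = j) (jsf i Xs Ys)) else 0))"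
  unfolding PP_def using mvs_ac[OF m s i(1)] by (intro sum.cong refl) (simp add: distrib_left)
 also have "... = PP n Ys + (\<Sum>i'\<in>{1..<n}. \<Sum>j\<in>{1..i'}. if i' = i then (n + 1 - j) * length (filter (\<lambda>x. x = j) (jsf i Xs Ys)) else 0)"
  by (simp add: sum.distrib PP_def)
 also have "(\<Sum>i'\<in>{1..<n}. \<Sum>j\<in>{1..i'}. if i' = i then (n + 1 - j) * length (filter (\<lambda>x. x = j) (jsf i Xs Ys)) else 0)
  = (\<Sum>i'\<in>{1..<n}. if i' = i then (\<Sum>j\<in>{1..i}. (n + 1 - j) * length (filter (\<lambda>x. x = j) (jsf i Xs Ys))) else 0)"
  by (intro sum.cong refl) auto
 also have "... = (\<Sum>j\<in>{1..i}. (n + 1 - j) * length (filter (\<lambda>x. x = j) (jsf i Xs Ys)))" using i by (simp add: sum.delta)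
 finally show ?thesis using sum_count[OF js] by simp
qed

lemma PS_Cons: assumes "1 \<le> j" "j \<le> i" "i < n" "(j, i) \<notin> set S" shows "PS n ((j, i) # S) \<alpha> = PS n S \<alpha> + (n + 1 - j) * \<alpha> j i"
proof -
 have "PS n ((j, i) # S) \<alpha> = (\<Sum>i'\<in>{1..<n}. \<Sum>j'\<in>{1..i'}. (n + 1 - j') * (if (j', i') \<in> set S then \<alpha> j' i' else 0) + (if j' = j then (if i' = i then (n + 1 - j) * \<alpha> j i else 0) else 0))"
  unfolding PS_def using assms by (intro sum.cong refl) auto
 also have "... = PS n S \<alpha> + (\<Sum>i'\<in>{1..<n}. \<Sum>j'\<in>{1..i'}. if j' = j then (if i' = i then (n + 1 - j) * \<alpha> j i else 0) else 0)"
  by (simp add: sum.distrib PS_def)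
 also have "(\<Sum>i'\<in>{1..<n}. \<Sum>j'\<in>{1..i'}. if j' = j then (if i' = i then (n + 1 - j) * \<alpha> j i else 0) else 0) = (\<Sum>i'\<in>{1..<n}. if i' = i then (n + 1 - j) * \<alpha> j i else 0)"
  using assms by (intro sum.cong refl) (auto simp: sum.delta)
 also have "... = (n + 1 - j) * \<alpha> j i" using assms by (simp add: sum.delta)
 finally show ?thesis .
qed

text \<open>The head of the list is the factor that acts last. Later columns are moved before
  earlier ones, and within a column the values i are treated in increasing order.\<close>

definition ws :: "nat => (nat \<times> nat) list => bool" where
 "ws n S \<longleftrightarrow> sorted_wrt (\<lambda>(j, i) (j', i'). j < j' \<or> j = j' \<and> i' < i) S \<and> (\<forall>(j, i)\<in>set S. 1 \<le> j \<and> j \<le> i \<and> i < n)"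

lemma ws_Cons: "ws n ((j, i) # S) \<longleftrightarrow> 1 \<le> j \<and> j \<le> i \<and> i < n \<and> (\<forall>(j', i')\<in>set S. j < j' \<or> j = j' \<and> i' < i) \<and> ws n S"
 by (auto simp: ws_def)

fun stp :: "nat => nat => (nat \<times> nat) list" where
 "stp n 0 = []"
| "stp n (Suc d) = map (\<lambda>i. (n - Suc d, i)) (rev [n - Suc d..<n]) @ stp n d"

lemma stp: "d < n ==> set (stp n d) = {(j, i). n - d \<le> j \<and> j \<le> i \<and> i < n} \<and> ws n (stp n d)"
proof (induction d)
 case (Suc d)
 hence IH: "set (stp n d) = {(j, i). n - d \<le> j \<and> j \<le> i \<and> i < n}" "ws n (stp n d)" by auto
 have e: "n - d = Suc (n - Suc d)" using Suc.prems by simp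
 have "set (stp n (Suc d)) = {(j, i). n - Suc d \<le> j \<and> j \<le> i \<and> i < n}"
  unfolding stp.simps set_append IH(1) e by (auto simp: le_Suc_eq not_less_eq_eq)
 moreover have "sorted_wrt (\<lambda>(j, i) (j', i'). j < j' \<or> j = j' \<and> i' < i) (map (\<lambda>i. (n - Suc d, i)) (rev [n - Suc d..<n]))"
  by (simp add: sorted_wrt_map sorted_wrt_rev)
 ultimately show ?case using IH Suc.prems e by (auto simp: ws_def sorted_wrt_append)
qed (auto simp: ws_def)

definition unm :: "nat => nat => nat set list => nat set list" where
 "unm j i = map (\<lambda>Z. if card (Z \<inter> {1..i}) < j \<and> j \<le> card Z then insert i (Z - {Suc i}) else Z)"

lemma unm_simps [simp]: "unm j i [] = []" "unm j i (Z # zs) = (if card (Z \<inter> {1..i}) < j \<and> j \<le> card Z then insert i (Z - {Suc i}) else Z) # unm j i zs"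
 by (simp_all add: unm_def)

lemma mvs_unm: "\<forall>Z\<in>set zs. card (Z \<inter> {1..i}) < j \<and> j \<le> card Z --> Suc i \<in> Z \<and> i \<notin> Z ==> mvs i (ac zs j i) zs (unm j i zs)"
 by (induction zs) auto

text \<open>If every moved entry lies in column j, the altered rows are among those counted by
  \<open>ac\<close>. When their number equals this count, all of them were altered and the previous
  list is determined.\<close>

lemma unm_unique: "mvs i l Xs Ys ==> subs n Ys ==> 1 \<le> i ==> 1 \<le> j ==> (\<forall>x\<in>set (jsf i Xs Ys). x = j) ==>
 l \<le> ac Xs j i \<and> (l = ac Xs j i --> Ys = unm j i Xs)"
proof (induction i l Xs Ys rule: mvs.induct)
 case (2 i l X Xs Y Ys)
 have f: "finite Y" using 2 finite_subset[of Y "{1..n}"] by (auto simp: subs_def)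
 show ?case
 proof (cases "X = Y")
  case True
  have p: "mvs i l Xs Ys" "subs n Ys" "\<forall>x\<in>set (jsf i Xs Ys). x = j" using "2.prems" True by (simp_all add: subs_def)
  have "l \<le> ac Xs j i \<and> (l = ac Xs j i --> Ys = unm j i Xs)" by (rule "2.IH"(1)[OF True p(1,2) "2.prems"(3,4) p(3)])
  thus ?thesis using True by auto
 next
  case False
  hence m: "0 < l" "i \<in> Y" "Suc i \<notin> Y" "X = insert (Suc i) (Y - {i})" "mvs i (l - 1) Xs Ys" "card (Y \<inter> {1..i}) = j" using "2.prems" by auto
  have IH: "l - 1 \<le> ac Xs j i \<and> (l - 1 = ac Xs j i --> Ys = unm j i Xs)"
  proof -
   have p: "subs n Ys" "\<forall>x\<in>set (jsf i Xs Ys). x = j" using "2.prems" False by (simp_all add: subs_def)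
   show ?thesis by (rule "2.IH"(2); rule False m(5) p "2.prems"(3,4))
  qed
  have c: "card X = card Y" unfolding m(4) using f m card_Suc_Diff1[of Y i] by simp
  have le: "card (Y \<inter> {1..i}) \<le> card Y" using f by (intro card_mono) auto
  have R: "card (X \<inter> {1..i}) < j \<and> j \<le> card X" using move_card[OF f m(2,3) "2.prems"(3), of i] m(4,6) c le "2.prems"(4) by auto
  have "insert i (X - {Suc i}) = Y" using m by auto
  thus ?thesis using R IH m(1) by auto
 qed
qed auto

lemma ac_zeroD: "ac zs j i = 0 ==> Z \<in> set zs ==> j \<le> card Z ==> j \<le> card (Z \<inter> {1..i})"
 by (auto simp: ac_def filter_empty_conv)

lemma ac_unm: "(\<And>Z. Z \<in> set zs ==> finite Z) ==> 1 \<le> i ==>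
 \<forall>Z\<in>set zs. card (Z \<inter> {1..i}) < j \<and> j \<le> card Z --> Suc i \<in> Z \<and> i \<notin> Z \<and> card (Z \<inter> {1..i}) = j - 1 ==>
 ac (unm j i zs) j' i' = (if j' = j \<and> i' = i then 0 else ac zs j' i')"
proof (induction zs)
 case (Cons Z zs)
 have IH: "ac (unm j i zs) j' i' = (if j' = j \<and> i' = i then 0 else ac zs j' i')" using Cons by auto
 show ?case
 proof (cases "card (Z \<inter> {1..i}) < j \<and> j \<le> card Z")
  case True
  hence R: "Suc i \<in> Z" "i \<notin> Z" "card (Z \<inter> {1..i}) = j - 1" "finite Z" using Cons.prems by auto
  define Y where "Y = insert i (Z - {Suc i})"
  have Y: "finite Y" "i \<in> Y" "Suc i \<notin> Y" "insert (Suc i) (Y - {i}) = Z" using R by (auto simp: Y_def)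
  have c: "card Y = card Z" using R card_Suc_Diff1[of Z "Suc i"] by (simp add: Y_def)
  have "0 < card (Y \<inter> {1..i})" using Y Cons.prems(2) by (auto simp: card_gt_0_iff)
  hence "card (Y \<inter> {1..i}) = j" using move_card[OF Y(1-3) Cons.prems(2), of i] Y(4) R True by auto
  thus ?thesis using IH True R(3) move_card[OF Y(1-3) Cons.prems(2), of i'] unfolding Y(4) by (auto simp: Y_def[symmetric] c)
 next
  case False
  thus ?thesis using IH by auto
 qed
qed simp

lemma card_last: "1 \<le> (i::nat) ==> card (Z \<inter> {1..i}) = card (Z \<inter> {1..i - 1}) + (if i \<in> Z then 1 else 0)"
 using card_Suc[of Z "i - 1"] by simp

section \<open>Extreme row lists, and data that determine shape and rows\<close>

definition HH :: "nat list => nat set list" where "HH k = map (\<lambda>c. {1..c}) k"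
lemma HH_zset: "(\<forall>c\<in>set k. c \<le> n) ==> HH k \<in> zset n k"
 by (auto simp: HH_def zset_def subs_def comp_def)

lemma sum_k: "(\<forall>c\<in>set k. c \<le> n) ==> sum_list k + sF n r k = sT r k + n * (length k - r)"
proof (induction k arbitrary: r)
 case (Cons c k)
 have IH: "sum_list k + sF n (r - 1) k = sT (r - 1) k + n * (length k - (r - 1))" using Cons by auto
 show ?case
 proof (cases "0 < r")
  case True
  hence "Suc (length k) - r = length k - (r - 1)" by simp
  thus ?thesis using IH True by simp
 next
  case False
  thus ?thesis using IH Cons.prems by simp
 qed
qed simp

lemma sorted_counts: fixes xs ys :: "nat list"
 assumes "sorted xs" "sorted ys" "\<And>j. count_list xs j = count_list ys j" shows "xs = ys"
proof -
 have "mset xs = mset ys" using assms(3) by (intro multiset_eqI) (simp add: count_mset)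
 thus ?thesis using properties_for_sort assms(1,2) by (metis sorted_sort_id)
qed

lemma sorted_levels: fixes xs ys :: "nat list"
 assumes "sorted xs" "sorted ys" and e: "\<And>j. length (filter ((\<le>) j) xs) = length (filter ((\<le>) j) ys)" shows "xs = ys"
proof (rule sorted_counts[OF assms(1,2)])
 have "count_list xs j + length (filter ((\<le>) (Suc j)) xs) = length (filter ((\<le>) j) xs)" for xs j by (induction xs) auto
 thus "count_list xs j = count_list ys j" for j using e by (metis add_right_cancel)
qed

definition HL :: "nat => nat list => nat set list" where "HL n k = map (\<lambda>c. {n + 1 - c..n}) k"
definition SS :: "nat set list => nat" where "SS zs = sum_list (map Sum zs)"

lemma HL_zset: "(\<forall>c\<in>set k. c \<le> n) ==> HL n k \<in> zset n k"
 by (induction k) (auto simp: HL_def zset_def subs_def)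

lemma mvs_SS: "mvs i l Xs Ys ==> subs n Ys ==> SS Xs = SS Ys + l"
proof (induction i l Xs Ys rule: mvs.induct)
 case (2 i l X Xs Y Ys)
 have f: "finite Y" using 2 finite_subset[of Y "{1..n}"] by (auto simp: subs_def)
 show ?case
 proof (cases "X = Y")
  case True
  thus ?thesis using 2 by (auto simp: subs_def SS_def)
 next
  case False
  hence m: "0 < l" "i \<in> Y" "Suc i \<notin> Y" "X = insert (Suc i) (Y - {i})" "mvs i (l - 1) Xs Ys" using "2.prems" by auto
  hence "\<Sum>X = Suc (\<Sum>Y)" using f by (simp add: sum.remove[of Y i])
  thus ?thesis using 2 False m by (auto simp: subs_def SS_def)
 qed
qed (auto simp: SS_def)

lemma sum_le_threshold: fixes A B :: "nat set"
 assumes f: "finite A" "finite B" "card A = card B" and t: "\<And>x. x \<in> A ==> x \<notin> B ==> c < x" "\<And>x. x \<in> B ==> x \<notin> A ==> x \<le> c"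
 shows "\<Sum>B \<le> \<Sum>A \<and> (\<Sum>B = \<Sum>A --> B = A)"
proof -
 have "card (A - B) + card (A \<inter> B) = card (B - A) + card (A \<inter> B)" using f card_Int_Diff[of A B] card_Int_Diff[of B A] by (simp add: Int_commute)
 hence c: "card (A - B) = card (B - A)" by simp
 have 1: "card (A - B) * Suc c \<le> \<Sum>(A - B)" using sum_mono[of "A - B" "\<lambda>_. Suc c" "\<lambda>x. x"] t(1) by (simp add: Suc_le_eq)
 have 2: "\<Sum>(B - A) \<le> card (B - A) * c" using sum_mono[of "B - A" "\<lambda>x. x" "\<lambda>_. c"] t(2) by auto
 have 3: "\<Sum>A = \<Sum>(A \<inter> B) + \<Sum>(A - B)" "\<Sum>B = \<Sum>(A \<inter> B) + \<Sum>(B - A)"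
  using sum.Int_Diff[OF f(1), of "\<lambda>x. x" B] sum.Int_Diff[OF f(2), of "\<lambda>x. x" A] by (simp_all add: Int_commute)
 have le: "\<Sum>B + card (A - B) \<le> \<Sum>A" using 1 2 3 c by simp
 moreover have "B = A" if "card (A - B) = 0"
  using that c f card_subset_eq[of A B] by auto
 ultimately show ?thesis by auto
qed

text \<open>Among subsets of {1..n} of given size the initial interval has the smallest and the
  final interval the largest sum, each uniquely. As f_i^(l) raises the entry sum by l, this limits
  the total shift possible within a shape.\<close>

lemma SS_bounds: "subs n W ==> SS (HH (map card W)) \<le> SS W \<and> (SS (HH (map card W)) = SS W --> HH (map card W) = W) \<and>
 SS W \<le> SS (HL n (map card W)) \<and> (SS W = SS (HL n (map card W)) --> W = HL n (map card W))"
proof (induction W)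
 case (Cons Z W)
 have Z: "Z \<subseteq> {1..n}" "finite Z" using Cons.prems finite_subset[of Z "{1..n}"] by (auto simp: subs_def)
 hence c: "card Z \<le> n" using card_mono[of "{1..n}" Z] by simp
 have 1: "\<Sum>{1..card Z} \<le> \<Sum>Z \<and> (\<Sum>{1..card Z} = \<Sum>Z --> {1..card Z} = Z)"
  by (rule sum_le_threshold[of _ _ "card Z"]) (use Z in auto)
 have 2: "\<Sum>Z \<le> \<Sum>{n + 1 - card Z..n} \<and> (\<Sum>Z = \<Sum>{n + 1 - card Z..n} --> Z = {n + 1 - card Z..n})"
  by (rule sum_le_threshold[of _ _ "n - card Z"]) (use Z c in auto)
 have "subs n W" using Cons.prems by (simp add: subs_def)
 from Cons.IH[OF this] 1 2 show ?case by (auto simp: SS_def HH_def HL_def)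
qed (simp add: SS_def HH_def HL_def)

text \<open>A row {n+1-c..n} with c > 0 has c - 1 entries below n, so at i = n - 1 it is counted
  exactly in column c. The shape can be read off from these numbers.\<close>

lemma ac_HL: "(\<forall>c\<in>set k. c \<le> n) ==> 1 \<le> j ==> ac (HL n k) j (n - 1) = count_list k j"
proof (induction k)
 case (Cons c k)
 have "{n + 1 - c..n} \<inter> {1..n - 1} = {n + 1 - c..n - 1}" using Cons.prems by auto
 hence "card ({n + 1 - c..n} \<inter> {1..n - 1}) = c - 1" using Cons.prems by (simp only: card_atLeastAtMost) auto
 thus ?case using Cons by (auto simp: HL_def)
qed (simp add: HL_def)

text \<open>The numbers of rows of length 0 and n are not given; they follow from the number of rows
  and the total size.\<close>

lemma sorted_shape: fixes k k' :: "nat list"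
 assumes k: "sorted k" "sorted k'" "length k = length k'" "\<forall>c\<in>set k. c \<le> n" "\<forall>c\<in>set k'. c \<le> n" "sum_list k = sum_list k'"
 and n: "1 \<le> n" and e: "\<And>j. 1 \<le> j ==> j < n ==> count_list k j = count_list k' j" shows "k = k'"
proof -
 have S: "length z = count_list z 0 + ((\<Sum>j\<in>{1..<n}. count_list z j) + count_list z n)"
  "sum_list z = (\<Sum>j\<in>{1..<n}. count_list z j * j) + count_list z n * n" if "\<forall>c\<in>set z. c \<le> n" for z
 proof -
  have I: "{..n} = insert 0 (insert n {1..<n})" using n by auto
  have z: "set z \<subseteq> {..n}" using that by auto
  show "length z = count_list z 0 + ((\<Sum>j\<in>{1..<n}. count_list z j) + count_list z n)"
   using sum_count_set[OF z] n unfolding I by simp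
  show "sum_list z = (\<Sum>j\<in>{1..<n}. count_list z j * j) + count_list z n * n"
   using sum_list_map_eq_sum_count2[OF z, of "\<lambda>x. x"] n unfolding I by simp
 qed
 have "(\<Sum>j\<in>{1..<n}. count_list k j) = (\<Sum>j\<in>{1..<n}. count_list k' j)" "(\<Sum>j\<in>{1..<n}. count_list k j * j) = (\<Sum>j\<in>{1..<n}. count_list k' j * j)"
  by (intro sum.cong; use e in simp)+
 hence n0: "count_list k n = count_list k' n" "count_list k 0 = count_list k' 0" using S[OF k(4)] S[OF k(5)] k(3,6) n by auto
 have "count_list k j = count_list k' j" for j
 proof -
  consider "j = 0" | "1 \<le> j" "j < n" | "j = n" | "n < j" by linarith
  thus ?thesis
  proof cases
   case 4
   hence "j \<notin> set k" "j \<notin> set k'" using k(4,5) by auto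
   thus ?thesis by simp
  qed (use e n0 in auto)
 qed
 thus ?thesis by (rule sorted_counts[OF k(1,2)])
qed

lemma stdz_mono: assumes "stdz n zs" "x \<le> n" shows "p \<le> p' ==> p' < length zs ==> card (zs ! p \<inter> {1..x}) \<le> card (zs ! p' \<inter> {1..x})"
proof (induction p' rule: nat_induct_at_least)
 case (Suc p')
 hence "gle n (zs ! p') (zs ! Suc p')" using assms(1) by (simp add: stdz_def successively_conv_nth)
 hence "card (zs ! p' \<inter> {1..x}) \<le> card (zs ! Suc p' \<inter> {1..x})" using assms(2) by (simp add: gle_def)
 thus ?case using Suc by simp
qed simp

lemma stdz_sorted: assumes "stdz n zs" "zs \<in> zset n k" shows "sorted k"
proof -
 have "zs ! p \<inter> {1..n} = zs ! p" if "p < length zs" for p using assms(2) that nth_mem[OF that] by (fastforce simp: zset_def subs_def)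
 hence "p \<le> p' ==> p' < length zs ==> card (zs ! p) \<le> card (zs ! p')" for p p'
  using stdz_mono[OF assms(1), of n p p'] by simp
 thus ?thesis using assms(2) by (auto simp: zset_def sorted_iff_nth_mono)
qed

text \<open>In a standard list the prefix counts increase along the list, so for each i they are
  determined as a multiset, hence by the numbers \<open>ac\<close>. The prefix counts for all i give
  back the sets.\<close>

lemma ac_determines: assumes X: "X \<in> zset n k" "stdz n X" and Y: "Y \<in> zset n k" "stdz n Y"
 and e: "\<And>j i. 1 \<le> j ==> j \<le> i ==> i < n ==> ac X j i = ac Y j i"
 shows "X = Y"
proof -
 have l: "length X = length Y" "map card X = k" "map card Y = k" "subs n X" "subs n Y" using X Y by (auto simp: zset_def dest: map_eq_imp_length_eq)
 have sX: "X ! p \<subseteq> {1..n}" "Y ! p \<subseteq> {1..n}" if "p < length X" for p using that l nth_mem[of p X] nth_mem[of p Y] by (auto simp: subs_def)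
 have eq: "map (\<lambda>Z. card (Z \<inter> {1..i})) X = map (\<lambda>Z. card (Z \<inter> {1..i})) Y" if i: "i \<le> n" for i
 proof (cases "i = n")
  case True
  have m: "map (\<lambda>Z. card (Z \<inter> {1..n})) Z = map card Z" if "subs n Z" for Z using that by (auto simp: subs_def Int_absorb2)
  show ?thesis unfolding True m[OF l(4)] m[OF l(5)] l(2,3) ..
 next
  case False
  have A: "length (filter ((\<le>) j) (map (\<lambda>Z. card (Z \<inter> {1..i})) zs)) + ac zs j i = length (filter ((\<le>) j) (map card zs))" if "subs n zs" for zs j
   using that
  proof (induction zs)
   case (Cons Z zs)
   hence "finite Z" using finite_subset[of Z "{1..n}"] by (auto simp: subs_def)
   hence "card (Z \<inter> {1..i}) \<le> card Z" by (intro card_mono) auto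
   thus ?case using Cons by (auto simp: subs_def)
  qed simp
  show ?thesis
  proof (rule sorted_levels)
   show "sorted (map (\<lambda>Z. card (Z \<inter> {1..i})) X)" "sorted (map (\<lambda>Z. card (Z \<inter> {1..i})) Y)"
    using stdz_mono[OF X(2) i] stdz_mono[OF Y(2) i] by (simp_all add: sorted_iff_nth_mono)
   fix j
   show "length (filter ((\<le>) j) (map (\<lambda>Z. card (Z \<inter> {1..i})) X)) = length (filter ((\<le>) j) (map (\<lambda>Z. card (Z \<inter> {1..i})) Y))"
   proof (cases "1 \<le> j \<and> j \<le> i")
    case True
    thus ?thesis using A[OF l(4), of j] A[OF l(5), of j] e[of j i] False i l(2,3) by simp
   next
    case False
    have "card (Z \<inter> {1..i}) \<le> i" for Z :: "nat set" using card_mono[of "{1..i}" "Z \<inter> {1..i}"] by simp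
    hence "i < j ==> \<not> j \<le> card (Z \<inter> {1..i})" for Z :: "nat set" by (meson leD le_less_trans)
    thus ?thesis using False l(1) by (cases "j = 0") (auto simp: filter_empty_conv)
   qed
  qed
 qed
 have C: "card (X ! p \<inter> {1..i}) = card (Y ! p \<inter> {1..i})" if "i \<le> n" "p < length X" for i p
  using eq[OF that(1)] that(2) l(1) by (metis nth_map)
 show ?thesis
 proof (rule nth_equalityI[OF l(1)])
  fix p assume p: "p < length X"
  show "X ! p = Y ! p"
  proof (rule set_eqI)
   fix x
   show "x \<in> X ! p \<longleftrightarrow> x \<in> Y ! p"
   proof (cases "x \<in> {1..n}")
    case True
    hence "card (X ! p \<inter> {1..x}) = card (Y ! p \<inter> {1..x})" "card (X ! p \<inter> {1..x - 1}) = card (Y ! p \<inter> {1..x - 1})" using C p by auto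
    moreover have "1 \<le> x" using True by simp
    ultimately have "(if x \<in> X ! p then 1 else 0) = (if x \<in> Y ! p then 1 else (0::nat))"
     using card_last[of x "X ! p"] card_last[of x "Y ! p"] by linarith
    thus ?thesis by (simp split: if_splits)
   qed (use sX[OF p] in blast)
  qed
 qed
qed

section \<open>Triangular systems with unit diagonal over a commutative ring\<close>

lemma triangular_solve: fixes A :: "'i => 'i => 'a::comm_ring_1" and f :: "'i => nat"
 assumes "finite I" and "\<And>j. j \<in> I ==> A j j dvd 1" and "\<And>i j. i \<in> I ==> j \<in> I ==> i \<noteq> j ==> A i j \<noteq> 0 ==> f j < f i"
 shows "\<exists>c. \<forall>i\<in>I. (\<Sum>j\<in>I. A i j * c j) = b i"
 using assms
proof (induction I rule: finite_ranking_induct[where f = f])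
 case (insert x S)
 show ?case
 proof (cases "x \<in> S")
  case True
  hence "insert x S = S" by blast
  thus ?thesis using insert by simp
 next
  case False
  obtain c where c: "\<forall>i\<in>S. (\<Sum>j\<in>S. A i j * c j) = b i" using insert by auto
  have "A x x dvd 1" using insert.prems(1)[of x] by simp
  then obtain v where v: "A x x * v = 1" by (auto simp: dvd_def)
  define c' where "c' j = (if j = x then v * (b x - (\<Sum>j\<in>S. A x j * c j)) else c j)" for j
  have s: "(\<Sum>j\<in>insert x S. A i j * c' j) = A i x * c' x + (\<Sum>j\<in>S. A i j * c j)" for i
  proof -
   have "(\<Sum>j\<in>S. A i j * c' j) = (\<Sum>j\<in>S. A i j * c j)" using False by (intro sum.cong) (auto simp: c'_def)
   thus ?thesis using insert.hyps(1) False by simp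
  qed
  have "(\<Sum>j\<in>insert x S. A i j * c' j) = b i" if i: "i \<in> insert x S" for i
  proof (cases "i = x")
   case True
   have "A x x * c' x = b x - (\<Sum>j\<in>S. A x j * c j)" using v by (simp add: c'_def mult.assoc[symmetric])
   thus ?thesis unfolding s True by simp
  next
   case F: False
   hence iS: "i \<in> S" using i by simp
   have "A i x = 0" using insert.prems(2)[of i x] insert.hyps(2)[OF iS] F iS by force
   thus ?thesis unfolding s using c iS by simp
  qed
  thus ?thesis by blast
 qed
qed simp

lemma triangular_zero: fixes A :: "'i => 'i => 'a::comm_ring_1" and f :: "'i => nat"
 assumes I: "finite I" and d: "\<And>j. j \<in> I ==> A j j dvd 1" and t: "\<And>i j. i \<in> I ==> j \<in> I ==> i \<noteq> j ==> A i j \<noteq> 0 ==> f j < f i"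
 and z: "\<And>i. i \<in> I ==> (\<Sum>j\<in>I. A i j * c j) = 0"
 shows "i \<in> I ==> c i = 0"
proof (induction "f i" arbitrary: i rule: less_induct)
 case less
 have "A i j * c j = 0" if "j \<in> I" "j \<noteq> i" for j
  using t[of i j] less that by (cases "A i j = 0") auto
 hence "(\<Sum>j\<in>I. A i j * c j) = A i i * c i" using I less.prems by (intro sum_single) auto
 hence "A i i * c i = 0" using z[OF less.prems] by simp
 thus ?case using unit_cancel[OF d[OF less.prems]] by blast
qed

section \<open>Products of divided powers along the steps\<close>

context
 fixes q :: "'a::comm_ring_1" and n :: nat
 assumes q: "q dvd 1" and n: "1 \<le> n"
begin

lemma sym_1: "sym (\<lambda>r x. 1 :: 'a)" by (simp add: sym_def[OF q n])

lemma mid_dg: "mid n (r + s) = dg n r s ((\<lambda>r x. 1 :: 'a) r)" by (auto simp: dg_def[OF q n] mid_def fun_eq_iff)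

lemma lv_mid: "c \<le> r ==> c \<le> s ==> lv n r s c (mid n (r + s) :: 'a mat) = mid n (r - c + (s - c))"
proof (induction c arbitrary: r s)
 case 0 thus ?case by (simp add: lv.simps[OF q n])
next
 case (Suc c)
 obtain r' s' where rs: "r = Suc r'" "s = Suc s'" using Suc.prems by (metis Suc_le_D)
 have "nx n r' s' (mid n (r + s) :: 'a mat) = mid n (r' + s')"
  unfolding mid_dg rs by (rule Wr_nx[OF q n dg_Wr[OF q n sym_1]])
 thus ?case using Suc rs by (simp add: lv.simps[OF q n])
qed

lemma Dz_mid: assumes k: "lvl n r s k l" and X: "X \<in> rws n (kp n r k)" and Y: "Y \<in> rws n (kp n r k)"
 shows "Dz q n r s k l (mid n (r + s)) X Y = (if X = Y then 1 else 0)"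
proof -
 let ?m = "sT r k + sF n r k"
 have e: "l \<le> r" "l \<le> s" "r - l = sT r k" "s - l = sF n r k" using lvl_sub[OF q n k] by auto
 have b: "bas n ?m (x0 X)" using x0_bas[OF X] by (simp add: tot_kp)
 have L: "lv n r s l (mid n (r + s) :: 'a mat) = mid n ?m" using lv_mid[OF e(1,2)] unfolding e(3,4) .
 have "Dz q n r s k l (mid n (r + s)) X Y = (\<Sum>z\<in>bset n ?m. mid n ?m (x0 X) z * cf q Y z)"
  by (simp add: Dz_def[OF q n] DD_def L ap_def)
 also have "... = cf q Y (x0 X)"
  by (subst sum_single[of _ "x0 X"]) (use b in \<open>auto simp: mid_def\<close>)
 finally show ?thesis using cf_x0[OF X Y, of q] by auto
qed

fun Gop :: "nat => nat => (nat => nat => nat) => (nat \<times> nat) list => 'a mat" where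
 "Gop r s \<alpha> [] = mid n (r + s)"
| "Gop r s \<alpha> ((j, i) # S) = mmul n (r + s) (FM n q r s i (\<alpha> j i)) (Gop r s \<alpha> S)"

lemma Gop_qSchur: "ws n S ==> Gop r s \<alpha> S \<in> qSchur n q r s"
proof (induction S)
 case (Cons ji S)
 obtain j i where ji: "ji = (j, i)" by (cases ji)
 hence "1 \<le> i" "i < n" "ws n S" using Cons.prems by (auto simp: ws_Cons)
 thus ?case using Cons by (simp add: ji qSchur_mult[OF q n] FM_qSchur[OF q n])
qed (simp add: one_qSchur[OF q n])

context
 fixes r s :: nat and k :: "nat list" and l :: nat
 assumes k: "lvl n r s k l"
begin

lemma rwz: "zX \<in> zset n k ==> rw n r zX \<in> rws n (kp n r k)" using rw_rws[of n zX r] by (simp add: zset_def)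

lemma Dz_prod: assumes A: "A \<in> qSchur n q r s" and C: "C \<in> qSchur n q r s" and X: "X \<in> zset n k" and Y: "Y \<in> zset n k"
 and nz: "Dz q n r s k l (mmul n (r + s) A C) (rw n r X) (rw n r Y) \<noteq> 0"
 shows "\<exists>W\<in>zset n k. Dz q n r s k l A (rw n r X) (rw n r W) \<noteq> 0 \<and> Dz q n r s k l C (rw n r W) (rw n r Y) \<noteq> 0"
proof -
 obtain W where W: "W \<in> rws n (kp n r k)" "Dz q n r s k l A (rw n r X) W * Dz q n r s k l C W (rw n r Y) \<noteq> 0"
  using nz unfolding Dz_mult[OF q n A C k rwz[OF X] rwz[OF Y]] by (meson sum.neutral)
 then obtain zW where "W = rw n r zW" "zW \<in> zset n k" using rws_kp[OF W(1)] k by (auto simp: lvl_def[OF q n] zset_def)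
 thus ?thesis using W(2) by force
qed

text \<open>If only one intermediate row list contributes, the coefficient of a product is a product
  of two coefficients; this is how units are produced without controlling any sum.\<close>

lemma Dz_prod_unit: assumes A: "A \<in> qSchur n q r s" and C: "C \<in> qSchur n q r s" and X: "X \<in> zset n k" and Y: "Y \<in> zset n k" and U: "U \<in> zset n k"
 and u: "Dz q n r s k l A (rw n r X) (rw n r U) dvd 1" "Dz q n r s k l C (rw n r U) (rw n r Y) dvd 1"
 and z: "\<And>W. W \<in> zset n k ==> Dz q n r s k l A (rw n r X) (rw n r W) \<noteq> 0 ==> Dz q n r s k l C (rw n r W) (rw n r Y) \<noteq> 0 ==> W = U"
 shows "Dz q n r s k l (mmul n (r + s) A C) (rw n r X) (rw n r Y) dvd 1"
proof -
 have "Dz q n r s k l (mmul n (r + s) A C) (rw n r X) (rw n r Y)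
  = Dz q n r s k l A (rw n r X) (rw n r U) * Dz q n r s k l C (rw n r U) (rw n r Y)"
  unfolding Dz_mult[OF q n A C k rwz[OF X] rwz[OF Y]]
 proof (rule sum_single[OF finite_rws rwz[OF U]])
  fix W assume W: "W \<in> rws n (kp n r k)" "W \<noteq> rw n r U"
  obtain zW where zW: "W = rw n r zW" "zW \<in> zset n k" using rws_kp[OF W(1)] k by (auto simp: lvl_def[OF q n] zset_def)
  have "zW \<noteq> U" using W(2) zW(1) by blast
  thus "Dz q n r s k l A (rw n r X) W * Dz q n r s k l C W (rw n r Y) = 0" using z[OF zW(2)] unfolding zW(1) by fastforce
 qed
 thus ?thesis using mult_dvd_mono[OF u] by simp
qed

lemma Dz_nonzero: assumes i: "1 \<le> i" "i < n" and G: "G \<in> qSchur n q r s" and zX: "zX \<in> zset n k" and zY: "zY \<in> zset n k"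
 and nz: "Dz q n r s k l (mmul n (r + s) (FM n q r s i c) G) (rw n r zX) (rw n r zY) \<noteq> 0"
 shows "\<exists>zW\<in>zset n k. mvs i c zX zW \<and> Dz q n r s k l G (rw n r zW) (rw n r zY) \<noteq> 0"
 using Dz_prod[OF FM_qSchur[OF q n i] G zX zY nz] Dz_FM_mvs(1)[OF q n i k zX] by blast

lemma kn: "\<forall>c\<in>set k. c \<le> n" using k by (simp add: lvl_def[OF q n])

lemma subs_fin: "zX \<in> zset n k ==> Z \<in> set zX ==> finite Z \<and> Z \<subseteq> {1..n}"
 using finite_subset[of Z "{1..n}"] by (auto simp: zset_def subs_def)

lemma rw_inj: "subs n zs ==> subs n zs' ==> rw n a zs = rw n a zs' ==> zs = zs'"
proof (induction zs arbitrary: zs' a)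
 case Nil thus ?case by (cases zs') auto
next
 case (Cons Z zs)
 then obtain Z' zs'' where "zs' = Z' # zs''" by (cases zs') auto
 thus ?case using Cons by (auto simp: subs_def split: if_splits)
qed

lemma HH_ac: "1 \<le> j ==> j \<le> i ==> ac (HH k) j i = 0"
 by (auto simp: ac_def HH_def filter_empty_conv Int_atLeastAtMost)

lemma initial_rows: assumes "zX \<in> zset n k" "\<And>j i. 1 \<le> j ==> j \<le> i ==> i < n ==> ac zX j i = 0" shows "zX = HH k"
proof -
 have "Z = {1..card Z}" if Z: "Z \<in> set zX" for Z
 proof -
  note f = subs_fin[OF assms(1) Z]
  have c: "card Z \<le> n" using card_mono[of "{1..n}" Z] f by simp
  have "{1..card Z} \<subseteq> Z"
  proof (cases "card Z = n")
   case True
   hence "Z = {1..n}" using f by (intro card_subset_eq) auto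
   thus ?thesis by simp
  next
   case False
   show ?thesis
   proof (cases "card Z = 0")
    case F: False
    \<comment> \<open>The case j = i = card Z: even the largest entry is at most the number of
      entries.\<close>
    have "card Z \<le> card (Z \<inter> {1..card Z})" by (rule ac_zeroD[OF assms(2) Z]) (use F False c in auto)
    hence "Z \<inter> {1..card Z} = {1..card Z}" by (intro card_seteq) auto
    thus ?thesis by blast
   qed simp
  qed
  thus ?thesis using card_subset_eq[of Z "{1..card Z}"] f by simp
 qed
 moreover have "k = map card zX" using assms(1) by (simp add: zset_def)
 ultimately show ?thesis unfolding HH_def by (simp add: comp_def map_idI)
qed

text \<open>The first j - 1 entries of every row are still 1, ..., j - 1, as far as the row has that
  many; so an entry i \<ge> j that moves lies in column j or later.\<close>

lemma move_js: assumes m: "mvs i c zX zW" and zW: "zW \<in> zset n k" and j: "1 \<le> j" "j \<le> i"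
 and ini: "\<forall>Z\<in>set zW. {1..min (j - 1) (card Z)} \<subseteq> Z" and x: "x \<in> set (jsf i zX zW)"
 shows "j \<le> x \<and> x \<le> i"
proof -
 obtain Z where Z: "Z \<in> set zW" "i \<in> Z" "x = card (Z \<inter> {1..i})" using jsf_rows[OF m x] by blast
 note f = subs_fin[OF zW Z(1)]
 have "x \<le> i" using card_mono[of "{1..i}" "Z \<inter> {1..i}"] Z(3) by simp
 moreover have "j \<le> x"
 proof (cases "j - 1 \<le> card Z")
  case True
  have "{1..min (j - 1) (card Z)} \<subseteq> Z" using ini Z(1) by blast
  hence "{1..j - 1} \<subseteq> Z" using True by (simp add: min_absorb1)
  hence "insert i {1..j - 1} \<subseteq> Z \<inter> {1..i}" using Z(2) j by auto
  hence "card (insert i {1..j - 1}) \<le> x" unfolding Z(3) using f by (intro card_mono) auto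
  moreover have "card (insert i {1..j - 1}) = j" using j by (subst card_insert_disjoint) auto
  ultimately show ?thesis by simp
 next
  case False
  have "{1..min (j - 1) (card Z)} \<subseteq> Z" using ini Z(1) by blast
  hence "{1..card Z} \<subseteq> Z" using False by (simp add: min_absorb2)
  hence "Z = {1..card Z}" using f by (intro card_subset_eq[symmetric]) auto
  hence "i \<in> {1..card Z}" using Z(2) by blast
  thus ?thesis using False j by simp
 qed
 ultimately show ?thesis by simp
qed

lemma sum_list_bound: "(\<forall>x\<in>set js. f x \<le> (c::nat)) ==> sum_list (map f js) \<le> length js * c \<and> (sum_list (map f js) = length js * c --> (\<forall>x\<in>set js. f x = c))"
 by (induction js) auto

lemma move_potential: assumes m: "mvs i c zX zW" and zW: "zW \<in> zset n k" and j: "1 \<le> j" "j \<le> i" "i < n"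
 and ini: "\<forall>Z\<in>set zW. {1..min (j - 1) (card Z)} \<subseteq> Z"
 shows "PP n zX \<le> PP n zW + (n + 1 - j) * c" "PP n zX = PP n zW + (n + 1 - j) * c ==> \<forall>x\<in>set (jsf i zX zW). x = j"
proof -
 have js: "x \<in> set (jsf i zX zW) ==> j \<le> x \<and> x \<le> i" for x by (rule move_js[OF m zW j(1,2) ini])
 have sub: "set (jsf i zX zW) \<subseteq> {1..i}" using js j(1) by (meson atLeastAtMost_iff le_trans subsetI)
 have s: "subs n zW" "1 \<le> i" using zW j by (auto simp: zset_def)
 have E: "PP n zX = PP n zW + sum_list (map (\<lambda>j. n + 1 - j) (jsf i zX zW))" by (rule PP_move[OF m s j(3) sub])
 have len: "length (jsf i zX zW) = c" using mvs_ac[OF m s] by blast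
 have b: "sum_list (map (\<lambda>j. n + 1 - j) (jsf i zX zW)) \<le> c * (n + 1 - j)"
  "sum_list (map (\<lambda>j. n + 1 - j) (jsf i zX zW)) = c * (n + 1 - j) --> (\<forall>x\<in>set (jsf i zX zW). n + 1 - x = n + 1 - j)"
 proof -
  have "\<forall>x\<in>set (jsf i zX zW). n + 1 - x \<le> n + 1 - j" using js by (meson diff_le_mono2)
  from sum_list_bound[OF this] show "sum_list (map (\<lambda>j. n + 1 - j) (jsf i zX zW)) \<le> c * (n + 1 - j)"
   "sum_list (map (\<lambda>j. n + 1 - j) (jsf i zX zW)) = c * (n + 1 - j) --> (\<forall>x\<in>set (jsf i zX zW). n + 1 - x = n + 1 - j)"
   unfolding len by blast+
 qed
 show "PP n zX \<le> PP n zW + (n + 1 - j) * c" unfolding E using b(1) by (simp add: mult.commute)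
 assume "PP n zX = PP n zW + (n + 1 - j) * c"
 hence "\<forall>x\<in>set (jsf i zX zW). n + 1 - x = n + 1 - j" unfolding E using b(2) by (simp add: mult.commute)
 moreover have "n + 1 - x = n + 1 - j ==> j \<le> x ==> x \<le> i ==> x = j" for x using j by linarith
 ultimately show "\<forall>x\<in>set (jsf i zX zW). x = j" using js by blast
qed

text \<open>The steps done so far belong to columns at least j and leave the entries below j in
  place. Hence step (j, i) gains at most n + 1 - j for each moved entry, which sums up to the bound.
  Equality keeps each step in its own column, and then the numbers \<open>ac\<close> are the
  exponents.\<close>

lemma Gop_potential: "ws n S ==> zX \<in> zset n k ==> Dz q n r s k l (Gop r s \<alpha> S) (rw n r zX) (rw n r (HH k)) \<noteq> 0 ==>
 (\<forall>j0. (\<forall>(j, i)\<in>set S. j0 \<le> j) --> (\<forall>Z\<in>set zX. {1..min (j0 - 1) (card Z)} \<subseteq> Z)) \<and>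
 PP n zX \<le> PS n S \<alpha> \<and>
 (PP n zX = PS n S \<alpha> --> (\<forall>j i. 1 \<le> j \<and> j \<le> i \<and> i < n --> ac zX j i = (if (j, i) \<in> set S then \<alpha> j i else 0)))"
proof (induction S arbitrary: zX)
 case Nil
 have H: "HH k \<in> zset n k" by (rule HH_zset[OF kn])
 have "rw n r zX = rw n r (HH k)" using Nil.prems(3) Dz_mid[OF k rwz[OF Nil.prems(2)] rwz[OF H]] by (auto split: if_splits)
 hence X: "zX = HH k" using rw_inj Nil.prems(2) H by (auto simp: zset_def)
 have "ac (HH k) j i = 0" if "1 \<le> j" "j \<le> i" for j i using HH_ac that by blast
 hence "PP n zX = 0" unfolding PP_def X by (intro sum.neutral ballI) simp
 thus ?case unfolding X using HH_ac by (auto simp: HH_def PS_def)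
next
 case (Cons ji S)
 obtain j i where ji: "ji = (j, i)" by (cases ji)
 hence w: "1 \<le> j" "j \<le> i" "i < n" "1 \<le> i" "ws n S" and later: "\<forall>(j', i')\<in>set S. j < j' \<or> j = j' \<and> i' < i"
  using Cons.prems(1) by (auto simp: ws_Cons)
 have notin: "(j, i) \<notin> set S" using later by auto
 have H: "HH k \<in> zset n k" by (rule HH_zset[OF kn])
 obtain zW where zW: "zW \<in> zset n k" "mvs i (\<alpha> j i) zX zW" "Dz q n r s k l (Gop r s \<alpha> S) (rw n r zW) (rw n r (HH k)) \<noteq> 0"
  using Dz_nonzero[OF w(4,3) Gop_qSchur[OF w(5)] Cons.prems(2) H] Cons.prems(3) by (auto simp: ji)
 note IH = Cons.IH[OF w(5) zW(1,3)]
 have ini: "\<forall>Z\<in>set zW. {1..min (j - 1) (card Z)} \<subseteq> Z"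
 proof -
  have "\<forall>(j', i')\<in>set S. j \<le> j'" using later by auto
  thus ?thesis using IH by blast
 qed
 have s: "subs n zW" using zW by (simp add: zset_def)
 have A: "\<forall>j0. (\<forall>(j, i)\<in>set (ji # S). j0 \<le> j) --> (\<forall>Z\<in>set zX. {1..min (j0 - 1) (card Z)} \<subseteq> Z)"
 proof (intro allI impI ballI)
  fix j0 X assume j0: "\<forall>(j, i)\<in>set (ji # S). j0 \<le> j" and X: "X \<in> set zX"
  have "\<forall>Z\<in>set zW. {1..min (j0 - 1) (card Z)} \<subseteq> Z" using IH j0 by auto
  moreover obtain Z where Z: "Z \<in> set zW" "X = Z \<or> i \<in> Z \<and> Suc i \<notin> Z \<and> X = insert (Suc i) (Z - {i})"
   using mvs_rows[OF zW(2) X] by blast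
  moreover have "card X = card Z"
  proof -
   have "finite Z" using subs_fin[OF zW(1) Z(1)] by simp
   thus ?thesis using Z(2) card_Suc_Diff1[of Z i] by auto
  qed
  moreover have "j0 \<le> j" using j0 ji by auto
  ultimately show "{1..min (j0 - 1) (card X)} \<subseteq> X" using w(1,2) by fastforce
 qed
 have PSC: "PS n (ji # S) \<alpha> = PS n S \<alpha> + (n + 1 - j) * \<alpha> j i" unfolding ji by (rule PS_Cons[OF w(1-3) notin])
 have pot: "PP n zX \<le> PP n zW + (n + 1 - j) * \<alpha> j i" "PP n zX = PP n zW + (n + 1 - j) * \<alpha> j i ==> \<forall>x\<in>set (jsf i zX zW). x = j"
  using move_potential[OF zW(2,1) w(1-3) ini] by blast+
 have le: "PP n zX \<le> PS n (ji # S) \<alpha>" unfolding PSC using pot(1) IH by linarith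
 have "\<forall>j' i'. 1 \<le> j' \<and> j' \<le> i' \<and> i' < n --> ac zX j' i' = (if (j', i') \<in> set (ji # S) then \<alpha> j' i' else 0)" if eq: "PP n zX = PS n (ji # S) \<alpha>"
 proof -
  have e: "PP n zW = PS n S \<alpha>" "PP n zX = PP n zW + (n + 1 - j) * \<alpha> j i" using eq pot(1) IH unfolding PSC by linarith+
  have js: "\<forall>x\<in>set (jsf i zX zW). x = j" by (rule pot(2)[OF e(2)])
  have m: "ac zX j' i' = ac zW j' i' + (if i' = i then length (filter (\<lambda>x. x = j') (jsf i zX zW)) else 0)" "length (jsf i zX zW) = \<alpha> j i" for j' i'
   using mvs_ac[OF zW(2) s w(4)] by blast+
  have "length (filter (\<lambda>x. x = j') (jsf i zX zW)) = (if j' = j then \<alpha> j i else 0)" for j'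
  proof (cases "j' = j")
   case True
   hence "filter (\<lambda>x. x = j') (jsf i zX zW) = jsf i zX zW" using js by (simp add: filter_id_conv)
   thus ?thesis using True m(2) by simp
  next
   case False
   hence "filter (\<lambda>x. x = j') (jsf i zX zW) = []" using js by (auto simp: filter_empty_conv)
   thus ?thesis using False by simp
  qed
  thus ?thesis using IH e(1) m(1) notin by (auto simp: ji)
 qed
 thus ?case using A le by blast
qed

lemma Gop_SS: "ws n S ==> zX \<in> zset n k ==> zY \<in> zset n k ==> Dz q n r s k l (Gop r s \<alpha> S) (rw n r zX) (rw n r zY) \<noteq> 0 ==>
 SS zX = SS zY + (\<Sum>(j, i)\<leftarrow>S. \<alpha> j i)"
proof (induction S arbitrary: zX)
 case Nil
 hence "rw n r zX = rw n r zY" using Dz_mid[OF k rwz[OF Nil.prems(2)] rwz[OF Nil.prems(3)]] by (auto split: if_splits)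
 thus ?case using rw_inj Nil.prems by (auto simp: zset_def)
next
 case (Cons ji S)
 obtain j i where ji: "ji = (j, i)" by (cases ji)
 hence w: "1 \<le> i" "i < n" "ws n S" using Cons.prems(1) by (auto simp: ws_Cons)
 obtain zW where zW: "zW \<in> zset n k" "mvs i (\<alpha> j i) zX zW" "Dz q n r s k l (Gop r s \<alpha> S) (rw n r zW) (rw n r zY) \<noteq> 0"
  using Dz_nonzero[OF w(1,2) Gop_qSchur[OF w(3)] Cons.prems(2,3)] Cons.prems(4) by (auto simp: ji)
 thus ?case using Cons.IH[OF w(3) zW(1) Cons.prems(3) zW(3)] mvs_SS[OF zW(2), of n] by (simp add: ji zset_def)
qed

lemma PP_PS: assumes "\<And>j i. 1 \<le> j ==> j \<le> i ==> i < n ==> ac zX j i = (if (j, i) \<in> set S then \<alpha> j i else 0)"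
 shows "PP n zX = PS n S \<alpha>"
 unfolding PP_def PS_def by (intro sum.cong refl) (use assms in auto)

text \<open>The list before the outermost step is \<open>unm j i zX\<close>; by the potential no
  other intermediate list contributes. So the coefficient is a product of units.\<close>

lemma Gop_unit: "ws n S ==> zX \<in> zset n k ==> (\<And>j i. 1 \<le> j ==> j \<le> i ==> i < n ==> ac zX j i = (if (j, i) \<in> set S then \<alpha> j i else 0)) ==>
  Dz q n r s k l (Gop r s \<alpha> S) (rw n r zX) (rw n r (HH k)) dvd 1"
proof (induction S arbitrary: zX)
 case Nil
 have H: "HH k \<in> zset n k" by (rule HH_zset[OF kn])
 have "zX = HH k" by (rule initial_rows[OF Nil.prems(2)]) (use Nil.prems(3) in simp)
 thus ?case using Dz_mid[OF k rwz[OF H] rwz[OF H]] by simp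
next
 case (Cons ji S)
 obtain j i where ji: "ji = (j, i)" by (cases ji)
 hence w: "1 \<le> j" "j \<le> i" "i < n" "1 \<le> i" "ws n S" and later: "\<forall>(j', i')\<in>set S. j < j' \<or> j = j' \<and> i' < i"
  using Cons.prems(1) by (auto simp: ws_Cons)
 have notin: "(j, i) \<notin> set S" using later by auto
 have H: "HH k \<in> zset n k" by (rule HH_zset[OF kn])
 have acX: "ac zX j' i' = (if (j', i') \<in> set (ji # S) then \<alpha> j' i' else 0)" if "1 \<le> j'" "j' \<le> i'" "i' < n" for j' i' using Cons.prems(3) that by blast
 \<comment> \<open>In the order of the steps (j, i + 1) and (j - 1, i - 1) do not occur, so their
   counts vanish where they apply. Hence a j-th entry above i is exactly i + 1, and the j - 1
   entries before it are below i.\<close>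
 have R: "\<forall>Z\<in>set zX. card (Z \<inter> {1..i}) < j \<and> j \<le> card Z --> Suc i \<in> Z \<and> i \<notin> Z \<and> card (Z \<inter> {1..i}) = j - 1"
 proof (intro ballI impI)
  fix Z assume Z: "Z \<in> set zX" and c: "card (Z \<inter> {1..i}) < j \<and> j \<le> card Z"
  note f = subs_fin[OF Cons.prems(2) Z]
  have 1: "j \<le> card (Z \<inter> {1..Suc i})"
  proof (cases "Suc i = n")
   case True
   thus ?thesis using c f by (simp add: Int_absorb2 del: One_nat_def)
  next
   case False
   have "(j, Suc i) \<notin> set (ji # S)" using later by (auto simp: ji)
   hence "ac zX j (Suc i) = 0" using acX[of j "Suc i"] w False by simp
   thus ?thesis using ac_zeroD Z c by blast
  qed
  have 2: "j - 1 \<le> card (Z \<inter> {1..i - 1})"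
  proof (cases "j = 1")
   case False
   have "(j - 1, i - 1) \<notin> set (ji # S)" using later w(1) by (auto simp: ji)
   hence "ac zX (j - 1) (i - 1) = 0" using acX[of "j - 1" "i - 1"] w False by simp
   thus ?thesis using ac_zeroD Z c by (metis diff_le_self le_trans)
  qed simp
  have "card (Z \<inter> {1..Suc i}) = card (Z \<inter> {1..i}) + (if Suc i \<in> Z then 1 else 0)" by (rule card_Suc)
  moreover have "card (Z \<inter> {1..i}) = card (Z \<inter> {1..i - 1}) + (if i \<in> Z then 1 else 0)" by (rule card_last[OF w(4)])
  ultimately show "Suc i \<in> Z \<and> i \<notin> Z \<and> card (Z \<inter> {1..i}) = j - 1" using 1 2 c by (simp split: if_splits)
 qed
 define X' where "X' = unm j i zX"
 have fin: "Z \<in> set zX ==> finite Z" for Z using subs_fin[OF Cons.prems(2)] by blast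
 have m: "mvs i (ac zX j i) zX X'" unfolding X'_def by (rule mvs_unm) (use R in blast)
 have sX': "subs n X'" using subs_fin[OF Cons.prems(2)] w by (auto simp: X'_def unm_def subs_def)
 have zX': "X' \<in> zset n k" using mvs_card[OF m sX'] sX' Cons.prems(2) by (simp add: zset_def)
 have acX': "ac X' j' i' = (if j' = j \<and> i' = i then 0 else ac zX j' i')" for j' i'
  unfolding X'_def by (rule ac_unm[OF fin w(4) R])
 have a: "ac zX j i = \<alpha> j i" using acX[OF w(1-3)] by (simp add: ji)
 have U1: "Dz q n r s k l (Gop r s \<alpha> S) (rw n r X') (rw n r (HH k)) dvd 1"
  by (rule Cons.IH[OF w(5) zX']) (use acX acX' notin in \<open>auto simp: ji\<close>)
 have U2: "Dz q n r s k l (FM n q r s i (\<alpha> j i)) (rw n r zX) (rw n r X') dvd 1"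
  by (rule Dz_FM_mvs(2)[OF q n w(4,3) k Cons.prems(2) zX']) (use m a in simp)
 have PX: "PP n zX = PS n (ji # S) \<alpha>" by (rule PP_PS) (rule acX)
 have PSC: "PS n (ji # S) \<alpha> = PS n S \<alpha> + (n + 1 - j) * \<alpha> j i" unfolding ji by (rule PS_Cons[OF w(1-3) notin])
 show ?case unfolding ji Gop.simps
 proof (rule Dz_prod_unit[OF FM_qSchur[OF q n w(4,3)] Gop_qSchur[OF w(5)] Cons.prems(2) H zX' U2 U1])
  fix zW assume zW: "zW \<in> zset n k" and nz: "Dz q n r s k l (FM n q r s i (\<alpha> j i)) (rw n r zX) (rw n r zW) \<noteq> 0" "Dz q n r s k l (Gop r s \<alpha> S) (rw n r zW) (rw n r (HH k)) \<noteq> 0"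
  have mW: "mvs i (\<alpha> j i) zX zW" using Dz_FM_mvs(1)[OF q n w(4,3) k Cons.prems(2) zW] nz(1) by blast
  note A = Gop_potential[OF w(5) zW nz(2)]
  have "\<forall>(j', i')\<in>set S. j \<le> j'" using later by auto
  hence ini: "\<forall>Z\<in>set zW. {1..min (j - 1) (card Z)} \<subseteq> Z" using A by blast
  have "PP n zX = PP n zW + (n + 1 - j) * \<alpha> j i"
   using move_potential(1)[OF mW zW w(1-3) ini] PX A unfolding PSC by linarith
  hence js: "\<forall>x\<in>set (jsf i zX zW). x = j" by (rule move_potential(2)[OF mW zW w(1-3) ini])
  show "zW = X'" using unm_unique[OF mW _ w(4,1) js, of n] zW a by (simp add: zset_def X'_def)
 qed
qed

end

end

section \<open>The basis elements and the triangularity of their coefficients\<close>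

context
 fixes q :: "'a::comm_ring_1" and n :: nat
 assumes q: "q dvd 1" and n: "1 \<le> n"
begin

lemma TT_mult: "TT q r (mmul n m A C) = mmul n m (TT q r C) (TT q r A)"
proof (intro ext)
 fix x y
 have "tw q r x y * (A y z * C z x) = (tw q r x z * C z x) * (tw q r z y * A y z)" for z
  using tw_mult[OF q, of r x z y] by (simp add: mult_ac)
 thus "TT q r (mmul n m A C) x y = mmul n m (TT q r C) (TT q r A) x y"
  by (simp add: TT_def[OF q n] mmul_def sum_distrib_left)
qed

lemma TT_diag: "(\<And>x y. x \<noteq> y ==> A x y = 0) ==> TT q r A = A"
proof (intro ext)
 fix x y assume A: "\<And>x y. x \<noteq> y ==> A x y = 0"
 show "TT q r A x y = A x y" by (cases "x = y") (use A[of x y] A[of y x] in \<open>auto simp: TT_def[OF q n] tw_def\<close>)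
qed

lemma full_steps: "ws n (stp n (n - 1))" "1 \<le> j ==> j \<le> i ==> i < n ==> (j, i) \<in> set (stp n (n - 1))"
 using stp[of "n - 1" n] n by auto

lemma Gop_rho: "ws n S ==> Gop q n r s \<alpha> S \<in> rho_U' n q r s \<and> TT q r (Gop q n r s \<alpha> S) \<in> rho_U' n q r s"
proof (induction S)
 case Nil
 have "TT q r (mid n (r + s)) = (mid n (r + s) :: 'a mat)" by (rule TT_diag) (simp add: mid_def)
 moreover have "mid n (r + s) \<in> rho_U' n q r s" unfolding rho_U'_def by (rule alg_gen.one)
 ultimately show ?case by (simp add: Gop.simps[OF q n])
next
 case (Cons ji S)
 obtain j i where ji: "ji = (j, i)" by (cases ji)
 hence "1 \<le> i" "i < n" "ws n S" using Cons.prems by (auto simp: ws_Cons)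
 thus ?case using Cons FM_rho[OF q n, of i r s] TT_FM_rho[OF q n, of i r s]
  by (simp add: ji Gop.simps[OF q n] TT_mult mult_rho[OF q n])
qed

definition uel :: "nat => nat => nat set list => 'a mat" where
 "uel r s t = Gop q n r s (ac t) (stp n (n - 1))"

text \<open>It leads from t back to the rows {1..c} and on to the opposite extreme list. The second
  passage uses the whole range of entry sums of the shape, so at another shape it vanishes unless
  that shape has at least as much room.\<close>

definition BB :: "nat => nat => nat set list => 'a mat" where
 "BB r s t = mmul n (r + s) (uel r s (HL n (map card t))) (TT q r (uel r s t))"

text \<open>Two halves hinged at the extreme list, in the manner of a cellular basis: at the top
  order the coefficient splits into a factor for t and one for t'.\<close>

definition uu :: "nat => nat => nat set list \<times> nat set list => 'a mat" where
 "uu r s p = mmul n (r + s) (TT q r (BB r s (fst p))) (BB r s (snd p))"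

lemma uel_rho: "uel r s t \<in> rho_U' n q r s" "TT q r (uel r s t) \<in> rho_U' n q r s"
 using Gop_rho[OF full_steps(1)] by (auto simp: uel_def)

lemma BB_rho: "BB r s t \<in> rho_U' n q r s" "TT q r (BB r s t) \<in> rho_U' n q r s"
 unfolding BB_def TT_mult TT_TT[OF q n] by (intro mult_rho[OF q n] uel_rho)+

lemma uu_rho: "uu r s p \<in> rho_U' n q r s" unfolding uu_def by (intro mult_rho[OF q n] BB_rho)

lemma rho_qSchur: "A \<in> rho_U' n q r s ==> A \<in> qSchur n q r s" using rho_U'_sub[OF q n] rho_U_sub[OF q n] by blast

definition adm :: "nat => nat => nat set list => bool" where
 "adm r s t \<longleftrightarrow> subs n t \<and> stdz n t \<and> (\<exists>l. lvl n r s (map card t) l)"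

definition I0 :: "nat => nat => (nat set list \<times> nat set list) set" where
 "I0 r s = {(t, t'). adm r s t \<and> adm r s t' \<and> map card t = map card t'}"

definition crd :: "nat => nat => nat set list \<times> nat set list => 'a mat => 'a" where
 "crd r s p M = Dz q n r s (map card (fst p)) (r - sT r (map card (fst p))) M (rw n r (fst p)) (rw n r (snd p))"

lemma level_eq: "lvl n r s k l ==> l = r - sT r k" by (auto simp: lvl_def[OF q n])

lemma finite_I0: "finite (I0 r s)"
proof -
 have "I0 r s \<subseteq> {zs. set zs \<subseteq> Pow {1..n} \<and> length zs = r + s} \<times> {zs. set zs \<subseteq> Pow {1..n} \<and> length zs = r + s}"
 proof -
  have "set t \<subseteq> Pow {1..n} \<and> length t = r + s" if "adm r s t" for t
   using that unfolding adm_def subs_def lvl_def[OF q n] by (auto simp del: atLeastAtMost_iff)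
  thus ?thesis unfolding I0_def by blast
 qed
 moreover have "finite {zs. set zs \<subseteq> Pow {1..n} \<and> length zs = r + s}" by (rule finite_lists_length_eq) simp
 ultimately show ?thesis by (meson finite_SigmaI finite_subset)
qed

lemma tw_dvd: "tw q m x y dvd 1" unfolding tw_def by (rule qpow_unit[OF q])

text \<open>The largest increase of the entry sum possible within shape k, from {1..c} rows to
  {n+1-c..n} rows.\<close>

definition ee :: "nat list => nat" where "ee k = SS (HL n k) - SS (HH k)"

context
 fixes r s :: nat and k1 :: "nat list" and l1 :: nat
 assumes k1: "lvl n r s k1 l1"
begin

lemma Dz_TTz: assumes "A \<in> qSchur n q r s" "X \<in> zset n k1" "Y \<in> zset n k1"
 shows "Dz q n r s k1 l1 (TT q r A) (rw n r X) (rw n r Y) = tw q (sT r k1) (x0 (rw n r X)) (x0 (rw n r Y)) * Dz q n r s k1 l1 A (rw n r Y) (rw n r X)"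
 by (rule Dz_TT[OF q n assms(1) k1]) (use rwz[OF q n k1] assms in auto)

lemma HHz: "HH k1 \<in> zset n k1" "HL n k1 \<in> zset n k1" using k1 by (auto intro!: HH_zset HL_zset simp: lvl_def[OF q n])

lemma SS_level: assumes "W \<in> zset n k1"
 shows "SS (HH k1) \<le> SS W" "SS (HH k1) = SS W ==> W = HH k1" "SS W \<le> SS (HL n k1)" "SS W = SS (HL n k1) ==> W = HL n k1"
 using SS_bounds[of n W] assms by (auto simp: zset_def)

lemma uel_PS: "PS n (stp n (n - 1)) (ac t) = PP n t"
 by (rule PP_PS[OF q n k1, symmetric]) (use full_steps(2) in presburger)

lemma uel_unit: assumes t: "t \<in> zset n k1" shows "Dz q n r s k1 l1 (uel r s t) (rw n r t) (rw n r (HH k1)) dvd 1"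
 unfolding uel_def by (rule Gop_unit[OF q n k1 full_steps(1) t]) (use full_steps(2) in presburger)

lemma uel_SS: assumes "U \<in> zset n k1" "W \<in> zset n k1" "Dz q n r s k1 l1 (uel r s t) (rw n r U) (rw n r W) \<noteq> 0"
 shows "SS U = SS W + (\<Sum>(j, i)\<leftarrow>stp n (n - 1). ac t j i)"
 using Gop_SS[OF q n k1 full_steps(1) assms(1,2)] assms(3) by (simp add: uel_def)

lemma ee_sum: assumes "(0::'a) \<noteq> 1" shows "ee k1 = (\<Sum>(j, i)\<leftarrow>stp n (n - 1). ac (HL n k1) j i)"
proof -
 have "Dz q n r s k1 l1 (uel r s (HL n k1)) (rw n r (HL n k1)) (rw n r (HH k1)) \<noteq> 0" using uel_unit[OF HHz(2)] assms by auto
 thus ?thesis using uel_SS[OF HHz(2,1)] by (simp add: ee_def)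
qed

end

text \<open>A nonzero coefficient of the first factor of BB at the level k1 bounds the total shift by the maximal
 possible one; in the case of equality it forces the extreme rows.\<close>

lemma uel_HL: assumes k1: "lvl n r s k1 l1" and k: "lvl n r s k l" and U: "U \<in> zset n k1" and W: "W \<in> zset n k1"
 and nz: "Dz q n r s k1 l1 (uel r s (HL n k)) (rw n r U) (rw n r W) \<noteq> 0" and so: "sorted k" "sorted k1"
 shows "ee k < ee k1 \<or> ee k = ee k1 \<and> U = HL n k1 \<and> W = HH k1 \<and> PP n (HL n k1) \<le> PP n (HL n k) \<and> (PP n (HL n k1) = PP n (HL n k) --> k1 = k)"
proof -
 have "(0::'a) \<noteq> 1" using nz by (metis mult_1 mult_zero_left)
 hence S: "SS U = SS W + ee k" using uel_SS[OF k1 U W nz] ee_sum[OF k] by simp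
 note b = SS_level[OF k1 U] SS_level[OF k1 W]
 have e: "ee k \<le> ee k1" "ee k = ee k1 ==> U = HL n k1 \<and> W = HH k1" using S b unfolding ee_def by linarith+
 show ?thesis
 proof (cases "ee k = ee k1")
  case True
  hence VW: "U = HL n k1" "W = HH k1" using e(2) by auto
  note G = Gop_potential[OF q n k1 full_steps(1) U nz[unfolded uel_def VW(2)]]
  \<comment> \<open>Equal potentials force the extreme lists of both shapes to share the numbers
    \<open>ac\<close>; those at i = n - 1 count row lengths, so the shapes coincide.\<close>
  have "k1 = k" if "PP n (HL n k1) = PP n (HL n k)"
  proof (rule sorted_shape)
   show "sorted k1" "sorted k" "1 \<le> n" by (rule so n)+
   show "length k1 = length k" "\<forall>c\<in>set k1. c \<le> n" "\<forall>c\<in>set k. c \<le> n" using k k1 by (auto simp: lvl_def[OF q n])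
   have "sum_list k1 + sF n r k1 = sT r k1 + n * s" "sum_list k + sF n r k = sT r k + n * s"
    using sum_k[of k1 n r] sum_k[of k n r] k1 k by (auto simp: lvl_def[OF q n])
   moreover have "sT r k1 + l1 = r" "sF n r k1 + l1 = s" "sT r k + l = r" "sF n r k + l = s" using k1 k by (auto simp: lvl_def[OF q n])
   ultimately show "sum_list k1 = sum_list k" by linarith
   fix j assume j: "1 \<le> j" "j < n"
   hence "ac (HL n k1) j (n - 1) = ac (HL n k) j (n - 1)"
    using G that full_steps(2)[of j "n - 1"] unfolding uel_PS[OF k1] VW(1) by auto
   thus "count_list k1 j = count_list k j" using ac_HL j k k1 by (simp add: lvl_def[OF q n])
  qed
  thus ?thesis using True VW G unfolding uel_PS[OF k1] by blast
 qed (use e in simp)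
qed

context
 fixes r s :: nat and k1 :: "nat list" and l1 :: nat and t :: "nat set list"
 assumes k1: "lvl n r s k1 l1" and t: "adm r s t"
begin

lemma uel_S: "uel r s t \<in> qSchur n q r s" "TT q r (uel r s t) \<in> qSchur n q r s" "BB r s t \<in> qSchur n q r s" "TT q r (BB r s t) \<in> qSchur n q r s"
 using rho_qSchur uel_rho BB_rho by auto

lemma tz: "t \<in> zset n (map card t)" "stdz n t" "sorted (map card t)"
proof -
 show z: "t \<in> zset n (map card t)" "stdz n t" using t by (auto simp: adm_def zset_def)
 show "sorted (map card t)" by (rule stdz_sorted[OF z(2,1)])
qed

text \<open>The first factor of \<open>BB\<close> restricts the shape and, in the extreme case, pins
  both lists next to it. The second factor is then a transposed coefficient from {1..c} rows to X,
  which the potential compares with t.\<close>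

lemma BB_triangular: assumes U: "U \<in> zset n k1" and X: "X \<in> zset n k1" "stdz n X"
 and nz: "Dz q n r s k1 l1 (BB r s t) (rw n r U) (rw n r X) \<noteq> 0"
 shows "ee (map card t) < ee k1 \<or> ee (map card t) = ee k1 \<and> U = HL n k1 \<and>
  (PP n (HL n k1) < PP n (HL n (map card t)) \<or> k1 = map card t \<and> PP n X \<le> PP n t \<and> (PP n X = PP n t --> X = t))"
proof -
 obtain l where l: "lvl n r s (map card t) l" using t by (auto simp: adm_def)
 obtain W where W: "W \<in> zset n k1" "Dz q n r s k1 l1 (uel r s (HL n (map card t))) (rw n r U) (rw n r W) \<noteq> 0"
  "Dz q n r s k1 l1 (TT q r (uel r s t)) (rw n r W) (rw n r X) \<noteq> 0"
  using Dz_prod[OF q n k1 _ uel_S(2) U X(1) nz[unfolded BB_def]] rho_qSchur uel_rho by blast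
 have nz: "Dz q n r s k1 l1 (uel r s t) (rw n r X) (rw n r W) \<noteq> 0"
  using W(3) unfolding Dz_TTz[OF k1 uel_S(1) W(1) X(1)] by auto
 have "PP n X \<le> PP n t \<and> (PP n X = PP n t --> X = t)" if kk: "k1 = map card t" and WH: "W = HH k1"
 proof -
  note G = Gop_potential[OF q n k1 full_steps(1) X(1) nz[unfolded uel_def WH]]
  have "X = t" if e: "PP n X = PP n t"
  proof (rule ac_determines[OF X])
   show "t \<in> zset n k1" "stdz n t" using tz kk by auto
   fix j i assume "1 \<le> j" "j \<le> i" "i < n"
   thus "ac X j i = ac t j i" using G e full_steps(2)[of j i] unfolding uel_PS[OF k1] by auto
  qed
  thus ?thesis using G unfolding uel_PS[OF k1] by blast
 qed
 thus ?thesis using uel_HL[OF k1 l U W(1,2) tz(3) stdz_sorted[OF X(2,1)]] by linarith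
qed

lemma BB_unit: assumes kk: "k1 = map card t" shows "Dz q n r s k1 l1 (BB r s t) (rw n r (HL n k1)) (rw n r t) dvd 1"
 unfolding BB_def kk[symmetric]
proof (rule Dz_prod_unit[OF q n k1])
 have t1: "t \<in> zset n k1" using tz kk by simp
 show "HL n k1 \<in> zset n k1" "HH k1 \<in> zset n k1" "t \<in> zset n k1" by (rule HHz[OF k1] t1)+
 show "uel r s (HL n k1) \<in> qSchur n q r s" "TT q r (uel r s t) \<in> qSchur n q r s" using rho_qSchur uel_rho by auto
 show "Dz q n r s k1 l1 (uel r s (HL n k1)) (rw n r (HL n k1)) (rw n r (HH k1)) dvd 1" by (rule uel_unit[OF k1 HHz(2)[OF k1]])
 show "Dz q n r s k1 l1 (TT q r (uel r s t)) (rw n r (HH k1)) (rw n r t) dvd 1"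
  unfolding Dz_TTz[OF k1 uel_S(1) HHz(1)[OF k1] t1] using mult_dvd_mono[OF tw_dvd uel_unit[OF k1 t1]] by simp
 fix W assume W: "W \<in> zset n k1" "Dz q n r s k1 l1 (uel r s (HL n k1)) (rw n r (HL n k1)) (rw n r W) \<noteq> 0"
 thus "W = HH k1" using uel_HL[OF k1 k1 HHz(2)[OF k1] W] tz(3) kk by blast
qed

end

lemma uu_triangular: assumes p: "(X, Y) \<in> I0 r s" and p': "(t, t') \<in> I0 r s" and nz: "crd r s (X, Y) (uu r s (t, t')) \<noteq> 0"
 shows "ee (map card t) < ee (map card X) \<or> ee (map card t) = ee (map card X) \<and> (PP n (HL n (map card X)) < PP n (HL n (map card t)) \<or>
  map card t = map card X \<and> PP n X \<le> PP n t \<and> PP n Y \<le> PP n t' \<and> (PP n X = PP n t --> X = t) \<and> (PP n Y = PP n t' --> Y = t'))"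
proof -
 define k where "k = map card X"
 have a: "adm r s X" "adm r s Y" "map card Y = k" "adm r s t" "adm r s t'" "map card t' = map card t" using p p' by (auto simp: I0_def k_def)
 obtain l where l: "lvl n r s k l" using a(1) by (auto simp: adm_def k_def)
 have XY: "X \<in> zset n k" "Y \<in> zset n k" "stdz n X" "stdz n Y" using a by (auto simp: adm_def zset_def k_def)
 have "Dz q n r s k l (uu r s (t, t')) (rw n r X) (rw n r Y) \<noteq> 0" using nz level_eq[OF l] by (simp add: crd_def k_def)
 then obtain U where U: "U \<in> zset n k" "Dz q n r s k l (TT q r (BB r s t)) (rw n r X) (rw n r U) \<noteq> 0" "Dz q n r s k l (BB r s t') (rw n r U) (rw n r Y) \<noteq> 0"
  using Dz_prod[OF q n l uel_S(4)[OF l a(4)] uel_S(3)[OF l a(5)] XY(1,2)] unfolding uu_def by auto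
 have "Dz q n r s k l (BB r s t) (rw n r U) (rw n r X) \<noteq> 0" using U(2) unfolding Dz_TTz[OF l uel_S(3)[OF l a(4)] XY(1) U(1)] by auto
 from BB_triangular[OF l a(4) U(1) XY(1,3) this] BB_triangular[OF l a(5) U(1) XY(2,4) U(3)]
 show ?thesis unfolding k_def[symmetric] a(6) by auto
qed

lemma uu_unit: assumes p: "(t, t') \<in> I0 r s" shows "crd r s (t, t') (uu r s (t, t')) dvd 1"
proof -
 define k where "k = map card t"
 have a: "adm r s t" "adm r s t'" "map card t' = k" using p by (auto simp: I0_def k_def)
 obtain l where l: "lvl n r s k l" using a(1) by (auto simp: adm_def k_def)
 have tt: "t \<in> zset n k" "t' \<in> zset n k" "stdz n t'" using a by (auto simp: adm_def zset_def k_def)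
 note H = HHz(2)[OF l]
 have "Dz q n r s k l (uu r s (t, t')) (rw n r t) (rw n r t') dvd 1" unfolding uu_def fst_conv snd_conv
 proof (rule Dz_prod_unit[OF q n l uel_S(4)[OF l a(1)] uel_S(3)[OF l a(2)] tt(1,2) H])
  show "Dz q n r s k l (TT q r (BB r s t)) (rw n r t) (rw n r (HL n k)) dvd 1"
   unfolding Dz_TTz[OF l uel_S(3)[OF l a(1)] tt(1) H] using mult_dvd_mono[OF tw_dvd BB_unit[OF l a(1)]] by (simp add: k_def)
  show "Dz q n r s k l (BB r s t') (rw n r (HL n k)) (rw n r t') dvd 1" by (rule BB_unit[OF l a(2)]) (simp add: a(3))
  show "W = HL n k" if "W \<in> zset n k" "Dz q n r s k l (BB r s t') (rw n r W) (rw n r t') \<noteq> 0" for W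
   using BB_triangular[OF l a(2) that(1) tt(2,3) that(2)] a(3) by simp
 qed
 thus ?thesis using level_eq[OF l] by (simp add: crd_def k_def)
qed

lemma qSchur_sum: fixes A :: "'p => 'a mat"
 shows "finite I ==> (\<And>p. p \<in> I ==> A p \<in> qSchur n q r s) ==> (\<lambda>x y. \<Sum>p\<in>I. c p * A p x y) \<in> qSchur n q r s"
proof (induction I rule: finite_induct)
 case empty
 show ?case using qSchur_smult[OF q n one_qSchur[OF q n], of 0 r s] by simp
next
 case (insert p I)
 have "(\<lambda>x y. c p * A p x y + (\<Sum>p\<in>I. c p * A p x y)) \<in> qSchur n q r s"
  by (intro qSchur_add[OF q n] qSchur_smult[OF q n]) (use insert in auto)
 thus ?case using insert by simp
qed

lemma lv_sum: fixes A :: "'p => 'a mat"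
 shows "lv n r s l (\<lambda>x y. \<Sum>p\<in>I. c p * A p x y) = (\<lambda>x y. \<Sum>p\<in>I. c p * lv n r s l (A p) x y)"
proof (induction l arbitrary: r s A)
 case 0 thus ?case by (simp add: lv.simps[OF q n])
next
 case (Suc l)
 have "nx n r' s' (\<lambda>x y. \<Sum>p\<in>I. c p * A p x y) = (\<lambda>x y. \<Sum>p\<in>I. c p * nx n r' s' (A p) x y)" for r' s' and A :: "'p => 'a mat"
  by (intro ext) (auto simp: nx_def[OF q n] sum_distrib_left intro: sum.swap)
 thus ?case using Suc by (simp add: lv.simps[OF q n])
qed

lemma Dz_sum: fixes A :: "'p => 'a mat"
 shows "Dz q n r s k l (\<lambda>x y. \<Sum>p\<in>I. c p * A p x y) X Y = (\<Sum>p\<in>I. c p * Dz q n r s k l (A p) X Y)"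
 unfolding Dz_def[OF q n] DD_def lv_sum ap_def sum_distrib_left sum_distrib_right
 by (subst sum.swap) (simp add: mult.assoc)

lemma crd_sum: fixes A :: "'p => 'a mat"
 shows "crd r s p' (\<lambda>x y. \<Sum>p\<in>I. c p * A p x y) = (\<Sum>p\<in>I. c p * crd r s p' (A p))"
 by (simp add: crd_def Dz_sum)

lemma crd_zero: assumes M: "M \<in> qSchur n q r s" and z: "\<And>p. p \<in> I0 r s ==> crd r s p M = 0" shows "M = (\<lambda>x y. 0)"
proof (intro ext)
 fix x y
 show "M x y = 0"
 proof (rule standard_injective[OF q n M])
  fix k l t t' assume h: "lvl n r s k l" "t \<in> zset n k" "t' \<in> zset n k" "stdz n t" "stdz n t'"
  hence "(t, t') \<in> I0 r s" by (auto simp: I0_def adm_def zset_def)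
  from z[OF this] show "Dz q n r s k l M (rw n r t) (rw n r t') = 0" using h level_eq[OF h(1)] by (simp add: crd_def zset_def)
 qed
qed

definition bnd :: "nat => nat => nat" where "bnd r s = (\<Sum>p\<in>I0 r s. PP n (fst p) + PP n (snd p))"

definition wgt :: "nat => nat => nat set list \<times> nat set list => nat" where
 "wgt r s p = PP n (HL n (map card (fst p))) * Suc (bnd r s) + (PP n (fst p) + PP n (snd p))"

text \<open>A lexicographic order packed into one number: first \<open>ee\<close>, then, reversed,
  the potential of the extreme list followed by the potentials of the two tableaux. The factors
  \<open>Suc\<close> of upper bounds keep the components apart.\<close>

definition rk :: "nat => nat => nat set list \<times> nat set list => nat" where
 "rk r s p = ee (map card (fst p)) * Suc (\<Sum>p\<in>I0 r s. wgt r s p) + ((\<Sum>p\<in>I0 r s. wgt r s p) - wgt r s p)"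

lemma rk_less: assumes "p \<in> I0 r s" "p' \<in> I0 r s" "p \<noteq> p'" "crd r s p (uu r s p') \<noteq> 0" shows "rk r s p' < rk r s p"
proof -
 have b: "PP n (fst z) + PP n (snd z) \<le> bnd r s" "wgt r s z \<le> (\<Sum>p\<in>I0 r s. wgt r s p)" if "z \<in> I0 r s" for z
  unfolding bnd_def by (rule member_le_sum[OF that _ finite_I0]; simp)+
 have lex: "a * Suc d + c < a' * Suc d + c'" if "a < a'" "c \<le> d" for a a' c c' d :: nat
 proof -
  have "Suc a * Suc d \<le> a' * Suc d" using that by (intro mult_le_mono1) simp
  thus ?thesis using that by simp
 qed
 obtain X Y t t' where pp: "p = (X, Y)" "p' = (t, t')" by (cases p; cases p')
 from uu_triangular[of X Y r s t t'] assms pp have "ee (map card t) < ee (map card X) \<or> ee (map card t) = ee (map card X) \<and> wgt r s p < wgt r s p'"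
  using lex[of "PP n (HL n (map card X))" "PP n (HL n (map card t))" "PP n X + PP n Y" "bnd r s"] b(1)[OF assms(1)] unfolding wgt_def by (auto simp: pp)
 thus ?thesis using lex[of "ee (map card t)" "ee (map card X)" "(\<Sum>p\<in>I0 r s. wgt r s p) - wgt r s p'" "\<Sum>p\<in>I0 r s. wgt r s p"] b(2)[OF assms(2)]
  unfolding rk_def pp fst_conv by (auto simp del: mult_Suc_right)
qed

text \<open>The triangular system yields a combination with the same standard coefficients as M.
  Their difference lies in the commutant and has none, so it is zero. Uniqueness is the triviality
  of the kernel of the same system.\<close>

theorem standard_basis: assumes M: "M \<in> qSchur n q r s" and f: "bij_betw f B (I0 r s)"
 shows "\<exists>!c. (\<forall>p. p \<notin> B --> c p = 0) \<and> M = (\<lambda>x y. \<Sum>p\<in>B. c p * uu r s (f p) x y)"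
proof -
 let ?A = "\<lambda>p p'. crd r s (f p) (uu r s (f p'))" and ?L = "\<lambda>c x y. \<Sum>p\<in>B. c p * uu r s (f p) x y"
 have B: "finite B" using bij_betw_finite[OF f] finite_I0 by simp
 have fB: "p \<in> B ==> f p \<in> I0 r s" for p using f by (auto simp: bij_betw_def)
 have u: "?A p p dvd 1" if "p \<in> B" for p using uu_unit[of "fst (f p)" "snd (f p)" r s] fB[OF that] by simp
 have rk: "rk r s (f p') < rk r s (f p)" if "p \<in> B" "p' \<in> B" "p \<noteq> p'" "?A p p' \<noteq> 0" for p p'
  using rk_less[OF fB fB _ that(4)] that f by (auto simp: bij_betw_def dest: inj_onD)
 have uS: "uu r s p \<in> qSchur n q r s" for p using rho_qSchur uu_rho by blast
 obtain c where c: "\<forall>p'\<in>B. (\<Sum>p\<in>B. ?A p' p * c p) = crd r s (f p') M"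
  using triangular_solve[where I = B and A = ?A and f = "\<lambda>p. rk r s (f p)" and b = "\<lambda>p. crd r s (f p) M", OF B u rk] by blast
 define c' where "c' p = (if p \<in> B then c p else 0)" for p
 have crdM: "crd r s (f p') (?L c') = crd r s (f p') M" if "p' \<in> B" for p'
 proof -
  have "(\<Sum>p\<in>B. c' p * ?A p' p) = (\<Sum>p\<in>B. ?A p' p * c p)" by (intro sum.cong) (auto simp: c'_def mult.commute)
  thus ?thesis using c that by (simp add: crd_sum)
 qed
 \<comment> \<open>The difference is written as a sum over the two booleans, so that the lemmas on
   finite linear combinations apply to it.\<close>
 define D where "D = (\<lambda>x y. \<Sum>b\<in>UNIV. (if b then 1 else -1) * (if b then M else ?L c') x y)"
 have "D = (\<lambda>x y. 0)"
 proof (rule crd_zero)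
  show "D \<in> qSchur n q r s" unfolding D_def by (rule qSchur_sum) (use M in \<open>auto intro!: qSchur_sum B uS\<close>)
  fix p assume "p \<in> I0 r s"
  then obtain t where "t \<in> B" "p = f t" using f by (auto simp: bij_betw_def)
  thus "crd r s p D = 0" unfolding D_def crd_sum using crdM by (simp add: UNIV_bool)
 qed
 hence MS: "M = ?L c'" by (auto simp: D_def UNIV_bool fun_eq_iff)
 show ?thesis
 proof (rule ex1I[of _ c'])
  show "(\<forall>p. p \<notin> B --> c' p = 0) \<and> M = ?L c'" using MS by (simp add: c'_def)
  fix d assume d: "(\<forall>p. p \<notin> B --> d p = 0) \<and> M = ?L d"
  have "(\<Sum>p\<in>B. ?A p' p * (d p - c' p)) = 0" if "p' \<in> B" for p'
  proof -
   have "(\<Sum>p\<in>B. ?A p' p * (d p - c' p)) = crd r s (f p') (?L d) - crd r s (f p') (?L c')"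
    unfolding crd_sum sum_subtractf[symmetric] by (intro sum.cong refl) (simp add: algebra_simps)
   thus ?thesis using d MS by simp
  qed
  hence "d p - c' p = 0" if "p \<in> B" for p
   using triangular_zero[where I = B and A = ?A and f = "\<lambda>p. rk r s (f p)" and c = "\<lambda>p. d p - c' p", OF B u rk _ that] by blast
  moreover have "d p = c' p" if "p \<notin> B" for p using d[THEN conjunct1, rule_format, OF that] that by (simp add: c'_def)
  ultimately have "d p = c' p" for p by (cases "p \<in> B") auto
  thus "d = c'" by blast
 qed
qed

end

section \<open>Rational tableaux\<close>

definition rlen :: "nat list => nat => nat" where "rlen lam i = (if i < length lam then lam ! i else 0)"

text \<open>Rows as sets, padded by empty ones to a fixed number N. With N = r and N = s the
  position of the wall does not depend on the shape.\<close>

definition rowl :: "nat => nat list => (nat \<times> nat => nat) => nat set list" where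
 "rowl N lam t = map (\<lambda>i. (\<lambda>j. t (Suc i, j)) ` {1..rlen lam i}) [0..<N]"

definition lamof :: "nat set list => nat list" where "lamof wz = filter (\<lambda>c. 0 < c) (map card wz)"

definition tabof :: "nat set list => nat \<times> nat => nat" where
 "tabof wz = (\<lambda>(i, j). if (i, j) \<in> diagram (lamof wz) then sorted_list_of_set (wz ! (i - 1)) ! (j - 1) else 0)"

definition dec :: "nat => nat set list => bool" where
 "dec n = successively (\<lambda>A B. gle n B A)"

lemma diagram_Suc: "(Suc i, j) \<in> diagram lam \<longleftrightarrow> 1 \<le> j \<and> j \<le> rlen lam i"
 by (auto simp: diagram_def rlen_def)

lemma diagram_0: "(0, j) \<notin> diagram lam" by (simp add: diagram_def)

lemma diagram_eq: "c \<in> diagram lam \<longleftrightarrow> (\<exists>i j. c = (Suc i, j) \<and> 1 \<le> j \<and> j \<le> rlen lam i)"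
proof (cases c)
 case (Pair a j)
 show ?thesis by (cases a) (auto simp: Pair diagram_0 diagram_Suc)
qed

lemma enum: assumes f: "\<And>j. 1 \<le> j ==> j < m ==> f j < (f (Suc j) :: nat)"
 shows "sorted_list_of_set (f ` {1..m}) = map f [1..<Suc m]" "card (f ` {1..m}) = m" "inj_on f {1..m}"
proof -
 have lt: "1 \<le> i ==> i < j ==> j \<le> m ==> f i < f j" for i j
 proof (induction j)
  case (Suc j)
  show ?case
  proof (cases "i = j")
   case False
   hence "f i < f j" using Suc by simp
   thus ?thesis using f[of j] Suc.prems by simp
  qed (use f[of j] Suc.prems in simp)
 qed simp
 have s: "sorted_wrt (<) (map f [1..<Suc m])"
  unfolding sorted_wrt_map by (rule sorted_wrt_mono_rel[OF _ sorted_wrt_upt]) (use lt in auto)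
 have "set (map f [1..<Suc m]) = f ` {1..m}" by (simp add: atLeastLessThanSuc_atLeastAtMost del: upt_Suc)
 thus "sorted_list_of_set (f ` {1..m}) = map f [1..<Suc m]"
  using s sorted_list_of_set.idem_if_sorted_distinct[of "map f [1..<Suc m]"] by (metis strict_sorted_iff)
 show "inj_on f {1..m}"
 proof (rule inj_onI)
  fix i j assume "i \<in> {1..m}" "j \<in> {1..m}" "f i = f j"
  thus "i = j" using lt[of i j] lt[of j i] by (cases i j rule: linorder_cases) auto
 qed
 thus "card (f ` {1..m}) = m" by (simp add: card_image)
qed

lemma image_prefix: assumes "inj_on f {1..m}" "f ` {1..m} \<subseteq> {1..n::nat}" shows "card (f ` {1..m} \<inter> {1..x}) = card {j \<in> {1..m}. f j \<le> x}"
proof -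
 have p: "1 \<le> f j" if "j \<in> {1..m}" for j using assms(2) that by (meson atLeastAtMost_iff image_subset_iff)
 have "f ` {1..m} \<inter> {1..x} = f ` {j \<in> {1..m}. f j \<le> x}" using p by auto
 moreover have "inj_on f {j \<in> {1..m}. f j \<le> x}" by (rule inj_on_subset[OF assms(1)]) blast
 ultimately show ?thesis by (simp only: card_image)
qed

lemma partition_length: "is_partition lam m ==> length lam \<le> m"
proof -
 have "(\<forall>x\<in>set lam. 0 < x) ==> length lam \<le> sum_list lam" by (induction lam) auto
 thus "is_partition lam m ==> length lam \<le> m" by (auto simp: is_partition_def)
qed

lemma rlen_mono: "is_partition lam m ==> rlen lam (Suc i) \<le> rlen lam i"
 by (auto simp: is_partition_def rlen_def sorted_wrt_iff_nth_less)

context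
 fixes n m N :: nat and lam :: "nat list" and t :: "nat \<times> nat => nat"
 assumes P: "is_partition lam m" and T: "is_tableau n lam t" and S: "standard_tab lam t" and N: "m \<le> N"
begin

lemma row_inc: "1 \<le> j ==> j < rlen lam i ==> t (Suc i, j) < t (Suc i, Suc j)"
 using S by (simp add: standard_tab_def diagram_Suc)

lemma row_range: "(\<lambda>j. t (Suc i, j)) ` {1..rlen lam i} \<subseteq> {1..n}"
proof (rule image_subsetI)
 fix j assume "j \<in> {1..rlen lam i}"
 hence "(Suc i, j) \<in> diagram lam" by (simp add: diagram_Suc)
 thus "t (Suc i, j) \<in> {1..n}" using T unfolding is_tableau_def by blast
qed

lemma row_enum: "sorted_list_of_set ((\<lambda>j. t (Suc i, j)) ` {1..rlen lam i}) = map (\<lambda>j. t (Suc i, j)) [1..<Suc (rlen lam i)]"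
 "card ((\<lambda>j. t (Suc i, j)) ` {1..rlen lam i}) = rlen lam i" "inj_on (\<lambda>j. t (Suc i, j)) {1..rlen lam i}"
 by (rule enum; rule row_inc; assumption)+

lemma rowl_length: "length (rowl N lam t) = N" by (simp add: rowl_def)
lemma rowl_nth: "i < N ==> rowl N lam t ! i = (\<lambda>j. t (Suc i, j)) ` {1..rlen lam i}" by (simp add: rowl_def)

lemma rowl_card: "map card (rowl N lam t) = lam @ replicate (N - length lam) 0"
proof (rule nth_equalityI)
 have "length lam \<le> N" using partition_length[OF P] N by simp
 thus "length (map card (rowl N lam t)) = length (lam @ replicate (N - length lam) 0)" by (simp add: rowl_length)
 fix i assume "i < length (map card (rowl N lam t))"
 hence i: "i < N" by (simp add: rowl_length)
 hence "map card (rowl N lam t) ! i = rlen lam i" using row_enum(2)[of i] rowl_length by (simp add: rowl_nth)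
 also have "... = (lam @ replicate (N - length lam) 0) ! i" using i by (simp add: rlen_def nth_append)
 finally show "map card (rowl N lam t) ! i = (lam @ replicate (N - length lam) 0) ! i" .
qed

lemma rowl_sum: "sum_list (map card (rowl N lam t)) = m"
 unfolding rowl_card using P by (simp add: is_partition_def)

lemma rowl_subs: "subs n (rowl N lam t)"
 unfolding subs_def rowl_def using row_range by auto

lemma rowl_prefix: "i < N ==> card (rowl N lam t ! i \<inter> {1..x}) = card {j \<in> {1..rlen lam i}. t (Suc i, j) \<le> x}"
 unfolding rowl_nth by (rule image_prefix[OF row_enum(3) row_range])

lemma rowl_dec: "dec n (rowl N lam t)"
 unfolding dec_def successively_conv_nth gle_def rowl_length
proof (intro allI impI)
 fix i x assume i: "Suc i < N"
 have "{j \<in> {1..rlen lam (Suc i)}. t (Suc (Suc i), j) \<le> x} \<subseteq> {j \<in> {1..rlen lam i}. t (Suc i, j) \<le> x}"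
 proof
  fix j assume j: "j \<in> {j \<in> {1..rlen lam (Suc i)}. t (Suc (Suc i), j) \<le> x}"
  hence d: "(Suc i, j) \<in> diagram lam" "(Suc (Suc i), j) \<in> diagram lam" using rlen_mono[OF P, of i] by (auto simp: diagram_Suc)
  hence "t (Suc i, j) \<le> t (Suc (Suc i), j)" using S unfolding standard_tab_def by blast
  thus "j \<in> {j \<in> {1..rlen lam i}. t (Suc i, j) \<le> x}" using j d by (auto simp: diagram_Suc)
 qed
 thus "card (rowl N lam t ! Suc i \<inter> {1..x}) \<le> card (rowl N lam t ! i \<inter> {1..x})"
  using i by (simp add: rowl_prefix card_mono del: One_nat_def)
qed

lemma rowl_lamof: "lamof (rowl N lam t) = lam"
 unfolding lamof_def rowl_card using P by (auto simp: is_partition_def filter_id_conv)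

lemma rowl_tabof: "tabof (rowl N lam t) = t"
proof (rule ext)
 fix c
 show "tabof (rowl N lam t) c = t c"
 proof (cases "c \<in> diagram lam")
  case True
  then obtain i j where c: "c = (Suc i, j)" "1 \<le> j" "j \<le> rlen lam i" by (auto simp: diagram_eq)
  hence "i < length lam" by (auto simp: rlen_def split: if_splits)
  hence i: "i < N" using partition_length[OF P] N by simp
  have "sorted_list_of_set (rowl N lam t ! i) ! (j - 1) = t (Suc i, j)"
   unfolding rowl_nth[OF i] row_enum(1)[of i] using c by (subst nth_map) (auto simp del: upt_Suc)
  thus ?thesis using True c by (simp add: tabof_def rowl_lamof)
 next
  case False
  thus ?thesis using T by (cases c) (simp add: tabof_def rowl_lamof is_tableau_def)
 qed
qed

lemma rowl_first: "0 < N ==> card {j. (1, j) \<in> diagram lam \<and> t (1, j) \<le> x} = card (rowl N lam t ! 0 \<inter> {1..x})"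
 using diagram_Suc[of 0 _ lam] by (subst rowl_prefix) (auto intro!: arg_cong[where f = card])

end

section \<open>From decreasing lists of subsets back to tableaux\<close>

lemma filter_dec: "sorted_wrt (\<ge>) (cs :: nat list) ==> cs = filter (\<lambda>c. 0 < c) cs @ replicate (length cs - length (filter (\<lambda>c. 0 < c) cs)) 0"
proof (induction cs)
 case (Cons c cs)
 show ?case
 proof (cases "c = 0")
  case True
  hence "\<forall>x\<in>set cs. x = 0" using Cons.prems by auto
  hence "cs = replicate (length cs) 0" "filter (\<lambda>c. 0 < c) cs = []" by (auto simp: replicate_length_same filter_empty_conv)
  thus ?thesis using True by (simp add: replicate_Suc[symmetric] del: replicate_Suc) (metis replicate_Suc)
 next
  case False
  have "length (filter (\<lambda>c. 0 < c) cs) \<le> length cs" by (rule length_filter_le)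
  thus ?thesis using Cons False by auto
 qed
qed simp

text \<open>Links entries of a row with its prefix counts; it translates \<open>gle\<close> of
  adjacent rows into weakly increasing columns.\<close>

lemma nth_le_iff: assumes Z: "Z \<subseteq> {1..n::nat}" and j: "j < card Z" shows "sorted_list_of_set Z ! j \<le> x \<longleftrightarrow> j < card (Z \<inter> {1..x})"
proof -
 have f: "finite Z" using Z finite_subset by blast
 define l where "l = sorted_list_of_set Z"
 have l: "sorted_wrt (<) l" "set l = Z" "length l = card Z" "distinct l" using f by (simp_all add: l_def)
 have mono: "i < i' ==> i' < length l ==> l ! i < l ! i'" for i i' using l(1) by (simp add: sorted_wrt_iff_nth_less)
 have "Z \<inter> {1..x} = (!) l ` {i. i < length l \<and> l ! i \<le> x}" using Z l(2) by (auto simp: set_conv_nth image_iff)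
 moreover have "inj_on ((!) l) {i. i < length l \<and> l ! i \<le> x}" using l(4) by (auto simp: inj_on_def nth_eq_iff_index_eq)
 ultimately have c: "card (Z \<inter> {1..x}) = card {i. i < length l \<and> l ! i \<le> x}" by (simp add: card_image)
 show ?thesis unfolding l_def[symmetric] c
 proof
  assume h: "l ! j \<le> x"
  have "{..j} \<subseteq> {i. i < length l \<and> l ! i \<le> x}"
  proof
   fix i assume "i \<in> {..j}"
   hence "l ! i \<le> l ! j" "i < length l" using mono[of i j] j l(3) by (cases "i = j"; auto)+
   thus "i \<in> {i. i < length l \<and> l ! i \<le> x}" using h by auto
  qed
  hence "card {..j} \<le> card {i. i < length l \<and> l ! i \<le> x}" by (intro card_mono) auto
  thus "j < card {i. i < length l \<and> l ! i \<le> x}" by simp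
 next
  assume h: "j < card {i. i < length l \<and> l ! i \<le> x}"
  show "l ! j \<le> x"
  proof (rule ccontr)
   assume nle: "\<not> l ! j \<le> x"
   have "{i. i < length l \<and> l ! i \<le> x} \<subseteq> {..<j}"
   proof
    fix i assume i: "i \<in> {i. i < length l \<and> l ! i \<le> x}"
    show "i \<in> {..<j}"
    proof (rule ccontr)
     assume "i \<notin> {..<j}"
     hence "l ! j \<le> l ! i" using mono[of j i] i by (cases "i = j") auto
     thus False using i nle by auto
    qed
   qed
   hence "card {i. i < length l \<and> l ! i \<le> x} \<le> card {..<j}" by (intro card_mono) auto
   thus False using h by simp
  qed
 qed
qed

context
 fixes n :: nat and wz :: "nat set list"
 assumes W: "subs n wz" and D: "dec n wz"
begin

lemma ws_sub: "i < length wz ==> wz ! i \<subseteq> {1..n}" using W nth_mem by (auto simp: subs_def)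
lemma ws_fin: "i < length wz ==> finite (wz ! i)" using ws_sub finite_subset by blast

lemma ws_card: "i \<le> i' ==> i' < length wz ==> card (wz ! i') \<le> card (wz ! i)"
proof (induction i' rule: nat_induct_at_least)
 case (Suc i')
 hence "gle n (wz ! Suc i') (wz ! i')" using D by (simp add: dec_def successively_conv_nth)
 hence "card (wz ! Suc i' \<inter> {1..n}) \<le> card (wz ! i' \<inter> {1..n})" by (simp add: gle_def)
 hence "card (wz ! Suc i') \<le> card (wz ! i')" using ws_sub[of i'] ws_sub[of "Suc i'"] Suc.prems by (simp add: Int_absorb2 del: One_nat_def)
 thus ?case using Suc by simp
qed simp

lemma lamof_pad: "map card wz = lamof wz @ replicate (length wz - length (lamof wz)) 0"
proof -
 have "sorted_wrt (\<ge>) (map card wz)" using ws_card by (auto simp: sorted_wrt_iff_nth_less)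
 from filter_dec[OF this] show ?thesis by (simp add: lamof_def)
qed

lemma lamof_partition: "is_partition (lamof wz) (sum_list (map card wz))"
proof -
 have "sorted_wrt (\<ge>) (map card wz)" using ws_card by (auto simp: sorted_wrt_iff_nth_less)
 hence "sorted_wrt (\<ge>) (lamof wz)" unfolding lamof_def by (rule sorted_wrt_filter)
 moreover have "sum_list (map card wz) = sum_list (lamof wz)" by (subst lamof_pad) simp
 ultimately show ?thesis by (auto simp: is_partition_def lamof_def)
qed

lemma rlen_lamof: "i < length wz ==> rlen (lamof wz) i = card (wz ! i)"
proof -
 assume i: "i < length wz"
 have "card (wz ! i) = (lamof wz @ replicate (length wz - length (lamof wz)) 0) ! i" unfolding lamof_pad[symmetric] using i by simp
 thus ?thesis using i by (simp add: rlen_def nth_append)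
qed

lemma lamof_length: "length (lamof wz) \<le> length wz" unfolding lamof_def using length_filter_le[of _ "map card wz"] by simp

lemma tabof_eq: "i < length wz ==> 1 \<le> j ==> j \<le> card (wz ! i) ==> tabof wz (Suc i, j) = sorted_list_of_set (wz ! i) ! (j - 1)"
 by (simp add: tabof_def diagram_Suc rlen_lamof)

lemma diagram_lamof: "c \<in> diagram (lamof wz) \<longleftrightarrow> (\<exists>i j. c = (Suc i, j) \<and> i < length wz \<and> 1 \<le> j \<and> j \<le> card (wz ! i))"
proof -
 have "i < length wz" if "1 \<le> j" "j \<le> rlen (lamof wz) i" for i j using that lamof_length by (auto simp: rlen_def split: if_splits)
 thus ?thesis unfolding diagram_eq using rlen_lamof by metis
qed

lemma tabof_tableau: "is_tableau n (lamof wz) (tabof wz)"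
 unfolding is_tableau_def
proof (intro conjI ballI allI impI)
 fix c assume "c \<in> diagram (lamof wz)"
 then obtain i j where c: "c = (Suc i, j)" "i < length wz" "1 \<le> j" "j \<le> card (wz ! i)" by (auto simp: diagram_lamof)
 have "sorted_list_of_set (wz ! i) ! (j - 1) \<in> set (sorted_list_of_set (wz ! i))" using c ws_fin by (intro nth_mem) simp
 hence "tabof wz c \<in> wz ! i" using c ws_fin by (simp add: tabof_eq)
 thus "tabof wz c \<in> {1..n}" using ws_sub[OF c(2)] by blast
next
 fix c assume "c \<notin> diagram (lamof wz)"
 thus "tabof wz c = 0" by (cases c) (simp add: tabof_def)
qed

lemma tabof_standard: "standard_tab (lamof wz) (tabof wz)"
 unfolding standard_tab_def
proof (intro conjI allI impI)
 fix a j assume "(a, j) \<in> diagram (lamof wz) \<and> (a, Suc j) \<in> diagram (lamof wz)"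
 then obtain i where c: "a = Suc i" "i < length wz" "1 \<le> j" "Suc j \<le> card (wz ! i)" by (auto simp: diagram_lamof)
 have "sorted_wrt (<) (sorted_list_of_set (wz ! i))" by simp
 hence "sorted_list_of_set (wz ! i) ! (j - 1) < sorted_list_of_set (wz ! i) ! j"
  using c ws_fin[OF c(2)] by (simp add: sorted_wrt_iff_nth_less)
 thus "tabof wz (a, j) < tabof wz (a, Suc j)" using c by (simp add: tabof_eq)
next
 fix a j assume "(a, j) \<in> diagram (lamof wz) \<and> (Suc a, j) \<in> diagram (lamof wz)"
 then obtain i where c: "a = Suc i" "Suc i < length wz" "1 \<le> j" "j \<le> card (wz ! i)" "j \<le> card (wz ! Suc i)" by (auto simp: diagram_lamof)
 define x where "x = sorted_list_of_set (wz ! Suc i) ! (j - 1)"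
 have s: "wz ! i \<subseteq> {1..n}" "wz ! Suc i \<subseteq> {1..n}" using ws_sub c by auto
 have "x \<in> set (sorted_list_of_set (wz ! Suc i))" unfolding x_def using c ws_fin[OF c(2)] by (intro nth_mem) simp
 hence xn: "x \<le> n" using s ws_fin[OF c(2)] by auto
 have "j - 1 < card (wz ! Suc i \<inter> {1..x})" using nth_le_iff[OF s(2), of "j - 1" x] c by (simp add: x_def)
 also have "... \<le> card (wz ! i \<inter> {1..x})" using D c xn by (auto simp: dec_def successively_conv_nth gle_def)
 finally have "sorted_list_of_set (wz ! i) ! (j - 1) \<le> x" using nth_le_iff[OF s(1), of "j - 1" x] c by simp
 thus "tabof wz (a, j) \<le> tabof wz (Suc a, j)" using c by (simp add: tabof_eq x_def)
qed

lemma rowl_ws: "rowl (length wz) (lamof wz) (tabof wz) = wz"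
proof (rule nth_equalityI)
 fix i assume "i < length (rowl (length wz) (lamof wz) (tabof wz))"
 hence i: "i < length wz" by (simp add: rowl_def)
 have "rowl (length wz) (lamof wz) (tabof wz) ! i = (\<lambda>j. sorted_list_of_set (wz ! i) ! (j - 1)) ` {1..card (wz ! i)}"
  using i by (auto simp: rowl_def rlen_lamof tabof_eq intro!: image_cong)
 also have "... = (!) (sorted_list_of_set (wz ! i)) ` {..<card (wz ! i)}"
  unfolding image_Suc_lessThan[symmetric] image_image by simp
 also have "... = set (sorted_list_of_set (wz ! i))" using ws_fin[OF i] by (auto simp: set_conv_nth)
 finally show "rowl (length wz) (lamof wz) (tabof wz) ! i = wz ! i" using ws_fin[OF i] by simp
qed (simp add: rowl_def)

end

section \<open>Gluing the two tableaux at the wall\<close>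

lemma sT_sum: "length k = r ==> sT r (k @ k') = sum_list k" "length k = r ==> sF n r (k @ k') = sum_list (map (\<lambda>c. n - c) k')"
proof -
 have "length k \<le> r ==> sT r k = sum_list k" for k r by (induction k arbitrary: r) auto
 thus "length k = r ==> sT r (k @ k') = sum_list k" by (simp add: sT_append)
 have "sF n 0 k' = sum_list (map (\<lambda>c. n - c) k')" by (induction k') auto
 thus "length k = r ==> sF n r (k @ k') = sum_list (map (\<lambda>c. n - c) k')" by (simp add: sF_append sF_long)
qed

lemma card_compl: "A \<subseteq> {1..n} ==> x \<le> n ==> card (({1..n} - A) \<inter> {1..x}) + card (A \<inter> {1..x}) = x"
proof -
 assume A: "A \<subseteq> {1..n}" "x \<le> n"
 have "({1..n} - A) \<inter> {1..x} \<union> A \<inter> {1..x} = {1..x}" using A by auto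
 hence "card (({1..n} - A) \<inter> {1..x} \<union> A \<inter> {1..x}) = x" by simp
 thus ?thesis by (subst (asm) card_Un_disjoint) auto
qed

lemma gle_compl: "A \<subseteq> {1..n} ==> B \<subseteq> {1..n} ==> gle n ({1..n} - A) ({1..n} - B) \<longleftrightarrow> gle n B A"
proof -
 assume A: "A \<subseteq> {1..n}" "B \<subseteq> {1..n}"
 have "x \<le> n ==> card (({1..n} - A) \<inter> {1..x}) \<le> card (({1..n} - B) \<inter> {1..x}) \<longleftrightarrow> card (B \<inter> {1..x}) \<le> card (A \<inter> {1..x})" for x
  using card_compl[OF A(1), of x] card_compl[OF A(2), of x] by linarith
 thus ?thesis unfolding gle_def by blast
qed

text \<open>In {1..x} the complement of B has x minus the number of entries of B. So standardness of
  the two rows at the wall is the condition on \<open>first_cnt\<close> that defines standard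
  rational tableaux.\<close>

lemma gle_wall: "B \<subseteq> {1..n} ==> gle n A ({1..n} - B) \<longleftrightarrow> (\<forall>x\<le>n. card (A \<inter> {1..x}) + card (B \<inter> {1..x}) \<le> x)"
proof -
 assume B: "B \<subseteq> {1..n}"
 have "x \<le> n ==> card (A \<inter> {1..x}) \<le> card (({1..n} - B) \<inter> {1..x}) \<longleftrightarrow> card (A \<inter> {1..x}) + card (B \<inter> {1..x}) \<le> x" for x
  using card_compl[OF B, of x] by linarith
 thus ?thesis unfolding gle_def by blast
qed

text \<open>Listing the V-rows in reverse and complementing the dual rows both reverse the direction
  of \<open>gle\<close>, so the two halves become standard in the same direction and only the wall
  adds a condition.\<close>

lemma stdz_glue: assumes B: "subs n B"
 shows "stdz n (rev A @ map (\<lambda>Z. {1..n} - Z) B) \<longleftrightarrow> dec n A \<and> dec n B \<and> (A \<noteq> [] \<and> B \<noteq> [] --> gle n (A ! 0) ({1..n} - B ! 0))"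
proof -
 have "successively (\<lambda>A B. gle n ({1..n} - A) ({1..n} - B)) B \<longleftrightarrow> dec n B"
  unfolding dec_def by (rule successively_cong) (use B gle_compl in \<open>auto simp: subs_def\<close>)
 thus ?thesis by (cases "A = []"; cases "B = []") (auto simp: stdz_def dec_def successively_append_iff successively_map last_rev hd_map hd_conv_nth)
qed

definition Ez :: "nat => nat => nat => nat list \<times> nat list => (nat \<times> nat => nat) \<times> (nat \<times> nat => nat) => nat set list" where
 "Ez n r s sh T = rev (rowl r (fst sh) (fst T)) @ map (\<lambda>Z. {1..n} - Z) (rowl s (snd sh) (snd T))"

definition shz :: "nat => nat => nat set list => nat list \<times> nat list" where
 "shz n r zs = (lamof (rev (take r zs)), lamof (map (\<lambda>Z. {1..n} - Z) (drop r zs)))"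
definition tbz :: "nat => nat => nat set list => (nat \<times> nat => nat) \<times> (nat \<times> nat => nat)" where
 "tbz n r zs = (tabof (rev (take r zs)), tabof (map (\<lambda>Z. {1..n} - Z) (drop r zs)))"

lemma compl_compl: "subs n B ==> map (\<lambda>Z. {1..n} - Z) (map (\<lambda>Z. {1..n} - Z) B) = B"
 by (auto simp: subs_def double_diff intro!: map_idI)

lemma compl_card: "subs n B ==> map card (map (\<lambda>Z. {1..n} - Z) B) = map (\<lambda>c. n - c) (map card B)"
proof -
 assume B: "subs n B"
 have "card ({1..n} - Z) = n - card Z" if "Z \<in> set B" for Z
  using card_Diff_subset[of Z "{1..n}"] B that finite_subset[of Z "{1..n}"] by (auto simp: subs_def)
 thus ?thesis by simp
qed

lemma subs_card: "subs n B ==> x \<in> set (map card B) ==> x \<le> n"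
 using card_mono[of "{1..n}"] by (auto simp: subs_def)

context
 fixes q :: "'a::comm_ring_1" and n :: nat
 assumes q: "q dvd 1" and n: "1 \<le> n"
begin

lemma lvl_glue: assumes A: "subs n A" "length A = r" and B: "subs n B" "length B = s"
 shows "lvl n r s (map card (rev A @ map (\<lambda>Z. {1..n} - Z) B)) l \<longleftrightarrow> sum_list (map card A) + l = r \<and> sum_list (map card B) + l = s"
proof -
 have "map (\<lambda>c. n - c) (map card (map (\<lambda>Z. {1..n} - Z) B)) = map card B"
  unfolding compl_card[OF B(1)] using subs_card[OF B(1)] by (auto intro!: map_idI simp: comp_def)
 hence "sF n r (map card (rev A @ map (\<lambda>Z. {1..n} - Z) B)) = sum_list (map card B)"
  unfolding map_append using A(2) sT_sum(2)[where k = "map card (rev A)" and r = r] by (simp only: length_map length_rev)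
 moreover have "sT r (map card (rev A @ map (\<lambda>Z. {1..n} - Z) B)) = sum_list (map card A)"
  unfolding map_append using A(2) sT_sum(1)[where k = "map card (rev A)" and r = r] by (simp add: rev_map[symmetric])
 moreover have "subs n (rev A @ map (\<lambda>Z. {1..n} - Z) B)" using A by (auto simp: subs_def)
 hence "\<forall>x\<in>set (map card (rev A @ map (\<lambda>Z. {1..n} - Z) B)). x \<le> n" using subs_card by blast
 moreover have "length (map card (rev A @ map (\<lambda>Z. {1..n} - Z) B)) = r + s" using A(2) B(2) by simp
 ultimately show ?thesis unfolding lvl_def[OF q n] by metis
qed

lemma Ez_props: assumes sh: "rat_shape n r s sh" and T: "std_rat_tab n sh T"
 shows "adm n r s (Ez n r s sh T)" "shz n r (Ez n r s sh T) = sh" "tbz n r (Ez n r s sh T) = T"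
  "map card (Ez n r s sh T) = rev (fst sh @ replicate (r - length (fst sh)) 0) @ map (\<lambda>c. n - c) (snd sh @ replicate (s - length (snd sh)) 0)"
proof -
 obtain k where k: "k \<le> min r s" "is_partition (fst sh) (r - k)" "is_partition (snd sh) (s - k)" using sh by (auto simp: rat_shape_def)
 have t: "is_tableau n (fst sh) (fst T)" "is_tableau n (snd sh) (snd T)" "standard_tab (fst sh) (fst T)" "standard_tab (snd sh) (snd T)"
  "\<forall>i\<in>{1..n}. first_cnt i sh T \<le> i" using T by (auto simp: std_rat_tab_def)
 define A B where "A = rowl r (fst sh) (fst T)" and "B = rowl s (snd sh) (snd T)"
 have le: "r - k \<le> r" "s - k \<le> s" by auto
 note A = rowl_length[OF k(2) t(1,3) le(1)] rowl_card[OF k(2) t(1,3) le(1)] rowl_sum[OF k(2) t(1,3) le(1)] rowl_subs[OF k(2) t(1,3) le(1)]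
  rowl_dec[OF k(2) t(1,3) le(1)] rowl_lamof[OF k(2) t(1,3) le(1)] rowl_tabof[OF k(2) t(1,3) le(1)]
 note B = rowl_length[OF k(3) t(2,4) le(2)] rowl_card[OF k(3) t(2,4) le(2)] rowl_sum[OF k(3) t(2,4) le(2)] rowl_subs[OF k(3) t(2,4) le(2)]
  rowl_dec[OF k(3) t(2,4) le(2)] rowl_lamof[OF k(3) t(2,4) le(2)] rowl_tabof[OF k(3) t(2,4) le(2)]
 note A = A[folded A_def] and B = B[folded B_def]
 have E: "Ez n r s sh T = rev A @ map (\<lambda>Z. {1..n} - Z) B" by (simp add: Ez_def A_def B_def)
 have tk: "rev (take r (Ez n r s sh T)) = A" "map (\<lambda>Z. {1..n} - Z) (drop r (Ez n r s sh T)) = B"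
  using A(1) compl_compl[OF B(4)] by (simp_all add: E)
 show "shz n r (Ez n r s sh T) = sh" unfolding shz_def tk A(6) B(6) by simp
 show "tbz n r (Ez n r s sh T) = T" unfolding tbz_def tk A(7) B(7) by simp
 show C: "map card (Ez n r s sh T) = rev (fst sh @ replicate (r - length (fst sh)) 0) @ map (\<lambda>c. n - c) (snd sh @ replicate (s - length (snd sh)) 0)"
  unfolding E map_append compl_card[OF B(4)] B(2) rev_map[symmetric] A(2) ..
 have subz: "subs n (Ez n r s sh T)" using A(4) by (auto simp: E subs_def)
 have wall: "gle n (A ! 0) ({1..n} - B ! 0)" if "A \<noteq> []" "B \<noteq> []"
 proof -
  have rs: "0 < r" "0 < s" using that A(1) B(1) by auto
  have "B ! 0 \<in> set B" using that by simp
  hence B0: "B ! 0 \<subseteq> {1..n}" using B(4) by (auto simp: subs_def)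
  have "card (A ! 0 \<inter> {1..x}) + card (B ! 0 \<inter> {1..x}) \<le> x" if x: "x \<le> n" for x
  proof (cases "x = 0")
   case False
   have "first_cnt x sh T \<le> x" using t(5) x False by auto
   thus ?thesis
    using rowl_first[OF k(2) t(1,3) le(1) rs(1), of x] rowl_first[OF k(3) t(2,4) le(2) rs(2), of x] unfolding A_def B_def first_cnt_def by simp
  qed simp
  thus ?thesis using gle_wall[OF B0] by blast
 qed
 have "stdz n (Ez n r s sh T)" unfolding E stdz_glue[OF B(4)] using A(5) B(5) wall by blast
 moreover have "lvl n r s (map card (Ez n r s sh T)) k"
  unfolding E lvl_glue[OF A(4,1) B(4,1)] using A(3) B(3) k(1) by simp
 ultimately show "adm n r s (Ez n r s sh T)" using subz by (auto simp: adm_def[OF q n])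
qed

lemma adm_props: assumes a: "adm n r s zs"
 shows "rat_shape n r s (shz n r zs)" "std_rat_tab n (shz n r zs) (tbz n r zs)" "Ez n r s (shz n r zs) (tbz n r zs) = zs"
proof -
 obtain l where z: "subs n zs" "stdz n zs" "lvl n r s (map card zs) l" using a by (auto simp: adm_def[OF q n])
 have len: "length zs = r + s" using z(3) by (simp add: lvl_def[OF q n])
 define A B where "A = rev (take r zs)" and "B = map (\<lambda>Z. {1..n} - Z) (drop r zs)"
 have lA: "length A = r" "length B = s" using len by (simp_all add: A_def B_def)
 have sA: "subs n A" "subs n B" "subs n (drop r zs)" using z(1) by (auto simp: A_def B_def subs_def dest: in_set_takeD in_set_dropD)
 have zz: "zs = rev A @ map (\<lambda>Z. {1..n} - Z) B" using compl_compl[OF sA(3)] by (simp add: A_def B_def)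
 have g: "dec n A" "dec n B" "A \<noteq> [] \<and> B \<noteq> [] --> gle n (A ! 0) ({1..n} - B ! 0)"
  using z(2) unfolding zz stdz_glue[OF sA(2)] by blast+
 have SZ: "shz n r zs = (lamof A, lamof B)" "tbz n r zs = (tabof A, tabof B)" by (simp_all add: shz_def tbz_def A_def B_def)
 have rA: "rowl r (lamof A) (tabof A) = A" "rowl s (lamof B) (tabof B) = B"
  using rowl_ws[OF sA(1) g(1)] rowl_ws[OF sA(2) g(2)] lA by simp_all
 show "Ez n r s (shz n r zs) (tbz n r zs) = zs" unfolding Ez_def SZ fst_conv snd_conv rA by (rule zz[symmetric])
 have sums: "sum_list (map card A) + l = r" "sum_list (map card B) + l = s"
  using z(3) lvl_glue[OF sA(1) lA(1) sA(2) lA(2), of l] unfolding zz[symmetric] by blast+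
 have part: "is_partition (lamof A) (r - l)" "is_partition (lamof B) (s - l)"
  using lamof_partition[OF sA(1) g(1)] lamof_partition[OF sA(2) g(2)] sums by (simp_all flip: sums)
 have tabs: "is_tableau n (lamof A) (tabof A)" "is_tableau n (lamof B) (tabof B)" "standard_tab (lamof A) (tabof A)" "standard_tab (lamof B) (tabof B)"
  using tabof_tableau[OF sA(1) g(1)] tabof_tableau[OF sA(2) g(2)] tabof_standard[OF sA(1) g(1)] tabof_standard[OF sA(2) g(2)] by auto
 have cnt: "first_cnt x (shz n r zs) (tbz n r zs) \<le> x" if x: "x \<le> n" for x
 proof -
  have f1: "card {j. (1, j) \<in> diagram (lamof X) \<and> tabof X (1, j) \<le> x} = (if X = [] then 0 else card (X ! 0 \<inter> {1..x}))"
   if X: "subs n X" "dec n X" and N: "sum_list (map card X) \<le> length X" for X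
  proof (cases "X = []")
   case False
   thus ?thesis using rowl_first[OF lamof_partition[OF X] tabof_tableau[OF X] tabof_standard[OF X] N, of x]
    rowl_ws[OF X] by simp
  qed (simp add: lamof_def diagram_def)
  have "sum_list (map card A) \<le> length A" "sum_list (map card B) \<le> length B" using sums lA by simp_all
  note f1 = f1[OF sA(1) g(1) this(1)] f1[OF sA(2) g(2) this(2)]
  have c: "card (Z \<inter> {1..x}) \<le> x" for Z :: "nat set" using card_mono[of "{1..x}" "Z \<inter> {1..x}"] by simp
  have "card (A ! 0 \<inter> {1..x}) + card (B ! 0 \<inter> {1..x}) \<le> x" if "A \<noteq> []" "B \<noteq> []"
  proof -
   have "B ! 0 \<subseteq> {1..n}" using sA(2) that(2) by (auto simp: subs_def)
   thus ?thesis using g(3) that x gle_wall by blast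
  qed
  thus ?thesis unfolding first_cnt_def SZ fst_conv snd_conv f1 using c by auto
 qed
 thus "std_rat_tab n (shz n r zs) (tbz n r zs)" unfolding std_rat_tab_def using tabs by (auto simp: SZ)
 \<comment> \<open>The shape condition \<rho>_1 + \<sigma>_1 \<le> n is the wall condition at x =
   n.\<close>
 have "row1 (lamof A) + row1 (lamof B) \<le> n"
 proof -
  have r1: "row1 (lamof X) = (if X = [] then 0 else card (X ! 0))" if "subs n X" "dec n X" for X
  proof (cases X)
   case Nil
   thus ?thesis by (simp add: lamof_def row1_def)
  next
   case (Cons Z Zs)
   have "rlen (lamof X) 0 = card (X ! 0)" by (rule rlen_lamof[OF that]) (simp add: Cons)
   moreover have "rlen (lamof X) 0 = row1 (lamof X)" by (cases "lamof X") (auto simp: rlen_def row1_def)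
   ultimately show ?thesis using Cons by simp
  qed
  have X0: "X \<noteq> [] ==> X ! 0 \<inter> {1..n} = X ! 0 \<and> card (X ! 0) \<le> n" if "subs n X" for X
   using that card_mono[of "{1..n}" "X ! 0"] nth_mem[of 0 X] by (auto simp: subs_def)
  have "card (A ! 0) + card (B ! 0) \<le> n" if ne: "A \<noteq> []" "B \<noteq> []"
  proof -
   have "B ! 0 \<subseteq> {1..n}" using sA(2) ne(2) by (auto simp: subs_def)
   hence "card (A ! 0 \<inter> {1..n}) + card (B ! 0 \<inter> {1..n}) \<le> n" using g(3) ne gle_wall by blast
   thus ?thesis using X0[OF sA(1) ne(1)] X0[OF sA(2) ne(2)] by simp
  qed
  thus ?thesis using r1[OF sA(1) g(1)] r1[OF sA(2) g(2)] X0[OF sA(1)] X0[OF sA(2)] by auto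
 qed
 moreover have "l \<le> min r s" using sums by simp
 ultimately show "rat_shape n r s (shz n r zs)" unfolding rat_shape_def SZ fst_conv snd_conv using part by blast
qed

lemma shz_card: assumes "map card zs = map card zs'" "subs n zs" "subs n zs'" shows "shz n r zs = shz n r zs'"
proof -
 have sd: "subs n (drop r zs)" "subs n (drop r zs')" using assms by (auto simp: subs_def dest: in_set_dropD)
 have "map card (rev (take r zs)) = map card (rev (take r zs'))" using assms(1) by (metis rev_map take_map)
 moreover have "map card (map (\<lambda>Z. {1..n} - Z) (drop r zs)) = map card (map (\<lambda>Z. {1..n} - Z) (drop r zs'))"
  unfolding compl_card[OF sd(1)] compl_card[OF sd(2)] using assms(1) by (metis drop_map)
 ultimately show ?thesis unfolding shz_def lamof_def by metis
qed

lemma bitab_bij: "bij_betw (\<lambda>(sh, T1, T2). (Ez n r s sh T1, Ez n r s sh T2)) (std_rat_bitab n r s) (I0 n r s)"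
proof (rule bij_betw_byWitness[where f' = "\<lambda>(t, t'). (shz n r t, tbz n r t, tbz n r t')"])
 show "\<forall>a\<in>std_rat_bitab n r s. (\<lambda>(t, t'). (shz n r t, tbz n r t, tbz n r t')) ((\<lambda>(sh, T1, T2). (Ez n r s sh T1, Ez n r s sh T2)) a) = a"
  using Ez_props(2,3) by (auto simp: std_rat_bitab_def)
 show "\<forall>a\<in>I0 n r s. (\<lambda>(sh, T1, T2). (Ez n r s sh T1, Ez n r s sh T2)) ((\<lambda>(t, t'). (shz n r t, tbz n r t, tbz n r t')) a) = a"
 proof
  fix a assume "a \<in> I0 n r s"
  then obtain t t' where a: "a = (t, t')" "adm n r s t" "adm n r s t'" "map card t = map card t'" by (auto simp: I0_def[OF q n])
  have "shz n r t = shz n r t'" by (rule shz_card[OF a(4)]) (use a in \<open>auto simp: adm_def[OF q n]\<close>)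
  thus "(\<lambda>(sh, T1, T2). (Ez n r s sh T1, Ez n r s sh T2)) ((\<lambda>(t, t'). (shz n r t, tbz n r t, tbz n r t')) a) = a"
   using adm_props(3)[OF a(2)] adm_props(3)[OF a(3)] a(1) by simp
 qed
 show "(\<lambda>(sh, T1, T2). (Ez n r s sh T1, Ez n r s sh T2)) ` std_rat_bitab n r s \<subseteq> I0 n r s"
  using Ez_props(1,4) by (auto simp: std_rat_bitab_def I0_def[OF q n])
 show "(\<lambda>(t, t'). (shz n r t, tbz n r t, tbz n r t')) ` I0 n r s \<subseteq> std_rat_bitab n r s"
 proof
  fix b assume "b \<in> (\<lambda>(t, t'). (shz n r t, tbz n r t, tbz n r t')) ` I0 n r s"
  then obtain t t' where a: "b = (shz n r t, tbz n r t, tbz n r t')" "adm n r s t" "adm n r s t'" "map card t = map card t'" by (auto simp: I0_def[OF q n])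
  have "shz n r t = shz n r t'" by (rule shz_card[OF a(4)]) (use a in \<open>auto simp: adm_def[OF q n]\<close>)
  thus "b \<in> std_rat_bitab n r s" using adm_props[OF a(2)] adm_props[OF a(3)] a(1) by (simp add: std_rat_bitab_def)
 qed
qed

lemma rho_U'_sum: assumes "finite I" shows "(\<lambda>x y. \<Sum>p\<in>I. c p * uu q n r s (f p) x y) \<in> rho_U' n q r s"
 using assms
proof (induction I rule: finite_induct)
 case empty
 have "(\<lambda>x y. 0 * mid n (r + s) x y) \<in> rho_U' n q r s" unfolding rho_U'_def by (intro alg_gen.smult alg_gen.one)
 thus ?case by simp
next
 case (insert p I)
 thus ?case using uu_rho[OF q n, of r s "f p"] unfolding rho_U'_def by (simp add: alg_gen.add alg_gen.smult)
qed

end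

theorem theorem6p11:
  fixes q :: "'a::comm_ring_1" and n r s :: nat
  assumes "n \<ge> 1" and "q dvd 1"
  shows "qSchur n q r s = rho_U n q r s \<and> rho_U n q r s = rho_U' n q r s
    \<and> (\<exists>b. (\<forall>t\<in>std_rat_bitab n r s. b t \<in> qSchur n q r s)
         \<and> (\<forall>M\<in>qSchur n q r s. \<exists>!c. (\<forall>t. t \<notin> std_rat_bitab n r s \<longrightarrow> c t = 0)
               \<and> M = (\<lambda>x y. \<Sum>t\<in>std_rat_bitab n r s. c t * b t x y)))"
proof -
 note q = assms(2) and n = assms(1)
 obtain f where f: "bij_betw f (std_rat_bitab n r s) (I0 n r s)" using bitab_bij[OF q n] by blast
 note basis = standard_basis[OF q n _ f]
 have "finite (std_rat_bitab n r s)" using bij_betw_finite[OF f] finite_I0[OF q n] by simp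
 \<comment> \<open>The basis elements lie in the image of U', which closes the chain of inclusions
   from U' through U to the commutant.\<close>
 hence "qSchur n q r s \<subseteq> rho_U' n q r s" using basis rho_U'_sum[OF q n] by blast
 hence "qSchur n q r s = rho_U n q r s" "rho_U n q r s = rho_U' n q r s"
  using rho_U'_sub[OF q n, of r s] rho_U_sub[OF q n, of r s] by auto
 thus ?thesis using basis uu_rho[OF q n, of r s] by (intro conjI exI[of _ "\<lambda>t. uu q n r s (f t)"]) auto
qed

end
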